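(* The functor $(-)^{N_-}:\mathrm{Wh}(\mathfrak m_N)\to\mathrm{Vect}$ of $\mathfrak n_-^\psi$-invariants is an equivalence of categories such that for any representation $V$ of the mirabolic subgroup $\mathrm M_N$ there is a canonical isomorphism $$\bigl(\mathfrak n_-^\psi\backslash V\otimes \mathrm U(\mathfrak m_N)\bigr)^{N_-}\cong V .$$
   Context: $\mathbf C$ is an algebraically closed field of characteristic zero; $\mathrm{Vect}$ is the category of $\mathbf C$-vector spaces. $E_{ij}$ are the matrix units of $\mathfrak{gl}_N$. $\mathrm M_N\subset \mathrm{GL}_N$ is the mirabolic subgroup of matrices preserving the last basis vector, i.e. matrices whose last column is $(0,\dots,0,1)^T$; its Lie algebra is $\mathfrak m_N=\mathrm{span}(E_{ij}:1\le i\le N,\ 1\le j\le N-1)$, with (non-asymptotic) universal enveloping algebra $\mathrm U(\mathfrak m_N)$. For a representation $V$ of $\mathrm M_N$ and $\xi\in\mathfrak m_N$, $\mathrm{ad}_\xi$ denotes the differentiated action of $\xi$ on $V$. $\mathfrak n_-=\mathrm{span}(E_{ij}:i>j)\subset\mathfrak m_N$; $\psi:\mathfrak n_-\to\mathbf C$ is the character with $\psi(E_{i+1,i})=1$ for all $i$ (so $\psi(E_{ij})=0$ for $i>j+1$); $\mathfrak n_-^\psi=\{x-\psi(x)\mid x\in\mathfrak n_-\}\subset\mathrm U(\mathfrak m_N)$. $\mathrm{Wh}(\mathfrak m_N)$ is the category of right Whittaker modules over the mirabolic subalgebra: right $\mathrm U(\mathfrak m_N)$-modules on which $\mathfrak n_-^\psi$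 acts locally nilpotently. For such a module $W$, $W^{N_-}=\{w\in W: w\cdot(x-\psi(x))=0\ \text{for all }x\in\mathfrak n_-\}$ is the space of Whittaker vectors. $V\otimes\mathrm U(\mathfrak m_N)$ is a $\mathrm U(\mathfrak m_N)$-bimodule: the right action is by right multiplication on the second factor, and the left action is $\xi\cdot(v\otimes z)=\mathrm{ad}_\xi(v)\otimes z+v\otimes\xi z$ for $\xi\in\mathfrak m_N$. The notation $\mathfrak n_-^\psi\backslash X$ means the quotient $X/\mathfrak n_-^\psi X$ by the left action, considered as a right $\mathrm U(\mathfrak m_N)$-module. *)

theory Defs
  imports
    "HOL-Algebra.QuotRing"
    "HOL-Computational_Algebra.Polynomial"
    "Jordan_Normal_Form.VS_Connect"
begin

hide_const (open) Polynomial.smult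

section \<open>Categories, functors and equivalences\<close>

text \<open>Arrows carry no source or target, so composition and functors take the objects as
  explicit arguments. Only objects in \<open>Ob C\<close> and arrows in the corresponding hom-sets matter.\<close>

record ('o, 'a) cat =
  Ob :: "'o set"
  Hom :: "'o \<Rightarrow> 'o \<Rightarrow> 'a set"
  Id :: "'o \<Rightarrow> 'a"
  Comp :: "'o \<Rightarrow> 'o \<Rightarrow> 'o \<Rightarrow> 'a \<Rightarrow> 'a \<Rightarrow> 'a"

locale category =
  fixes C :: "('o, 'a) cat"
  assumes Id_in_Hom: "X \<in> Ob C \<Longrightarrow> Id C X \<in> Hom C X X"
    and Comp_in_Hom:
      "\<lbrakk>X \<in> Ob C; Y \<in> Ob C; Z \<in> Ob C; f \<in> Hom C X Y; g \<in> Hom C Y Z\<rbrakk>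
        \<Longrightarrow> Comp C X Y Z g f \<in> Hom C X Z"
    and Comp_Id_right:
      "\<lbrakk>X \<in> Ob C; Y \<in> Ob C; f \<in> Hom C X Y\<rbrakk> \<Longrightarrow> Comp C X X Y f (Id C X) = f"
    and Comp_Id_left:
      "\<lbrakk>X \<in> Ob C; Y \<in> Ob C; f \<in> Hom C X Y\<rbrakk> \<Longrightarrow> Comp C X Y Y (Id C Y) f = f"
    and Comp_assoc:
      "\<lbrakk>X \<in> Ob C; Y \<in> Ob C; Z \<in> Ob C; T \<in> Ob C;
        f \<in> Hom C X Y; g \<in> Hom C Y Z; h \<in> Hom C Z T\<rbrakk>
        \<Longrightarrow> Comp C X Z T h (Comp C X Y Z g f) = Comp C X Y T (Comp C Y Z T h g) f"

record ('o1, 'a1, 'o2, 'a2) cat_functor =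
  fob :: "'o1 \<Rightarrow> 'o2"
  far :: "'o1 \<Rightarrow> 'o1 \<Rightarrow> 'a1 \<Rightarrow> 'a2"

definition is_functor ::
  "('o1, 'a1) cat \<Rightarrow> ('o2, 'a2) cat \<Rightarrow> ('o1, 'a1, 'o2, 'a2) cat_functor \<Rightarrow> bool" where
  "is_functor C D F \<longleftrightarrow> category C \<and> category D \<and>
    (\<forall>X\<in>Ob C. fob F X \<in> Ob D) \<and>
    (\<forall>X\<in>Ob C. \<forall>Y\<in>Ob C. \<forall>f\<in>Hom C X Y. far F X Y f \<in> Hom D (fob F X) (fob F Y)) \<and>
    (\<forall>X\<in>Ob C. far F X X (Id C X) = Id D (fob F X)) \<and>
    (\<forall>X\<in>Ob C. \<forall>Y\<in>Ob C. \<forall>Z\<in>Ob C. \<forall>f\<in>Hom C X Y. \<forall>g\<in>Hom C Y Z.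
      far F X Z (Comp C X Y Z g f) =
      Comp D (fob F X) (fob F Y) (fob F Z) (far F Y Z g) (far F X Y f))"

definition id_functor :: "('o, 'a, 'o, 'a) cat_functor" where
  "id_functor = \<lparr>fob = (\<lambda>X. X), far = (\<lambda>X Y f. f)\<rparr>"

definition comp_functor ::
  "('o2, 'a2, 'o3, 'a3) cat_functor \<Rightarrow> ('o1, 'a1, 'o2, 'a2) cat_functor
    \<Rightarrow> ('o1, 'a1, 'o3, 'a3) cat_functor" where
  "comp_functor G F = \<lparr>fob = (\<lambda>X. fob G (fob F X)),
    far = (\<lambda>X Y f. far G (fob F X) (fob F Y) (far F X Y f))\<rparr>"

definition iso_arrow :: "('o, 'a) cat \<Rightarrow> 'o \<Rightarrow> 'o \<Rightarrow> 'a \<Rightarrow> bool" where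
  "iso_arrow C X Y f \<longleftrightarrow> f \<in> Hom C X Y \<and>
    (\<exists>g\<in>Hom C Y X. Comp C X Y X g f = Id C X \<and> Comp C Y X Y f g = Id C Y)"

definition naturally_isomorphic ::
  "('o1, 'a1) cat \<Rightarrow> ('o2, 'a2) cat \<Rightarrow> ('o1, 'a1, 'o2, 'a2) cat_functor
    \<Rightarrow> ('o1, 'a1, 'o2, 'a2) cat_functor \<Rightarrow> bool" where
  "naturally_isomorphic C D F G \<longleftrightarrow> (\<exists>\<eta>.
    (\<forall>X\<in>Ob C. iso_arrow D (fob F X) (fob G X) (\<eta> X)) \<and>
    (\<forall>X\<in>Ob C. \<forall>Y\<in>Ob C. \<forall>f\<in>Hom C X Y.
      Comp D (fob F X) (fob F Y) (fob G Y) (\<eta> Y) (far F X Y f) =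
      Comp D (fob F X) (fob G X) (fob G Y) (far G X Y f) (\<eta> X)))"

definition equivalence_of_categories ::
  "('o1, 'a1) cat \<Rightarrow> ('o2, 'a2) cat \<Rightarrow> ('o1, 'a1, 'o2, 'a2) cat_functor \<Rightarrow> bool" where
  "equivalence_of_categories C D F \<longleftrightarrow> is_functor C D F \<and>
    (\<exists>G. is_functor D C G \<and>
      naturally_isomorphic C C (comp_functor G F) id_functor \<and>
      naturally_isomorphic D D (comp_functor F G) id_functor)"


section \<open>Vector spaces, quotients and tensor products\<close>

text \<open>A vector space over the field \<open>'k\<close> is a \<open>vectorspace class_ring V\<close>; the fields
  \<open>mult\<close> and \<open>one\<close>, which module records inherit from rings, are ignored. Linear maps are taken
  to be extensional, so that they are equal iff they agree on the carrier.\<close>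

definition lin_hom ::
  "('k::field, 'v, 'm) module_scheme \<Rightarrow> ('k, 'w, 'n) module_scheme \<Rightarrow> ('v \<Rightarrow> 'w) set" where
  "lin_hom V W = LinearCombinations.module_hom class_ring V W \<inter> extensional (carrier V)"

definition lin_iso ::
  "('k::field, 'v, 'm) module_scheme \<Rightarrow> ('k, 'w, 'n) module_scheme \<Rightarrow> ('v \<Rightarrow> 'w) set" where
  "lin_iso V W = {f \<in> lin_hom V W. bij_betw f (carrier V) (carrier W)}"

abbreviation lin_span :: "('k::field, 'v, 'm) module_scheme \<Rightarrow> 'v set \<Rightarrow> 'v set" where
  "lin_span V \<equiv> LinearCombinations.module.span class_ring V"

text \<open>The type \<open>'v\<close> serves as universe: objects are the vector spaces with carrier a subset of
  \<open>'v\<close>, of arbitrary dimension. The categories \<open>Wh\<close> and \<open>Rep\<close> below follow the same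
  convention.\<close>

definition Vect :: "(('k::field, 'v) module, 'v \<Rightarrow> 'v) cat" where
  "Vect = \<lparr>Ob = {V. vectorspace class_ring V},
    Hom = lin_hom,
    Id = (\<lambda>V. restrict id (carrier V)),
    Comp = (\<lambda>V W X g f. compose (carrier V) g f)\<rparr>"

definition quotient_space ::
  "('k::field, 'v, 'm) module_scheme \<Rightarrow> 'v set \<Rightarrow> ('k, 'v set) module" where
  "quotient_space V S = \<lparr>carrier = a_rcosets\<^bsub>V\<^esub> S, mult = undefined, one = undefined,
    zero = S, add = set_add V, smult = (\<lambda>c A. \<Union>a\<in>A. S +>\<^bsub>V\<^esub> (c \<odot>\<^bsub>V\<^esub> a))\<rparr>"

definition single :: "'s \<Rightarrow> 's \<Rightarrow> 'k::zero_neq_one" where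
  "single s = (\<lambda>t. if t = s then 1 else 0)"

text \<open>Finitely supported functions; the basis vector of \<open>s \<in> S\<close> is \<open>single s\<close>.\<close>

definition free_space :: "'s set \<Rightarrow> ('k::field, 's \<Rightarrow> 'k) module" where
  "free_space S = \<lparr>carrier = {p. finite {s. p s \<noteq> 0} \<and> {s. p s \<noteq> 0} \<subseteq> S},
    mult = undefined, one = undefined,
    zero = (\<lambda>_. 0), add = (\<lambda>p q s. p s + q s), smult = (\<lambda>c p s. c * p s)\<rparr>"

definition tensor_rels ::
  "('k::field, 'v, 'm) module_scheme \<Rightarrow> ('k, 'w, 'n) module_scheme \<Rightarrow> ('v \<times> 'w \<Rightarrow> 'k) set" where
  "tensor_rels V W = lin_span (free_space (carrier V \<times> carrier W))
    ({\<lambda>s. single (v \<oplus>\<^bsub>V\<^esub> v', w) s - single (v, w) s - single (v', w) s | v v' w.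
        v \<in> carrier V \<and> v' \<in> carrier V \<and> w \<in> carrier W} \<union>
     {\<lambda>s. single (v, w \<oplus>\<^bsub>W\<^esub> w') s - single (v, w) s - single (v, w') s | v w w'.
        v \<in> carrier V \<and> w \<in> carrier W \<and> w' \<in> carrier W} \<union>
     {\<lambda>s. single (c \<odot>\<^bsub>V\<^esub> v, w) s - c * single (v, w) s | c v w.
        v \<in> carrier V \<and> w \<in> carrier W} \<union>
     {\<lambda>s. single (v, c \<odot>\<^bsub>W\<^esub> w) s - c * single (v, w) s | c v w.
        v \<in> carrier V \<and> w \<in> carrier W})"

definition tensor ::
  "('k::field, 'v, 'm) module_scheme \<Rightarrow> ('k, 'w, 'n) module_scheme
    \<Rightarrow> ('k, ('v \<times> 'w \<Rightarrow> 'k) set) module" where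
  "tensor V W = quotient_space (free_space (carrier V \<times> carrier W)) (tensor_rels V W)"

definition pure_tensor ::
  "('k::field, 'v, 'm) module_scheme \<Rightarrow> ('k, 'w, 'n) module_scheme
    \<Rightarrow> 'v \<Rightarrow> 'w \<Rightarrow> ('v \<times> 'w \<Rightarrow> 'k) set" where
  "pure_tensor V W v w =
    tensor_rels V W +>\<^bsub>free_space (carrier V \<times> carrier W)\<^esub> single (v, w)"

text \<open>The linear map on the tensor product with \<open>v \<otimes> w \<mapsto> h v w\<close>, for bilinear \<open>h\<close>.\<close>

definition tensor_lift ::
  "('k::field, 'v, 'm) module_scheme \<Rightarrow> ('k, 'w, 'n) module_scheme
    \<Rightarrow> ('k, 'x, 'l) module_scheme \<Rightarrow> ('v \<Rightarrow> 'w \<Rightarrow> 'x) \<Rightarrow> ('v \<times> 'w \<Rightarrow> 'k) set \<Rightarrow> 'x" where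
  "tensor_lift V W X h = (THE f. f \<in> lin_hom (tensor V W) X \<and>
    (\<forall>v\<in>carrier V. \<forall>w\<in>carrier W. f (pure_tensor V W v w) = h v w))"


section \<open>Universal enveloping algebras and right modules\<close>

record ('k, 'g) lie_alg = "('k, 'g) module" +
  lie_bracket :: "'g \<Rightarrow> 'g \<Rightarrow> 'g"

text \<open>Noncommutative polynomials in the elements of \<open>S\<close>: finitely supported functions on words,
  multiplied by concatenation of words.\<close>

definition free_algebra :: "'g set \<Rightarrow> ('k::field, 'g list \<Rightarrow> 'k) module" where
  "free_algebra S = (free_space (lists S))
    \<lparr>mult := (\<lambda>p q w. \<Sum>i\<le>length w. p (take i w) * q (drop i w)), one := single []\<rparr>"

text \<open>The universal enveloping algebra is the free algebra on the elements of the Lie algebra,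
  modulo linearity of the generators and \<open>x y - y x = [x, y]\<close>.\<close>

definition uea_ideal :: "('k::field, 'g, 'm) lie_alg_scheme \<Rightarrow> ('g list \<Rightarrow> 'k) set" where
  "uea_ideal L = Idl\<^bsub>free_algebra (carrier L)\<^esub>
    ({\<lambda>w. single [x \<oplus>\<^bsub>L\<^esub> y] w - single [x] w - single [y] w | x y.
        x \<in> carrier L \<and> y \<in> carrier L} \<union>
     {\<lambda>w. single [c \<odot>\<^bsub>L\<^esub> x] w - c * single [x] w | c x. x \<in> carrier L} \<union>
     {\<lambda>w. single [x, y] w - single [y, x] w - single [lie_bracket L x y] w | x y.
        x \<in> carrier L \<and> y \<in> carrier L})"

definition uea :: "('k::field, 'g, 'm) lie_alg_scheme \<Rightarrow> ('k, ('g list \<Rightarrow> 'k) set) module" where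
  "uea L = (let F = free_algebra (carrier L); I = uea_ideal L; Q = F Quot I in
    \<lparr>carrier = carrier Q, mult = mult Q, one = one Q, zero = zero Q, add = add Q,
     smult = (\<lambda>c z. (I +>\<^bsub>F\<^esub> (c \<odot>\<^bsub>F\<^esub> \<one>\<^bsub>F\<^esub>)) \<otimes>\<^bsub>Q\<^esub> z)\<rparr>)"

definition uea_incl :: "('k::field, 'g, 'm) lie_alg_scheme \<Rightarrow> 'g \<Rightarrow> ('g list \<Rightarrow> 'k) set" where
  "uea_incl L x = uea_ideal L +>\<^bsub>free_algebra (carrier L)\<^esub> single [x]"

record ('k, 'u, 'w) rmod = "('k, 'w) module" +
  ract :: "'w \<Rightarrow> 'u \<Rightarrow> 'w" (infixl \<open>\<triangleleft>\<index>\<close> 70)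

locale right_module =
  fixes U :: "('k::field, 'u) module" and W :: "('k, 'u, 'w) rmod" (structure)
  assumes vectorspace: "vectorspace class_ring W"
    and ract_closed: "\<lbrakk>w \<in> carrier W; y \<in> carrier U\<rbrakk> \<Longrightarrow> w \<triangleleft> y \<in> carrier W"
    and ract_add_left: "\<lbrakk>w \<in> carrier W; w' \<in> carrier W; y \<in> carrier U\<rbrakk>
      \<Longrightarrow> (w \<oplus> w') \<triangleleft> y = (w \<triangleleft> y) \<oplus> (w' \<triangleleft> y)"
    and ract_add_right: "\<lbrakk>w \<in> carrier W; y \<in> carrier U; z \<in> carrier U\<rbrakk>
      \<Longrightarrow> w \<triangleleft> (y \<oplus>\<^bsub>U\<^esub> z) = (w \<triangleleft> y) \<oplus> (w \<triangleleft> z)"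
    and ract_smult_left: "\<lbrakk>w \<in> carrier W; y \<in> carrier U\<rbrakk> \<Longrightarrow> (c \<odot> w) \<triangleleft> y = c \<odot> (w \<triangleleft> y)"
    and ract_smult_right:
      "\<lbrakk>w \<in> carrier W; y \<in> carrier U\<rbrakk> \<Longrightarrow> w \<triangleleft> (c \<odot>\<^bsub>U\<^esub> y) = c \<odot> (w \<triangleleft> y)"
    and ract_one: "w \<in> carrier W \<Longrightarrow> w \<triangleleft> \<one>\<^bsub>U\<^esub> = w"
    and ract_mult: "\<lbrakk>w \<in> carrier W; y \<in> carrier U; z \<in> carrier U\<rbrakk>
      \<Longrightarrow> w \<triangleleft> (y \<otimes>\<^bsub>U\<^esub> z) = (w \<triangleleft> y) \<triangleleft> z"

definition rmod_hom ::
  "('k::field, 'u) module \<Rightarrow> ('k, 'u, 'w) rmod \<Rightarrow> ('k, 'u, 'x) rmod \<Rightarrow> ('w \<Rightarrow> 'x) set" where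
  "rmod_hom U W X = {f \<in> lin_hom W X.
    \<forall>w\<in>carrier W. \<forall>y\<in>carrier U. f (w \<triangleleft>\<^bsub>W\<^esub> y) = f w \<triangleleft>\<^bsub>X\<^esub> y}"


section \<open>The mirabolic Lie algebra and Whittaker modules\<close>

text \<open>Matrices are indexed from \<open>0\<close>, so the last column of an \<open>N \<times> N\<close> matrix has index
  \<open>N - 1\<close>.\<close>

definition mirabolic_lie :: "nat \<Rightarrow> ('k::field, 'k mat) lie_alg" where
  "mirabolic_lie N = \<lparr>carrier = {A \<in> carrier_mat N N. \<forall>i<N. A $$ (i, N - 1) = 0},
    mult = undefined, one = undefined, zero = 0\<^sub>m N N, add = (+), smult = (\<cdot>\<^sub>m),
    lie_bracket = (\<lambda>A B. A * B - B * A)\<rparr>"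

abbreviation Um :: "nat \<Rightarrow> ('k::field, ('k mat list \<Rightarrow> 'k) set) module" where
  "Um N \<equiv> uea (mirabolic_lie N)"

definition n_minus :: "nat \<Rightarrow> 'k::field mat set" where
  "n_minus N = {A \<in> carrier_mat N N. \<forall>i<N. \<forall>j<N. i \<le> j \<longrightarrow> A $$ (i, j) = 0}"

definition psi :: "nat \<Rightarrow> 'k::field mat \<Rightarrow> 'k" where
  "psi N A = (\<Sum>i<N - 1. A $$ (Suc i, i))"

definition n_minus_psi :: "nat \<Rightarrow> ('k::field mat list \<Rightarrow> 'k) set set" where
  "n_minus_psi N =
    (\<lambda>x. uea_incl (mirabolic_lie N) x \<ominus>\<^bsub>Um N\<^esub> (psi N x \<odot>\<^bsub>Um N\<^esub> \<one>\<^bsub>Um N\<^esub>)) ` n_minus N"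

text \<open>Local nilpotency: every vector is annihilated by all products of sufficiently many
  elements of \<open>n_minus_psi N\<close>.\<close>

definition whittaker_module ::
  "nat \<Rightarrow> ('k::field, ('k mat list \<Rightarrow> 'k) set, 'w) rmod \<Rightarrow> bool" where
  "whittaker_module N W \<longleftrightarrow> right_module (Um N) W \<and>
    (\<forall>w\<in>carrier W. \<exists>n. \<forall>ys. length ys = n \<and> set ys \<subseteq> n_minus_psi N \<longrightarrow>
      foldl (ract W) w ys = \<zero>\<^bsub>W\<^esub>)"

definition Wh :: "nat \<Rightarrow> (('k::field, ('k mat list \<Rightarrow> 'k) set, 'w) rmod, 'w \<Rightarrow> 'w) cat" where
  "Wh N = \<lparr>Ob = {W. whittaker_module N W},
    Hom = rmod_hom (Um N),
    Id = (\<lambda>W. restrict id (carrier W)),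
    Comp = (\<lambda>W X Y g f. compose (carrier W) g f)\<rparr>"

definition whittaker_vectors ::
  "nat \<Rightarrow> ('k::field, ('k mat list \<Rightarrow> 'k) set, 'w) rmod \<Rightarrow> ('k, 'w) module" where
  "whittaker_vectors N W = \<lparr>carrier = {w \<in> carrier W. \<forall>y\<in>n_minus_psi N. w \<triangleleft>\<^bsub>W\<^esub> y = \<zero>\<^bsub>W\<^esub>},
    mult = mult W, one = one W, zero = zero W, add = add W, smult = smult W\<rparr>"

definition whittaker_functor ::
  "nat \<Rightarrow> (('k::field, ('k mat list \<Rightarrow> 'k) set, 'w) rmod, 'w \<Rightarrow> 'w,
           ('k, 'w) module, 'w \<Rightarrow> 'w) cat_functor" where
  "whittaker_functor N = \<lparr>fob = whittaker_vectors N,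
    far = (\<lambda>W X f. restrict f (carrier (whittaker_vectors N W)))\<rparr>"


section \<open>Representations of the mirabolic group\<close>

definition mirabolic_group :: "nat \<Rightarrow> 'k::field mat set" where
  "mirabolic_group N = {g \<in> carrier_mat N N. det g \<noteq> 0 \<and>
    (\<forall>i<N. g $$ (i, N - 1) = (if i = N - 1 then 1 else 0))}"

text \<open>The coordinate ring of the mirabolic group: polynomials in the matrix entries and the
  inverse determinant, as functions on the group.\<close>

inductive_set regular_funs :: "nat \<Rightarrow> ('k::field mat \<Rightarrow> 'k) set" for N where
  const: "restrict (\<lambda>g. c) (mirabolic_group N) \<in> regular_funs N"
| entry: "\<lbrakk>i < N; j < N\<rbrakk> \<Longrightarrow> restrict (\<lambda>g. g $$ (i, j)) (mirabolic_group N) \<in> regular_funs N"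
| inv_det: "restrict (\<lambda>g. inverse (det g)) (mirabolic_group N) \<in> regular_funs N"
| add: "\<lbrakk>p \<in> regular_funs N; q \<in> regular_funs N\<rbrakk>
    \<Longrightarrow> restrict (\<lambda>g. p g + q g) (mirabolic_group N) \<in> regular_funs N"
| mult: "\<lbrakk>p \<in> regular_funs N; q \<in> regular_funs N\<rbrakk>
    \<Longrightarrow> restrict (\<lambda>g. p g * q g) (mirabolic_group N) \<in> regular_funs N"

text \<open>The tangent vector \<open>\<xi>\<close> at the identity, as the point derivation of the coordinate ring
  that maps the coordinate \<open>(i, j)\<close> to the entry \<open>(i, j)\<close> of \<open>\<xi>\<close>. These values determine the
  derivation on regular functions (and only there).\<close>

definition point_derivation :: "nat \<Rightarrow> 'k::field mat \<Rightarrow> (('k mat \<Rightarrow> 'k) \<Rightarrow> 'k) \<Rightarrow> bool" where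
  "point_derivation N \<xi> D \<longleftrightarrow>
    (\<forall>c. D (restrict (\<lambda>g. c) (mirabolic_group N)) = 0) \<and>
    (\<forall>p\<in>regular_funs N. \<forall>q\<in>regular_funs N.
      D (restrict (\<lambda>g. p g + q g) (mirabolic_group N)) = D p + D q) \<and>
    (\<forall>p\<in>regular_funs N. \<forall>q\<in>regular_funs N.
      D (restrict (\<lambda>g. p g * q g) (mirabolic_group N)) = D p * q (1\<^sub>m N) + p (1\<^sub>m N) * D q) \<and>
    (\<forall>i<N. \<forall>j<N. D (restrict (\<lambda>g. g $$ (i, j)) (mirabolic_group N)) = \<xi> $$ (i, j))"

definition tangent :: "nat \<Rightarrow> 'k::field mat \<Rightarrow> ('k mat \<Rightarrow> 'k) \<Rightarrow> 'k" where
  "tangent N \<xi> = (SOME D. point_derivation N \<xi> D)"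

record ('k, 'v) grep = "('k, 'v) module" +
  gact :: "'k mat \<Rightarrow> 'v \<Rightarrow> 'v"

text \<open>\<open>orbit_expansion N V v n p u\<close>: the orbit map of \<open>v\<close> is \<open>g \<mapsto> \<Sum>i<n. p i g u i\<close> with
  regular functions \<open>p i\<close>.\<close>

definition orbit_expansion ::
  "nat \<Rightarrow> ('k::field, 'v) grep \<Rightarrow> 'v \<Rightarrow> nat \<Rightarrow> (nat \<Rightarrow> 'k mat \<Rightarrow> 'k) \<Rightarrow> (nat \<Rightarrow> 'v) \<Rightarrow> bool" where
  "orbit_expansion N V v n p u \<longleftrightarrow>
    (\<forall>i<n. p i \<in> regular_funs N \<and> u i \<in> carrier V) \<and>
    (\<forall>g\<in>mirabolic_group N. gact V g v = (\<Oplus>\<^bsub>V\<^esub>i\<in>{..<n}. p i g \<odot>\<^bsub>V\<^esub> u i))"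

text \<open>Rational representations, not necessarily finite-dimensional.\<close>

locale mirabolic_rep =
  fixes N :: nat and V :: "('k::field, 'v) grep" (structure)
  assumes vectorspace: "vectorspace class_ring V"
    and gact_hom: "g \<in> mirabolic_group N \<Longrightarrow>
        gact V g \<in> LinearCombinations.module_hom class_ring V V"
    and gact_one: "v \<in> carrier V \<Longrightarrow> gact V (1\<^sub>m N) v = v"
    and gact_mult: "\<lbrakk>g \<in> mirabolic_group N; h \<in> mirabolic_group N; v \<in> carrier V\<rbrakk>
      \<Longrightarrow> gact V (g * h) v = gact V g (gact V h v)"
    and rational: "v \<in> carrier V \<Longrightarrow> \<exists>n p u. orbit_expansion N V v n p u"

definition rep_hom :: "nat \<Rightarrow> ('k::field, 'v) grep \<Rightarrow> ('k, 'v) grep \<Rightarrow> ('v \<Rightarrow> 'v) set" where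
  "rep_hom N V W = {f \<in> lin_hom V W.
    \<forall>g\<in>mirabolic_group N. \<forall>v\<in>carrier V. f (gact V g v) = gact W g (f v)}"

definition Rep :: "nat \<Rightarrow> (('k::field, 'v) grep, 'v \<Rightarrow> 'v) cat" where
  "Rep N = \<lparr>Ob = {V. mirabolic_rep N V},
    Hom = rep_hom N,
    Id = (\<lambda>V. restrict id (carrier V)),
    Comp = (\<lambda>V W X g f. compose (carrier V) g f)\<rparr>"

text \<open>The differentiated action; it does not depend on the expansion of the orbit map.\<close>

definition ad :: "nat \<Rightarrow> ('k::field, 'v) grep \<Rightarrow> 'k mat \<Rightarrow> 'v \<Rightarrow> 'v" where
  "ad N V \<xi> v = (THE w. \<exists>n p u. orbit_expansion N V v n p u \<and>
    w = (\<Oplus>\<^bsub>V\<^esub>i\<in>{..<n}. tangent N \<xi> (p i) \<odot>\<^bsub>V\<^esub> u i))"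


section \<open>The Whittaker module of a representation\<close>

type_synonym ('k, 'v) VU = "('v \<times> ('k mat list \<Rightarrow> 'k) set \<Rightarrow> 'k) set"

abbreviation VU :: "nat \<Rightarrow> ('k::field, 'v) grep \<Rightarrow> ('k, ('k, 'v) VU) module" where
  "VU N V \<equiv> tensor V (Um N)"

definition VU_left :: "nat \<Rightarrow> ('k::field, 'v) grep \<Rightarrow> 'k mat \<Rightarrow> ('k, 'v) VU \<Rightarrow> ('k, 'v) VU" where
  "VU_left N V \<xi> = tensor_lift V (Um N) (VU N V)
    (\<lambda>v z. pure_tensor V (Um N) (ad N V \<xi> v) z \<oplus>\<^bsub>VU N V\<^esub>
           pure_tensor V (Um N) v (uea_incl (mirabolic_lie N) \<xi> \<otimes>\<^bsub>Um N\<^esub> z))"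

definition VU_right ::
  "nat \<Rightarrow> ('k::field, 'v) grep \<Rightarrow> ('k mat list \<Rightarrow> 'k) set \<Rightarrow> ('k, 'v) VU \<Rightarrow> ('k, 'v) VU" where
  "VU_right N V y = tensor_lift V (Um N) (VU N V)
    (\<lambda>v z. pure_tensor V (Um N) v (z \<otimes>\<^bsub>Um N\<^esub> y))"

text \<open>The subspace \<open>n_minus_psi N \<cdot> (V \<otimes> U)\<close> for the left action; the element \<open>x - \<psi>(x)\<close> maps
  \<open>t\<close> to \<open>x \<cdot> t - \<psi>(x) t\<close>.\<close>

definition psi_sub :: "nat \<Rightarrow> ('k::field, 'v) grep \<Rightarrow> ('k, 'v) VU set" where
  "psi_sub N V = lin_span (VU N V)
    {VU_left N V x t \<ominus>\<^bsub>VU N V\<^esub> (psi N x \<odot>\<^bsub>VU N V\<^esub> t) | x t.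
      x \<in> n_minus N \<and> t \<in> carrier (VU N V)}"

definition psi_quotient ::
  "nat \<Rightarrow> ('k::field, 'v) grep \<Rightarrow> ('k, ('k mat list \<Rightarrow> 'k) set, ('k, 'v) VU set) rmod" where
  "psi_quotient N V = module.extend (quotient_space (VU N V) (psi_sub N V))
    \<lparr>ract = (\<lambda>A y. \<Union>t\<in>A. psi_sub N V +>\<^bsub>VU N V\<^esub> VU_right N V y t)\<rparr>"

definition psi_class ::
  "nat \<Rightarrow> ('k::field, 'v) grep \<Rightarrow> 'v \<Rightarrow> ('k mat list \<Rightarrow> 'k) set \<Rightarrow> ('k, 'v) VU set" where
  "psi_class N V v z = psi_sub N V +>\<^bsub>VU N V\<^esub> pure_tensor V (Um N) v z"

text \<open>An equivariant map \<open>f\<close> induces the map of quotients given by \<open>[v \<otimes> z] \<mapsto> [f v \<otimes> z]\<close>.\<close>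

definition psi_quotient_functor ::
  "nat \<Rightarrow> (('k::field, 'v) grep, 'v \<Rightarrow> 'v,
    ('k, ('k mat list \<Rightarrow> 'k) set, ('k, 'v) VU set) rmod,
    ('k, 'v) VU set \<Rightarrow> ('k, 'v) VU set) cat_functor" where
  "psi_quotient_functor N = \<lparr>fob = psi_quotient N,
    far = (\<lambda>V W f. THE h. h \<in> lin_hom (psi_quotient N V) (psi_quotient N W) \<and>
      (\<forall>v\<in>carrier V. \<forall>z\<in>carrier (Um N). h (psi_class N V v z) = psi_class N W (f v) z))\<rparr>"

end

theory Submission
  imports Defs "HOL-Library.Poly_Mapping" "HOL-Library.Product_Plus" "HOL-Library.Countable_Set"
begin

text \<open>
  On a Whittaker module the operators \<open>x - \<psi>(x)\<close> for \<open>x\<close> in \<open>\<nn>\<^sub>-\<close> are locally nilpotent, and each matrix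
  unit of \<open>\<nn>\<^sub>-\<close> has a matrix unit of \<open>\<mm>\<^sub>N\<close> whose commutator with it is unipotent. As in
  Kashiwara's theorem on modules over the Weyl algebra, this shows one matrix unit at a time that a Whittaker module is
  generated by its Whittaker vectors, that the submodule generated by a space of Whittaker vectors
  contains no further ones, and that the first cohomology of \<open>\<nn>\<^sub>-\<^sup>\<psi>\<close> vanishes. Hence the functor of Whittaker
  vectors is fully faithful; it is essentially surjective because \<open>\<mm>\<^sub>N\<close> acts by vector fields on
  polynomial functions in the coordinates of a product of affine charts of Grassmannians, where, after a twist by an
  exponential, the constant function \<open>1\<close> is a Whittaker vector.

  For a representation \<open>V\<close>, the classes \<open>v \<otimes> 1\<close> generate the quotient \<open>\<nn>\<^sub>-\<^sup>\<psi>\<setminus>V \<otimes> U\<close> and satisfy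
  \<open>(v \<otimes> 1) (x - \<psi>(x)) = - ad\<^sub>x v \<otimes> 1\<close>. Since \<open>\<nn>\<^sub>-\<close> acts locally nilpotently on \<open>V\<close>, the quotient is a
  Whittaker module. A Whittaker module is cofree over \<open>\<nn>\<^sub>-\<^sup>\<psi>\<close>, hence has a natural projection to its
  Whittaker vectors, and the isomorphism from \<open>V\<close> sends \<open>v\<close> to the projection of \<open>v \<otimes> 1\<close>.
\<close>

text \<open>A matrix unit E_{r,j} of n_-, with j < r, is paired with E_{j,r-1}; up to sign their
  commutator is E_{r,r-1}, on which \<psi> is 1. The pairing is a bijection from the matrix units of
  n_- to those of m_N outside n_-. So every generator of m_N is used up by exactly one step of
  Kashiwara type; this is why the mirabolic subalgebra, of dimension twice that of n_-, gives an
  equivalence.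

  The obstacle is that the common kernel of the operators already treated must be stable under the
  next pair. This fixes the order: rows from the bottom up, each row from left to right. The
  commutators that could leave the kernel then involve only matrix units in rows already treated and
  at least two below the diagonal, which act by 0.

  All objects live in prescribed types. So the module built for a vector space must not be larger
  than the space, which is a cardinality count over an infinite field; the injectivity of the
  comparison map also uses such a module, realised inside the carrier type of V.\<close>

section \<open>Subspaces and linear maps of a type with scalars\<close>

definition is_subspace :: "('k \<Rightarrow> 'b \<Rightarrow> 'b) \<Rightarrow> 'b::ab_group_add set \<Rightarrow> bool" where
  "is_subspace sc S \<longleftrightarrow> 0 \<in> S \<and> (\<forall>x\<in>S. \<forall>y\<in>S. x + y \<in> S) \<and> (\<forall>c. \<forall>x\<in>S. sc c x \<in> S)"

definition is_linear :: "('k \<Rightarrow> 'b \<Rightarrow> 'b) \<Rightarrow> ('k \<Rightarrow> 'c \<Rightarrow> 'c) \<Rightarrow> ('b::ab_group_add \<Rightarrow> 'c::ab_group_add) \<Rightarrow> bool" where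
  "is_linear s t f \<longleftrightarrow> (\<forall>x y. f (x + y) = f x + f y) \<and> (\<forall>c x. f (s c x) = t c (f x))"

lemma is_linearI: "(\<And>x y. f (x + y) = f x + f y) \<Longrightarrow> (\<And>c x. f (s c x) = t c (f x)) \<Longrightarrow> is_linear s t f"
  by (auto simp: is_linear_def)

lemma is_linear_add: "is_linear s t f \<Longrightarrow> f (x + y) = f x + f y"
  by (auto simp: is_linear_def)

lemma is_linear_scale: "is_linear s t f \<Longrightarrow> f (s c x) = t c (f x)"
  by (auto simp: is_linear_def)

lemma is_linear_zero: assumes "is_linear s t f" shows "f 0 = 0"
proof -
  have "f 0 + f 0 = f 0" using is_linear_add[OF assms, of 0 0] by simp
  then show ?thesis by simp
qed

lemma is_linear_minus: assumes "is_linear s t f" shows "f (- x) = - f x"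
proof -
  have "f (- x) + f x = 0" using is_linear_add[OF assms, of "- x" x] is_linear_zero[OF assms] by simp
  then show ?thesis by (simp add: eq_neg_iff_add_eq_0)
qed

lemma is_linear_diff: assumes "is_linear s t f" shows "f (x - y) = f x - f y"
  using is_linear_add[OF assms, of x "- y"] is_linear_minus[OF assms, of y] by simp

lemma is_linear_funpow: "is_linear s s f \<Longrightarrow> is_linear s s (f ^^ n)"
  by (induction n) (auto simp: is_linear_def)

lemma is_linear_comp: "is_linear s t f \<Longrightarrow> is_linear t u g \<Longrightarrow> is_linear s u (\<lambda>x. g (f x))"
  by (auto simp: is_linear_def)

context vector_space
begin

lemma sub_zero: "is_subspace scale S \<Longrightarrow> 0 \<in> S"
  by (auto simp: is_subspace_def)

lemma sub_add: "is_subspace scale S \<Longrightarrow> x \<in> S \<Longrightarrow> y \<in> S \<Longrightarrow> x + y \<in> S"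
  by (auto simp: is_subspace_def)

lemma sub_scale: "is_subspace scale S \<Longrightarrow> x \<in> S \<Longrightarrow> scale c x \<in> S"
  by (auto simp: is_subspace_def)

lemma sub_minus: "is_subspace scale S \<Longrightarrow> x \<in> S \<Longrightarrow> - x \<in> S"
  using sub_scale[of S x "- 1"] by simp

lemma sub_diff: "is_subspace scale S \<Longrightarrow> x \<in> S \<Longrightarrow> y \<in> S \<Longrightarrow> x - y \<in> S"
  using sub_add[of S x "- y"] sub_minus[of S y] by simp

lemma sub_sum: "is_subspace scale S \<Longrightarrow> (\<And>i. i \<in> A \<Longrightarrow> g i \<in> S) \<Longrightarrow> (\<Sum>i\<in>A. g i) \<in> S"
  by (induction A rule: infinite_finite_induct) (auto intro: sub_zero sub_add)

lemma sub_diff_cancel: "is_subspace scale S \<Longrightarrow> x - y \<in> S \<Longrightarrow> y \<in> S \<Longrightarrow> x \<in> S"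
  using sub_add[of S "x - y" y] by simp

lemma is_linear_const_zero: "is_linear s scale (\<lambda>x. 0)"
  by (auto simp: is_linear_def)

end

section \<open>One Kashiwara step for a pair of operators\<close>

text \<open>For a subspace \<open>M\<close> and linear \<open>q\<close> these are the polynomials in
  \<open>q\<close> applied to \<open>M\<close>. Scalars enter only through \<open>M\<close>, see
  \<open>closure_under_sub\<close>.\<close>

inductive_set closure_under :: "('b \<Rightarrow> 'b) \<Rightarrow> 'b::ab_group_add set \<Rightarrow> 'b set" for q M where
  base: "x \<in> M \<Longrightarrow> x \<in> closure_under q M"
| add: "x \<in> closure_under q M \<Longrightarrow> y \<in> closure_under q M \<Longrightarrow> x + y \<in> closure_under q M"
| app: "x \<in> closure_under q M \<Longrightarrow> q x \<in> closure_under q M"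

lemma closure_under_mono: "M \<subseteq> M' \<Longrightarrow> closure_under q M \<subseteq> closure_under q M'"
proof
  fix x assume "M \<subseteq> M'" "x \<in> closure_under q M"
  from this(2,1) show "x \<in> closure_under q M'"
    by induction (auto intro: closure_under.intros)
qed

lemma (in vector_space) closure_under_sub:
  assumes "is_subspace scale M" "is_linear scale scale q"
  shows "is_subspace scale (closure_under q M)"
proof -
  have "scale c x \<in> closure_under q M" if "x \<in> closure_under q M" for c x
    using that
  proof induction
    case (base x) then show ?case using sub_scale[OF assms(1)] by (auto intro: closure_under.base)
  next
    case (add x y) then show ?case by (auto simp: scale_right_distrib intro: closure_under.add)
  next
    case (app x) then show ?case
      using is_linear_scale[OF assms(2), of c x] closure_under.app by metis
  qed
  then show ?thesis using sub_zero[OF assms(1)]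
    by (auto simp: is_subspace_def intro: closure_under.intros)
qed

text \<open>Splits a polynomial in \<open>q\<close> into its constant term and a multiple of
  \<open>q\<close>.\<close>

lemma (in vector_space) closure_under_decomp:
  assumes "is_subspace scale M" "is_linear scale scale q" "y \<in> closure_under q M"
  shows "\<exists>m\<in>M. \<exists>w\<in>closure_under q M. y = m + q w"
  using assms(3)
proof induction
  case (base x)
  have "0 \<in> closure_under q M" using sub_zero[OF assms(1)] by (rule closure_under.base)
  then show ?case using base is_linear_zero[OF assms(2)] by (intro bexI[of _ x] bexI[of _ 0]) auto
next
  case (add x y)
  then obtain m w m' w' where *: "m \<in> M" "w \<in> closure_under q M" "x = m + q w"
    "m' \<in> M" "w' \<in> closure_under q M" "y = m' + q w'" by blast
  then show ?case
    by (intro bexI[of _ "m + m'"] bexI[of _ "w + w'"])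
      (auto simp: is_linear_add[OF assms(2)] closure_under.add sub_add[OF assms(1)])
next
  case (app x)
  then show ?case using sub_zero[OF assms(1)] by (intro bexI[of _ 0] bexI[of _ x]) auto
qed

text \<open>One step of Kashiwara's equivalence: \<open>p\<close> is locally nilpotent and \<open>[p, q] = - z\<close> with \<open>z\<close>
  unipotent. No relation between \<open>q\<close> and \<open>z\<close> is needed.\<close>

locale kashiwara = vector_space scale
  for scale :: "'k::field_char_0 \<Rightarrow> 'b::ab_group_add \<Rightarrow> 'b" +
  fixes W :: "'b set" and p q z :: "'b \<Rightarrow> 'b"
  assumes W_sub: "is_subspace scale W"
    and p_lin: "is_linear scale scale p" and q_lin: "is_linear scale scale q"
    and z_lin: "is_linear scale scale z"
    and p_W: "w \<in> W \<Longrightarrow> p w \<in> W" and q_W: "w \<in> W \<Longrightarrow> q w \<in> W" and z_W: "w \<in> W \<Longrightarrow> z w \<in> W"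
    and pq: "w \<in> W \<Longrightarrow> p (q w) = q (p w) - z w"
    and pz: "w \<in> W \<Longrightarrow> p (z w) = z (p w)"
    and p_nil: "w \<in> W \<Longrightarrow> \<exists>n. (p ^^ n) w = 0"
    and z_unip: "w \<in> W \<Longrightarrow> \<exists>n. ((\<lambda>x. z x - x) ^^ n) w = 0"
begin

lemma p_pow_W: "w \<in> W \<Longrightarrow> (p ^^ n) w \<in> W" by (induction n) (auto intro: p_W)
lemma q_pow_W: "w \<in> W \<Longrightarrow> (q ^^ n) w \<in> W" by (induction n) (auto intro: q_W)
text \<open>Moving \<open>q\<close> past each of the \<open>Suc n\<close> factors \<open>p\<close>
  produces one term \<open>- z\<close>, and these terms agree because \<open>p\<close> commutes with
  \<open>z\<close>.\<close>

lemma p_pow_q: "w \<in> W \<Longrightarrow> (p ^^ Suc n) (q w) = q ((p ^^ Suc n) w) - scale (of_nat (Suc n)) (z ((p ^^ n) w))"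
proof (induction n)
  case 0 then show ?case by (simp add: pq)
next
  case (Suc n)
  have "(p ^^ Suc (Suc n)) (q w) = p (q ((p ^^ Suc n) w)) - scale (of_nat (Suc n)) (p (z ((p ^^ n) w)))"
    using Suc by (simp add: is_linear_diff[OF p_lin] is_linear_scale[OF p_lin])
  also have "\<dots> = q ((p ^^ Suc (Suc n)) w) - z ((p ^^ Suc n) w) - scale (of_nat (Suc n)) (z ((p ^^ Suc n) w))"
    using pq[OF p_pow_W[OF Suc.prems], of "Suc n"] pz[OF p_pow_W[OF Suc.prems], of n] by simp
  also have "\<dots> = q ((p ^^ Suc (Suc n)) w) - scale (of_nat (Suc (Suc n))) (z ((p ^^ Suc n) w))"
    by (simp only: of_nat_Suc[of "Suc n"] scale_left_distrib scale_one) (simp only: diff_diff_eq)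
  finally show ?case .
qed

text \<open>If \<open>z w = 0\<close>, then \<open>z - 1\<close> only changes the sign of
  \<open>w\<close>, so it can be nilpotent there only for \<open>w = 0\<close>.\<close>

lemma z_inj: assumes "w \<in> W" "z w = 0" shows "w = 0"
proof -
  have "((\<lambda>x. z x - x) ^^ n) w = w \<or> ((\<lambda>x. z x - x) ^^ n) w = - w" for n
    by (induction n) (auto simp: assms(2) is_linear_minus[OF z_lin])
  then show ?thesis using z_unip[OF assms(1)] by (metis neg_equal_0_iff_equal)
qed

text \<open>Inverts the unipotent \<open>z\<close> one order of nilpotency at a time:
  \<open>z w - w\<close> has smaller order, and if \<open>x\<close> is a preimage of it, then
  \<open>w - x\<close> is a preimage of \<open>w\<close>. The subspace is a parameter because
  preimages are wanted inside the kernel of \<open>p\<close>.\<close>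

lemma z_surj_sub:
  assumes K: "is_subspace scale K" "K \<subseteq> W" "\<And>w. w \<in> K \<Longrightarrow> z w \<in> K" and "w \<in> K"
  shows "\<exists>x\<in>K. z x = w"
proof -
  obtain n where "((\<lambda>x. z x - x) ^^ n) w = 0" using z_unip assms by blast
  then show ?thesis using \<open>w \<in> K\<close>
  proof (induction n arbitrary: w)
    case 0
    then show ?case using is_linear_zero[OF z_lin] by auto
  next
    case (Suc n)
    have "z w - w \<in> K" using K Suc.prems by (intro sub_diff) auto
    moreover have "((\<lambda>x. z x - x) ^^ n) (z w - w) = 0"
      using Suc.prems(1) by (simp del: funpow.simps add: funpow_Suc_right)
    ultimately obtain x where x: "x \<in> K" "z x = z w - w" using Suc.IH by blast
    then have "z (w - x) = w" by (simp add: is_linear_diff[OF z_lin])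
    then show ?case using x Suc.prems sub_diff[OF K(1)] by blast
  qed
qed

definition K :: "'b set" where "K = {w \<in> W. p w = 0}"

lemma K_sub: "is_subspace scale K"
  using sub_zero[OF W_sub] sub_add[OF W_sub] sub_scale[OF W_sub]
  by (auto simp: is_subspace_def K_def is_linear_zero[OF p_lin] is_linear_add[OF p_lin]
      is_linear_scale[OF p_lin])

lemma z_K: "w \<in> K \<Longrightarrow> z w \<in> K"
  by (auto simp: K_def z_W pz is_linear_zero[OF z_lin])

lemma z_pow_surj_K: "w \<in> K \<Longrightarrow> \<exists>x\<in>K. (z ^^ n) x = w"
proof (induction n arbitrary: w)
  case 0 then show ?case by auto
next
  case (Suc n)
  obtain y where y: "y \<in> K" "z y = w"
    using z_surj_sub[OF K_sub _ z_K Suc.prems] by (auto simp: K_def)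
  then obtain x where "x \<in> K" "(z ^^ n) x = y" using Suc.IH by blast
  then show ?case using y by auto
qed

text \<open>On the kernel of \<open>p\<close> the pair behaves like a derivative and a variable with
  commutator \<open>- z\<close>; hence the factorial, the sign and the power of \<open>z\<close>.
  Both claims share one induction, because the leading term for \<open>Suc n\<close> needs that
  \<open>p ^^ Suc n\<close> kills \<open>(q ^^ n) u\<close>.\<close>

lemma p_pow_q_pow:
  assumes "u \<in> K"
  shows "(p ^^ Suc n) ((q ^^ n) u) = 0 \<and> (p ^^ n) ((q ^^ n) u) = scale ((- 1) ^ n * fact n) ((z ^^ n) u)"
proof (induction n)
  case 0 then show ?case using assms by (simp add: K_def)
next
  case (Suc n)
  have W: "(q ^^ n) u \<in> W" using assms by (auto simp: K_def intro: q_pow_W)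
  have 2: "(p ^^ Suc n) ((q ^^ Suc n) u) = scale ((- 1) ^ Suc n * fact (Suc n)) ((z ^^ Suc n) u)"
  proof -
    have "(p ^^ Suc n) ((q ^^ n) u) = 0" "(p ^^ n) ((q ^^ n) u) = scale ((- 1) ^ n * fact n) ((z ^^ n) u)"
      using Suc by auto
    then show ?thesis using p_pow_q[OF W, of n]
      by (simp del: funpow.simps(2)[of n p] of_nat_Suc
          add: is_linear_zero[OF q_lin] is_linear_scale[OF z_lin] mult_ac)
  qed
  have "(z ^^ m) u \<in> K" for m by (induction m) (auto simp: assms z_K)
  then have "p ((z ^^ Suc n) u) = 0" by (auto simp only: K_def)
  then have "(p ^^ Suc (Suc n)) ((q ^^ Suc n) u) = 0"
    using 2 by (simp add: is_linear_scale[OF p_lin] is_linear_minus[OF p_lin])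
  then show ?case using 2 by simp
qed

text \<open>Choosing the leading coefficient: the vectors \<open>q\<^sup>n u\<close> with \<open>u \<in> K\<close> have all possible leading
  terms with respect to the filtration by the kernels of the powers of \<open>p\<close>.\<close>

lemma leading_term:
  assumes "y \<in> K" shows "\<exists>u\<in>K. (p ^^ n) ((q ^^ n) u) = y"
proof -
  define c :: 'k where "c = (- 1) ^ n * fact n"
  have c: "c \<noteq> 0" by (simp add: c_def)
  obtain u where u: "u \<in> K" "(z ^^ n) u = scale (inverse c) y"
    using z_pow_surj_K[OF sub_scale[OF K_sub assms]] by blast
  have "(p ^^ n) ((q ^^ n) u) = y"
    using p_pow_q_pow[OF u(1), of n] u(2) c by (simp flip: c_def)
  then show ?thesis using u by blast
qed

text \<open>By \<open>leading_term\<close> some \<open>(q ^^ n) u\<close> has the same image under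
  \<open>p ^^ n\<close> as \<open>w\<close>; subtracting it lowers the order of nilpotency.\<close>

lemma W_eq_closure: "W \<subseteq> closure_under q K"
proof
  fix w assume "w \<in> W"
  obtain n where "(p ^^ n) w = 0" using p_nil[OF \<open>w \<in> W\<close>] by blast
  then show "w \<in> closure_under q K" using \<open>w \<in> W\<close>
  proof (induction n arbitrary: w)
    case 0
    then show ?case using sub_zero[OF K_sub] by (auto intro: closure_under.base)
  next
    case (Suc n)
    have "(p ^^ n) w \<in> K" using Suc.prems p_pow_W by (auto simp: K_def)
    then obtain u where u: "u \<in> K" "(p ^^ n) ((q ^^ n) u) = (p ^^ n) w" using leading_term by blast
    have "u \<in> W" using u by (simp add: K_def)
    then have "(q ^^ n) u \<in> W" using q_pow_W by blast
    moreover have "(p ^^ n) (w - (q ^^ n) u) = 0"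
      using u(2) is_linear_diff[OF is_linear_funpow[OF p_lin]] by simp
    ultimately have 1: "w - (q ^^ n) u \<in> closure_under q K"
      using Suc.IH Suc.prems sub_diff[OF W_sub] by blast
    have "(q ^^ m) u \<in> closure_under q K" for m
      by (induction m) (auto intro: closure_under.intros u)
    from closure_under.add[OF 1 this[of n]] show ?case by simp
  qed
qed

lemma closure_sub_W: "closure_under q K \<subseteq> W"
proof
  fix x assume "x \<in> closure_under q K" then show "x \<in> W"
    by induction (auto simp: K_def intro: q_W sub_add[OF W_sub])
qed

text \<open>If \<open>m\<close> is the largest exponent with \<open>(p ^^ m) w \<noteq> 0\<close>,
  then \<open>p ^^ Suc m\<close> maps \<open>q w\<close> to minus \<open>Suc m\<close> times
  \<open>z ((p ^^ m) w)\<close>. This is nonzero, since the characteristic is 0 and \<open>z\<close>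
  is injective. So \<open>q\<close> strictly raises the order of nilpotency.\<close>

lemma q_K_zero: assumes "w \<in> W" "q w \<in> K" shows "w = 0"
proof (rule ccontr)
  assume "w \<noteq> 0"
  define n where "n = (LEAST n. (p ^^ n) w = 0)"
  have n: "(p ^^ n) w = 0" unfolding n_def using p_nil[OF assms(1)] by (rule LeastI_ex)
  then have "n \<noteq> 0" using \<open>w \<noteq> 0\<close> by (metis funpow_0)
  then obtain m where m: "n = Suc m" by (cases n) auto
  have nz: "(p ^^ m) w \<noteq> 0" using not_less_Least[of m "\<lambda>n. (p ^^ n) w = 0"] by (auto simp: m simp flip: n_def)
  have "(p ^^ n) (q w) = - scale (of_nat n) (z ((p ^^ m) w))"
    using p_pow_q[OF assms(1), of m] n unfolding m by (simp add: is_linear_zero[OF q_lin])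
  moreover have "(p ^^ Suc m) (q w) = 0"
    using assms(2) is_linear_zero[OF is_linear_funpow[OF p_lin]] by (simp add: K_def funpow_swap1)
  ultimately have "scale (of_nat n) (z ((p ^^ m) w)) = 0" by (simp add: m)
  then have "z ((p ^^ m) w) = 0" using m by (simp del: of_nat_Suc)
  then show False using z_inj[OF p_pow_W[OF assms(1)]] nz by blast
qed

text \<open>In \<open>y = m + q w\<close> the term \<open>q w\<close> is a difference of elements of
  \<open>K\<close>, so it vanishes by \<open>q_K_zero\<close>. This keeps a generated submodule from
  acquiring new kernel vectors.\<close>

lemma closure_inter_K:
  assumes "is_subspace scale M" "M \<subseteq> K" "y \<in> closure_under q M" "y \<in> K" shows "y \<in> M"
proof -
  obtain m w where *: "m \<in> M" "w \<in> closure_under q M" "y = m + q w"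
    using closure_under_decomp[OF assms(1) q_lin assms(3)] by blast
  have "w \<in> W" using closure_under_mono[OF assms(2)] closure_sub_W * by blast
  moreover have "q w \<in> K" using * assms sub_diff[OF K_sub, of y m] by auto
  ultimately have "w = 0" by (rule q_K_zero)
  then show ?thesis using * is_linear_zero[OF q_lin] by simp
qed

lemma W_decomp: assumes "w \<in> W" shows "\<exists>m\<in>K. \<exists>x\<in>W. w = m + q x"
  using closure_under_decomp[OF K_sub q_lin] W_eq_closure closure_sub_W assms by blast

text \<open>Some \<open>p ((q ^^ Suc n) u)\<close> has the same leading term as \<open>w\<close>,
  and the difference has smaller order of nilpotency.\<close>

lemma p_surj: assumes "w \<in> W" shows "\<exists>x\<in>W. p x = w"
proof -
  obtain n where "(p ^^ n) w = 0" using p_nil[OF assms] by blast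
  then show ?thesis using assms
  proof (induction n arbitrary: w)
    case 0
    then show ?case using sub_zero[OF W_sub] is_linear_zero[OF p_lin] by auto
  next
    case (Suc n)
    have "(p ^^ n) w \<in> K" using Suc.prems p_pow_W by (auto simp: K_def)
    then obtain u where u: "u \<in> K" "(p ^^ Suc n) ((q ^^ Suc n) u) = (p ^^ n) w" using leading_term by blast
    have W: "(q ^^ Suc n) u \<in> W" using u q_pow_W unfolding K_def by blast
    have "(p ^^ n) (w - p ((q ^^ Suc n) u)) = 0"
      using u(2) is_linear_diff[OF is_linear_funpow[OF p_lin]] by (simp add: funpow_swap1)
    moreover have "w - p ((q ^^ Suc n) u) \<in> W" using W Suc.prems sub_diff[OF W_sub] p_W by blast
    ultimately obtain x where "x \<in> W" "p x = w - p ((q ^^ Suc n) u)" using Suc.IH by blast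
    then have "p (x + (q ^^ Suc n) u) = w" "x + (q ^^ Suc n) u \<in> W"
      using W sub_add[OF W_sub] by (auto simp: is_linear_add[OF p_lin])
    then show ?case by blast
  qed
qed

end

text \<open>Right modules over the mirabolic Lie algebra: \<open>e i j\<close> is the action of the matrix unit
  \<open>E\<^bsub>ij\<^esub>\<close> (indices from 0, so \<open>j < N - 1\<close>).\<close>

locale mir_ops = vector_space sc
  for sc :: "'k::field_char_0 \<Rightarrow> 'b::ab_group_add \<Rightarrow> 'b" +
  fixes N :: nat and e :: "nat \<Rightarrow> nat \<Rightarrow> 'b \<Rightarrow> 'b"
  assumes e_lin: "is_linear sc sc (e i j)"
    and bracket: "\<lbrakk>i < N; Suc j < N; k < N; Suc l < N\<rbrakk> \<Longrightarrow>
      e k l (e i j w) = e i j (e k l w) + (if j = k then e i l w else 0) - (if l = i then e k j w else 0)"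
begin

section \<open>Lowering operators and the filtration by order of nilpotency\<close>

definition gens :: "(nat \<times> nat) set" where "gens = {(i, j). i < N \<and> Suc j < N}"

definition neg :: "(nat \<times> nat) set" where "neg = {(i, j). j < i \<and> i < N}"

definition e' :: "nat \<times> nat \<Rightarrow> 'b \<Rightarrow> 'b" where "e' g = e (fst g) (snd g)"

text \<open>For \<open>a\<close> in \<open>neg\<close> this is the right action of x - \<psi>(x),
  where x is the matrix unit at \<open>a\<close>: \<psi> is 1 on the subdiagonal and 0 further
  below.\<close>

definition p :: "nat \<times> nat \<Rightarrow> 'b \<Rightarrow> 'b" where
  "p a w = e (fst a) (snd a) w - (if fst a = Suc (snd a) then w else 0)"

definition nil :: "nat \<Rightarrow> 'b set" where
  "nil n = {w. \<forall>u. set u \<subseteq> neg \<and> length u = n \<longrightarrow> fold p u w = 0}"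

lemma e'_lin: "is_linear sc sc (e' g)" unfolding e'_def by (rule e_lin)

lemma p_lin: "is_linear sc sc (p a)"
  using e_lin[of "fst a" "snd a"] by (auto simp: p_def is_linear_def algebra_simps)

lemma fold_lin: "(\<And>a. is_linear sc sc (f a)) \<Longrightarrow> is_linear sc sc (fold f u)"
  by (induction u) (auto simp: is_linear_def)

lemma p_e: "\<lbrakk>i < N; Suc j < N; (s, l) \<in> neg\<rbrakk> \<Longrightarrow>
    p (s, l) (e i j w) = e i j (p (s, l) w) + (if j = s then e i l w else 0) - (if l = i then e s j w else 0)"
  using bracket[of i j s l w]
  by (auto simp: p_def neg_def is_linear_diff[OF e_lin] is_linear_zero[OF e_lin])

text \<open>A commutator of two matrix units of n_- lies at least two below the diagonal, where
  \<psi> is 0. So the shift by \<psi> keeps the bracket relations.\<close>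

lemma p_p: "\<lbrakk>(i, j) \<in> neg; (k, l) \<in> neg\<rbrakk> \<Longrightarrow>
    p (k, l) (p (i, j) w) = p (i, j) (p (k, l) w) + (if j = k then p (i, l) w else 0) - (if l = i then p (k, j) w else 0)"
proof -
  assume *: "(i, j) \<in> neg" "(k, l) \<in> neg"
  have "p (i, l) w = e i l w" if "j = k" using * that by (auto simp: p_def neg_def)
  moreover have "p (k, j) w = e k j w" if "l = i" using * that by (auto simp: p_def neg_def)
  moreover have "p (k, l) (p (i, j) w) = p (k, l) (e i j w) - (if i = Suc j then p (k, l) w else 0)"
    by (simp add: p_def[of "(i, j)"] is_linear_diff[OF p_lin] is_linear_zero[OF p_lin])
  moreover have "p (i, j) (p (k, l) w) = e i j (p (k, l) w) - (if i = Suc j then p (k, l) w else 0)"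
    by (simp add: p_def[of "(i, j)"])
  moreover have "i < N" "Suc j < N" using * by (auto simp: neg_def)
  ultimately show ?thesis using p_e[of i j k l w] * by auto
qed

lemma nil_0: "nil 0 = {0}" by (auto simp: nil_def)

lemma nil_Suc: "w \<in> nil (Suc n) \<longleftrightarrow> (\<forall>a\<in>neg. p a w \<in> nil n)"
proof
  assume "w \<in> nil (Suc n)"
  then have *: "set u \<subseteq> neg \<Longrightarrow> length u = Suc n \<Longrightarrow> fold p u w = 0" for u by (simp add: nil_def)
  have "fold p u (p a w) = 0" if "a \<in> neg" "set u \<subseteq> neg" "length u = n" for a u
    using *[of "a # u"] that by simp
  then show "\<forall>a\<in>neg. p a w \<in> nil n" by (auto simp: nil_def)
next
  assume *: "\<forall>a\<in>neg. p a w \<in> nil n"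
  have "fold p u w = 0" if "set u \<subseteq> neg" "length u = Suc n" for u
    using that * by (cases u) (auto simp: nil_def)
  then show "w \<in> nil (Suc n)" by (auto simp: nil_def)
qed

lemma nil_sub: "is_subspace sc (nil n)"
  by (auto simp: is_subspace_def nil_def is_linear_zero[OF fold_lin, OF p_lin]
      is_linear_add[OF fold_lin, OF p_lin] is_linear_scale[OF fold_lin, OF p_lin])

lemma nil_mono: "w \<in> nil n \<Longrightarrow> n \<le> m \<Longrightarrow> w \<in> nil m"
proof -
  have step: "w \<in> nil n \<Longrightarrow> w \<in> nil (Suc n)" for n w
  proof (induction n arbitrary: w)
    case 0 then show ?case by (auto simp: nil_0 nil_Suc is_linear_zero[OF p_lin])
  next
    case (Suc n) then show ?case by (auto simp: nil_Suc)
  qed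
  show "w \<in> nil n \<Longrightarrow> n \<le> m \<Longrightarrow> w \<in> nil m"
    by (induction m) (auto simp: le_Suc_eq step)
qed

text \<open>Commuting a lowering operator past \<open>e i j\<close> lowers either the nilpotency order of the vector or
  the weight \<open>j - i\<close>, which is bounded below.\<close>

lemma e_nil:
  "\<lbrakk>w \<in> nil n; i < N; Suc j < N; n + (j + N - i) \<le> m\<rbrakk> \<Longrightarrow> e i j w \<in> nil m"
proof (induction m arbitrary: n i j w)
  case 0 then show ?case by simp
next
  case (Suc m)
  show ?case
  proof (cases n)
    case 0
    then show ?thesis using Suc.prems(1) sub_zero[OF nil_sub] by (simp add: nil_0 is_linear_zero[OF e_lin])
  next
    case (Suc n')
    have "p a (e i j w) \<in> nil m" if a: "a \<in> neg" for a
    proof -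
      obtain s l where sl: "a = (s, l)" "l < s" "s < N" using a by (auto simp: neg_def)
      have "e i j (p (s, l) w) \<in> nil m"
        using Suc.IH[of "p (s, l) w" n' i j] Suc.prems Suc a sl by (auto simp: nil_Suc)
      moreover have "e i l w \<in> nil m" if "j = s"
        using Suc.IH[of w n i l] Suc.prems sl that by auto
      moreover have "e s j w \<in> nil m" if "l = i"
        using Suc.IH[of w n s j] Suc.prems sl that by auto
      ultimately show ?thesis
        using p_e[of i j s l w] a sl Suc.prems
        by (auto intro!: sub_add[OF nil_sub] sub_diff[OF nil_sub] sub_zero[OF nil_sub])
    qed
    then show ?thesis by (auto simp: nil_Suc)
  qed
qed

section \<open>Submodules generated by a subspace\<close>

text \<open>\<open>fold\<close> lets the first letter act first, as a right action does. Scalar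
  multiples come from the subspace \<open>V\<close>, see \<open>gen_sub\<close>.\<close>

inductive_set gen :: "'b set \<Rightarrow> 'b set" for V where
  word: "x \<in> V \<Longrightarrow> set u \<subseteq> gens \<Longrightarrow> fold e' u x \<in> gen V"
| add: "x \<in> gen V \<Longrightarrow> y \<in> gen V \<Longrightarrow> x + y \<in> gen V"

lemma gen_base: "V \<subseteq> gen V" using gen.word[of _ V "[]"] by auto

lemma gen_e: "x \<in> gen V \<Longrightarrow> i < N \<Longrightarrow> Suc j < N \<Longrightarrow> e i j x \<in> gen V"
proof (induction rule: gen.induct)
  case (word x u)
  then have "fold e' (u @ [(i, j)]) x \<in> gen V" by (intro gen.word) (auto simp: gens_def)
  then show ?case by (simp add: e'_def)
next
  case (add x y) then show ?case by (auto simp: is_linear_add[OF e_lin] intro: gen.add)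
qed

lemma gen_sub: assumes "is_subspace sc V" shows "is_subspace sc (gen V)"
proof -
  have "sc c x \<in> gen V" if "x \<in> gen V" for c x
    using that
  proof induction
    case (word x u)
    then have "fold e' u (sc c x) \<in> gen V" by (intro gen.word sub_scale[OF assms])
    then show ?case by (simp add: is_linear_scale[OF fold_lin, OF e'_lin])
  next
    case (add x y) then show ?case by (auto simp: scale_right_distrib intro: gen.add)
  qed
  then show ?thesis using gen_base[of V] sub_zero[OF assms] by (auto simp: is_subspace_def intro: gen.add)
qed

definition stable :: "'b set \<Rightarrow> bool" where
  "stable S \<longleftrightarrow> is_subspace sc S \<and> (\<forall>i j. \<forall>w\<in>S. i < N \<longrightarrow> Suc j < N \<longrightarrow> e i j w \<in> S)"

lemma stable_gen: "is_subspace sc V \<Longrightarrow> stable (gen V)"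
  by (auto simp: stable_def gen_sub gen_e)

lemma stable_fold: "stable S \<Longrightarrow> x \<in> S \<Longrightarrow> set u \<subseteq> gens \<Longrightarrow> fold e' u x \<in> S"
  by (induction u arbitrary: x) (auto simp: stable_def e'_def gens_def)

lemma gen_least: "stable S \<Longrightarrow> V \<subseteq> S \<Longrightarrow> gen V \<subseteq> S"
proof
  fix x assume *: "stable S" "V \<subseteq> S" "x \<in> gen V"
  from this(3,1,2) show "x \<in> S"
    by induction (auto intro: stable_fold simp: stable_def is_subspace_def)
qed

text \<open>By \<open>e_nil\<close> a letter raises the order of nilpotency by at most a bound that
  depends only on the letter.\<close>

lemma loc_nil_gen:
  assumes "\<And>x. x \<in> V \<Longrightarrow> \<exists>n. x \<in> nil n" and "w \<in> gen V" shows "\<exists>n. w \<in> nil n"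
  using assms(2)
proof induction
  case (word x u)
  obtain n where "x \<in> nil n" using assms(1) word by blast
  then have "\<exists>n. x \<in> nil n" by blast
  then show ?case using word(2)
  proof (induction u arbitrary: x)
    case Nil then show ?case by simp
  next
    case (Cons g u)
    obtain n where "x \<in> nil n" using Cons.prems by blast
    then have "e' g x \<in> nil (n + (snd g + N - fst g))"
      using Cons.prems unfolding e'_def by (intro e_nil) (auto simp: gens_def)
    then have "\<exists>n. e' g x \<in> nil n" by blast
    then show ?case using Cons by simp
  qed
next
  case (add x y)
  then obtain n m where "x \<in> nil n" "y \<in> nil m" by blast
  then have "x \<in> nil (max n m)" "y \<in> nil (max n m)" using nil_mono by auto
  then show ?case using sub_add[OF nil_sub] by blast
qed

definition invs :: "'b set \<Rightarrow> 'b set" where "invs S = {w \<in> S. \<forall>a\<in>neg. p a w = 0}"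

lemma invs_sub: "is_subspace sc S \<Longrightarrow> is_subspace sc (invs S)"
  by (auto simp: is_subspace_def invs_def is_linear_zero[OF p_lin] is_linear_add[OF p_lin]
      is_linear_scale[OF p_lin])

section \<open>The order of the matrix units and their partners\<close>

text \<open>Lexicographic: a lower row has larger rank, and within a row a column further left. On
  \<open>neg\<close> the term \<open>N - snd a\<close> lies between 1 and \<open>N\<close>, so the
  ranks of different rows do not overlap.\<close>

definition rk :: "nat \<times> nat \<Rightarrow> nat" where "rk a = fst a * N + (N - snd a)"

lemma rk_less: "(r, j) \<in> neg \<Longrightarrow> (s, l) \<in> neg \<Longrightarrow> rk (r, j) < rk (s, l) \<longleftrightarrow> r < s \<or> r = s \<and> l < j"
proof -
  have *: "rk (r, j) < rk (s, l)" if "(r, j) \<in> neg" "(s, l) \<in> neg" "r < s" for r j s l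
  proof -
    have "Suc r * N \<le> s * N" using that by (intro mult_right_mono) auto
    then show ?thesis using that by (auto simp: rk_def neg_def)
  qed
  show "(r, j) \<in> neg \<Longrightarrow> (s, l) \<in> neg \<Longrightarrow> ?thesis"
    using *[of r j s l] *[of s l r j] by (cases r s rule: linorder_cases) (auto simp: rk_def neg_def)
qed

lemma finite_neg: "finite neg"
  by (rule finite_subset[of _ "{..<N} \<times> {..<N}"]) (auto simp: neg_def)

text \<open>From the largest rank to the smallest: the bottom row comes first, and each row is read
  from left to right. The stability of kernels in \<open>kash\<close> depends on this order.\<close>

definition L :: "(nat \<times> nat) list" where
  "L = (SOME L. set L = neg \<and> sorted_wrt (\<lambda>a b. rk b < rk a) L)"

lemma L_props: "set L = neg \<and> sorted_wrt (\<lambda>a b. rk b < rk a) L"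
proof -
  obtain xs where xs: "set xs = neg" "distinct xs" using finite_distinct_list[OF finite_neg] by blast
  have inj: "inj_on rk neg"
  proof (rule inj_onI, rule ccontr)
    fix a b assume *: "a \<in> neg" "b \<in> neg" "rk a = rk b" "a \<noteq> b"
    then show False using rk_less[of "fst a" "snd a" "fst b" "snd b"]
        rk_less[of "fst b" "snd b" "fst a" "snd a"] by (auto simp: prod_eq_iff)
  qed
  define ys where "ys = sort_key rk xs"
  have ys: "set ys = neg" "distinct ys" "sorted (map rk ys)" using xs by (auto simp: ys_def)
  then have "sorted_wrt (<) (map rk ys)"
    using inj by (simp add: strict_sorted_iff distinct_map)
  then have "set (rev ys) = neg \<and> sorted_wrt (\<lambda>a b. rk b < rk a) (rev ys)"
    using ys by (auto simp: sorted_wrt_map sorted_wrt_rev)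
  then show ?thesis unfolding L_def by (rule someI)
qed

lemma set_L: "set L = neg" using L_props by blast

lemma L_split:
  assumes "L = xs @ a # ys" shows "set xs = {b \<in> neg. rk a < rk b}" "set ys = {b \<in> neg. rk b < rk a}" "a \<in> neg"
proof -
  have s: "sorted_wrt (\<lambda>a b. rk b < rk a) (xs @ a # ys)" and n: "set (xs @ a # ys) = neg"
    using L_props assms by auto
  show "a \<in> neg" using n by auto
  have "\<forall>b\<in>set xs. rk a < rk b" "\<forall>b\<in>set ys. rk b < rk a"
    using s by (auto simp: sorted_wrt_append)
  then show "set xs = {b \<in> neg. rk a < rk b}" "set ys = {b \<in> neg. rk b < rk a}"
    using n by fastforce+
qed

text \<open>The partner of E_{r,j} is E_{j,r-1}. The map from (r, j) to (j, r-1) is a bijection from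
  \<open>neg\<close> onto the elements of \<open>gens\<close> outside \<open>neg\<close>, with
  inverse from (i, k) to (k+1, i).\<close>

definition q :: "nat \<times> nat \<Rightarrow> 'b \<Rightarrow> 'b" where "q a = e (snd a) (fst a - 1)"

text \<open>For \<open>a = (r, j)\<close> this is \<open>p (r, r - 1)\<close> plus the identity,
  hence unipotent where the lowering operators are nilpotent.\<close>

definition z :: "nat \<times> nat \<Rightarrow> 'b \<Rightarrow> 'b" where "z a = e (fst a) (fst a - 1)"

lemma q_lin: "is_linear sc sc (q a)" unfolding q_def by (rule e_lin)

text \<open>The closures of the successive Kashiwara steps, nested: the operator of the last entry
  acts innermost, next to \<open>V\<close>.\<close>

fun chain :: "(nat \<times> nat) list \<Rightarrow> 'b set \<Rightarrow> 'b set" where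
  "chain [] V = V"
| "chain (a # ys) V = closure_under (q a) (chain ys V)"

lemma chain_sub: "is_subspace sc V \<Longrightarrow> is_subspace sc (chain ys V)"
  by (induction ys) (auto intro: closure_under_sub q_lin)

lemma chain_base: "V \<subseteq> chain ys V"
  by (induction ys) (auto intro: closure_under.base)

lemma chain_app: "chain ys V \<subseteq> chain (xs @ ys) V"
  by (induction xs) (auto intro: closure_under.base)

lemma chain_gen: "set ys \<subseteq> neg \<Longrightarrow> chain ys V \<subseteq> gen V"
proof (induction ys)
  case Nil then show ?case by (simp add: gen_base)
next
  case (Cons a ys)
  show ?case
  proof
    fix x assume "x \<in> chain (a # ys) V"
    then have "x \<in> closure_under (q a) (chain ys V)" by simp
    then show "x \<in> gen V"
    proof induction
      case (base x) then show ?case using Cons by auto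
    next
      case (add x y) then show ?case by (auto intro: gen.add)
    next
      case (app x) then show ?case using Cons.prems gen_e[of x V "snd a" "fst a - 1"]
        by (auto simp: q_def neg_def)
    qed
  qed
qed

subsection \<open>Sorting words\<close>

text \<open>A sorting key for letters. Those of n_- get 0 and come first in a sorted word, where
  they meet vectors on which they act by scalars. The others are operators \<open>q a\<close> and
  get the rank of \<open>a\<close>.\<close>

definition rk2 :: "nat \<times> nat \<Rightarrow> nat" where
  "rk2 g = (if snd g < fst g then 0 else rk (Suc (snd g), fst g))"

text \<open>Peel off the last letter, the one of largest rank. The remaining letters have at most
  this rank, so their roots lie in the tail of the list that starts at the root of the last
  letter.\<close>

lemma sorted_word_chain:
  assumes "L = xs @ ys" "x \<in> V"
    and "\<forall>g\<in>set s. g \<in> gens \<and> rk2 g > 0 \<and> (Suc (snd g), fst g) \<in> set ys"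
    and "sorted (map rk2 s)"
  shows "fold e' s x \<in> chain ys V"
  using assms
proof (induction s arbitrary: xs ys rule: rev_induct)
  case Nil then show ?case using chain_base by auto
next
  case (snoc g s)
  define a where "a = (Suc (snd g), fst g)"
  have "a \<in> set ys" using snoc.prems by (simp add: a_def)
  then obtain y1 y2 where ys: "ys = y1 @ a # y2" by (meson split_list)
  have L': "L = (xs @ y1) @ a # y2" using snoc.prems ys by simp
  have ra: "rk2 h = rk (Suc (snd h), fst h)" if "rk2 h > 0" for h
    using that by (auto simp: rk2_def split: if_splits)
  have "(Suc (snd h), fst h) \<in> set (a # y2)" if h: "h \<in> set s" for h
  proof -
    let ?b = "(Suc (snd h), fst h)"
    have "rk2 h \<le> rk2 g" using snoc.prems(4) h by (auto simp: sorted_append)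
    then have "rk ?b \<le> rk a" using ra[of h] ra[of g] snoc.prems(3) h by (auto simp: a_def)
    then have "?b \<notin> set (xs @ y1)" unfolding L_split(1)[OF L'] by simp
    moreover have "?b \<in> set ys" using snoc.prems(3) h by simp
    ultimately show ?thesis by (auto simp: ys)
  qed
  then have "fold e' s x \<in> chain (a # y2) V"
    using snoc.prems(2-4) by (intro snoc.IH[OF L']) (auto simp: sorted_append)
  then have "q a (fold e' s x) \<in> chain (a # y2) V" by (auto intro: closure_under.app)
  then show ?case using chain_app[of "a # y2" V y1] by (auto simp: ys q_def a_def e'_def[of g])
qed

context
  fixes V M d
  assumes M_sub: "is_subspace sc M"
    and shorter: "\<And>u x. set u \<subseteq> gens \<Longrightarrow> length u < d \<Longrightarrow> x \<in> V \<Longrightarrow> fold e' u x \<in> M"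
begin

text \<open>The straightening step: a commutator of two letters is a combination of single letters,
  so the error consists of words that are one letter shorter, and \<open>M\<close> contains these by
  \<open>shorter\<close>.\<close>

lemma swap_word:
  assumes "set (a @ g # h # b) \<subseteq> gens" "length (a @ g # h # b) = d" "x \<in> V"
  shows "fold e' (a @ g # h # b) x - fold e' (a @ h # g # b) x \<in> M"
proof -
  obtain i j k l where gh: "g = (i, j)" "h = (k, l)" by fastforce
  define y where "y = fold e' a x"
  have lin: "is_linear sc sc (fold e' b)" by (rule fold_lin[OF e'_lin])
  have "e' h (e' g y) - e' g (e' h y) = (if j = k then e i l y else 0) - (if l = i then e k j y else 0)"
    using bracket[of i j k l y] assms(1) by (auto simp: gh gens_def e'_def)
  then have "fold e' (a @ g # h # b) x - fold e' (a @ h # g # b) x =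
      fold e' b ((if j = k then e i l y else 0) - (if l = i then e k j y else 0))"
    using is_linear_diff[OF lin, of "e' h (e' g y)" "e' g (e' h y)"] by (simp add: y_def)
  also have "\<dots> = (if j = k then fold e' (a @ (i, l) # b) x else 0) - (if l = i then fold e' (a @ (k, j) # b) x else 0)"
    by (simp add: is_linear_diff[OF lin] is_linear_zero[OF lin] y_def e'_def is_linear_minus[OF lin])
  also have "\<dots> \<in> M"
    using assms shorter[of "a @ (i, l) # b" x] shorter[of "a @ (k, j) # b" x]
    by (intro sub_diff[OF M_sub]) (auto simp: gh gens_def sub_zero[OF M_sub])
  finally show ?thesis .
qed

lemma insort_word:
  assumes "set (a @ g # u) \<subseteq> gens" "length (a @ g # u) = d" "x \<in> V"
  shows "fold e' (a @ g # u) x - fold e' (a @ insort_key rk2 g u) x \<in> M"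
  using assms
proof (induction u arbitrary: a)
  case Nil then show ?case using sub_zero[OF M_sub] by simp
next
  case (Cons h u)
  show ?case
  proof (cases "rk2 g \<le> rk2 h")
    case True then show ?thesis using sub_zero[OF M_sub] by simp
  next
    case False
    have 1: "fold e' (a @ g # h # u) x - fold e' (a @ h # g # u) x \<in> M"
      using swap_word Cons.prems by blast
    have 2: "fold e' ((a @ [h]) @ g # u) x - fold e' ((a @ [h]) @ insort_key rk2 g u) x \<in> M"
      using Cons.prems by (intro Cons.IH) auto
    show ?thesis using sub_add[OF M_sub 1 2] False by simp
  qed
qed

lemma sort_word:
  assumes "set (a @ u) \<subseteq> gens" "length (a @ u) = d" "x \<in> V"
  shows "fold e' (a @ u) x - fold e' (a @ sort_key rk2 u) x \<in> M"
  using assms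
proof (induction u arbitrary: a)
  case Nil then show ?case using sub_zero[OF M_sub] by simp
next
  case (Cons g u)
  have 1: "fold e' ((a @ [g]) @ u) x - fold e' ((a @ [g]) @ sort_key rk2 u) x \<in> M"
    using Cons.prems by (intro Cons.IH) auto
  have 2: "fold e' (a @ g # sort_key rk2 u) x - fold e' (a @ insort_key rk2 g (sort_key rk2 u)) x \<in> M"
    using Cons.prems by (intro insort_word) auto
  show ?case using sub_add[OF M_sub 1 2] by simp
qed

end

text \<open>Induction on the length, sorting modulo shorter words. If a sorted word begins with a
  letter of n_-, this letter acts on \<open>x\<close> by the value of \<psi>, which is 0 or 1, and a
  shorter word is left. Otherwise all letters are operators \<open>q a\<close> in the right
  order.\<close>

lemma word_chain:
  assumes V: "is_subspace sc V" "\<And>x a. x \<in> V \<Longrightarrow> a \<in> neg \<Longrightarrow> p a x = 0"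
    and "set u \<subseteq> gens" "x \<in> V"
  shows "fold e' u x \<in> chain L V"
  using assms(3,4)
proof (induction "length u" arbitrary: u x rule: less_induct)
  case less
  let ?s = "sort_key rk2 u"
  have M: "is_subspace sc (chain L V)" by (rule chain_sub[OF V(1)])
  have 1: "fold e' ([] @ u) x - fold e' ([] @ ?s) x \<in> chain L V"
    using less by (intro sort_word[OF M, where d = "length u" and V = V]) auto
  have "fold e' ?s x \<in> chain L V"
  proof (cases ?s)
    case Nil then show ?thesis using less.prems(2) chain_base[of V L] by (auto simp del: set_empty)
  next
    case (Cons g s)
    have set_s: "set (g # s) = set u" using Cons by (metis set_sort)
    have len: "length u = Suc (length s)" using Cons by (metis length_Cons length_sort)
    show ?thesis
    proof (cases "rk2 g = 0")
      case True
      have "g \<in> gens" using set_s less.prems by auto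
      then have g: "g \<in> neg" using True by (auto simp: rk2_def rk_def gens_def neg_def split: if_splits)
      then have "p g x = 0" using V less.prems by blast
      then have "e' g x = x \<or> e' g x = 0" by (auto simp: p_def e'_def split: if_splits)
      moreover have "fold e' s x \<in> chain L V" using less set_s len by auto
      ultimately show ?thesis
        using sub_zero[OF M] by (auto simp: Cons is_linear_zero[OF fold_lin, OF e'_lin])
    next
      case False
      have sorted: "sorted (map rk2 (g # s))" using Cons by (metis sorted_sort_key)
      have "h \<in> gens \<and> rk2 h > 0 \<and> (Suc (snd h), fst h) \<in> set L" if "h \<in> set (g # s)" for h
      proof -
        have "rk2 g \<le> rk2 h" using sorted that by auto
        then have "rk2 h > 0" using False by simp
        moreover have "h \<in> gens" using that set_s less.prems by auto
        ultimately show ?thesis by (auto simp: set_L rk2_def gens_def neg_def split: if_splits)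
      qed
      then have "fold e' (g # s) x \<in> chain L V"
        using sorted less.prems by (intro sorted_word_chain[of "[]"]) auto
      then show ?thesis by (simp only: Cons)
    qed
  qed
  then show ?case using sub_diff_cancel[OF M 1[simplified append_Nil]] by blast
qed

lemma gen_chain:
  assumes "is_subspace sc V" "\<And>x a. x \<in> V \<Longrightarrow> a \<in> neg \<Longrightarrow> p a x = 0"
  shows "gen V = chain L V"
proof
  show "chain L V \<subseteq> gen V" using chain_gen set_L by auto
  show "gen V \<subseteq> chain L V"
  proof
    fix x assume "x \<in> gen V" then show "x \<in> chain L V"
      by induction (auto intro: word_chain assms sub_add[OF chain_sub[OF assms(1)]])
  qed
qed

end

section \<open>Locally nilpotent modules and the iterated Kashiwara step\<close>

text \<open>The module is a subset of an ambient type, so that submodules such as graphs and kernels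
  are instances with the same operators.\<close>

locale mir_mod = mir_ops +
  fixes S
  assumes S_stable: "stable S" and S_nil: "w \<in> S \<Longrightarrow> \<exists>n. w \<in> nil n"
begin

lemma S_sub: "is_subspace sc S" using S_stable by (simp add: stable_def)

lemma S_e: "w \<in> S \<Longrightarrow> i < N \<Longrightarrow> Suc j < N \<Longrightarrow> e i j w \<in> S" using S_stable by (auto simp: stable_def)

lemma S_p: "w \<in> S \<Longrightarrow> a \<in> neg \<Longrightarrow> p a w \<in> S"
  using S_e[of w "fst a" "snd a"] sub_diff[OF S_sub] sub_zero[OF S_sub]
  by (auto simp: p_def neg_def)

lemma S_pfold: "w \<in> S \<Longrightarrow> set u \<subseteq> neg \<Longrightarrow> fold p u w \<in> S"
  by (induction u arbitrary: w) (auto simp: S_p)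

definition W :: "(nat \<times> nat) list \<Rightarrow> 'b set" where "W xs = {w \<in> S. \<forall>a\<in>set xs. p a w = 0}"

lemma W_Nil: "W [] = S" by (simp add: W_def)

lemma W_L: "W L = invs S" by (simp add: W_def invs_def set_L)

lemma p_pow_nil: assumes "w \<in> nil n" "a \<in> neg" shows "(p a ^^ n) w = 0"
proof -
  have "set (replicate n a) \<subseteq> neg" using assms by (cases n) auto
  then have "fold p (replicate n a) w = 0" using assms(1) by (simp only: nil_def mem_Collect_eq length_replicate)
  moreover have "fold p (replicate n a) = p a ^^ n" by (induction n) (auto simp: funpow_Suc_right simp del: funpow.simps)
  ultimately show ?thesis by simp
qed

text \<open>Let \<open>a = (r, j)\<close>. Then \<open>xs\<close> consists of the rows below r and,
  in row r, of the columns left of j. On \<open>W xs\<close> the matrix units E_{s,i} with s > r > i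
  act by 0, because they lie at least two below the diagonal. The commutators of earlier operators
  with E_{j,r-1} or with a unit E_{r,k}, k < r, are 0 or up to sign of this kind, so
  \<open>W xs\<close> is stable.\<close>

lemma kash:
  assumes L: "L = xs @ a # ys" shows "kashiwara sc (W xs) (p a) (q a) (z a)"
proof -
  obtain r j where a: "a = (r, j)" "j < r" "r < N" using L_split(3)[OF L] by (auto simp: neg_def)
  have an: "(r, j) \<in> neg" using a by (simp add: neg_def)
  have xs: "(s, l) \<in> set xs \<longleftrightarrow> (s, l) \<in> neg \<and> (r < s \<or> r = s \<and> l < j)" for s l
    using L_split(1)[OF L] rk_less[OF an, of s l] a by auto
  have far: "e s i w = 0" if "w \<in> W xs" "r < s" "s < N" "i < r" for s i w
  proof -
    have "(s, i) \<in> set xs" using that by (auto simp: xs neg_def)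
    then have "p (s, i) w = 0" using that by (auto simp: W_def)
    then show ?thesis using that by (simp add: p_def)
  qed
  have WS: "w \<in> S" if "w \<in> W xs" for w using that by (simp add: W_def)
  have W0: "p b w = 0" if "w \<in> W xs" "b \<in> set xs" for w b using that by (simp add: W_def)
  have r1: "Suc (r - 1) = r" "r - 1 < r" using a by auto
  \<comment> \<open>The case \<open>i = r\<close> serves \<open>p a\<close> and \<open>z a\<close>,
    the other case serves \<open>q a\<close>.\<close>
  have stab: "e i k w \<in> W xs" if w: "w \<in> W xs" and i: "i \<le> r" and k: "k < r"
    and *: "\<And>s. k = s \<Longrightarrow> r \<le> s \<Longrightarrow> False" and **: "i = r \<or> (i = j \<and> k = r - 1)" for w i k
  proof -
    have "p b (e i k w) = 0" if b: "b \<in> set xs" for b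
    proof -
      obtain s l where sl: "b = (s, l)" by force
      then have sln: "(s, l) \<in> neg" "r < s \<or> r = s \<and> l < j" using b xs by auto
      have "p (s, l) (e i k w) = e i k (p (s, l) w) + (if k = s then e i l w else 0) - (if l = i then e s k w else 0)"
        using sln a i k by (intro p_e) auto
      moreover have "e s k w = 0" if "l = i" using sln that ** a far[OF w, of s k] k by (auto simp: neg_def)
      moreover have "k \<noteq> s" using sln k by auto
      ultimately show ?thesis using W0[OF w] b sl by (simp add: is_linear_zero[OF e_lin])
    qed
    moreover have "e i k w \<in> S" using WS[OF w] a i k by (intro S_e) auto
    ultimately show ?thesis by (simp add: W_def)
  qed
  have Wsub: "is_subspace sc (W xs)"
    using S_sub by (auto simp: is_subspace_def W_def is_linear_zero[OF p_lin] is_linear_add[OF p_lin]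
      is_linear_scale[OF p_lin])
  have er: "e r k w \<in> W xs" if "w \<in> W xs" "k < r" for k w
    using that by (intro stab) auto
  have rr: "(r, r - 1) \<in> neg" using a by (auto simp: neg_def)
  have zp: "z a w - w = p (r, r - 1) w" for w
    using r1 by (simp add: z_def p_def a(1))
  show ?thesis
  proof
    show "is_subspace sc (W xs)" by (rule Wsub)
    show "is_linear sc sc (p a)" "is_linear sc sc (q a)" "is_linear sc sc (z a)"
      by (auto simp: q_def z_def intro: p_lin e_lin)
    fix w assume w: "w \<in> W xs"
    show "p a w \<in> W xs" using er[OF w a(2)] sub_diff[OF Wsub er[OF w a(2)] w]
      by (cases "r = Suc j") (simp_all add: p_def a(1))
    show "q a w \<in> W xs" unfolding q_def using w a by (intro stab) auto
    show "z a w \<in> W xs" unfolding z_def using w a by (auto intro: er)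
    have ne: "r - Suc 0 \<noteq> r" using a by simp
    show "p a (q a w) = q a (p a w) - z a w"
      using p_e[of j "r - 1" r j w] an a r1 ne by (simp add: q_def z_def)
    show "p a (z a w) = z a (p a w)"
      using p_e[of r "r - 1" r j w] an a r1 ne by (simp add: z_def)
    obtain n where n: "w \<in> nil n" using S_nil[OF WS[OF w]] by blast
    show "\<exists>n. (p a ^^ n) w = 0" using p_pow_nil[OF n] an a by blast
    show "\<exists>n. ((\<lambda>x. z a x - x) ^^ n) w = 0" unfolding zp using p_pow_nil[OF n rr] by blast
  qed
qed

lemma kash_K: assumes L: "L = xs @ a # ys" shows "kashiwara.K (W xs) (p a) = W (xs @ [a])"
  unfolding kashiwara.K_def[OF kash[OF L]] by (auto simp: W_def)

lemma W_chain: "L = xs @ ys \<Longrightarrow> W xs \<subseteq> chain ys (invs S)"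
proof (induction ys arbitrary: xs)
  case Nil then show ?case using W_L by simp
next
  case (Cons a ys)
  have "W xs \<subseteq> closure_under (q a) (W (xs @ [a]))"
    using kashiwara.W_eq_closure[OF kash[OF Cons.prems]] kash_K[OF Cons.prems] by simp
  also have "\<dots> \<subseteq> closure_under (q a) (chain ys (invs S))"
    using Cons by (intro closure_under_mono) auto
  finally show ?case by simp
qed

text \<open>Each kernel \<open>W xs\<close> is the closure under \<open>q a\<close> of the next
  smaller one; composed along \<open>L\<close>, these closures start from the invariants and end at
  \<open>S\<close>.\<close>

theorem gen_invs: "gen (invs S) = S"
proof
  show "gen (invs S) \<subseteq> S" using S_stable by (rule gen_least) (auto simp: invs_def)
  show "S \<subseteq> gen (invs S)" using W_chain[of "[]" L] chain_gen[of L] by (auto simp: W_Nil set_L)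
qed

lemma chain_W: "L = xs @ ys \<Longrightarrow> V \<subseteq> invs S \<Longrightarrow> chain ys V \<subseteq> W xs"
proof (induction ys arbitrary: xs)
  case Nil then show ?case using W_L by simp
next
  case (Cons a ys)
  have "chain ys V \<subseteq> W (xs @ [a])" using Cons by simp
  then have "chain (a # ys) V \<subseteq> closure_under (q a) (W (xs @ [a]))" by (simp add: closure_under_mono)
  also have "\<dots> \<subseteq> W xs"
    using kashiwara.closure_sub_W[OF kash[OF Cons.prems(1)]] by (simp only: kash_K[OF Cons.prems(1)])
  finally show ?case .
qed

text \<open>An invariant vector lies in every kernel \<open>W xs\<close>, so
  \<open>closure_inter_K\<close> removes the outer closures one at a time.\<close>

lemma chain_inter:
  "L = xs @ ys \<Longrightarrow> V \<subseteq> invs S \<Longrightarrow> is_subspace sc V \<Longrightarrow> chain ys V \<inter> invs S \<subseteq> V"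
proof (induction ys arbitrary: xs)
  case Nil then show ?case by simp
next
  case (Cons a ys)
  show ?case
  proof
    fix y assume y: "y \<in> chain (a # ys) V \<inter> invs S"
    have "chain ys V \<subseteq> W (xs @ [a])" using Cons.prems by (intro chain_W) auto
    moreover have "y \<in> W (xs @ [a])" using y Cons.prems(1) by (auto simp: W_def invs_def simp flip: set_L)
    ultimately have "y \<in> chain ys V"
      using y kashiwara.closure_inter_K[OF kash[OF Cons.prems(1)] chain_sub[OF Cons.prems(3)], where y = y]
      unfolding kash_K[OF Cons.prems(1)] by simp
    then show "y \<in> V" using Cons.IH[of "xs @ [a]"] Cons.prems y by auto
  qed
qed

text \<open>Sorting words rewrites \<open>gen V\<close> as nested closures, and in these each
  Kashiwara step can be undone without leaving \<open>V\<close>.\<close>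

theorem gen_inter_invs:
  assumes "is_subspace sc V" "V \<subseteq> invs S" shows "gen V \<inter> invs S = V"
proof -
  have "gen V = chain L V" using assms by (intro gen_chain) (auto simp: invs_def)
  then show ?thesis using chain_inter[of "[]" L V] assms gen_base[of V] by auto
qed

text \<open>Apply lowering operators as long as something nonzero remains. Local nilpotency ends
  this, and the last nonzero vector is invariant.\<close>

lemma engel_word:
  assumes "w \<in> S" "w \<noteq> 0" shows "\<exists>u. set u \<subseteq> neg \<and> fold p u w \<in> invs S \<and> fold p u w \<noteq> 0"
proof -
  obtain n where "w \<in> nil n" using S_nil assms by blast
  then show ?thesis using assms
  proof (induction n arbitrary: w)
    case 0 then show ?case by (simp add: nil_0)
  next
    case (Suc n)
    show ?case
    proof (cases "\<forall>a\<in>neg. p a w = 0")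
      case True then show ?thesis using Suc.prems by (intro exI[of _ "[]"]) (auto simp: invs_def)
    next
      case False
      then obtain a where a: "a \<in> neg" "p a w \<noteq> 0" by blast
      then obtain u where "set u \<subseteq> neg" "fold p u (p a w) \<in> invs S" "fold p u (p a w) \<noteq> 0"
        using Suc.IH[of "p a w"] Suc.prems S_p by (auto simp: nil_Suc)
      then show ?thesis using a by (intro exI[of _ "a # u"]) auto
    qed
  qed
qed

lemma trivial_invs: assumes "\<And>w. w \<in> invs S \<Longrightarrow> w = 0" "w \<in> S" shows "w = 0"
  using engel_word[OF assms(2)] assms(1) by metis

subsection \<open>The projection onto the Whittaker vectors\<close>

text \<open>A complement of the invariants in \<open>W xs\<close> when \<open>xs\<close> followed by
  \<open>ys\<close> is \<open>L\<close>. It is built from the operators \<open>q\<close> and the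
  kernels \<open>W\<close> alone, without choices; this makes the resulting projection
  natural.\<close>

fun J :: "(nat \<times> nat) list \<Rightarrow> (nat \<times> nat) list \<Rightarrow> 'b set" where
  "J xs [] = {0}"
| "J xs (a # ys) = {q a w + y | w y. w \<in> W xs \<and> y \<in> J (xs @ [a]) ys}"

lemma W_sub: "is_subspace sc (W xs)"
  using S_sub by (auto simp: is_subspace_def W_def is_linear_zero[OF p_lin] is_linear_add[OF p_lin]
      is_linear_scale[OF p_lin])

lemma J_sub: "is_subspace sc (J xs ys)"
proof (induction ys arbitrary: xs)
  case Nil then show ?case by (simp add: is_subspace_def)
next
  case (Cons a ys)
  show ?case unfolding is_subspace_def
  proof (intro conjI ballI allI)
    show "0 \<in> J xs (a # ys)" using sub_zero[OF W_sub, of xs] sub_zero[OF Cons, of "xs @ [a]"]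
      by (auto intro!: exI[of _ 0] simp: is_linear_zero[OF q_lin])
    fix x assume "x \<in> J xs (a # ys)"
    then obtain w v where x: "x = q a w + v" "w \<in> W xs" "v \<in> J (xs @ [a]) ys" by auto
    show "sc c x \<in> J xs (a # ys)" for c
      using sub_scale[OF W_sub x(2), of c] sub_scale[OF Cons x(3), of c]
      by (auto simp: x(1) scale_right_distrib is_linear_scale[OF q_lin, symmetric])
    fix y assume "y \<in> J xs (a # ys)"
    then obtain w' v' where y: "y = q a w' + v'" "w' \<in> W xs" "v' \<in> J (xs @ [a]) ys" by auto
    have "x + y = q a (w + w') + (v + v')" by (simp add: x y is_linear_add[OF q_lin] algebra_simps)
    then show "x + y \<in> J xs (a # ys)"
      using sub_add[OF W_sub x(2) y(2)] sub_add[OF Cons x(3) y(3)] by auto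
  qed
qed

lemma J_W: "L = xs @ ys \<Longrightarrow> J xs ys \<subseteq> W xs"
proof (induction ys arbitrary: xs)
  case Nil then show ?case using sub_zero[OF W_sub] by auto
next
  case (Cons a ys)
  interpret kashiwara sc "W xs" "p a" "q a" "z a" using Cons.prems by (rule kash)
  show ?case
  proof
    fix x assume "x \<in> J xs (a # ys)"
    then obtain w y where *: "x = q a w + y" "w \<in> W xs" "y \<in> J (xs @ [a]) ys" by auto
    have "y \<in> W (xs @ [a])" using Cons.IH[of "xs @ [a]"] Cons.prems * by auto
    then have "y \<in> W xs" by (simp add: W_def)
    then show "x \<in> W xs" using * sub_add[OF W_sub] q_W by simp
  qed
qed

lemma J_decomp: "L = xs @ ys \<Longrightarrow> w \<in> W xs \<Longrightarrow> \<exists>m\<in>invs S. \<exists>y\<in>J xs ys. w = m + y"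
proof (induction ys arbitrary: xs w)
  case Nil then show ?case using W_L by auto
next
  case (Cons a ys)
  obtain m x where mx: "m \<in> W (xs @ [a])" "x \<in> W xs" "w = m + q a x"
    using kashiwara.W_decomp[OF kash[OF Cons.prems(1)] Cons.prems(2)]
    unfolding kash_K[OF Cons.prems(1)] by blast
  obtain m' y where my: "m' \<in> invs S" "y \<in> J (xs @ [a]) ys" "m = m' + y"
    using Cons.IH[of "xs @ [a]" m] mx Cons.prems by auto
  then have "w = m' + (q a x + y)" using mx by simp
  moreover have "q a x + y \<in> J xs (a # ys)" using my mx by auto
  ultimately show ?case using my(1) by blast
qed

text \<open>The term \<open>q a w\<close> is a difference of vectors killed by \<open>p a\<close>,
  so \<open>w\<close> vanishes by \<open>q_K_zero\<close>, and the claim passes to the tail of the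
  list.\<close>

lemma J_inter: "L = xs @ ys \<Longrightarrow> m \<in> invs S \<Longrightarrow> m \<in> J xs ys \<Longrightarrow> m = 0"
proof (induction ys arbitrary: xs)
  case Nil then show ?case by simp
next
  case (Cons a ys)
  obtain w y where *: "m = q a w + y" "w \<in> W xs" "y \<in> J (xs @ [a]) ys" using Cons.prems by auto
  have y: "y \<in> W (xs @ [a])" using J_W[of "xs @ [a]" ys] * Cons.prems by auto
  have m: "m \<in> W (xs @ [a])" using Cons.prems(1,2) by (auto simp: W_def invs_def simp flip: set_L)
  have "q a w = m - y" using * by simp
  then have "q a w \<in> W (xs @ [a])" using sub_diff[OF W_sub m y] by simp
  then have "w = 0" using kashiwara.q_K_zero[OF kash[OF Cons.prems(1)] *(2)]
    unfolding kash_K[OF Cons.prems(1)] by blast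
  then have "m = y" using * is_linear_zero[OF q_lin] by simp
  then show ?case using Cons.IH[of "xs @ [a]"] Cons.prems * by auto
qed

definition proj :: "'b \<Rightarrow> 'b" where "proj w = (THE m. m \<in> invs S \<and> w - m \<in> J [] L)"

lemma proj_unique:
  assumes "w \<in> S" "m \<in> invs S" "w - m \<in> J [] L" shows "proj w = m"
  unfolding proj_def
proof (rule the_equality)
  show "m \<in> invs S \<and> w - m \<in> J [] L" using assms by simp
  fix m' assume m': "m' \<in> invs S \<and> w - m' \<in> J [] L"
  have "m' - m \<in> invs S" using m' assms by (intro sub_diff[OF invs_sub[OF S_sub]]) auto
  moreover have "m' - m \<in> J [] L" using sub_diff[OF J_sub, of "w - m" "[]" L "w - m'"] m' assms by simp
  ultimately have "m' - m = 0" by (intro J_inter[of "[]" L]) auto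
  then show "m' = m" by simp
qed

lemma proj_props: assumes "w \<in> S" shows "proj w \<in> invs S" "w - proj w \<in> J [] L"
proof -
  obtain m y where "m \<in> invs S" "y \<in> J [] L" "w = m + y" using J_decomp[of "[]" L w] assms W_Nil by auto
  then have "proj w = m" using assms by (intro proj_unique) auto
  then show "proj w \<in> invs S" "w - proj w \<in> J [] L" using \<open>m \<in> invs S\<close> \<open>y \<in> J [] L\<close> \<open>w = m + y\<close> by auto
qed

lemma proj_invs: "w \<in> invs S \<Longrightarrow> proj w = w"
  by (rule proj_unique) (auto simp: invs_def sub_zero[OF J_sub])

lemma proj_add: assumes "w \<in> S" "v \<in> S" shows "proj (w + v) = proj w + proj v"
proof (rule proj_unique)
  show "w + v \<in> S" using assms sub_add[OF S_sub] by blast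
  show "proj w + proj v \<in> invs S" using assms proj_props sub_add[OF invs_sub[OF S_sub]] by blast
  show "w + v - (proj w + proj v) \<in> J [] L"
    using sub_add[OF J_sub proj_props(2)[OF assms(1)] proj_props(2)[OF assms(2)]] by (simp add: algebra_simps)
qed

lemma proj_scale: assumes "w \<in> S" shows "proj (sc c w) = sc c (proj w)"
proof (rule proj_unique)
  show "sc c w \<in> S" using assms sub_scale[OF S_sub] by blast
  show "sc c (proj w) \<in> invs S" using assms proj_props sub_scale[OF invs_sub[OF S_sub]] by blast
  show "sc c w - sc c (proj w) \<in> J [] L"
    using sub_scale[OF J_sub proj_props(2)[OF assms(1)], of c] by (simp add: scale_right_diff_distrib)
qed

lemma proj_diff: assumes "w \<in> S" "v \<in> S" shows "proj (w - v) = proj w - proj v"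
  using proj_add[OF sub_diff[OF S_sub assms] assms(2)] by simp

text \<open>Some word takes a nonzero \<open>w\<close> to a nonzero invariant, which
  \<open>proj\<close> fixes. So a vector is determined by its matrix coefficients
  \<open>proj (fold p u w)\<close>.\<close>

lemma cofree:
  assumes "w \<in> S" "\<And>u. set u \<subseteq> neg \<Longrightarrow> proj (fold p u w) = 0" shows "w = 0"
  using engel_word[of w] assms proj_invs by fastforce

subsection \<open>Vanishing of the first cohomology\<close>

text \<open>Solve the equations in the order of \<open>L\<close>. If \<open>w\<close> solves those
  in \<open>xs\<close>, the cocycle identity shows that the error \<open>c a - p a w\<close> is
  killed by the operators in \<open>xs\<close>: a commutator of an earlier matrix unit with
  \<open>a\<close> is 0 or, up to sign, again an earlier one. On this common kernel
  \<open>p a\<close> is surjective, and correcting \<open>w\<close> there does not disturb the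
  equations already solved.\<close>

theorem solve_cocycle:
  assumes cS: "\<And>a. a \<in> neg \<Longrightarrow> c a \<in> S"
    and cocycle: "\<And>i j k l. (i, j) \<in> neg \<Longrightarrow> (k, l) \<in> neg \<Longrightarrow>
      p (k, l) (c (i, j)) = p (i, j) (c (k, l)) + (if j = k then c (i, l) else 0) - (if l = i then c (k, j) else 0)"
  shows "\<exists>w\<in>S. \<forall>a\<in>neg. p a w = c a"
proof -
  have "\<exists>w\<in>S. \<forall>a\<in>set xs. p a w = c a" if "L = xs @ ys" for xs ys
    using that
  proof (induction xs arbitrary: ys rule: rev_induct)
    case Nil then show ?case using sub_zero[OF S_sub] by auto
  next
    case (snoc a xs)
    then have L: "L = xs @ a # ys" by simp
    obtain r j where a: "a = (r, j)" "j < r" "r < N" using L_split(3)[OF L] by (auto simp: neg_def)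
    have an: "(r, j) \<in> neg" using a by (simp add: neg_def)
    obtain w where w: "w \<in> S" "\<And>b. b \<in> set xs \<Longrightarrow> p b w = c b" using snoc.IH[OF L] by blast
    have "p b (c a - p a w) = 0" if b: "b \<in> set xs" for b
    proof -
      obtain s l where sl: "b = (s, l)" by force
      have bn: "(s, l) \<in> neg" "r < s \<or> r = s \<and> l < j"
        using b L_split(1)[OF L] rk_less[OF an, of s l] a sl by auto
      have "(s, j) \<in> set xs" if "l = r"
        using that L_split(1)[OF L] rk_less[OF an, of s j] a bn by (auto simp: neg_def)
      then have 2: "p (s, j) w = c (s, j)" if "l = r" using that w by blast
      have 3: "p (s, l) w = c (s, l)" using w b sl by simp
      have ne: "j \<noteq> s" using bn a by auto
      show ?thesis
        using cocycle[OF an bn(1)] p_p[OF an bn(1), of w] 2 3 ne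
        by (simp add: a(1) sl is_linear_diff[OF p_lin])
    qed
    moreover have "c a - p a w \<in> S" using cS w(1) S_p an a sub_diff[OF S_sub] by auto
    ultimately have "c a - p a w \<in> W xs" by (simp add: W_def)
    then obtain x where x: "x \<in> W xs" "p a x = c a - p a w"
      using kashiwara.p_surj[OF kash[OF L]] by blast
    have "w + x \<in> S" using w x sub_add[OF S_sub] by (auto simp: W_def)
    moreover have "p b (w + x) = c b" if "b \<in> set (xs @ [a])" for b
    proof (cases "b = a")
      case True then show ?thesis using x by (simp add: is_linear_add[OF p_lin])
    next
      case False
      then have "b \<in> set xs" using that by simp
      then show ?thesis using w(2) x by (simp add: is_linear_add[OF p_lin] W_def)
    qed
    ultimately show ?case by blast
  qed
  from this[of L "[]"] show ?thesis by (simp add: set_L)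
qed

text \<open>Adding an invariant vector changes the projection at will and leaves the equations
  untouched.\<close>

lemma solve_cocycle_proj:
  assumes "\<And>a. a \<in> neg \<Longrightarrow> c a \<in> S"
    and "\<And>i j k l. (i, j) \<in> neg \<Longrightarrow> (k, l) \<in> neg \<Longrightarrow>
      p (k, l) (c (i, j)) = p (i, j) (c (k, l)) + (if j = k then c (i, l) else 0) - (if l = i then c (k, j) else 0)"
    and "m \<in> invs S"
  shows "\<exists>w\<in>S. proj w = m \<and> (\<forall>a\<in>neg. p a w = c a)"
proof -
  obtain w where w: "w \<in> S" "\<forall>a\<in>neg. p a w = c a" using solve_cocycle[OF assms(1,2)] by blast
  define w' where "w' = w + (m - proj w)"
  have pw: "proj w \<in> invs S" using proj_props w by blast
  have d: "m - proj w \<in> invs S" using assms(3) pw sub_diff[OF invs_sub[OF S_sub]] by blast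
  then have dS: "m - proj w \<in> S" by (simp add: invs_def)
  have "w' \<in> S" unfolding w'_def using w dS sub_add[OF S_sub] by blast
  moreover have "proj w' = m" unfolding w'_def by (simp add: proj_add[OF w(1) dS] proj_invs[OF d])
  moreover have "\<forall>a\<in>neg. p a w' = c a"
    using w d by (auto simp: w'_def is_linear_add[OF p_lin] invs_def)
  ultimately show ?thesis by blast
qed

end

text \<open>The extension is the set of all pairs \<open>(v, w)\<close> with equal matrix coefficients, so its construction
  involves no choices.\<close>

locale lower_ext = mir_mod +
  fixes sv :: "'a \<Rightarrow> 'c::ab_group_add \<Rightarrow> 'c" and SV :: "'c set" and b :: "nat \<times> nat \<Rightarrow> 'c \<Rightarrow> 'c" and lam :: "'c \<Rightarrow> 'b"
  assumes SV_sub: "is_subspace sv SV" and b_lin: "is_linear sv sv (b a)"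
    and b_SV: "v \<in> SV \<Longrightarrow> a \<in> neg \<Longrightarrow> b a v \<in> SV"
    and b_b: "\<lbrakk>v \<in> SV; (i, j) \<in> neg; (k, l) \<in> neg\<rbrakk> \<Longrightarrow>
      b (k, l) (b (i, j) v) = b (i, j) (b (k, l) v) + (if j = k then b (i, l) v else 0) - (if l = i then b (k, j) v else 0)"
    and b_nil: "v \<in> SV \<Longrightarrow> \<exists>n. \<forall>u. set u \<subseteq> neg \<and> length u = n \<longrightarrow> fold b u v = 0"
    and lam_lin: "is_linear sv sc lam" and lam_inv: "v \<in> SV \<Longrightarrow> lam v \<in> invs S"
begin

definition R :: "'c \<Rightarrow> 'b \<Rightarrow> bool" where
  "R v w \<longleftrightarrow> w \<in> S \<and> (\<forall>u. set u \<subseteq> neg \<longrightarrow> proj (fold p u w) = lam (fold b u v))"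

lemma R_unique: "R v w \<Longrightarrow> R v w' \<Longrightarrow> w = w'"
proof -
  assume *: "R v w" "R v w'"
  have "w - w' = 0"
  proof (rule cofree)
    show "w - w' \<in> S" using * sub_diff[OF S_sub] by (auto simp: R_def)
    fix u assume "set u \<subseteq> neg"
    then show "proj (fold p u (w - w')) = 0"
      using * by (simp add: is_linear_diff[OF fold_lin, OF p_lin] R_def proj_diff S_pfold)
  qed
  then show ?thesis by simp
qed

lemma fold_b_lin: "is_linear sv sv (fold b u)"
  using b_lin by (induction u) (auto simp: is_linear_def)

lemma R_add: "R v w \<Longrightarrow> R v' w' \<Longrightarrow> R (v + v') (w + w')"
  by (simp add: R_def sub_add[OF S_sub] is_linear_add[OF fold_lin, OF p_lin] proj_add S_pfold
      is_linear_add[OF lam_lin] is_linear_add[OF fold_b_lin])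

lemma R_scale: "R v w \<Longrightarrow> R (sv c v) (sc c w)"
  by (simp add: R_def sub_scale[OF S_sub] is_linear_scale[OF fold_lin, OF p_lin] proj_scale S_pfold
      is_linear_scale[OF lam_lin] is_linear_scale[OF fold_b_lin])

lemma R_minus: "R v w \<Longrightarrow> R v' w' \<Longrightarrow> R (v - v') (w - w')"
  by (simp add: R_def sub_diff[OF S_sub] is_linear_diff[OF fold_lin, OF p_lin] proj_diff S_pfold
      is_linear_diff[OF lam_lin] is_linear_diff[OF fold_b_lin])

lemma R_p: "R v w \<Longrightarrow> a \<in> neg \<Longrightarrow> R (b a v) (p a w)"
  unfolding R_def
proof (intro conjI allI impI)
  assume *: "w \<in> S \<and> (\<forall>u. set u \<subseteq> neg \<longrightarrow> proj (fold p u w) = lam (fold b u v))" "a \<in> neg"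
  show "p a w \<in> S" using * S_p by blast
  fix u assume "set u \<subseteq> neg"
  then show "proj (fold p u (p a w)) = lam (fold b u (b a v))"
    using *(1)[THEN conjunct2, rule_format, of "a # u"] *(2) by simp
qed

lemma R_zero: "R 0 0"
  using sub_zero[OF S_sub] proj_invs[OF sub_zero[OF invs_sub[OF S_sub]]]
  by (simp add: R_def is_linear_zero[OF fold_lin, OF p_lin] is_linear_zero[OF fold_b_lin] is_linear_zero[OF lam_lin])

text \<open>Induction on the order of nilpotency of \<open>v\<close>. The vectors related to the
  \<open>b a v\<close> exist by induction; as \<open>R\<close> determines its second argument, they
  inherit the relations of the \<open>b a\<close> and form a cocycle. Its solution with projection
  \<open>lam v\<close> is related to \<open>v\<close>.\<close>

lemma R_total: assumes "v \<in> SV" shows "\<exists>w. R v w"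
proof -
  obtain n where "\<forall>u. set u \<subseteq> neg \<and> length u = n \<longrightarrow> fold b u v = 0" using b_nil[OF assms] by blast
  then show ?thesis using assms
  proof (induction n arbitrary: v)
    case 0
    then have "v = 0" by auto
    then show ?case using R_zero by blast
  next
    case (Suc n)
    have "\<exists>w. R (b a v) w" if a: "a \<in> neg" for a
    proof (rule Suc.IH)
      show "\<forall>u. set u \<subseteq> neg \<and> length u = n \<longrightarrow> fold b u (b a v) = 0"
      proof (intro allI impI)
        fix u assume "set u \<subseteq> neg \<and> length u = n"
        then show "fold b u (b a v) = 0" using Suc.prems(1)[rule_format, of "a # u"] a by simp
      qed
      show "b a v \<in> SV" using b_SV Suc.prems a by blast
    qed
    then obtain c where c: "\<And>a. a \<in> neg \<Longrightarrow> R (b a v) (c a)" by metis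
    have il: "(i, l) \<in> neg" if "(i, k) \<in> neg" "(k, l) \<in> neg" for i k l using that by (auto simp: neg_def)
    have "\<exists>w\<in>S. proj w = lam v \<and> (\<forall>a\<in>neg. p a w = c a)"
    proof (rule solve_cocycle_proj)
      show "lam v \<in> invs S" using lam_inv Suc.prems by blast
      show "c a \<in> S" if "a \<in> neg" for a using c[OF that] by (simp add: R_def)
      fix i j k l assume *: "(i, j) \<in> neg" "(k, l) \<in> neg"
      have 1: "R (b (k, l) (b (i, j) v)) (p (k, l) (c (i, j)))" using R_p[OF c] * by simp
      have 2: "R (b (i, j) (b (k, l) v)) (p (i, j) (c (k, l)))" using R_p[OF c] * by simp
      have 3: "R (if j = k then b (i, l) v else 0) (if j = k then c (i, l) else 0)" 
        using c[OF il[of i j l]] * R_zero by simp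
      have 4: "R (if l = i then b (k, j) v else 0) (if l = i then c (k, j) else 0)" 
        using c[OF il[of k l j]] * R_zero by simp
      show "p (k, l) (c (i, j)) = p (i, j) (c (k, l)) + (if j = k then c (i, l) else 0) - (if l = i then c (k, j) else 0)"
        by (rule R_unique[OF 1]) (simp only: b_b[OF Suc.prems(2) *] R_minus[OF R_add[OF 2 3] 4])
    qed
    then obtain w where w: "w \<in> S" "proj w = lam v" "\<And>a. a \<in> neg \<Longrightarrow> p a w = c a" by blast
    have "proj (fold p u w) = lam (fold b u v)" if "set u \<subseteq> neg" for u
    proof (cases u)
      case Nil then show ?thesis using w by simp
    next
      case (Cons a u')
      then show ?thesis using that c[of a] w(3)[of a] by (simp add: R_def)
    qed
    then show ?case using w by (auto simp: R_def)
  qed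
qed

theorem lower_extension:
  "\<exists>f. (\<forall>v\<in>SV. f v \<in> S \<and> proj (f v) = lam v \<and> (\<forall>a\<in>neg. p a (f v) = f (b a v))) \<and>
    (\<forall>v\<in>SV. \<forall>v'\<in>SV. f (v + v') = f v + f v') \<and> (\<forall>c. \<forall>v\<in>SV. f (sv c v) = sc c (f v))"
proof -
  obtain f where f: "\<And>v. v \<in> SV \<Longrightarrow> R v (f v)" using R_total by metis
  have "f v \<in> S \<and> proj (f v) = lam v" if "v \<in> SV" for v
    using f[OF that] unfolding R_def by (metis empty_subsetI fold_simps(1) list.set(1))
  moreover have "p a (f v) = f (b a v)" if "v \<in> SV" "a \<in> neg" for v a
    using R_unique[OF R_p[OF f[OF that(1)] that(2)] f[OF b_SV[OF that]]] .
  moreover have "f (v + v') = f v + f v'" if "v \<in> SV" "v' \<in> SV" for v v'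
  proof -
    have "v + v' \<in> SV" using SV_sub that by (auto simp: is_subspace_def)
    then show ?thesis using R_unique[OF f R_add[OF f[OF that(1)] f[OF that(2)]]] by blast
  qed
  moreover have "f (sv c v) = sc c (f v)" if "v \<in> SV" for c v
  proof -
    have "sv c v \<in> SV" using SV_sub that by (auto simp: is_subspace_def)
    then show ?thesis using R_unique[OF f R_scale[OF f[OF that]]] by blast
  qed
  ultimately show ?thesis by blast
qed

end

section \<open>Homomorphisms of locally nilpotent modules\<close>

locale mir_mod_hom = A: mir_mod sc1 N e1 S1 + B: mir_mod sc2 N e2 S2
  for sc1 :: "'k::field_char_0 \<Rightarrow> 'b::ab_group_add \<Rightarrow> 'b" and N e1 S1
    and sc2 :: "'k \<Rightarrow> 'c::ab_group_add \<Rightarrow> 'c" and e2 S2 +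
  fixes F :: "'b \<Rightarrow> 'c"
  assumes F_S: "w \<in> S1 \<Longrightarrow> F w \<in> S2"
    and F_add: "w \<in> S1 \<Longrightarrow> v \<in> S1 \<Longrightarrow> F (w + v) = F w + F v"
    and F_e: "\<lbrakk>w \<in> S1; i < N; Suc j < N\<rbrakk> \<Longrightarrow> F (e1 i j w) = e2 i j (F w)"
begin

lemma F_zero: "F 0 = 0"
  using F_add[of 0 0] A.sub_zero[OF A.S_sub] by simp

lemma F_diff: assumes "w \<in> S1" "v \<in> S1" shows "F (w - v) = F w - F v"
  using F_add[of "w - v" v] assms A.sub_diff[OF A.S_sub] by simp

lemma F_p: "w \<in> S1 \<Longrightarrow> a \<in> A.neg \<Longrightarrow> F (A.p a w) = B.p a (F w)"
proof -
  assume *: "w \<in> S1" "a \<in> A.neg"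
  then have ij: "fst a < N" "Suc (snd a) < N" by (auto simp: A.neg_def)
  then have "e1 (fst a) (snd a) w \<in> S1" using A.S_e * by blast
  then show ?thesis using F_e[OF *(1) ij] * A.sub_zero[OF A.S_sub] F_zero
    by (simp add: A.p_def B.p_def F_diff)
qed

lemma F_invs: "w \<in> A.invs S1 \<Longrightarrow> F w \<in> B.invs S2"
proof -
  assume w: "w \<in> A.invs S1"
  have "B.p a (F w) = 0" if "a \<in> A.neg" for a
    using F_p[of w a] w that by (simp add: A.invs_def F_zero)
  then show ?thesis using w by (simp add: A.invs_def B.invs_def F_S)
qed

lemma F_W: "set xs \<subseteq> A.neg \<Longrightarrow> w \<in> A.W xs \<Longrightarrow> F w \<in> B.W xs"
proof -
  assume w: "set xs \<subseteq> A.neg" "w \<in> A.W xs"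
  have "B.p a (F w) = 0" if "a \<in> set xs" for a
    using F_p[of w a] w that by (auto simp: A.W_def F_zero)
  then show ?thesis using w by (simp add: A.W_def B.W_def F_S)
qed

text \<open>\<open>F\<close> commutes with \<open>q\<close> and respects the kernels
  \<open>W\<close>, the only ingredients of \<open>J\<close>. Naturality of the projection,
  \<open>F_proj\<close>, follows.\<close>

lemma F_J: "A.L = xs @ ys \<Longrightarrow> w \<in> A.J xs ys \<Longrightarrow> F w \<in> B.J xs ys"
proof (induction ys arbitrary: xs w)
  case Nil then show ?case by (simp add: F_zero)
next
  case (Cons a ys)
  obtain v y where *: "w = A.q a v + y" "v \<in> A.W xs" "y \<in> A.J (xs @ [a]) ys" using Cons.prems by auto
  have a: "a \<in> A.neg" "set xs \<subseteq> A.neg" using Cons.prems(1) A.set_L by auto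
  have v: "v \<in> S1" using * by (simp add: A.W_def)
  have ij: "snd a < N" "Suc (fst a - 1) < N" using a by (auto simp: A.neg_def)
  have "A.q a v \<in> S1" unfolding A.q_def using v ij by (rule A.S_e)
  moreover have "y \<in> S1" using A.J_W[of "xs @ [a]" ys] * Cons.prems by (auto simp: A.W_def)
  ultimately have "F w = B.q a (F v) + F y" using F_e[OF v ij] F_add * by (simp add: A.q_def B.q_def)
  moreover have "F y \<in> B.J (xs @ [a]) ys" using Cons * by auto
  ultimately show ?case using F_W[OF a(2) *(2)] by auto
qed

lemma F_proj: assumes "w \<in> S1" shows "F (A.proj w) = B.proj (F w)"
proof (rule B.proj_unique[symmetric])
  show "F w \<in> S2" using F_S assms .
  have i: "A.proj w \<in> A.invs S1" using A.proj_props assms by blast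
  then show "F (A.proj w) \<in> B.invs S2" by (rule F_invs)
  have "F w - F (A.proj w) = F (w - A.proj w)" using F_diff assms i by (simp add: A.invs_def)
  then show "F w - F (A.proj w) \<in> B.J [] B.L" using F_J[of "[]" A.L] A.proj_props[OF assms] by simp
qed

end

text \<open>By \<open>gen_invs\<close> the invariants generate the module. This yields faithfulness
  of the functor of Whittaker vectors.\<close>

lemma (in mir_mod_hom) F_zero_of_invs:
  assumes "\<And>w. w \<in> A.invs S1 \<Longrightarrow> F w = 0" and "w \<in> S1" shows "F w = 0"
proof -
  have fold_S: "fold A.e' u x \<in> S1" if "x \<in> S1" "set u \<subseteq> A.gens" for u x
    using A.stable_fold[OF A.S_stable that] .
  have *: "F (fold A.e' u x) = fold B.e' u (F x)" if "x \<in> S1" "set u \<subseteq> A.gens" for u x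
    using that
  proof (induction u arbitrary: x)
    case (Cons g u)
    have ij: "fst g < N" "Suc (snd g) < N" using Cons.prems by (auto simp: A.gens_def)
    have x: "x \<in> S1" "set u \<subseteq> A.gens" using Cons.prems by auto
    have "A.e' g x \<in> S1" unfolding A.e'_def using A.S_e[OF x(1) ij] .
    then have "F (fold A.e' u (A.e' g x)) = fold B.e' u (F (A.e' g x))" using Cons.IH x by blast
    also have "F (A.e' g x) = B.e' g (F x)" unfolding A.e'_def B.e'_def using F_e[OF x(1) ij] .
    finally show ?case by simp
  qed simp
  have "w \<in> A.gen (A.invs S1)" using assms(2) A.gen_invs by simp
  then have "w \<in> S1 \<and> F w = 0"
  proof induction
    case (word x u)
    then have "x \<in> S1" by (simp add: A.invs_def)
    then show ?case
      using *[OF _ word(2)] fold_S[OF _ word(2)] assms(1)[OF word(1)] is_linear_zero[OF B.fold_lin[OF B.e'_lin]] by simp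
  next
    case (add x y) then show ?case using F_add A.sub_add[OF A.S_sub] by simp
  qed
  then show ?thesis by simp
qed

text \<open>The submodule of \<open>S1 \<times> S2\<close> generated by the graph of a linear map between the Whittaker
  vectors is the graph of a homomorphism.\<close>

locale mir_mod_pair = A: mir_mod sc1 N e1 S1 + B: mir_mod sc2 N e2 S2
  for sc1 :: "'k::field_char_0 \<Rightarrow> 'b::ab_group_add \<Rightarrow> 'b" and N e1 S1
    and sc2 :: "'k \<Rightarrow> 'c::ab_group_add \<Rightarrow> 'c" and e2 S2 +
  fixes f :: "'b \<Rightarrow> 'c"
  assumes f_invs: "w \<in> A.invs S1 \<Longrightarrow> f w \<in> B.invs S2"
    and f_add: "w \<in> A.invs S1 \<Longrightarrow> v \<in> A.invs S1 \<Longrightarrow> f (w + v) = f w + f v"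
    and f_scale: "w \<in> A.invs S1 \<Longrightarrow> f (sc1 c w) = sc2 c (f w)"
begin

definition scP :: "'k \<Rightarrow> 'b \<times> 'c \<Rightarrow> 'b \<times> 'c" where "scP c x = (sc1 c (fst x), sc2 c (snd x))"

definition eP :: "nat \<Rightarrow> nat \<Rightarrow> 'b \<times> 'c \<Rightarrow> 'b \<times> 'c" where "eP i j x = (e1 i j (fst x), e2 i j (snd x))"

sublocale P: mir_ops scP N eP
proof
  show "scP a (x + y) = scP a x + scP a y" for a x y
    by (simp add: scP_def A.scale_right_distrib B.scale_right_distrib)
  show "scP (a + b) x = scP a x + scP b x" for a b x
    by (simp add: scP_def A.scale_left_distrib B.scale_left_distrib)
  show "scP a (scP b x) = scP (a * b) x" for a b x by (simp add: scP_def)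
  show "scP 1 x = x" for x by (simp add: scP_def)
  show "is_linear scP scP (eP i j)" for i j
    by (auto simp: is_linear_def eP_def scP_def is_linear_add[OF A.e_lin] is_linear_add[OF B.e_lin]
        is_linear_scale[OF A.e_lin] is_linear_scale[OF B.e_lin])
  show "eP k l (eP i j w) = eP i j (eP k l w) + (if j = k then eP i l w else 0) - (if l = i then eP k j w else 0)"
    if "i < N" "Suc j < N" "k < N" "Suc l < N" for i j k l w
    using A.bracket[OF that, of "fst w"] B.bracket[OF that, of "snd w"]
    by (auto simp: eP_def prod_eq_iff)
qed

lemma p_P: "P.p a x = (A.p a (fst x), B.p a (snd x))"
  by (auto simp: P.p_def A.p_def B.p_def eP_def prod_eq_iff)

lemma fold_p_P: "fold P.p u x = (fold A.p u (fst x), fold B.p u (snd x))"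
  by (induction u arbitrary: x) (auto simp: p_P)

sublocale PM: mir_mod scP N eP "S1 \<times> S2"
proof
  show "P.stable (S1 \<times> S2)"
    using A.S_stable B.S_stable by (auto simp: P.stable_def A.stable_def B.stable_def is_subspace_def eP_def scP_def zero_prod_def)
  fix w assume "w \<in> S1 \<times> S2"
  then obtain n m where "fst w \<in> A.nil n" "snd w \<in> B.nil m" using A.S_nil B.S_nil by fastforce
  then have "fst w \<in> A.nil (max n m)" "snd w \<in> B.nil (max n m)" using A.nil_mono B.nil_mono by auto
  then have "w \<in> P.nil (max n m)" by (auto simp: P.nil_def A.nil_def B.nil_def fold_p_P zero_prod_def)
  then show "\<exists>n. w \<in> P.nil n" by blast
qed

definition V :: "('b \<times> 'c) set" where "V = {(x, f x) | x. x \<in> A.invs S1}"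

lemma f_zero: "f 0 = 0"
  using f_add[of 0 0] A.sub_zero[OF A.invs_sub[OF A.S_sub]] by simp

lemma V_sub: "is_subspace scP V"
  using A.sub_zero[OF A.invs_sub[OF A.S_sub]] A.sub_add[OF A.invs_sub[OF A.S_sub]] A.sub_scale[OF A.invs_sub[OF A.S_sub]]
  by (auto simp: is_subspace_def V_def scP_def f_add f_scale f_zero zero_prod_def)

lemma V_invs: "V \<subseteq> P.invs (S1 \<times> S2)"
  using f_invs by (auto simp: V_def P.invs_def A.invs_def B.invs_def p_P zero_prod_def)

definition M :: "('b \<times> 'c) set" where "M = P.gen V"

lemma M_stable: "P.stable M" unfolding M_def using P.stable_gen[OF V_sub] .

lemma M_sub: "is_subspace scP M" using M_stable by (simp add: P.stable_def)

lemma M_S: "M \<subseteq> S1 \<times> S2"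
  unfolding M_def using PM.S_stable V_invs by (intro P.gen_least) (auto simp: P.invs_def)

lemma M_invs: "M \<inter> P.invs (S1 \<times> S2) = V"
  unfolding M_def by (rule PM.gen_inter_invs[OF V_sub V_invs])

text \<open>The elements of \<open>M\<close> with first component 0 form a submodule. Its invariants
  are invariants of \<open>M\<close>, so by \<open>M_invs\<close> they lie on the graph
  \<open>V\<close> and vanish; a module without nonzero invariants is 0.\<close>

lemma M_vertical: assumes "(0, y) \<in> M" shows "y = 0"
proof -
  define K where "K = {w \<in> M. fst w = 0}"
  have "P.stable K"
    unfolding P.stable_def is_subspace_def K_def
  proof (intro conjI ballI allI impI; (elim CollectE conjE)?; (intro CollectI conjI)?)
    show "0 \<in> M" "fst (0 :: 'b \<times> 'c) = 0" using P.sub_zero[OF M_sub] by auto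
    fix x assume x: "x \<in> M" "fst x = 0"
    show "scP c x \<in> M" "fst (scP c x) = 0" for c
      using P.sub_scale[OF M_sub x(1)] x(2) by (auto simp: scP_def)
    show "eP i j x \<in> M" if "i < N" "Suc j < N" for i j using M_stable x that by (simp add: P.stable_def)
    show "fst (eP i j x) = 0" for i j using x by (simp add: eP_def is_linear_zero[OF A.e_lin])
    fix y assume "y \<in> M" "fst y = 0"
    then show "x + y \<in> M" "fst (x + y) = 0" using P.sub_add[OF M_sub] x by auto
  qed
  then interpret K: mir_mod scP N eP K
    by unfold_locales (use PM.S_nil M_S in \<open>auto simp: K_def\<close>)
  have "w = 0" if "w \<in> P.invs K" for w
  proof -
    have "w \<in> M \<inter> P.invs (S1 \<times> S2)" "fst w = 0" using that M_S by (auto simp: P.invs_def K_def)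
    then show ?thesis unfolding M_invs by (auto simp: V_def f_zero zero_prod_def)
  qed
  from K.trivial_invs[OF this] have "(0, y) = (0 :: 'b \<times> 'c)" using assms by (simp add: K_def)
  then show ?thesis by (simp add: zero_prod_def)
qed

text \<open>The first components of \<open>M\<close> form a submodule that contains all invariants,
  and these generate \<open>S1\<close>.\<close>

lemma M_total: assumes "x \<in> S1" shows "\<exists>y. (x, y) \<in> M"
proof -
  have "A.stable (fst ` M)"
  proof -
    have "is_subspace sc1 (fst ` M)"
      unfolding is_subspace_def
    proof (intro conjI ballI allI)
      show "0 \<in> fst ` M" using P.sub_zero[OF M_sub] by (auto intro!: rev_image_eqI)
      fix x assume "x \<in> fst ` M"
      then obtain x' where x: "x' \<in> M" "x = fst x'" by blast
      show "sc1 c x \<in> fst ` M" for c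
        using P.sub_scale[OF M_sub x(1), of c] x(2) by (auto simp: scP_def intro!: rev_image_eqI)
      fix y assume "y \<in> fst ` M"
      then obtain y' where y: "y' \<in> M" "y = fst y'" by blast
      show "x + y \<in> fst ` M"
        using P.sub_add[OF M_sub x(1) y(1)] x(2) y(2) by (auto intro!: rev_image_eqI)
    qed
    moreover have "e1 i j w \<in> fst ` M" if w: "w \<in> fst ` M" and ij: "i < N" "Suc j < N" for i j w
    proof -
      obtain y where "(w, y) \<in> M" using w by fastforce
      then have "eP i j (w, y) \<in> M" using M_stable ij by (auto simp: P.stable_def)
      then show ?thesis by (auto simp: eP_def intro!: rev_image_eqI)
    qed
    ultimately show ?thesis by (auto simp: A.stable_def)
  qed
  moreover have "A.invs S1 \<subseteq> fst ` M" 
  proof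
    fix x assume "x \<in> A.invs S1"
    then have "(x, f x) \<in> M" using P.gen_base[of V] by (auto simp: M_def V_def)
    then show "x \<in> fst ` M" by (auto intro!: rev_image_eqI)
  qed
  ultimately have "A.gen (A.invs S1) \<subseteq> fst ` M" by (rule A.gen_least)
  then show ?thesis using assms A.gen_invs by force
qed

theorem extend_hom:
  "\<exists>F. (\<forall>w\<in>S1. F w \<in> S2) \<and> (\<forall>w\<in>S1. \<forall>v\<in>S1. F (w + v) = F w + F v) \<and>
    (\<forall>c. \<forall>w\<in>S1. F (sc1 c w) = sc2 c (F w)) \<and>
    (\<forall>i j. \<forall>w\<in>S1. i < N \<longrightarrow> Suc j < N \<longrightarrow> F (e1 i j w) = e2 i j (F w)) \<and>
    (\<forall>w\<in>A.invs S1. F w = f w)"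
proof -
  have uniq: "y = y'" if "(x, y) \<in> M" "(x, y') \<in> M" for x y y'
    using M_vertical[of "y - y'"] P.sub_diff[OF M_sub that] by simp
  obtain F where F: "\<And>x. x \<in> S1 \<Longrightarrow> (x, F x) \<in> M" using M_total by metis
  have FS: "F w \<in> S2" if "w \<in> S1" for w using F[OF that] M_S by auto
  moreover have "F (w + v) = F w + F v" if "w \<in> S1" "v \<in> S1" for w v
    using uniq[OF F P.sub_add[OF M_sub F[OF that(1)] F[OF that(2)], unfolded add_Pair]] that A.sub_add[OF A.S_sub] by blast
  moreover have "F (sc1 c w) = sc2 c (F w)" if "w \<in> S1" for c w
    using uniq[OF F P.sub_scale[OF M_sub F[OF that], of c, unfolded scP_def fst_conv snd_conv]] that A.sub_scale[OF A.S_sub] by blast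
  moreover have "F (e1 i j w) = e2 i j (F w)" if "w \<in> S1" "i < N" "Suc j < N" for i j w
  proof -
    have "eP i j (w, F w) \<in> M" using M_stable F that by (auto simp: P.stable_def)
    then have "(e1 i j w, e2 i j (F w)) \<in> M" by (simp add: eP_def)
    then show ?thesis using uniq F A.S_e that by blast
  qed
  moreover have "F w = f w" if "w \<in> A.invs S1" for w
  proof -
    have "(w, f w) \<in> M" using P.gen_base[of V] that by (auto simp: M_def V_def)
    then show ?thesis using uniq F that by (auto simp: A.invs_def)
  qed
  ultimately show ?thesis by blast
qed

end

subsection \<open>Derivations of polynomial rings\<close>

type_synonym ('v, 'k) mpoly = "('v \<Rightarrow>\<^sub>0 nat) \<Rightarrow>\<^sub>0 'k"

lemma poly_mapping_induct [case_names single sum]: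
  fixes P :: "('a \<Rightarrow>\<^sub>0 'b::monoid_add) \<Rightarrow> bool"
  assumes single: "\<And>k v. P (Poly_Mapping.single k v)" and sum: "\<And>f g. P f \<Longrightarrow> P g \<Longrightarrow> P (f + g)"
  shows "P f"
proof (induction f rule: update_induct)
  case const
  show ?case using single[of undefined 0] by simp
next
  case (update f a b)
  have "Poly_Mapping.update a b f = f + Poly_Mapping.single a b"
    by (rule poly_mapping_eqI)
      (use update in \<open>auto simp: lookup_add lookup_update lookup_single in_keys_iff when_def\<close>)
  then show ?case using sum update single by simp
qed

definition pconst :: "'k::comm_ring_1 \<Rightarrow> ('v, 'k) mpoly" where "pconst c = Poly_Mapping.single 0 c"

definition pvar :: "'v \<Rightarrow> ('v, 'k::comm_ring_1) mpoly" where
  "pvar x = Poly_Mapping.single (Poly_Mapping.single x 1) 1"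

definition pmon :: "('v \<Rightarrow>\<^sub>0 nat) \<Rightarrow> ('v, 'k::comm_ring_1) mpoly" where "pmon m = Poly_Mapping.single m 1"

text \<open>The value on the monomial with exponents \<open>m\<close> of the derivation that sends
  each variable \<open>x\<close> to \<open>d x\<close>.\<close>

definition der_mon :: "('v \<Rightarrow> ('v, 'k::comm_ring_1) mpoly) \<Rightarrow> ('v \<Rightarrow>\<^sub>0 nat) \<Rightarrow> ('v, 'k) mpoly" where
  "der_mon d m = (\<Sum>x\<in>Poly_Mapping.keys m. Poly_Mapping.single (m - Poly_Mapping.single x 1) (of_nat (Poly_Mapping.lookup m x)) * d x)"

definition der :: "('v \<Rightarrow> ('v, 'k::comm_ring_1) mpoly) \<Rightarrow> ('v, 'k) mpoly \<Rightarrow> ('v, 'k) mpoly" where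
  "der d f = (\<Sum>m\<in>Poly_Mapping.keys f. pconst (Poly_Mapping.lookup f m) * der_mon d m)"

lemma pconst_add: "pconst (a + b) = pconst a + pconst b"
  by (simp add: pconst_def single_add)
lemma pconst_mult: "pconst (a * b) = pconst a * pconst b"
  by (simp add: pconst_def mult_single)
lemma pconst_1: "pconst 1 = 1"
  by (simp add: pconst_def)
lemma pconst_0: "pconst 0 = 0"
  by (simp add: pconst_def)
lemma single_eq_pconst: "Poly_Mapping.single m c = pconst c * pmon m"
  by (simp add: pconst_def pmon_def mult_single)
lemma pmon_add: "pmon (m + n) = pmon m * pmon n"
  by (simp add: pmon_def mult_single)
lemma pmon_0: "pmon 0 = 1"
  by (simp add: pmon_def)

lemma der_superset: "finite A \<Longrightarrow> Poly_Mapping.keys f \<subseteq> A \<Longrightarrow> der d f = (\<Sum>m\<in>A. pconst (Poly_Mapping.lookup f m) * der_mon d m)"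
  unfolding der_def by (rule sum.mono_neutral_left) (auto simp: in_keys_iff pconst_0)

lemma der_mon_superset: "finite A \<Longrightarrow> Poly_Mapping.keys m \<subseteq> A \<Longrightarrow>
    der_mon d m = (\<Sum>x\<in>A. Poly_Mapping.single (m - Poly_Mapping.single x 1) (of_nat (Poly_Mapping.lookup m x)) * d x)"
  unfolding der_mon_def by (rule sum.mono_neutral_left) (auto simp: in_keys_iff)

lemma der_add: "der d (f + g) = der d f + der d g"
proof -
  let ?A = "Poly_Mapping.keys f \<union> Poly_Mapping.keys g"
  have "Poly_Mapping.keys (f + g) \<subseteq> ?A" by (rule Poly_Mapping.keys_add)
  then show ?thesis
    using der_superset[of ?A "f + g" d] der_superset[of ?A f d] der_superset[of ?A g d]
    by (simp add: lookup_add pconst_add distrib_right sum.distrib)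
qed

lemma der_single: "der d (Poly_Mapping.single m c) = pconst c * der_mon d m"
  using der_superset[of "{m}" "Poly_Mapping.single m c" d] by (simp add: lookup_single)

lemma der_mon_add: "der_mon d (m + n) = pmon m * der_mon d n + pmon n * der_mon d m"
proof -
  let ?A = "Poly_Mapping.keys m \<union> Poly_Mapping.keys n"
  have fin: "finite ?A" by simp
  have le: "Poly_Mapping.keys (m + n) \<subseteq> ?A" by (rule Poly_Mapping.keys_add)
  have shift: "m + (n - Poly_Mapping.single x 1) = m + n - Poly_Mapping.single x 1" if "Poly_Mapping.lookup n x \<noteq> 0" for m n :: "'a \<Rightarrow>\<^sub>0 nat" and x
    by (rule poly_mapping_eqI) (use that in \<open>auto simp: lookup_add lookup_minus lookup_single when_def\<close>)
  have *: "Poly_Mapping.single (m + n - Poly_Mapping.single x 1) (of_nat (Poly_Mapping.lookup (m + n) x)) =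
      pmon m * Poly_Mapping.single (n - Poly_Mapping.single x 1) (of_nat (Poly_Mapping.lookup n x)) +
      pmon n * (Poly_Mapping.single (m - Poly_Mapping.single x 1) (of_nat (Poly_Mapping.lookup m x)) :: ('a, 'b) mpoly)" for x
    using shift[of n x m] shift[of m x n]
    by (cases "Poly_Mapping.lookup n x = 0"; cases "Poly_Mapping.lookup m x = 0")
      (auto simp: pmon_def mult_single lookup_add single_add add.commute)
  show ?thesis
    unfolding der_mon_superset[OF fin le] der_mon_superset[OF fin Un_upper1] der_mon_superset[OF fin Un_upper2]
    by (simp only: * distrib_right sum.distrib sum_distrib_left mult.assoc)
qed

lemma der_mult: "der d (f * g) = f * der d g + g * der d f"
proof (induction f rule: poly_mapping_induct)
  case (single m a)
  show ?case
  proof (induction g rule: poly_mapping_induct)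
    case (single n b)
    show ?case
      by (simp add: mult_single der_single der_mon_add)
        (simp add: single_eq_pconst pconst_mult algebra_simps)
  next
    case (sum f g) then show ?case by (simp add: der_add distrib_left distrib_right algebra_simps)
  qed
next
  case (sum f g) then show ?case by (simp add: der_add distrib_left distrib_right algebra_simps)
qed

lemma der_pconst: "der d (pconst c) = 0"
  by (simp add: pconst_def der_single der_mon_def)

lemma der_one: "der d 1 = 0"
  using der_pconst[of d 1] by (simp add: pconst_1)

lemma der_pvar: "der d (pvar x) = d x"
  by (simp add: pvar_def der_single der_mon_def pconst_1 flip: One_nat_def)

lemma der_scale: "der d (pconst c * f) = pconst c * der d f"
  by (simp add: der_mult der_pconst)

lemma der_minus: "der d (- f) = - der d f"
  using der_scale[of d "- 1" f] by (simp add: pconst_def single_uminus)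

lemma der_diff: "der d (f - g) = der d f - der d g"
  using der_add[of d f "- g"] der_minus[of d g] by simp

lemma der_zero: "der d 0 = 0"
  by (simp add: der_def)

lemma der_sum: "der d (\<Sum>i\<in>A. f i) = (\<Sum>i\<in>A. der d (f i))"
  by (induction A rule: infinite_finite_induct) (auto simp: der_zero der_add)

text \<open>A commutator of derivations does not come in the form \<open>der d\<close>. Applied to a
  difference, this lemma compares it with another derivation on the variables.\<close>

lemma derivation_zero:
  fixes E :: "('v, 'k::comm_ring_1) mpoly \<Rightarrow> ('v, 'k) mpoly"
  assumes add: "\<And>f g. E (f + g) = E f + E g" and mult: "\<And>f g. E (f * g) = f * E g + g * E f"
    and const: "\<And>c. E (pconst c) = 0" and var: "\<And>x. E (pvar x) = 0"
  shows "E f = 0"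
proof -
  have mon: "E (pmon m) = 0" for m
  proof (induction m rule: poly_mapping_induct)
    case (single k n)
    show ?case
    proof (induction n)
      case 0
      then show ?case using const[of 1] by (simp add: pmon_0 pconst_1)
    next
      case (Suc n)
      have "pmon (Poly_Mapping.single k (Suc n)) = pvar k * (pmon (Poly_Mapping.single k n) :: ('v, 'k) mpoly)"
        by (simp add: pvar_def pmon_def mult_single flip: single_add)
      then show ?case using Suc by (simp add: mult var)
    qed
  next
    case (sum f g) then show ?case by (simp add: pmon_add mult)
  qed
  show ?thesis
  proof (induction f rule: poly_mapping_induct)
    case (single k v) then show ?case by (simp add: single_eq_pconst mult const mon)
  next
    case (sum f g) then show ?case by (simp add: add)
  qed
qed

subsection \<open>A Whittaker vector\<close>

text \<open>The Lie algebra acts by vector fields on the affine charts of the Grassmannians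
  \<open>Gr(c, N)\<close> for \<open>1 \<le> c < N\<close>: a point of the chart is the column span of a matrix \<open>G\<close> with \<open>N\<close> rows and
  \<open>c\<close> columns whose upper \<open>c\<close> rows form the identity, and the lower rows are the coordinates.\<close>

definition G :: "nat \<Rightarrow> nat \<Rightarrow> nat \<Rightarrow> (nat \<times> nat \<times> nat, 'k::comm_ring_1) mpoly" where
  "G c a b = (if a < c then (if a = b then 1 else 0) else pvar (c, a, b))"

text \<open>The entry (a, i) of 1 - G H, where H is the matrix that extracts the upper c rows. The
  factor 1 - G H brings the upper block back to the identity after an infinitesimal change of
  G.\<close>

definition Gu :: "nat \<Rightarrow> nat \<Rightarrow> nat \<Rightarrow> (nat \<times> nat \<times> nat, 'k::comm_ring_1) mpoly" where
  "Gu c a i = (if a = i then 1 else 0) - (if i < c then G c a i else 0)"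

text \<open>Multiply G by 1 + t E_{i,j} and renormalise the upper block to the identity. The
  derivative at t = 0 is E_{i,j} G minus G times the upper block of E_{i,j} G, and its entry (a, b)
  is \<open>Gu c a i * G c j b\<close>. Triples with \<open>a < c\<close> are not coordinates and
  get the value 0.\<close>

definition vf :: "nat \<Rightarrow> nat \<Rightarrow> (nat \<times> nat \<times> nat, 'k::comm_ring_1) mpoly \<Rightarrow> (nat \<times> nat \<times> nat, 'k) mpoly" where
  "vf i j = der (\<lambda>(c, a, b). if a < c then 0 else Gu c a i * G c j b)"

lemma vf_G: "vf i j (G c a b) = Gu c a i * G c j b"
  by (auto simp: vf_def G_def Gu_def der_pvar der_one der_zero)

lemma vf_Gu: "vf k l (Gu c a i) = (if i < c then - (Gu c a k * G c l i) else 0)"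
  by (auto simp: Gu_def[of c a i] vf_G[unfolded vf_def] der_diff der_one der_zero vf_def der_minus)

lemma vf_mult: "vf i j (f * g) = f * vf i j g + g * vf i j f"
  by (simp add: vf_def der_mult)

lemma vf_add: "vf i j (f + g) = vf i j f + vf i j g"
  by (simp add: vf_def der_add)

text \<open>Both sides are derivations in \<open>f\<close>, so it is enough to compare them on
  variables. The order of the indices is that of a right action, as in
  \<open>bracket\<close>.\<close>

lemma vf_bracket:
  fixes f :: "(nat \<times> nat \<times> nat, 'k::comm_ring_1) mpoly"
  shows "vf k l (vf i j f) - vf i j (vf k l f) = (if j = k then vf i l f else 0) - (if l = i then vf k j f else 0)"
proof -
  define E where "E f = vf k l (vf i j f) - vf i j (vf k l f) - ((if j = k then vf i l f else 0) - (if l = i then vf k j f else 0))"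
    for f :: "(nat \<times> nat \<times> nat, 'k) mpoly"
  have "E f = 0"
  proof (rule derivation_zero[of E])
    show "E (f + g) = E f + E g" for f g by (auto simp: E_def vf_add)
    show "E (f * g) = f * E g + g * E f" for f g
      by (cases "j = k"; cases "l = i") (simp_all add: E_def vf_add vf_mult algebra_simps)
    show "E (pconst c) = 0" for c by (simp add: E_def vf_def der_pconst der_zero)
    have G: "E (G c a b) = 0" for c a b
    proof -
      \<comment> \<open>With names for the four case distinctions, the claim on an entry of G
        becomes a polynomial identity.\<close>
      define g1 where "g1 = (if i < c then G c l i else 0 :: (nat \<times> nat \<times> nat, 'k) mpoly)"
      define g2 where "g2 = (if k < c then G c j k else 0 :: (nat \<times> nat \<times> nat, 'k) mpoly)"
      define d1 where "d1 = (if l = i then 1 else 0 :: (nat \<times> nat \<times> nat, 'k) mpoly)"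
      define d2 where "d2 = (if j = k then 1 else 0 :: (nat \<times> nat \<times> nat, 'k) mpoly)"
      have "vf k l (Gu c a i) = - (Gu c a k * g1)" by (simp add: vf_Gu g1_def)
      then have 1: "vf k l (vf i j (G c a b)) = Gu c a i * (Gu c j k * G c l b) - G c j b * (Gu c a k * g1)"
        by (simp add: vf_G vf_mult)
      have "vf i j (Gu c a k) = - (Gu c a i * g2)" by (simp add: vf_Gu g2_def)
      then have 2: "vf i j (vf k l (G c a b)) = Gu c a k * (Gu c l i * G c j b) - G c l b * (Gu c a i * g2)"
        by (simp add: vf_G vf_mult)
      have 3: "Gu c l i = d1 - g1" "Gu c j k = d2 - g2" by (simp_all add: Gu_def g1_def g2_def d1_def d2_def)
      have 4: "(if j = k then vf i l (G c a b) else 0) = d2 * (Gu c a i * G c l b)"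
        "(if l = i then vf k j (G c a b) else 0) = d1 * (Gu c a k * G c j b)"
        by (simp_all add: vf_G d1_def d2_def)
      show ?thesis unfolding E_def 1 2 3 4 by (simp add: algebra_simps)
    qed
    show "E (pvar x) = 0" for x
    proof -
      obtain c a b where x: "x = (c, a, b)" using prod_cases3 by blast
      show ?thesis
      proof (cases "a < c")
        case True
        then show ?thesis by (simp add: E_def x vf_def der_pvar der_zero)
      next
        case False
        then have "pvar x = (G c a b :: (_, 'k) mpoly)" by (simp add: x G_def)
        then show ?thesis using G by simp
      qed
    qed
  qed
  then show ?thesis by (simp add: E_def)
qed

text \<open>In chart c the summand is the coordinate just below the last diagonal entry of the
  identity block. The vector field of E_{c,c-1} moves it with speed 1, and those of all other matrix
  units of n_- annihilate it. So the exponential of the sum transforms under n_- by \<psi>.\<close>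

definition phase :: "nat \<Rightarrow> (nat \<times> nat \<times> nat, 'k::comm_ring_1) mpoly" where
  "phase N = (\<Sum>c\<in>{1..<N}. G c c (c - 1))"

lemma vf_phase: assumes "j < i" "i < N" shows "vf i j (phase N) = (if i = Suc j then 1 else 0)"
proof -
  have "vf i j (phase N) = (\<Sum>c\<in>{1..<N}. Gu c c i * G c j (c - 1))"
    by (simp add: phase_def vf_def der_sum vf_G[unfolded vf_def])
  also have "\<dots> = (\<Sum>c\<in>{1..<N}. if c = i then (if i = Suc j then 1 else 0) else 0)"
    by (rule sum.cong) (use assms in \<open>auto simp: Gu_def G_def\<close>)
  also have "\<dots> = (if i = Suc j then 1 else 0)" using assms by simp
  finally show ?thesis .
qed

text \<open>The functions on the product of the charts, twisted by the exponential of the phase.\<close>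

definition tw :: "nat \<Rightarrow> nat \<Rightarrow> nat \<Rightarrow> (nat \<times> nat \<times> nat, 'k::comm_ring_1) mpoly \<Rightarrow> (nat \<times> nat \<times> nat, 'k) mpoly" where
  "tw N i j f = vf i j f + vf i j (phase N) * f"

definition psc :: "'k::comm_ring_1 \<Rightarrow> ('v, 'k) mpoly \<Rightarrow> ('v, 'k) mpoly" where "psc c f = pconst c * f"

interpretation tw: mir_ops "psc :: 'k::field_char_0 \<Rightarrow> _" N "tw N" for N
proof
  show "psc a (x + y) = psc a x + psc a y" for a :: 'k and x y :: "(nat \<times> nat \<times> nat, 'k) mpoly"
    by (simp add: psc_def distrib_left)
  show "psc (a + b) x = psc a x + psc b x" for a b :: 'k and x :: "(nat \<times> nat \<times> nat, 'k) mpoly"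
    by (simp add: psc_def pconst_add distrib_right)
  show "psc a (psc b x) = psc (a * b) x" for a b :: 'k and x :: "(nat \<times> nat \<times> nat, 'k) mpoly"
    by (simp add: psc_def pconst_mult mult.assoc)
  show "psc 1 x = x" for x :: "(nat \<times> nat \<times> nat, 'k) mpoly" by (simp add: psc_def pconst_1)
  show "is_linear (psc :: 'k \<Rightarrow> _) psc (tw N i j)" for i j
  proof (rule is_linearI)
    fix x y :: "(nat \<times> nat \<times> nat, 'k) mpoly" and c :: 'k
    show "tw N i j (x + y) = tw N i j x + tw N i j y" by (simp add: tw_def vf_add distrib_left)
    show "tw N i j (psc c x) = psc c (tw N i j x)"
      by (simp add: tw_def psc_def vf_def der_scale distrib_left mult.left_commute)
  qed
  show "tw N k l (tw N i j w) = tw N i j (tw N k l w) + (if j = k then tw N i l w else 0) - (if l = i then tw N k j w else 0)"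
    for i j k l and w :: "(nat \<times> nat \<times> nat, 'k) mpoly"
  proof -
    let ?h = "phase N :: (nat \<times> nat \<times> nat, 'k) mpoly"
    have "tw N k l (tw N i j w) - tw N i j (tw N k l w) =
        (vf k l (vf i j w) - vf i j (vf k l w)) + (vf k l (vf i j ?h) - vf i j (vf k l ?h)) * w"
      by (simp add: tw_def vf_add vf_mult algebra_simps)
    also have "\<dots> = (if j = k then tw N i l w else 0) - (if l = i then tw N k j w else 0)"
      unfolding vf_bracket by (simp add: tw_def left_diff_distrib)
    finally show ?thesis by (simp add: algebra_simps)
  qed
qed

lemma tw_whittaker: assumes "a \<in> tw.neg N" shows "tw.p N a (1 :: (nat \<times> nat \<times> nat, 'k::field_char_0) mpoly) = 0"
  using assms by (auto simp: tw.neg_def tw.p_def tw_def vf_phase) (auto simp: vf_def der_one)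

subsection \<open>Coordinates of vector spaces\<close>

text \<open>Vectors of a carrier-based space are replaced by their coordinates in a basis. These are
  elements of a type with group structure, as the preceding locales require; the universe of the
  space serves as index set.\<close>

definition fsc :: "'k::field \<Rightarrow> ('v \<Rightarrow>\<^sub>0 'k) \<Rightarrow> ('v \<Rightarrow>\<^sub>0 'k)" where "fsc c f = Poly_Mapping.map ((*) c) f"

lemma lookup_fsc [simp]: "Poly_Mapping.lookup (fsc c f) x = c * Poly_Mapping.lookup f x"
  by (simp add: fsc_def map.rep_eq when_def)

interpretation fsc: vector_space fsc
  by unfold_locales (auto intro!: poly_mapping_eqI simp: lookup_add algebra_simps)

definition supp_in :: "'v set \<Rightarrow> ('v \<Rightarrow>\<^sub>0 'k::zero) set" where "supp_in B = {f. Poly_Mapping.keys f \<subseteq> B}"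

lemma supp_in_iff: "f \<in> supp_in B \<longleftrightarrow> (\<forall>x. x \<notin> B \<longrightarrow> Poly_Mapping.lookup f x = 0)"
  by (auto simp: supp_in_def in_keys_iff)

lemma supp_in_sub: "is_subspace fsc (supp_in B)"
  by (auto simp: is_subspace_def supp_in_iff lookup_add)

definition cutoff :: "'v set \<Rightarrow> ('v \<Rightarrow>\<^sub>0 'k::zero) \<Rightarrow> ('v \<Rightarrow>\<^sub>0 'k)" where
  "cutoff B f = Poly_Mapping.mapp (\<lambda>x c. if x \<in> B then c else 0) f"

lemma lookup_cutoff: "Poly_Mapping.lookup (cutoff B f) x = (if x \<in> B then Poly_Mapping.lookup f x else 0)"
  by (simp add: cutoff_def lookup_mapp when_def in_keys_iff)

lemma cutoff_in: "cutoff B f \<in> supp_in B"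
  by (simp add: supp_in_iff lookup_cutoff)

lemma cutoff_id: "f \<in> supp_in B \<Longrightarrow> cutoff B f = f"
  by (rule poly_mapping_eqI) (simp add: lookup_cutoff supp_in_iff)

lemma cutoff_lin: "is_linear fsc fsc (cutoff B)"
  by (auto simp: is_linear_def lookup_cutoff lookup_add intro!: poly_mapping_eqI)

locale kspace = vectorspace class_ring V for V :: "('k::field, 'v, 'm) module_scheme" (structure)
begin

lemma sc_closed [simp, intro]: "v \<in> carrier V \<Longrightarrow> c \<odot> v \<in> carrier V"
  using smult_closed[of c v] by simp

lemma sc_add: "v \<in> carrier V \<Longrightarrow> w \<in> carrier V \<Longrightarrow> c \<odot> (v \<oplus> w) = c \<odot> v \<oplus> c \<odot> w"
  using smult_r_distr[of c v w] by simp

lemma add_sc: "v \<in> carrier V \<Longrightarrow> (a + b) \<odot> v = a \<odot> v \<oplus> b \<odot> v"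
  using smult_l_distr[of a b v] by simp

lemma sc_sc: "v \<in> carrier V \<Longrightarrow> a \<odot> (b \<odot> v) = (a * b) \<odot> v"
  using smult_assoc1[of a b v] by simp

lemma sc_one: "v \<in> carrier V \<Longrightarrow> 1 \<odot> v = v"
  using smult_one[of v] by simp

lemma zero_sc: "v \<in> carrier V \<Longrightarrow> 0 \<odot> v = \<zero>"
  using smult_l_null[of v] by simp

lemma sc_zero: "c \<odot> \<zero> = \<zero>"
  using smult_r_null[of c] by simp

lemma neg_sc: "v \<in> carrier V \<Longrightarrow> \<ominus> v = (- 1) \<odot> v"
proof -
  assume v: "v \<in> carrier V"
  have "v \<oplus> (- 1) \<odot> v = (1 + - 1) \<odot> v" using add_sc[OF v, of 1 "- 1"] sc_one[OF v] by simp
  then have "v \<oplus> (- 1) \<odot> v = \<zero>" using zero_sc[OF v] by simp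
  then show ?thesis using v M.minus_equality[of "(- 1) \<odot> v" v] M.a_comm by simp
qed

definition lc :: "('v \<Rightarrow>\<^sub>0 'k) \<Rightarrow> 'v" where
  "lc f = (\<Oplus>b\<in>Poly_Mapping.keys f. Poly_Mapping.lookup f b \<odot> b)"

lemma lc_superset:
  assumes "finite A" "Poly_Mapping.keys f \<subseteq> A" "A \<subseteq> carrier V"
  shows "lc f = (\<Oplus>b\<in>A. Poly_Mapping.lookup f b \<odot> b)"
  unfolding lc_def
  by (rule M.add.finprod_mono_neutral_cong_left)
    (use assms in \<open>auto simp: in_keys_iff zero_sc subset_iff\<close>)

lemma lc_closed: "f \<in> supp_in (carrier V) \<Longrightarrow> lc f \<in> carrier V"
  unfolding lc_def by (rule M.finsum_closed) (auto simp: supp_in_def)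

lemma lc_add:
  assumes "f \<in> supp_in (carrier V)" "g \<in> supp_in (carrier V)" shows "lc (f + g) = lc f \<oplus> lc g"
proof -
  let ?A = "Poly_Mapping.keys f \<union> Poly_Mapping.keys g"
  have A: "finite ?A" "?A \<subseteq> carrier V" using assms by (auto simp: supp_in_def)
  have "lc (f + g) = (\<Oplus>b\<in>?A. Poly_Mapping.lookup f b \<odot> b \<oplus> Poly_Mapping.lookup g b \<odot> b)"
    unfolding lc_superset[OF A(1) Poly_Mapping.keys_add A(2)] lookup_add
    by (rule M.finsum_cong') (use A in \<open>auto simp: add_sc subset_iff\<close>)
  also have "\<dots> = lc f \<oplus> lc g"
    unfolding lc_superset[OF A(1) Un_upper1 A(2)] lc_superset[OF A(1) Un_upper2 A(2)]
    by (rule M.finsum_addf) (use A in \<open>auto simp: subset_iff\<close>)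
  finally show ?thesis .
qed

lemma lc_zero: "lc 0 = \<zero>"
  by (simp add: lc_def)

lemma lc_single: "b \<in> carrier V \<Longrightarrow> lc (Poly_Mapping.single b c) = c \<odot> b"
  using lc_superset[of "{b}" "Poly_Mapping.single b c"] by (auto simp: supp_in_def)

lemma lc_scale: assumes "f \<in> supp_in (carrier V)" shows "lc (fsc c f) = c \<odot> lc f"
  using assms
proof (induction f rule: update_induct)
  case const then show ?case by (simp add: lc_zero sc_zero)
next
  case (update f a b)
  have eq: "Poly_Mapping.update a b f = f + Poly_Mapping.single a b"
    by (rule poly_mapping_eqI)
      (use update in \<open>auto simp: lookup_add lookup_update lookup_single in_keys_iff when_def\<close>)
  have f: "f \<in> supp_in (carrier V)"
  proof -
    have "Poly_Mapping.lookup f x = 0" if "x \<notin> carrier V" for x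
      using update.prems that update.hyps by (cases "x = a") (auto simp: supp_in_iff lookup_update in_keys_iff)
    then show ?thesis by (simp add: supp_in_iff)
  qed
  have a: "a \<in> carrier V" using update.prems update.hyps by (auto simp: supp_in_iff lookup_update)
  have s: "fsc c (Poly_Mapping.single a b) = Poly_Mapping.single a (c * b)"
    by (rule poly_mapping_eqI) (auto simp: lookup_single when_def)
  have sa: "Poly_Mapping.single a x \<in> supp_in (carrier V)" for x using a by (auto simp: supp_in_iff lookup_single when_def)
  have fs: "fsc c f \<in> supp_in (carrier V)" using f by (auto simp: supp_in_iff)
  have "lc (fsc c (Poly_Mapping.update a b f)) = lc (fsc c f) \<oplus> (c * b) \<odot> a"
    unfolding eq fsc.scale_right_distrib s using lc_add[OF fs sa] lc_single[OF a] by simp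
  also have "\<dots> = c \<odot> lc (Poly_Mapping.update a b f)"
    unfolding eq lc_add[OF f sa] lc_single[OF a] update.IH[OF f]
    using a lc_closed[OF f] by (simp add: sc_add sc_sc)
  finally show ?case .
qed

definition indep :: "'v set \<Rightarrow> bool" where
  "indep B \<longleftrightarrow> B \<subseteq> carrier V \<and> (\<forall>f\<in>supp_in B. lc f = \<zero> \<longrightarrow> f = 0)"

lemma indep_Union:
  assumes "C \<in> chains {B. indep B}" shows "indep (\<Union>C)"
  unfolding indep_def
proof (intro conjI ballI impI)
  show "\<Union>C \<subseteq> carrier V" using assms by (auto simp: chains_def indep_def)
  fix f assume f: "f \<in> supp_in (\<Union>C)" "lc f = \<zero>"
  show "f = 0"
  proof (cases "C = {}")
    case True then show ?thesis using f by (auto simp: supp_in_iff intro: poly_mapping_eqI)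
  next
    case False
    have fin: "finite (Poly_Mapping.keys f)" "Poly_Mapping.keys f \<subseteq> \<Union>C" using f by (auto simp: supp_in_def)
    have "subset.chain UNIV C" using assms by (auto simp: chains_def chain_subset_def subset.chain_def)
    then obtain B where "B \<in> C" "Poly_Mapping.keys f \<subseteq> B"
      using finite_subset_Union_chain[OF fin False] by blast
    then show ?thesis using f assms by (auto simp: chains_def indep_def supp_in_def)
  qed
qed

lemma ex_basis: "\<exists>B. indep B \<and> lc ` supp_in B = carrier V"
proof -
  obtain B where B: "indep B" and max: "\<And>B'. indep B' \<Longrightarrow> B \<subseteq> B' \<Longrightarrow> B' = B"
    using Zorn_Lemma[of "{B. indep B}"] indep_Union by (auto simp: Ball_def)
  have sub: "supp_in B \<subseteq> supp_in (carrier V)" using B by (auto simp: indep_def supp_in_def)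
  have "v \<in> lc ` supp_in B" if v: "v \<in> carrier V" for v
  proof (rule ccontr)
    assume nv: "v \<notin> lc ` supp_in B"
    have vB: "v \<notin> B"
    proof
      assume "v \<in> B"
      then have "Poly_Mapping.single v 1 \<in> supp_in B" by (auto simp: supp_in_iff lookup_single when_def)
      moreover have "lc (Poly_Mapping.single v 1) = v" using v by (simp add: lc_single sc_one)
      ultimately show False using nv by (metis imageI)
    qed
    have "indep (insert v B)"
      unfolding indep_def
    proof (intro conjI ballI impI)
      show "insert v B \<subseteq> carrier V" using v B by (auto simp: indep_def)
      fix f assume f: "f \<in> supp_in (insert v B)" "lc f = \<zero>"
      define c where "c = Poly_Mapping.lookup f v"
      define g where "g = f - Poly_Mapping.single v c"
      have g: "g \<in> supp_in B" using f by (auto simp: supp_in_iff g_def c_def lookup_minus lookup_single when_def)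
      have fg: "f = g + Poly_Mapping.single v c" by (simp add: g_def)
      have sv: "Poly_Mapping.single v c \<in> supp_in (carrier V)" using v by (auto simp: supp_in_iff lookup_single when_def)
      have gc: "lc g \<in> carrier V" using g sub lc_closed by blast
      have 0: "lc g \<oplus> c \<odot> v = \<zero>"
        using f(2) g sub unfolding fg by (subst (asm) lc_add) (auto simp: sv lc_single v)
      show "f = 0"
      proof (cases "c = 0")
        case True
        then have "lc g = \<zero>" using 0 gc v by (simp add: zero_sc)
        then show ?thesis using g B True by (auto simp: fg indep_def)
      next
        case False
        have "lc g = \<ominus> (c \<odot> v)" using 0 gc v M.minus_equality by auto
        then have "lc g = (- c) \<odot> v" using v by (simp add: neg_sc sc_sc)
        then have "lc (fsc (inverse (- c)) g) = v"
          using False g sub v by (subst lc_scale) (auto simp: sc_sc sc_one)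
        moreover have "fsc (inverse (- c)) g \<in> supp_in B" using g by (auto simp: supp_in_iff)
        ultimately show ?thesis using nv by (metis imageI)
      qed
    qed
    then show False using max[of "insert v B"] vB by blast
  qed
  moreover have "lc ` supp_in B \<subseteq> carrier V" using sub lc_closed by blast
  ultimately show ?thesis using B by blast
qed

definition bas :: "'v set" where "bas = (SOME B. indep B \<and> lc ` supp_in B = carrier V)"

lemma bas: "indep bas" "lc ` supp_in bas = carrier V"
  using someI_ex[OF ex_basis] by (auto simp: bas_def)

lemma bas_carrier: "bas \<subseteq> carrier V" using bas by (simp add: indep_def)

definition SV :: "('v \<Rightarrow>\<^sub>0 'k) set" where "SV = supp_in bas"

lemma SV_sub: "is_subspace fsc SV" by (simp add: SV_def supp_in_sub)

lemma SV_carrier: "SV \<subseteq> supp_in (carrier V)" using bas_carrier by (auto simp: SV_def supp_in_def)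

lemma lc_SV: "f \<in> SV \<Longrightarrow> lc f \<in> carrier V" using SV_carrier lc_closed by blast

lemma lc_SV_add: "f \<in> SV \<Longrightarrow> g \<in> SV \<Longrightarrow> lc (f + g) = lc f \<oplus> lc g" using SV_carrier lc_add by blast

lemma lc_SV_scale: "f \<in> SV \<Longrightarrow> lc (fsc c f) = c \<odot> lc f" using SV_carrier lc_scale by blast

lemma lc_inj: "inj_on lc SV"
proof (rule inj_onI)
  fix f g assume *: "f \<in> SV" "g \<in> SV" "lc f = lc g"
  have d: "f - g \<in> SV" using * fsc.sub_diff[OF SV_sub] by blast
  have "lc f = lc (f - g) \<oplus> lc g" using lc_SV_add[OF d *(2)] by simp
  then have "lc (f - g) = \<zero>" using * lc_SV d by (metis M.add.r_cancel_one)
  then have "f - g = 0" using bas(1) d by (auto simp: indep_def SV_def)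
  then show "f = g" by simp
qed

definition crd :: "'v \<Rightarrow> ('v \<Rightarrow>\<^sub>0 'k)" where "crd v = inv_into SV lc v"

lemma crd_SV [simp]: "v \<in> carrier V \<Longrightarrow> crd v \<in> SV"
  and lc_crd [simp]: "v \<in> carrier V \<Longrightarrow> lc (crd v) = v"
  using bas(2) by (auto simp: crd_def SV_def inv_into_into f_inv_into_f)

lemma crd_lc: "f \<in> SV \<Longrightarrow> crd (lc f) = f"
  using lc_inj by (simp add: crd_def inv_into_f_f)

lemma crd_add: "v \<in> carrier V \<Longrightarrow> w \<in> carrier V \<Longrightarrow> crd (v \<oplus> w) = crd v + crd w"
  using crd_lc[of "crd v + crd w"] lc_SV_add[of "crd v" "crd w"] fsc.sub_add[OF SV_sub] by simp

lemma crd_scale: "v \<in> carrier V \<Longrightarrow> crd (c \<odot> v) = fsc c (crd v)"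
  using crd_lc[of "fsc c (crd v)"] lc_SV_scale[of "crd v" c] fsc.sub_scale[OF SV_sub] by simp

lemma crd_inj: "v \<in> carrier V \<Longrightarrow> w \<in> carrier V \<Longrightarrow> crd v = crd w \<Longrightarrow> v = w"
  using lc_crd by metis

lemma crd_zero: "crd \<zero> = 0"
  using crd_scale[of \<zero> 0] by (simp add: sc_zero)

lemma crd_eq_0: "v \<in> carrier V \<Longrightarrow> crd v = 0 \<longleftrightarrow> v = \<zero>"
  using crd_inj[of v \<zero>] crd_zero by auto

text \<open>Cutting off the coordinates outside the basis makes the lifted operator linear on the
  whole type; on \<open>SV\<close> it is \<open>A\<close> in coordinates.\<close>

definition lift :: "('v \<Rightarrow> 'v) \<Rightarrow> ('v \<Rightarrow>\<^sub>0 'k) \<Rightarrow> ('v \<Rightarrow>\<^sub>0 'k)" where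
  "lift A f = crd (A (lc (cutoff bas f)))"

lemma cutoff_SV: "cutoff bas f \<in> SV" by (simp add: SV_def cutoff_in)

lemma lift_crd: "v \<in> carrier V \<Longrightarrow> lift A (crd v) = crd (A v)"
  using crd_SV[of v] by (simp add: lift_def cutoff_id SV_def)

lemma lift_lin:
  assumes "\<And>v. v \<in> carrier V \<Longrightarrow> A v \<in> carrier V"
    and "\<And>v w. v \<in> carrier V \<Longrightarrow> w \<in> carrier V \<Longrightarrow> A (v \<oplus> w) = A v \<oplus> A w"
    and "\<And>c v. v \<in> carrier V \<Longrightarrow> A (c \<odot> v) = c \<odot> A v"
  shows "is_linear fsc fsc (lift A)"
proof (rule is_linearI)
  fix f g show "lift A (f + g) = lift A f + lift A g"
    unfolding lift_def using assms lc_SV[OF cutoff_SV]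
    by (simp add: is_linear_add[OF cutoff_lin] lc_SV_add cutoff_SV crd_add)
next
  fix c f show "lift A (fsc c f) = fsc c (lift A f)"
    unfolding lift_def using assms lc_SV[OF cutoff_SV]
    by (simp add: is_linear_scale[OF cutoff_lin] lc_SV_scale cutoff_SV crd_scale)
qed

lemma SV_cases: "f \<in> SV \<Longrightarrow> \<exists>v\<in>carrier V. f = crd v"
  using crd_lc lc_SV by metis

end

section \<open>Vector space axioms, quotients and linear maps\<close>

lemma kspaceI: "vectorspace class_ring V \<Longrightarrow> kspace V" by (simp add: kspace_def)

lemma vectorspaceI:
  fixes V :: "('k::field, 'v, 'm) module_scheme" (structure)
  assumes "\<And>x y. x \<in> carrier V \<Longrightarrow> y \<in> carrier V \<Longrightarrow> x \<oplus> y \<in> carrier V"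
    and "\<zero> \<in> carrier V" and "\<And>c x. x \<in> carrier V \<Longrightarrow> c \<odot> x \<in> carrier V"
    and "\<And>x y z. x \<in> carrier V \<Longrightarrow> y \<in> carrier V \<Longrightarrow> z \<in> carrier V \<Longrightarrow> x \<oplus> y \<oplus> z = x \<oplus> (y \<oplus> z)"
    and "\<And>x y. x \<in> carrier V \<Longrightarrow> y \<in> carrier V \<Longrightarrow> x \<oplus> y = y \<oplus> x"
    and "\<And>x. x \<in> carrier V \<Longrightarrow> \<zero> \<oplus> x = x"
    and "\<And>x. x \<in> carrier V \<Longrightarrow> 0 \<odot> x = \<zero>" and "\<And>x. x \<in> carrier V \<Longrightarrow> 1 \<odot> x = x"
    and "\<And>a b x. x \<in> carrier V \<Longrightarrow> (a + b) \<odot> x = a \<odot> x \<oplus> b \<odot> x"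
    and "\<And>a x y. x \<in> carrier V \<Longrightarrow> y \<in> carrier V \<Longrightarrow> a \<odot> (x \<oplus> y) = a \<odot> x \<oplus> a \<odot> y"
    and "\<And>a b x. x \<in> carrier V \<Longrightarrow> (a * b) \<odot> x = a \<odot> (b \<odot> x)"
  shows "vectorspace class_ring V"
proof -
  have ag: "abelian_group V"
  proof (rule abelian_groupI)
    fix x assume x: "x \<in> carrier V"
    have "(- 1) \<odot> x \<oplus> x = (- 1 + 1) \<odot> x" using assms(9)[of x "- 1" 1] assms(8)[of x] x by simp
    then show "\<exists>y\<in>carrier V. y \<oplus> x = \<zero>" using assms(3,7) x by (intro bexI[of _ "(- 1) \<odot> x"]) auto
  qed (use assms in auto)
  have "Module.module class_ring V"
    by (rule moduleI) (use assms ag class_cring.is_cring in auto)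
  then show ?thesis by (simp add: vectorspace_def class_field)
qed

context kspace
begin

definition subsp :: "'v set \<Rightarrow> bool" where
  "subsp S \<longleftrightarrow> S \<subseteq> carrier V \<and> \<zero> \<in> S \<and> (\<forall>x\<in>S. \<forall>y\<in>S. x \<oplus> y \<in> S) \<and> (\<forall>c. \<forall>x\<in>S. c \<odot> x \<in> S)"

lemma subsp_minus: "subsp S \<Longrightarrow> x \<in> S \<Longrightarrow> \<ominus> x \<in> S"
  using neg_sc[of x] by (auto simp: subsp_def)

lemma mem_coset: "y \<in> S +> x \<longleftrightarrow> (\<exists>s\<in>S. y = s \<oplus> x)"
  by (auto simp: a_r_coset_def')

lemma coset_eq:
  assumes S: "subsp S" and x: "x \<in> carrier V" and y: "y \<in> carrier V"
  shows "S +> x = S +> y \<longleftrightarrow> x \<ominus> y \<in> S"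
proof
  assume "S +> x = S +> y"
  moreover have "x \<in> S +> x" using S x by (auto simp: mem_coset subsp_def intro!: bexI[of _ \<zero>])
  ultimately obtain s where s: "s \<in> S" "x = s \<oplus> y" by (auto simp: mem_coset)
  then have "x \<ominus> y = s" using S y by (auto simp: subsp_def M.minus_eq M.a_assoc M.r_neg subset_iff)
  then show "x \<ominus> y \<in> S" using s by simp
next
  assume d: "x \<ominus> y \<in> S"
  have *: "S +> x \<subseteq> S +> y" if "x \<ominus> y \<in> S" "x \<in> carrier V" "y \<in> carrier V" for x y
  proof
    fix z assume "z \<in> S +> x"
    then obtain s where s: "s \<in> S" "z = s \<oplus> x" by (auto simp: mem_coset)
    then have "z = (s \<oplus> (x \<ominus> y)) \<oplus> y" using S that
      by (auto simp: subsp_def M.minus_eq M.a_assoc M.l_neg subset_iff)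
    then show "z \<in> S +> y" using s that S by (auto simp: mem_coset subsp_def)
  qed
  have "y \<ominus> x = \<ominus> (x \<ominus> y)" using x y by (simp add: M.minus_eq M.minus_add M.a_comm)
  then have "y \<ominus> x \<in> S" using subsp_minus[OF S d] by simp
  then show "S +> x = S +> y" using * d x y by blast
qed

lemma coset_add:
  assumes S: "subsp S" and x: "x \<in> carrier V" and y: "y \<in> carrier V"
  shows "set_add V (S +> x) (S +> y) = S +> (x \<oplus> y)"
proof -
  have SV: "s \<in> S \<Longrightarrow> s \<in> carrier V" for s using S by (auto simp: subsp_def)
  have "(\<exists>h\<in>S. \<exists>k\<in>S. z = (h \<oplus> x) \<oplus> (k \<oplus> y)) \<longleftrightarrow> (\<exists>s\<in>S. z = s \<oplus> (x \<oplus> y))" for z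
  proof
    assume "\<exists>h\<in>S. \<exists>k\<in>S. z = (h \<oplus> x) \<oplus> (k \<oplus> y)"
    then obtain h k where hk: "h \<in> S" "k \<in> S" "z = (h \<oplus> x) \<oplus> (k \<oplus> y)" by blast
    then have "z = (h \<oplus> k) \<oplus> (x \<oplus> y)" using SV x y by (simp add: M.a_ac)
    then show "\<exists>s\<in>S. z = s \<oplus> (x \<oplus> y)" using hk S by (auto simp: subsp_def)
  next
    assume "\<exists>s\<in>S. z = s \<oplus> (x \<oplus> y)"
    then obtain s where s: "s \<in> S" "z = s \<oplus> (x \<oplus> y)" by blast
    then have "z = (s \<oplus> x) \<oplus> (\<zero> \<oplus> y)" using SV x y by (simp add: M.a_assoc)
    then show "\<exists>h\<in>S. \<exists>k\<in>S. z = (h \<oplus> x) \<oplus> (k \<oplus> y)" using s S by (auto simp: subsp_def)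
  qed
  then have "z \<in> set_add V (S +> x) (S +> y) \<longleftrightarrow> z \<in> S +> (x \<oplus> y)" for z
    by (simp add: set_add_def' mem_coset Bex_def) blast
  then show ?thesis by blast
qed

lemma coset_smult:
  assumes S: "subsp S" and x: "x \<in> carrier V"
  shows "(\<Union>a\<in>S +> x. S +> (c \<odot> a)) = S +> (c \<odot> x)"
proof -
  have SV: "s \<in> S \<Longrightarrow> s \<in> carrier V" for s using S by (auto simp: subsp_def)
  have "S +> (c \<odot> a) = S +> (c \<odot> x)" if "a \<in> S +> x" for a
  proof -
    obtain s where s: "s \<in> S" "a = s \<oplus> x" using \<open>a \<in> S +> x\<close> by (auto simp: mem_coset)
    then have "c \<odot> a \<ominus> c \<odot> x = c \<odot> s" using SV[of s] x by (simp add: sc_add M.minus_eq M.a_assoc M.r_neg)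
    moreover have "c \<odot> s \<in> S" using S s by (auto simp: subsp_def)
    ultimately show ?thesis using coset_eq[OF S, of "c \<odot> a" "c \<odot> x"] s SV x by simp
  qed
  moreover have "x \<in> S +> x" using S x by (auto simp: mem_coset subsp_def intro!: bexI[of _ \<zero>])
  ultimately show ?thesis by blast
qed

lemma coset_zero: "subsp S \<Longrightarrow> S +> \<zero> = S"
  by (force simp: mem_coset subsp_def subset_iff)

lemma quotient_carrier: "carrier (quotient_space V S) = (\<lambda>x. S +> x) ` carrier V"
  by (auto simp: quotient_space_def A_RCOSETS_def')

lemma quotient_zero: "subsp S \<Longrightarrow> \<zero>\<^bsub>quotient_space V S\<^esub> = S +> \<zero>"
  using coset_zero by (simp add: quotient_space_def)

lemma quotient_add: "subsp S \<Longrightarrow> x \<in> carrier V \<Longrightarrow> y \<in> carrier V \<Longrightarrow>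
    (S +> x) \<oplus>\<^bsub>quotient_space V S\<^esub> (S +> y) = S +> (x \<oplus> y)"
  by (simp add: quotient_space_def coset_add)

lemma quotient_smult: "subsp S \<Longrightarrow> x \<in> carrier V \<Longrightarrow>
    c \<odot>\<^bsub>quotient_space V S\<^esub> (S +> x) = S +> (c \<odot> x)"
  by (simp add: quotient_space_def coset_smult)

lemma quotient_kspace: assumes S: "subsp S" shows "kspace (quotient_space V S)"
  unfolding kspace_def
proof (rule vectorspaceI, goal_cases)
  case (5 x y)
  then obtain a b where "a \<in> carrier V" "b \<in> carrier V" "x = S +> a" "y = S +> b"
    by (auto simp: quotient_carrier)
  then show ?case by (simp add: quotient_add[OF S] M.a_comm)
qed (auto simp: quotient_carrier quotient_zero[OF S] quotient_add[OF S] quotient_smult[OF S] M.a_assoc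
  sc_add add_sc sc_sc sc_one zero_sc)

end

lemma lin_hom_iff:
  "f \<in> lin_hom V W \<longleftrightarrow> f \<in> carrier V \<rightarrow> carrier W \<and> f \<in> extensional (carrier V) \<and>
    (\<forall>x\<in>carrier V. \<forall>y\<in>carrier V. f (x \<oplus>\<^bsub>V\<^esub> y) = f x \<oplus>\<^bsub>W\<^esub> f y) \<and>
    (\<forall>c. \<forall>x\<in>carrier V. f (c \<odot>\<^bsub>V\<^esub> x) = c \<odot>\<^bsub>W\<^esub> f x)"
  by (auto simp: lin_hom_def LinearCombinations.module_hom_def)

lemma lin_homI:
  assumes "\<And>x. x \<in> carrier V \<Longrightarrow> f x \<in> carrier W" "f \<in> extensional (carrier V)"
    "\<And>x y. x \<in> carrier V \<Longrightarrow> y \<in> carrier V \<Longrightarrow> f (x \<oplus>\<^bsub>V\<^esub> y) = f x \<oplus>\<^bsub>W\<^esub> f y"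
    "\<And>c x. x \<in> carrier V \<Longrightarrow> f (c \<odot>\<^bsub>V\<^esub> x) = c \<odot>\<^bsub>W\<^esub> f x"
  shows "f \<in> lin_hom V W"
  using assms by (auto simp: lin_hom_iff)

lemma lin_homD:
  assumes "f \<in> lin_hom V W"
  shows "x \<in> carrier V \<Longrightarrow> f x \<in> carrier W" "f \<in> extensional (carrier V)"
    "x \<in> carrier V \<Longrightarrow> y \<in> carrier V \<Longrightarrow> f (x \<oplus>\<^bsub>V\<^esub> y) = f x \<oplus>\<^bsub>W\<^esub> f y"
    "x \<in> carrier V \<Longrightarrow> f (c \<odot>\<^bsub>V\<^esub> x) = c \<odot>\<^bsub>W\<^esub> f x"
  using assms by (auto simp: lin_hom_iff)

lemma lin_hom_zero:
  assumes "kspace V" "kspace W" "f \<in> lin_hom V W" shows "f \<zero>\<^bsub>V\<^esub> = \<zero>\<^bsub>W\<^esub>"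
proof -
  interpret V: kspace V by fact
  interpret W: kspace W by fact
  have "f (0 \<odot>\<^bsub>V\<^esub> \<zero>\<^bsub>V\<^esub>) = 0 \<odot>\<^bsub>W\<^esub> f \<zero>\<^bsub>V\<^esub>"
    using lin_homD(4)[OF assms(3), of "\<zero>\<^bsub>V\<^esub>" 0] by blast
  then show ?thesis using lin_homD(1)[OF assms(3), of "\<zero>\<^bsub>V\<^esub>"] by (simp add: V.zero_sc W.zero_sc)
qed

lemma lin_hom_diff:
  assumes "kspace V" "kspace W" "f \<in> lin_hom V W" "x \<in> carrier V" "y \<in> carrier V"
  shows "f (x \<ominus>\<^bsub>V\<^esub> y) = f x \<ominus>\<^bsub>W\<^esub> f y"
proof -
  interpret V: kspace V by fact
  interpret W: kspace W by fact
  show ?thesis using assms lin_homD(1)[OF assms(3)]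
    by (simp add: V.M.minus_eq W.M.minus_eq V.neg_sc W.neg_sc lin_homD(3,4)[OF assms(3)])
qed

context kspace
begin

lemma quotient_factor:
  assumes S: "subsp S" and W: "kspace W"
    and f: "\<And>x. x \<in> carrier V \<Longrightarrow> f x \<in> carrier W"
      "\<And>x y. x \<in> carrier V \<Longrightarrow> y \<in> carrier V \<Longrightarrow> f (x \<oplus> y) = f x \<oplus>\<^bsub>W\<^esub> f y"
      "\<And>c x. x \<in> carrier V \<Longrightarrow> f (c \<odot> x) = c \<odot>\<^bsub>W\<^esub> f x"
    and f0: "\<And>x. x \<in> S \<Longrightarrow> f x = \<zero>\<^bsub>W\<^esub>"
  shows "\<exists>!h. h \<in> lin_hom (quotient_space V S) W \<and> (\<forall>x\<in>carrier V. h (S +> x) = f x)"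
proof -
  interpret W: kspace W by fact
  have wd: "f x = f y" if "x \<in> carrier V" "y \<in> carrier V" "S +> x = S +> y" for x y
  proof -
    have d: "x \<ominus> y \<in> S" using that coset_eq[OF S] by simp
    then have "f ((x \<ominus> y) \<oplus> y) = \<zero>\<^bsub>W\<^esub> \<oplus>\<^bsub>W\<^esub> f y" using f0 f that by simp
    moreover have "(x \<ominus> y) \<oplus> y = x" using that by (simp add: M.minus_eq M.a_assoc M.l_neg)
    ultimately show ?thesis using f that by simp
  qed
  define h where "h = restrict (\<lambda>A. f (SOME x. x \<in> carrier V \<and> S +> x = A)) (carrier (quotient_space V S))"
  have h: "h (S +> x) = f x" if x: "x \<in> carrier V" for x
  proof -
    let ?y = "SOME y. y \<in> carrier V \<and> S +> y = S +> x"
    have "?y \<in> carrier V \<and> S +> ?y = S +> x" by (rule someI[of _ x]) (use x in simp)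
    then have "f ?y = f x" using wd x by blast
    then show ?thesis using x by (simp add: h_def quotient_carrier)
  qed
  show ?thesis
  proof (rule ex1I[of _ h], intro conjI ballI)
    show "h \<in> lin_hom (quotient_space V S) W"
    proof (rule lin_homI)
      show "h \<in> extensional (carrier (quotient_space V S))" by (simp add: h_def)
    qed (auto simp: quotient_carrier h f quotient_add[OF S] quotient_smult[OF S])
    show "h (S +> x) = f x" if "x \<in> carrier V" for x using h that .
    fix g assume g: "g \<in> lin_hom (quotient_space V S) W \<and> (\<forall>x\<in>carrier V. g (S +> x) = f x)"
    show "g = h"
    proof (rule extensionalityI[of _ "carrier (quotient_space V S)"])
      show "g \<in> extensional (carrier (quotient_space V S))" using g by (simp add: lin_hom_iff)
      show "h \<in> extensional (carrier (quotient_space V S))" by (simp add: h_def)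
      show "g A = h A" if "A \<in> carrier (quotient_space V S)" for A
        using that g h by (auto simp: quotient_carrier)
    qed
  qed
qed

end

subsection \<open>Finitely supported functions\<close>

lemma free_space_carrier: "p \<in> carrier (free_space S) \<longleftrightarrow> finite {s. p s \<noteq> 0} \<and> {s. p s \<noteq> 0} \<subseteq> S"
  by (simp add: free_space_def)

lemma free_space_simps:
  "\<zero>\<^bsub>free_space S\<^esub> = (\<lambda>_. 0)" "p \<oplus>\<^bsub>free_space S\<^esub> q = (\<lambda>s. p s + q s)" "c \<odot>\<^bsub>free_space S\<^esub> p = (\<lambda>s. c * p s)"
  by (simp_all add: free_space_def)

lemma free_space_kspace: "kspace (free_space S :: ('k::field, 's \<Rightarrow> 'k) module)"
  unfolding kspace_def
proof (rule vectorspaceI, goal_cases)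
  case (1 x y)
  have "{s. x s + y s \<noteq> 0} \<subseteq> {s. x s \<noteq> 0} \<union> {s. y s \<noteq> 0}" by auto
  then show ?case using 1 unfolding free_space_carrier free_space_simps by (meson finite_UnI finite_subset subset_trans Un_least)
next
  case (3 c x)
  have "{s. c * x s \<noteq> 0} \<subseteq> {s. x s \<noteq> 0}" by auto
  then show ?case using 3 unfolding free_space_carrier free_space_simps by (meson finite_subset subset_trans)
qed (auto simp: free_space_simps free_space_carrier algebra_simps)

lemma single_free: "s \<in> S \<Longrightarrow> single s \<in> carrier (free_space S)"
  by (auto simp: free_space_carrier Defs.single_def)

lemma free_space_induct [consumes 1, case_names zero add]:
  fixes p :: "'s \<Rightarrow> 'k::field"
  assumes "p \<in> carrier (free_space S)" and "P (\<lambda>_. 0)"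
    and "\<And>p c s. p \<in> carrier (free_space S) \<Longrightarrow> s \<in> S \<Longrightarrow> P p \<Longrightarrow> P (\<lambda>t. p t + c * single s t)"
  shows "P p"
proof -
  have "finite {s. p s \<noteq> 0}" "{s. p s \<noteq> 0} \<subseteq> S" using assms(1) by (auto simp: free_space_carrier)
  then show ?thesis
  proof (induction "{s. p s \<noteq> 0}" arbitrary: p rule: finite_induct)
    case empty
    then have "p = (\<lambda>_. 0)" by auto
    then show ?case using assms(2) by simp
  next
    case (insert s A)
    define r where "r = p(s := 0)"
    have A: "A = {t. r t \<noteq> 0}" using insert(2,4) by (auto simp: r_def set_eq_iff)
    have s: "s \<in> S" using insert(4,5) by auto
    have AS: "{t. r t \<noteq> 0} \<subseteq> S" using insert(4,5) A by auto
    have "P (\<lambda>t. r t + p s * single s t)"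
      using insert(1) A AS by (intro assms(3) s insert(3)) (auto simp: free_space_carrier)
    moreover have "(\<lambda>t. r t + p s * single s t) = p" by (auto simp: r_def Defs.single_def)
    ultimately show ?case by simp
  qed
qed

definition ext_lin :: "('k::field, 'x, 'm) module_scheme \<Rightarrow> ('s \<Rightarrow> 'x) \<Rightarrow> ('s \<Rightarrow> 'k) \<Rightarrow> 'x" where
  "ext_lin X h p = (\<Oplus>\<^bsub>X\<^esub>s\<in>{s. p s \<noteq> 0}. p s \<odot>\<^bsub>X\<^esub> h s)"

context kspace
begin

lemma ext_lin_superset:
  assumes "finite A" "{s. p s \<noteq> 0} \<subseteq> A" "\<And>s. s \<in> A \<Longrightarrow> h s \<in> carrier V"
  shows "ext_lin V h p = (\<Oplus>s\<in>A. p s \<odot> h s)"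
  unfolding ext_lin_def
  by (rule M.add.finprod_mono_neutral_cong_left) (use assms in \<open>auto simp: zero_sc subset_iff\<close>)

lemma ext_lin:
  assumes h: "\<And>s. s \<in> S \<Longrightarrow> h s \<in> carrier V"
  shows "p \<in> carrier (free_space S) \<Longrightarrow> ext_lin V h p \<in> carrier V"
    and "p \<in> carrier (free_space S) \<Longrightarrow> q \<in> carrier (free_space S) \<Longrightarrow>
      ext_lin V h (\<lambda>s. p s + q s) = ext_lin V h p \<oplus> ext_lin V h q"
    and "p \<in> carrier (free_space S) \<Longrightarrow> ext_lin V h (\<lambda>s. c * p s) = c \<odot> ext_lin V h p"
    and "s \<in> S \<Longrightarrow> ext_lin V h (single s) = h s"
proof -
  show 1: "ext_lin V h p \<in> carrier V" if "p \<in> carrier (free_space S)" for p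
    unfolding ext_lin_def by (rule M.finsum_closed) (use that h in \<open>auto simp: free_space_carrier\<close>)
  show 2: "ext_lin V h (\<lambda>s. p s + q s) = ext_lin V h p \<oplus> ext_lin V h q"
    if "p \<in> carrier (free_space S)" "q \<in> carrier (free_space S)" for p q
  proof -
    let ?A = "{s. p s \<noteq> 0} \<union> {s. q s \<noteq> 0}"
    have A: "finite ?A" "\<And>s. s \<in> ?A \<Longrightarrow> h s \<in> carrier V" using that h by (auto simp: free_space_carrier)
    have sub: "{s. p s + q s \<noteq> 0} \<subseteq> ?A" by auto
    have "ext_lin V h (\<lambda>s. p s + q s) = (\<Oplus>s\<in>?A. p s \<odot> h s \<oplus> q s \<odot> h s)"
    proof -
      have "ext_lin V h (\<lambda>s. p s + q s) = (\<Oplus>s\<in>?A. (p s + q s) \<odot> h s)"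
        by (rule ext_lin_superset[OF A(1) sub A(2)])
      also have "\<dots> = (\<Oplus>s\<in>?A. p s \<odot> h s \<oplus> q s \<odot> h s)"
        by (rule M.finsum_cong'[OF refl]) (use A in \<open>auto simp: add_sc\<close>)
      finally show ?thesis .
    qed
    also have "\<dots> = ext_lin V h p \<oplus> ext_lin V h q"
    proof -
      have "ext_lin V h p = (\<Oplus>s\<in>?A. p s \<odot> h s)" "ext_lin V h q = (\<Oplus>s\<in>?A. q s \<odot> h s)"
        by (rule ext_lin_superset[OF A(1) _ A(2)], auto)+
      moreover have "(\<Oplus>s\<in>?A. p s \<odot> h s \<oplus> q s \<odot> h s) = (\<Oplus>s\<in>?A. p s \<odot> h s) \<oplus> (\<Oplus>s\<in>?A. q s \<odot> h s)"
        by (rule M.finsum_addf) (use A in auto)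
      ultimately show ?thesis by simp
    qed
    finally show ?thesis .
  qed
  have 5: "ext_lin V h (\<lambda>t. c * single s t) = c \<odot> h s" if s: "s \<in> S" for s c
  proof -
    have sub: "{t. c * single s t \<noteq> 0} \<subseteq> {s}" by (auto simp: Defs.single_def split: if_splits)
    have "ext_lin V h (\<lambda>t. c * single s t) = (\<Oplus>t\<in>{s}. (c * single s t) \<odot> h t)"
      by (rule ext_lin_superset[OF _ sub]) (use h s in auto)
    then show ?thesis using h[OF s] by (simp add: Defs.single_def)
  qed
  show 4: "ext_lin V h (single s) = h s" if "s \<in> S" for s
    using 5[OF that, of 1] h[OF that] by (simp add: sc_one)
  show "ext_lin V h (\<lambda>s. c * p s) = c \<odot> ext_lin V h p" if "p \<in> carrier (free_space S)"
    using that
  proof (induction rule: free_space_induct)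
    case zero then show ?case by (simp add: ext_lin_def sc_zero)
  next
    case (add p d s)
    interpret F: kspace "free_space S :: ('k, _) module" by (rule free_space_kspace)
    have cp: "(\<lambda>t. c * p t) \<in> carrier (free_space S)" using F.sc_closed[OF add(1), of c] by (simp add: free_space_simps)
    have s: "(\<lambda>t. a * single s t) \<in> carrier (free_space S)" for a :: 'k
      using F.sc_closed[OF single_free[OF add(2)], of a] by (simp add: free_space_simps)
    have "ext_lin V h (\<lambda>t. c * (p t + d * single s t)) = ext_lin V h (\<lambda>t. c * p t + (c * d) * single s t)"
      by (simp add: algebra_simps)
    also have "\<dots> = c \<odot> ext_lin V h p \<oplus> (c * d) \<odot> h s" using 2[OF cp s] add 5 by simp
    also have "\<dots> = c \<odot> ext_lin V h (\<lambda>t. p t + d * single s t)"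
      using 2[OF add(1) s] 5[OF add(2)] 1[OF add(1)] h[OF add(2)] by (simp add: sc_add sc_sc)
    finally show ?case .
  qed
qed

end

subsection \<open>The free algebra\<close>

lemma free_algebra_simps:
  "carrier (free_algebra S) = carrier (free_space (lists S))"
  "\<zero>\<^bsub>free_algebra S\<^esub> = (\<lambda>_. 0)" "p \<oplus>\<^bsub>free_algebra S\<^esub> q = (\<lambda>s. p s + q s)" "c \<odot>\<^bsub>free_algebra S\<^esub> p = (\<lambda>s. c * p s)"
  "\<one>\<^bsub>free_algebra S\<^esub> = single []"
  "p \<otimes>\<^bsub>free_algebra S\<^esub> q = (\<lambda>w. \<Sum>i\<le>length w. p (take i w) * q (drop i w))"
  by (simp_all add: free_algebra_def free_space_def)

lemma free_algebra_kspace: "kspace (free_algebra S :: ('k::field, 'g list \<Rightarrow> 'k) module)"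
proof -
  interpret F: kspace "free_space (lists S) :: ('k, 'g list \<Rightarrow> 'k) module" by (rule free_space_kspace)
  show ?thesis unfolding kspace_def
  proof (rule vectorspaceI, goal_cases)
    case (1 x y) then show ?case using F.M.a_closed[of x y] by (simp add: free_algebra_simps free_space_simps)
  next
    case 2 then show ?case using F.M.zero_closed by (simp add: free_algebra_simps free_space_simps)
  next
    case (3 c x) then show ?case using F.sc_closed[of x c] by (simp add: free_algebra_simps free_space_simps)
  qed (auto simp: free_algebra_simps algebra_simps)
qed

lemma conv_closed:
  fixes p q :: "'g list \<Rightarrow> 'k::field"
  assumes "p \<in> carrier (free_algebra S)" "q \<in> carrier (free_algebra S)"
  shows "p \<otimes>\<^bsub>free_algebra S\<^esub> q \<in> carrier (free_algebra S)"
proof -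
  let ?A = "(\<lambda>(u, v). u @ v) ` ({u. p u \<noteq> 0} \<times> {v. q v \<noteq> 0})"
  have fin: "finite ?A" using assms by (auto simp: free_algebra_simps free_space_carrier)
  have "{w. (\<Sum>i\<le>length w. p (take i w) * q (drop i w)) \<noteq> 0} \<subseteq> ?A"
  proof
    fix w assume "w \<in> {w. (\<Sum>i\<le>length w. p (take i w) * q (drop i w)) \<noteq> 0}"
    then obtain i where "p (take i w) * q (drop i w) \<noteq> 0" by (auto elim: sum.not_neutral_contains_not_neutral)
    then have "(take i w, drop i w) \<in> {u. p u \<noteq> 0} \<times> {v. q v \<noteq> 0}" by auto
    then show "w \<in> ?A" by (force intro: rev_image_eqI)
  qed
  moreover have "?A \<subseteq> lists S"
  proof
    fix w assume "w \<in> ?A"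
    then obtain u v where "w = u @ v" "p u \<noteq> 0" "q v \<noteq> 0" by auto
    moreover from this have "u \<in> lists S" "v \<in> lists S"
      using assms unfolding free_algebra_simps free_space_carrier by blast+
    ultimately show "w \<in> lists S" by (simp only: append_in_lists_conv)
  qed
  ultimately show ?thesis using fin finite_subset
    by (simp add: free_algebra_simps free_space_carrier) blast
qed

text \<open>Both sides sum over the ways to cut \<open>w\<close> into three pieces; \<open>j\<close>
  and \<open>i\<close> in the term \<open>?t\<close> are the lengths of the first two.\<close>

lemma conv_assoc:
  fixes p q r :: "'g list \<Rightarrow> 'k::field"
  shows "(\<Sum>i\<le>length w. (\<Sum>j\<le>length (take i w). p (take j (take i w)) * q (drop j (take i w))) * r (drop i w)) =
    (\<Sum>j\<le>length w. p (take j w) * (\<Sum>i\<le>length (drop j w). q (take i (drop j w)) * r (drop i (drop j w))))"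
proof -
  let ?n = "length w"
  let ?t = "\<lambda>j i. p (take j w) * q (take i (drop j w)) * r (drop (j + i) w)"
  have "(\<Sum>i\<le>?n. (\<Sum>j\<le>length (take i w). p (take j (take i w)) * q (drop j (take i w))) * r (drop i w)) =
      (\<Sum>i\<le>?n. \<Sum>j\<le>i. ?t j (i - j))"
    by (rule sum.cong[OF refl]) (auto simp: sum_distrib_right min_def drop_take intro!: sum.cong)
  also have "\<dots> = (\<Sum>(i, j) | i + j \<le> ?n. ?t i j)"
    using sum.triangle_reindex_eq[of ?t ?n] by simp
  also have "\<dots> = (\<Sum>j\<le>?n. \<Sum>i\<le>?n - j. ?t j i)"
  proof -
    have "{(i, j). i + j \<le> ?n} = Sigma {..?n} (\<lambda>j. {..?n - j})" by auto
    then show ?thesis by (simp add: sum.Sigma)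
  qed
  also have "\<dots> = (\<Sum>j\<le>?n. p (take j w) * (\<Sum>i\<le>length (drop j w). q (take i (drop j w)) * r (drop i (drop j w))))"
    by (simp add: sum_distrib_left mult.assoc add.commute)
  finally show ?thesis .
qed

lemma conv_single_left: "(\<lambda>w. \<Sum>i\<le>length w. single u (take i w) * (q (drop i w) :: 'k::field)) = (\<lambda>w. if take (length u) w = u then q (drop (length u) w) else 0)"
proof
  fix w
  have "(\<Sum>i\<le>length w. single u (take i w) * q (drop i w)) = (\<Sum>i\<le>length w. if i = length u then (if take (length u) w = u then q (drop (length u) w) else 0) else 0)"
    by (rule sum.cong) (auto simp: Defs.single_def)
  also have "\<dots> = (if take (length u) w = u then q (drop (length u) w) else 0)"
    by (auto simp: min_def dest!: arg_cong[of _ _ length])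
  finally show "(\<Sum>i\<le>length w. single u (take i w) * q (drop i w)) = (if take (length u) w = u then q (drop (length u) w) else 0)" .
qed

lemma conv_single_single: "single u \<otimes>\<^bsub>free_algebra S\<^esub> single v = (single (u @ v) :: _ \<Rightarrow> 'k::field)"
  by (simp only: free_algebra_simps conv_single_left)
    (auto simp: fun_eq_iff Defs.single_def, metis append_take_drop_id)

lemma conv_single_nil_right: "(\<lambda>w. \<Sum>i\<le>length w. q (take i w) * single [] (drop i w)) = (q :: _ \<Rightarrow> 'k::field)"
proof
  fix w
  have "(\<Sum>i\<le>length w. q (take i w) * single [] (drop i w)) = (\<Sum>i\<le>length w. if i = length w then q w else 0)"
    by (rule sum.cong) (auto simp: Defs.single_def)
  then show "(\<Sum>i\<le>length w. q (take i w) * single [] (drop i w)) = q w" by simp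
qed

lemma free_algebra_ring: "ring (free_algebra S :: ('k::field, 'g list \<Rightarrow> 'k) module)"
proof -
  interpret F: kspace "free_algebra S :: ('k, 'g list \<Rightarrow> 'k) module" by (rule free_algebra_kspace)
  show ?thesis
  proof (rule ringI)
    show "abelian_group (free_algebra S :: ('k, 'g list \<Rightarrow> 'k) module)" by (rule F.M.abelian_group_axioms)
    show "Group.monoid (free_algebra S :: ('k, 'g list \<Rightarrow> 'k) module)"
    proof
      show "x \<otimes>\<^bsub>free_algebra S\<^esub> y \<in> carrier (free_algebra S)"
        if "x \<in> carrier (free_algebra S)" "y \<in> carrier (free_algebra S)" for x y :: "'g list \<Rightarrow> 'k"
        using conv_closed that .
      show "\<one>\<^bsub>free_algebra S\<^esub> \<in> carrier (free_algebra S :: ('k, 'g list \<Rightarrow> 'k) module)"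
        by (simp add: free_algebra_simps single_free)
      show "x \<otimes>\<^bsub>free_algebra S\<^esub> y \<otimes>\<^bsub>free_algebra S\<^esub> z = x \<otimes>\<^bsub>free_algebra S\<^esub> (y \<otimes>\<^bsub>free_algebra S\<^esub> z)" for x y z :: "'g list \<Rightarrow> 'k"
        by (simp only: free_algebra_simps conv_assoc)
    qed (simp_all add: free_algebra_simps conv_single_left conv_single_nil_right)
  qed (simp_all add: free_algebra_simps sum.distrib distrib_left distrib_right)
qed

subsection \<open>The universal enveloping algebra\<close>

locale lie_closed =
  fixes L :: "('k::field, 'g, 'm) lie_alg_scheme" (structure)
  assumes L_add: "x \<in> carrier L \<Longrightarrow> y \<in> carrier L \<Longrightarrow> x \<oplus> y \<in> carrier L"
    and L_smult: "x \<in> carrier L \<Longrightarrow> c \<odot> x \<in> carrier L"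
    and L_bracket: "x \<in> carrier L \<Longrightarrow> y \<in> carrier L \<Longrightarrow> lie_bracket L x y \<in> carrier L"
begin

abbreviation F :: "('k, 'g list \<Rightarrow> 'k) module" where "F \<equiv> free_algebra (carrier L)"

abbreviation U :: "('k, ('g list \<Rightarrow> 'k) set) module" where "U \<equiv> uea L"

definition I :: "('g list \<Rightarrow> 'k) set" where "I = uea_ideal L"

definition cls :: "('g list \<Rightarrow> 'k) \<Rightarrow> ('g list \<Rightarrow> 'k) set" where "cls p = I +>\<^bsub>F\<^esub> p"

sublocale F: kspace F by (rule free_algebra_kspace)
sublocale FR: ring F by (rule free_algebra_ring)

definition rels :: "('g list \<Rightarrow> 'k) set" where
  "rels = {\<lambda>w. single [x \<oplus> y] w - single [x] w - single [y] w | x y. x \<in> carrier L \<and> y \<in> carrier L} \<union>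
     {\<lambda>w. single [c \<odot> x] w - c * single [x] w | c x. x \<in> carrier L} \<union>
     {\<lambda>w. single [x, y] w - single [y, x] w - single [lie_bracket L x y] w | x y.
        x \<in> carrier L \<and> y \<in> carrier L}"

lemma single_F: "w \<in> lists (carrier L) \<Longrightarrow> single w \<in> carrier F"
  by (simp add: free_algebra_simps single_free)

lemma F_minus: "p \<in> carrier F \<Longrightarrow> q \<in> carrier F \<Longrightarrow> p \<ominus>\<^bsub>F\<^esub> q = (\<lambda>w. p w - q w)"
  by (simp add: F.M.minus_eq F.neg_sc) (simp add: free_algebra_simps)

lemma F_diff: "p \<in> carrier F \<Longrightarrow> q \<in> carrier F \<Longrightarrow> (\<lambda>w. p w - q w) \<in> carrier F"
  using F.M.minus_closed[of p q] by (simp add: F_minus)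

lemma F_smult: "p \<in> carrier F \<Longrightarrow> (\<lambda>w. c * p w) \<in> carrier F"
  using F.sc_closed[of p c] by (simp add: free_algebra_simps)

lemma rels_F: "rels \<subseteq> carrier F"
  unfolding rels_def using L_add L_smult L_bracket
  by (auto intro!: F_diff F_smult single_F)

interpretation I: ideal I F
  unfolding I_def uea_ideal_def rels_def[symmetric] by (rule FR.genideal_ideal[OF rels_F])

lemma rels_I: "rels \<subseteq> I"
  unfolding I_def uea_ideal_def rels_def[symmetric] by (rule FR.genideal_self[OF rels_F])

lemma F_smult_mult: "p \<in> carrier F \<Longrightarrow> (c \<odot>\<^bsub>F\<^esub> \<one>\<^bsub>F\<^esub>) \<otimes>\<^bsub>F\<^esub> p = c \<odot>\<^bsub>F\<^esub> p"
  using fun_cong[OF conv_single_left[of "[]" p]]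
  by (simp add: free_algebra_simps mult.assoc flip: sum_distrib_left)

lemma I_subsp: "F.subsp I"
proof -
  have "c \<odot>\<^bsub>F\<^esub> x \<in> I" if "x \<in> I" for c x
  proof -
    have "(c \<odot>\<^bsub>F\<^esub> \<one>\<^bsub>F\<^esub>) \<otimes>\<^bsub>F\<^esub> x \<in> I" using that by (intro I.I_l_closed) auto
    then show ?thesis using F_smult_mult I.Icarr that by simp
  qed
  then show ?thesis unfolding F.subsp_def using I.Icarr I.zero_closed I.a_closed by auto
qed

lemma U_carrier: "carrier U = cls ` carrier F"
  by (auto simp: uea_def Let_def FactRing_def A_RCOSETS_def' cls_def I_def)

lemma U_zero: "\<zero>\<^bsub>U\<^esub> = cls \<zero>\<^bsub>F\<^esub>"
  using F.coset_zero[OF I_subsp] by (simp add: uea_def Let_def FactRing_def cls_def I_def)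

lemma U_one: "\<one>\<^bsub>U\<^esub> = cls \<one>\<^bsub>F\<^esub>"
  by (simp add: uea_def Let_def FactRing_def cls_def I_def)

lemma U_add: "p \<in> carrier F \<Longrightarrow> q \<in> carrier F \<Longrightarrow> cls p \<oplus>\<^bsub>U\<^esub> cls q = cls (p \<oplus>\<^bsub>F\<^esub> q)"
  using F.coset_add[OF I_subsp] by (simp add: uea_def Let_def FactRing_def cls_def I_def)

lemma U_mult: "p \<in> carrier F \<Longrightarrow> q \<in> carrier F \<Longrightarrow> cls p \<otimes>\<^bsub>U\<^esub> cls q = cls (p \<otimes>\<^bsub>F\<^esub> q)"
  using I.rcoset_mult_add by (simp add: uea_def Let_def FactRing_def cls_def I_def)

lemma U_smult: "p \<in> carrier F \<Longrightarrow> c \<odot>\<^bsub>U\<^esub> cls p = cls (c \<odot>\<^bsub>F\<^esub> p)"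
proof -
  assume p: "p \<in> carrier F"
  have "c \<odot>\<^bsub>U\<^esub> cls p = cls (c \<odot>\<^bsub>F\<^esub> \<one>\<^bsub>F\<^esub>) \<otimes>\<^bsub>U\<^esub> cls p"
    by (simp add: uea_def Let_def FactRing_def cls_def I_def)
  then show ?thesis using p F_smult_mult by (simp add: U_mult)
qed

lemma cls_eq: "p \<in> carrier F \<Longrightarrow> q \<in> carrier F \<Longrightarrow> cls p = cls q \<longleftrightarrow> p \<ominus>\<^bsub>F\<^esub> q \<in> I"
  using F.coset_eq[OF I_subsp] by (simp add: cls_def)

lemma U_kspace: "kspace U"
  unfolding kspace_def
proof (rule vectorspaceI, goal_cases)
  case (5 x y)
  then obtain p q where "p \<in> carrier F" "q \<in> carrier F" "x = cls p" "y = cls q" by (auto simp: U_carrier)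
  then show ?case by (simp add: U_add F.M.a_comm)
qed (auto simp: U_carrier U_zero U_add U_smult F.M.a_assoc F.sc_add F.add_sc F.sc_sc F.sc_one F.zero_sc)

sublocale U: kspace U by (rule U_kspace)

lemma U_mult_closed: "y \<in> carrier U \<Longrightarrow> z \<in> carrier U \<Longrightarrow> y \<otimes>\<^bsub>U\<^esub> z \<in> carrier U"
  by (auto simp: U_carrier U_mult)

lemma U_one_closed: "\<one>\<^bsub>U\<^esub> \<in> carrier U"
  by (auto simp: U_carrier U_one)

lemma U_assoc: "x \<in> carrier U \<Longrightarrow> y \<in> carrier U \<Longrightarrow> z \<in> carrier U \<Longrightarrow> (x \<otimes>\<^bsub>U\<^esub> y) \<otimes>\<^bsub>U\<^esub> z = x \<otimes>\<^bsub>U\<^esub> (y \<otimes>\<^bsub>U\<^esub> z)"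
  by (auto simp: U_carrier U_mult FR.m_assoc)

lemma U_one_left: "x \<in> carrier U \<Longrightarrow> \<one>\<^bsub>U\<^esub> \<otimes>\<^bsub>U\<^esub> x = x"
  and U_one_right: "x \<in> carrier U \<Longrightarrow> x \<otimes>\<^bsub>U\<^esub> \<one>\<^bsub>U\<^esub> = x"
  by (auto simp: U_carrier U_mult U_one)

lemma U_distl: "x \<in> carrier U \<Longrightarrow> y \<in> carrier U \<Longrightarrow> z \<in> carrier U \<Longrightarrow> (x \<oplus>\<^bsub>U\<^esub> y) \<otimes>\<^bsub>U\<^esub> z = x \<otimes>\<^bsub>U\<^esub> z \<oplus>\<^bsub>U\<^esub> y \<otimes>\<^bsub>U\<^esub> z"
  and U_distr: "x \<in> carrier U \<Longrightarrow> y \<in> carrier U \<Longrightarrow> z \<in> carrier U \<Longrightarrow> z \<otimes>\<^bsub>U\<^esub> (x \<oplus>\<^bsub>U\<^esub> y) = z \<otimes>\<^bsub>U\<^esub> x \<oplus>\<^bsub>U\<^esub> z \<otimes>\<^bsub>U\<^esub> y"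
  by (auto simp: U_carrier U_mult U_add FR.l_distr FR.r_distr)

lemma F_smult_comm:
  "(c \<odot>\<^bsub>F\<^esub> p) \<otimes>\<^bsub>F\<^esub> q = c \<odot>\<^bsub>F\<^esub> (p \<otimes>\<^bsub>F\<^esub> q)" "p \<otimes>\<^bsub>F\<^esub> (c \<odot>\<^bsub>F\<^esub> q) = c \<odot>\<^bsub>F\<^esub> (p \<otimes>\<^bsub>F\<^esub> q)"
  by (auto simp: free_algebra_simps sum_distrib_left algebra_simps)

lemma U_smultl: "x \<in> carrier U \<Longrightarrow> z \<in> carrier U \<Longrightarrow> (c \<odot>\<^bsub>U\<^esub> x) \<otimes>\<^bsub>U\<^esub> z = c \<odot>\<^bsub>U\<^esub> (x \<otimes>\<^bsub>U\<^esub> z)"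
  and U_smultr: "x \<in> carrier U \<Longrightarrow> z \<in> carrier U \<Longrightarrow> z \<otimes>\<^bsub>U\<^esub> (c \<odot>\<^bsub>U\<^esub> x) = c \<odot>\<^bsub>U\<^esub> (z \<otimes>\<^bsub>U\<^esub> x)"
  by (auto simp: U_carrier U_mult U_smult F_smult_comm)

abbreviation inc :: "'g \<Rightarrow> ('g list \<Rightarrow> 'k) set" where "inc x \<equiv> uea_incl L x"

lemma inc_cls: "inc x = cls (single [x])"
  by (simp add: uea_incl_def cls_def I_def)

lemma inc_closed: "x \<in> carrier L \<Longrightarrow> inc x \<in> carrier U"
  by (auto simp: inc_cls U_carrier intro!: single_F)

lemma inc_add: assumes "x \<in> carrier L" "y \<in> carrier L" shows "inc (x \<oplus> y) = inc x \<oplus>\<^bsub>U\<^esub> inc y"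
proof -
  have c: "single [x] \<in> carrier F" "single [y] \<in> carrier F" "single [x \<oplus> y] \<in> carrier F"
    using assms L_add by (auto intro: single_F)
  have "(\<lambda>w. single [x \<oplus> y] w - single [x] w - single [y] w) \<in> rels"
    unfolding rels_def using assms by blast
  then have "(\<lambda>w. single [x \<oplus> y] w - single [x] w - single [y] w) \<in> I" using rels_I by blast
  then show ?thesis using c
    by (simp add: inc_cls U_add cls_eq F_minus) (simp add: free_algebra_simps diff_diff_eq)
qed

lemma inc_smult: assumes "x \<in> carrier L" shows "inc (c \<odot> x) = c \<odot>\<^bsub>U\<^esub> inc x"
proof -
  have c: "single [x] \<in> carrier F" "single [c \<odot> x] \<in> carrier F"
    using assms L_smult by (auto intro: single_F)
  have "(\<lambda>w. single [c \<odot> x] w - c * single [x] w) \<in> rels"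
    unfolding rels_def using assms by blast
  then have "(\<lambda>w. single [c \<odot> x] w - c * single [x] w) \<in> I" using rels_I by blast
  then show ?thesis using c
    by (simp add: inc_cls U_smult cls_eq F_minus) (simp add: free_algebra_simps)
qed

lemma inc_bracket: assumes "x \<in> carrier L" "y \<in> carrier L"
  shows "inc x \<otimes>\<^bsub>U\<^esub> inc y = inc y \<otimes>\<^bsub>U\<^esub> inc x \<oplus>\<^bsub>U\<^esub> inc (lie_bracket L x y)"
proof -
  have c: "single [x] \<in> carrier F" "single [y] \<in> carrier F" "single [lie_bracket L x y] \<in> carrier F"
    "single [x, y] \<in> carrier F" "single [y, x] \<in> carrier F"
    using assms L_bracket by (auto intro: single_F)
  have "(\<lambda>w. single [x, y] w - single [y, x] w - single [lie_bracket L x y] w) \<in> rels"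
    unfolding rels_def using assms by blast
  then have "(\<lambda>w. single [x, y] w - single [y, x] w - single [lie_bracket L x y] w) \<in> I" using rels_I by blast
  then show ?thesis using c
    by (simp add: inc_cls U_add U_mult cls_eq F_minus conv_single_single) (simp add: free_algebra_simps diff_diff_eq)
qed

text \<open>Words grow by generators on the right, which suits right modules: the step is one more
  application of a Lie algebra element.\<close>

lemma U_induct [consumes 1, case_names one add smult mult]:
  assumes "u \<in> carrier U" and one: "P \<one>\<^bsub>U\<^esub>"
    and add: "\<And>y z. y \<in> carrier U \<Longrightarrow> z \<in> carrier U \<Longrightarrow> P y \<Longrightarrow> P z \<Longrightarrow> P (y \<oplus>\<^bsub>U\<^esub> z)"
    and smult: "\<And>c y. y \<in> carrier U \<Longrightarrow> P y \<Longrightarrow> P (c \<odot>\<^bsub>U\<^esub> y)"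
    and mult: "\<And>y x. y \<in> carrier U \<Longrightarrow> x \<in> carrier L \<Longrightarrow> P y \<Longrightarrow> P (y \<otimes>\<^bsub>U\<^esub> inc x)"
  shows "P u"
proof -
  have word: "P (cls (single w))" if "w \<in> lists (carrier L)" for w
    using that
  proof (induction w rule: rev_induct)
    case Nil then show ?case using one by (simp add: U_one free_algebra_simps)
  next
    case (snoc x w)
    then have w: "w \<in> lists (carrier L)" "x \<in> carrier L" by auto
    have "cls (single (w @ [x])) = cls (single w) \<otimes>\<^bsub>U\<^esub> inc x"
      using w by (simp add: inc_cls U_mult single_F conv_single_single)
    then show ?case using mult[of "cls (single w)" x] w snoc.IH by (auto simp: U_carrier single_F)
  qed
  have zero: "P \<zero>\<^bsub>U\<^esub>" using smult[OF U_one_closed one, of 0] by (simp add: U.zero_sc U_one_closed)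
  obtain p where p: "p \<in> carrier F" "u = cls p" using assms(1) by (auto simp: U_carrier)
  have "p \<in> carrier (free_space (lists (carrier L)))" using p by (simp add: free_algebra_simps)
  then have "P (cls p)"
  proof (induction rule: free_space_induct)
    case zero then show ?case using \<open>P \<zero>\<^bsub>U\<^esub>\<close> by (simp add: U_zero free_algebra_simps)
  next
    case (add p c s)
    have pF: "p \<in> carrier F" using add by (simp add: free_algebra_simps)
    have s: "single s \<in> carrier F" using add by (intro single_F)
    have "cls (\<lambda>t. p t + c * single s t) = cls p \<oplus>\<^bsub>U\<^esub> c \<odot>\<^bsub>U\<^esub> cls (single s)"
      using pF s by (simp add: U_add U_smult) (simp add: free_algebra_simps)
    moreover have "cls p \<in> carrier U" "cls (single s) \<in> carrier U" using pF s by (auto simp: U_carrier)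
    ultimately show ?case using assms(3)[of "cls p" "c \<odot>\<^bsub>U\<^esub> cls (single s)"] smult word[OF add(2)] add.IH by simp
  qed
  then show ?thesis using p by simp
qed

end

subsection \<open>Modules from Lie algebra actions\<close>

text \<open>The order in \<open>a_bracket\<close> is that of a right action: a product x y acts
  first by \<open>a x\<close> and then by \<open>a y\<close>.\<close>

locale lie_action = lie_closed L + vector_space sc
  for L :: "('k::field, 'g, 'm) lie_alg_scheme" (structure) and sc :: "'k \<Rightarrow> 'b::ab_group_add \<Rightarrow> 'b" +
  fixes a :: "'g \<Rightarrow> 'b \<Rightarrow> 'b"
  assumes a_lin: "x \<in> carrier L \<Longrightarrow> is_linear sc sc (a x)"
    and a_add: "x \<in> carrier L \<Longrightarrow> y \<in> carrier L \<Longrightarrow> a (x \<oplus> y) w = a x w + a y w"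
    and a_smult: "x \<in> carrier L \<Longrightarrow> a (c \<odot> x) w = sc c (a x w)"
    and a_bracket: "x \<in> carrier L \<Longrightarrow> y \<in> carrier L \<Longrightarrow> a (lie_bracket L x y) w = a y (a x w) - a x (a y w)"
begin

interpretation I: ideal I F
  unfolding I_def uea_ideal_def rels_def[symmetric] by (rule FR.genideal_ideal[OF rels_F])

definition pact :: "('g list \<Rightarrow> 'k) \<Rightarrow> 'b \<Rightarrow> 'b" where
  "pact p w = (\<Sum>u | p u \<noteq> 0. sc (p u) (fold a u w))"

lemma pact_superset: "finite A \<Longrightarrow> {u. p u \<noteq> 0} \<subseteq> A \<Longrightarrow> pact p w = (\<Sum>u\<in>A. sc (p u) (fold a u w))"
  unfolding pact_def by (rule sum.mono_neutral_left) auto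

lemma fold_a_lin: "u \<in> lists (carrier L) \<Longrightarrow> is_linear sc sc (fold a u)"
proof (induction u)
  case Nil then show ?case by (simp add: is_linear_def)
next
  case (Cons x u) then show ?case using is_linear_comp[OF a_lin[of x], of sc "fold a u"] by (simp add: comp_def)
qed

lemma pact_lin: "p \<in> carrier F \<Longrightarrow> is_linear sc sc (pact p)"
  unfolding is_linear_def pact_def
  by (auto simp: free_algebra_simps free_space_carrier subset_iff is_linear_add[OF fold_a_lin] is_linear_scale[OF fold_a_lin]
      scale_right_distrib scale_sum_right mult.commute in_lists_conv_set intro!: sum.cong simp flip: sum.distrib)

lemma pact_add: assumes "p \<in> carrier F" "q \<in> carrier F" shows "pact (\<lambda>u. p u + q u) w = pact p w + pact q w"
proof -
  let ?A = "{u. p u \<noteq> 0} \<union> {u. q u \<noteq> 0}"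
  have A: "finite ?A" using assms by (auto simp: free_algebra_simps free_space_carrier)
  have "{u. p u + q u \<noteq> 0} \<subseteq> ?A" by auto
  then show ?thesis
    using pact_superset[OF A, of p w] pact_superset[OF A, of q w] pact_superset[OF A, of "\<lambda>u. p u + q u" w]
    by (simp add: scale_left_distrib sum.distrib)
qed

lemma pact_scale: assumes "p \<in> carrier F" shows "pact (\<lambda>u. c * p u) w = sc c (pact p w)"
proof -
  have A: "finite {u. p u \<noteq> 0}" using assms by (auto simp: free_algebra_simps free_space_carrier)
  have "{u. c * p u \<noteq> 0} \<subseteq> {u. p u \<noteq> 0}" by auto
  then show ?thesis
    using pact_superset[OF A, of p w] pact_superset[OF A, of "\<lambda>u. c * p u" w] by (simp add: scale_sum_right)
qed

lemma pact_single: "pact (single u) w = fold a u w"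
  using pact_superset[of "{u}" "single u" w] by (auto simp: Defs.single_def)

lemma pact_zero: "pact (\<lambda>_. 0) w = 0"
  by (simp add: pact_def)

lemma pact_mult:
  assumes "p \<in> carrier F" "q \<in> carrier F" shows "pact (p \<otimes>\<^bsub>F\<^esub> q) w = pact q (pact p w)"
proof -
  have ps: "p \<in> carrier (free_space (lists (carrier L)))" and qs: "q \<in> carrier (free_space (lists (carrier L)))"
    using assms by (simp_all add: free_algebra_simps)
  have sF: "c \<odot>\<^bsub>F\<^esub> single u \<in> carrier F" if "u \<in> lists (carrier L)" for c u
    using single_F[OF that] by blast
  have expand: "(\<lambda>t. r t + c * single s t) = r \<oplus>\<^bsub>F\<^esub> c \<odot>\<^bsub>F\<^esub> single s" for r :: "'g list \<Rightarrow> 'k" and c s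
    by (simp add: free_algebra_simps)
  have padd: "pact (r \<oplus>\<^bsub>F\<^esub> r') w = pact r w + pact r' w" if "r \<in> carrier F" "r' \<in> carrier F" for r r' w
    using pact_add[OF that] by (simp add: free_algebra_simps)
  have psc: "pact (c \<odot>\<^bsub>F\<^esub> r) w = sc c (pact r w)" if "r \<in> carrier F" for r c w
    using pact_scale[OF that] by (simp add: free_algebra_simps)
  have one: "pact (single u \<otimes>\<^bsub>F\<^esub> q) w = pact q (fold a u w)" if u: "u \<in> lists (carrier L)" for u w
    using qs
  proof (induction rule: free_space_induct)
    case zero
    have "single u \<otimes>\<^bsub>F\<^esub> \<zero>\<^bsub>F\<^esub> = \<zero>\<^bsub>F\<^esub>" using single_F[OF u] by simp
    then show ?case by (simp add: free_algebra_simps pact_zero)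
  next
    case (add r c s)
    have r: "r \<in> carrier F" using add by (simp add: free_algebra_simps)
    note s = single_F[OF add(2)]
    have "single u \<otimes>\<^bsub>F\<^esub> (r \<oplus>\<^bsub>F\<^esub> c \<odot>\<^bsub>F\<^esub> single s) = single u \<otimes>\<^bsub>F\<^esub> r \<oplus>\<^bsub>F\<^esub> c \<odot>\<^bsub>F\<^esub> single (u @ s)"
      using single_F[OF u] r s by (simp add: FR.r_distr F_smult_comm conv_single_single)
    then show ?case unfolding expand
      using add single_F[OF u] r s u single_F[of "u @ s"] by (simp add: padd psc pact_single)
  qed
  show ?thesis using ps
  proof (induction rule: free_space_induct)
    case zero
    have "\<zero>\<^bsub>F\<^esub> \<otimes>\<^bsub>F\<^esub> q = \<zero>\<^bsub>F\<^esub>" using assms by simp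
    then show ?case using is_linear_zero[OF pact_lin[OF assms(2)]] by (simp add: free_algebra_simps pact_zero)
  next
    case (add r c s)
    have r: "r \<in> carrier F" using add by (simp add: free_algebra_simps)
    note s = single_F[OF add(2)]
    have "(r \<oplus>\<^bsub>F\<^esub> c \<odot>\<^bsub>F\<^esub> single s) \<otimes>\<^bsub>F\<^esub> q = r \<otimes>\<^bsub>F\<^esub> q \<oplus>\<^bsub>F\<^esub> c \<odot>\<^bsub>F\<^esub> (single s \<otimes>\<^bsub>F\<^esub> q)"
      using assms r s by (simp add: FR.l_distr F_smult_comm)
    then show ?case unfolding expand
      using add assms r s one[OF add(2)]
      by (simp add: padd psc pact_single is_linear_add[OF pact_lin] is_linear_scale[OF pact_lin])
  qed
qed

text \<open>The noncommutative polynomials that act by 0 form a two-sided ideal, and it contains the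
  defining relations.\<close>

lemma pact_I: assumes "p \<in> I" shows "pact p w = 0"
proof -
  define K where "K = {p \<in> carrier F. \<forall>w. pact p w = 0}"
  have "ideal K F"
  proof (rule idealI)
    show "ring F" by (rule FR.ring_axioms)
    have inv: "\<ominus>\<^bsub>F\<^esub> p \<in> K" if "p \<in> K" for p
      using that pact_scale[of p "- 1"] by (auto simp: K_def F.neg_sc) (simp add: free_algebra_simps)
    show "subgroup K (add_monoid F)"
    proof (rule group.subgroupI[OF F.M.a_group], goal_cases)
      case 1 show ?case by (auto simp: K_def)
    next
      case 2 show ?case using pact_zero F.M.zero_closed by (auto simp: K_def free_algebra_simps)
    next
      case (3 p) then show ?case using inv by (simp add: a_inv_def)
    next
      case (4 p q)
      then show ?case using pact_add[of p q] by (auto simp: K_def) (simp add: free_algebra_simps)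
    qed
    show "x \<otimes>\<^bsub>F\<^esub> p \<in> K" "p \<otimes>\<^bsub>F\<^esub> x \<in> K" if "p \<in> K" "x \<in> carrier F" for p x
      using that by (auto simp: K_def pact_mult is_linear_zero[OF pact_lin])
  qed
  moreover have "rels \<subseteq> K"
  proof -
    have d: "pact (\<lambda>w. r w - s w) v = pact r v - pact s v" if "r \<in> carrier F" "s \<in> carrier F" for r s v
      using pact_add[OF that(1) F_smult[OF that(2), of "- 1"]] pact_scale[OF that(2), of "- 1"] by simp
    show ?thesis
      using rels_F unfolding rels_def K_def
      by (auto simp: d pact_scale pact_single single_F F_diff F_smult L_add L_smult L_bracket a_add a_smult a_bracket)
  qed
  ultimately have "I \<subseteq> K" unfolding I_def uea_ideal_def rels_def[symmetric] by (rule FR.genideal_minimal)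
  then show ?thesis using assms by (auto simp: K_def)
qed

definition uact :: "('g list \<Rightarrow> 'k) set \<Rightarrow> 'b \<Rightarrow> 'b" where
  "uact u w = pact (SOME p. p \<in> carrier F \<and> cls p = u) w"

lemma uact_cls: assumes "p \<in> carrier F" shows "uact (cls p) w = pact p w"
proof -
  let ?q = "SOME q. q \<in> carrier F \<and> cls q = cls p"
  have q: "?q \<in> carrier F \<and> cls ?q = cls p" by (rule someI[of _ p]) (use assms in simp)
  then have "?q \<ominus>\<^bsub>F\<^esub> p \<in> I" using cls_eq assms by blast
  then have "pact (\<lambda>w. ?q w - p w) w = 0" using pact_I F_minus assms q by simp
  moreover have "pact (\<lambda>w. (?q w - p w) + p w) w = pact (\<lambda>w. ?q w - p w) w + pact p w"
    using q assms F_diff by (intro pact_add) auto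
  ultimately show ?thesis by (simp add: uact_def)
qed

lemma uact_lin: "u \<in> carrier U \<Longrightarrow> is_linear sc sc (uact u)"
proof -
  assume "u \<in> carrier U"
  then obtain p where "p \<in> carrier F" "u = cls p" by (auto simp: U_carrier)
  then have "uact u = pact p" using uact_cls by (auto simp: fun_eq_iff)
  then show ?thesis using pact_lin \<open>p \<in> carrier F\<close> by simp
qed

lemma uact_add: "u \<in> carrier U \<Longrightarrow> v \<in> carrier U \<Longrightarrow> uact (u \<oplus>\<^bsub>U\<^esub> v) w = uact u w + uact v w"
  using pact_add F.M.a_closed by (auto simp: U_carrier U_add uact_cls) (simp add: free_algebra_simps)

lemma uact_scale: "u \<in> carrier U \<Longrightarrow> uact (c \<odot>\<^bsub>U\<^esub> u) w = sc c (uact u w)"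
  using pact_scale by (auto simp: U_carrier U_smult uact_cls) (simp add: free_algebra_simps)

lemma uact_one: "uact \<one>\<^bsub>U\<^esub> w = w"
  by (simp add: U_one uact_cls) (simp add: free_algebra_simps pact_single)

lemma uact_mult: "u \<in> carrier U \<Longrightarrow> v \<in> carrier U \<Longrightarrow> uact (u \<otimes>\<^bsub>U\<^esub> v) w = uact v (uact u w)"
  by (auto simp: U_carrier U_mult uact_cls pact_mult)

lemma uact_inc: "x \<in> carrier L \<Longrightarrow> uact (inc x) w = a x w"
  by (simp add: inc_cls uact_cls single_F pact_single)

end

subsection \<open>Matrix units\<close>

definition E :: "nat \<Rightarrow> nat \<Rightarrow> nat \<Rightarrow> 'k::field mat" where
  "E N i j = mat N N (\<lambda>(r, c). if r = i \<and> c = j then 1 else 0)"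

lemma E_carrier [simp]: "E N i j \<in> carrier_mat N N" by (simp add: E_def)

lemma E_index [simp]: "r < N \<Longrightarrow> c < N \<Longrightarrow> E N i j $$ (r, c) = (if r = i \<and> c = j then 1 else 0)"
  by (simp add: E_def)

lemma E_dim [simp]: "dim_row (E N i j) = N" "dim_col (E N i j) = N" by (simp_all add: E_def)

lemma E_mult: assumes "i < N" "j < N" "k < N" "l < N"
  shows "E N i j * E N k l = (if j = k then E N i l else 0\<^sub>m N N :: 'k::field mat)"
proof (rule eq_matI)
  fix r c assume "r < dim_row (if j = k then E N i l else 0\<^sub>m N N :: 'k mat)" "c < dim_col (if j = k then E N i l else 0\<^sub>m N N :: 'k mat)"
  then have rc: "r < N" "c < N" by (auto split: if_splits)
  have "(E N i j * E N k l :: 'k mat) $$ (r, c) = (\<Sum>x<N. E N i j $$ (r, x) * E N k l $$ (x, c))"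
    using rc by (simp add: scalar_prod_def atLeast0LessThan)
  also have "\<dots> = (\<Sum>x<N. if x = j then (if r = i \<and> j = k \<and> c = l then 1 else 0) else 0)"
    by (rule sum.cong) (use rc in auto)
  also have "\<dots> = (if j = k then E N i l else 0\<^sub>m N N) $$ (r, c)" using rc assms by auto
  finally show "(E N i j * E N k l :: 'k mat) $$ (r, c) = (if j = k then E N i l else 0\<^sub>m N N) $$ (r, c)" .
qed (auto split: if_splits)

text \<open>Removes one nonzero entry at a time. The set \<open>D\<close> of admissible positions
  lets the same induction serve m_N and n_-.\<close>

lemma mat_induct:
  fixes A :: "'k::field mat"
  assumes "A \<in> carrier_mat N N" and supp: "\<And>i j. i < N \<Longrightarrow> j < N \<Longrightarrow> (i, j) \<notin> D \<Longrightarrow> A $$ (i, j) = 0"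
    and zero: "P (0\<^sub>m N N)"
    and add: "\<And>B c i j. B \<in> carrier_mat N N \<Longrightarrow> (\<And>r s. r < N \<Longrightarrow> s < N \<Longrightarrow> (r, s) \<notin> D \<Longrightarrow> B $$ (r, s) = 0) \<Longrightarrow>
      P B \<Longrightarrow> i < N \<Longrightarrow> j < N \<Longrightarrow> (i, j) \<in> D \<Longrightarrow> P (B + c \<cdot>\<^sub>m E N i j)"
  shows "P A"
  using assms(1,2)
proof (induction "card {(i, j). i < N \<and> j < N \<and> A $$ (i, j) \<noteq> 0}" arbitrary: A rule: less_induct)
  case less
  let ?X = "\<lambda>A :: 'k mat. {(i, j). i < N \<and> j < N \<and> A $$ (i, j) \<noteq> 0}"
  have fin: "finite (?X A)" for A by (rule finite_subset[of _ "{..<N} \<times> {..<N}"]) auto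
  show ?case
  proof (cases "?X A = {}")
    case True
    then have "A = 0\<^sub>m N N" using less.prems(1) by (intro eq_matI) auto
    then show ?thesis using zero by simp
  next
    case False
    then obtain i j where ij: "i < N" "j < N" "A $$ (i, j) \<noteq> 0" by auto
    define B where "B = A + (- (A $$ (i, j))) \<cdot>\<^sub>m E N i j"
    have B: "B \<in> carrier_mat N N" using less.prems by (simp add: B_def)
    have Bi: "B $$ (r, s) = (if r = i \<and> s = j then 0 else A $$ (r, s))" if "r < N" "s < N" for r s
      using that less.prems by (auto simp: B_def)
    have "(i, j) \<in> ?X A" "(i, j) \<notin> ?X B" "?X B \<subseteq> ?X A" using ij Bi by (auto split: if_splits)
    then have "?X B \<subset> ?X A" by blast
    then have "card (?X B) < card (?X A)" by (rule psubset_card_mono[OF fin])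
    moreover have BD: "B $$ (r, s) = 0" if "r < N" "s < N" "(r, s) \<notin> D" for r s
      using Bi that less.prems by simp
    ultimately have "P B" using less.hyps B by blast
    moreover have "(i, j) \<in> D" using ij less.prems by blast
    ultimately have "P (B + A $$ (i, j) \<cdot>\<^sub>m E N i j)" using add B BD ij by blast
    moreover have "B + A $$ (i, j) \<cdot>\<^sub>m E N i j = A" using less.prems by (intro eq_matI) (auto simp: B_def)
    ultimately show ?thesis by simp
  qed
qed

lemma mirabolic_carrier: "A \<in> carrier (mirabolic_lie N) \<longleftrightarrow> A \<in> carrier_mat N N \<and> (\<forall>i<N. A $$ (i, N - 1) = 0)"
  by (simp add: mirabolic_lie_def)

lemma mirabolic_simps:
  "A \<oplus>\<^bsub>mirabolic_lie N\<^esub> B = A + B" "c \<odot>\<^bsub>mirabolic_lie N\<^esub> A = c \<cdot>\<^sub>m A" "lie_bracket (mirabolic_lie N) A B = A * B - B * A"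
  by (simp_all add: mirabolic_lie_def)

interpretation ml: lie_closed "mirabolic_lie N :: ('k::field, 'k mat) lie_alg" for N
proof
  fix x y :: "'k mat" and c :: 'k
  assume x: "x \<in> carrier (mirabolic_lie N)"
  show "c \<odot>\<^bsub>mirabolic_lie N\<^esub> x \<in> carrier (mirabolic_lie N)"
    using x by (auto simp: mirabolic_carrier mirabolic_simps)
  assume y: "y \<in> carrier (mirabolic_lie N)"
  show "x \<oplus>\<^bsub>mirabolic_lie N\<^esub> y \<in> carrier (mirabolic_lie N)"
    using x y by (auto simp: mirabolic_carrier mirabolic_simps)
  have "(x * y) $$ (i, N - 1) = 0" if "i < N" "x \<in> carrier (mirabolic_lie N)" "y \<in> carrier (mirabolic_lie N)" for i and x y :: "'k mat"
    using that by (auto simp: mirabolic_carrier scalar_prod_def intro!: sum.neutral)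
  then show "lie_bracket (mirabolic_lie N) x y \<in> carrier (mirabolic_lie N)"
    using x y by (auto simp: mirabolic_carrier mirabolic_simps simp del: index_mult_mat(1))
qed

lemma E_mirabolic: "i < N \<Longrightarrow> Suc j < N \<Longrightarrow> E N i j \<in> carrier (mirabolic_lie N)"
  by (auto simp: mirabolic_carrier)

lemma n_minus_mirabolic: "x \<in> n_minus N \<Longrightarrow> x \<in> carrier (mirabolic_lie N)"
  by (auto simp: n_minus_def mirabolic_carrier)

lemma E_n_minus: "j < i \<Longrightarrow> i < N \<Longrightarrow> E N i j \<in> n_minus N"
  by (auto simp: n_minus_def)

lemma psi_E: "j < i \<Longrightarrow> i < N \<Longrightarrow> psi N (E N i j) = (if i = Suc j then 1 else 0)"
proof -
  assume ij: "j < i" "i < N"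
  have "psi N (E N i j) = (\<Sum>x<N - 1. if x = j then (if i = Suc j then 1 else 0 :: 'a) else 0)"
    unfolding psi_def by (rule sum.cong) (use ij in auto)
  also have "\<dots> = (if i = Suc j then 1 else 0)" using ij by auto
  finally show ?thesis .
qed

lemma psi_zero: "psi N (0\<^sub>m N N) = 0"
  by (simp add: psi_def)

lemma psi_add: "x \<in> carrier_mat N N \<Longrightarrow> y \<in> carrier_mat N N \<Longrightarrow> psi N (x + y) = psi N x + psi N y"
proof -
  assume *: "x \<in> carrier_mat N N" "y \<in> carrier_mat N N"
  have "psi N (x + y) = (\<Sum>i<N - 1. x $$ (Suc i, i) + y $$ (Suc i, i))"
    unfolding psi_def by (rule sum.cong) (use * in auto)
  then show ?thesis by (simp add: psi_def sum.distrib)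
qed

lemma psi_smult: "x \<in> carrier_mat N N \<Longrightarrow> psi N (c \<cdot>\<^sub>m x) = c * psi N x"
proof -
  assume *: "x \<in> carrier_mat N N"
  have "psi N (c \<cdot>\<^sub>m x) = (\<Sum>i<N - 1. c * x $$ (Suc i, i))"
    unfolding psi_def by (rule sum.cong) (use * in auto)
  then show ?thesis by (simp add: psi_def sum_distrib_left)
qed

lemma mirabolic_induct [consumes 1, case_names zero add]:
  assumes "x \<in> carrier (mirabolic_lie N)" "P (0\<^sub>m N N)"
    "\<And>B c i j. B \<in> carrier (mirabolic_lie N) \<Longrightarrow> P B \<Longrightarrow> i < N \<Longrightarrow> Suc j < N \<Longrightarrow> P (B + c \<cdot>\<^sub>m E N i j)"
  shows "P x"
proof (rule mat_induct[of x N "{(i, j). Suc j < N}"])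
  show "x \<in> carrier_mat N N" using assms(1) by (simp add: mirabolic_carrier)
  show "x $$ (i, j) = 0" if "i < N" "j < N" "(i, j) \<notin> {(i, j). Suc j < N}" for i j
  proof -
    have "j = N - 1" using that by auto
    then show ?thesis using that assms(1) by (simp add: mirabolic_carrier)
  qed
  show "P (B + c \<cdot>\<^sub>m E N i j)" if "B \<in> carrier_mat N N"
    "\<And>r s. r < N \<Longrightarrow> s < N \<Longrightarrow> (r, s) \<notin> {(i, j). Suc j < N} \<Longrightarrow> B $$ (r, s) = 0"
    "P B" "i < N" "j < N" "(i, j) \<in> {(i, j). Suc j < N}" for B c i j
    using that by (intro assms(3)) (auto simp: mirabolic_carrier)
qed (use assms in auto)

lemma n_minus_induct [consumes 1, case_names zero add]:
  assumes "x \<in> n_minus N" "P (0\<^sub>m N N)"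
    "\<And>B c i j. B \<in> n_minus N \<Longrightarrow> P B \<Longrightarrow> j < i \<Longrightarrow> i < N \<Longrightarrow> P (B + c \<cdot>\<^sub>m E N i j)"
  shows "P x"
proof (rule mat_induct[of x N "{(i, j). j < i}"])
  show "x \<in> carrier_mat N N" using assms(1) by (simp add: n_minus_def)
  show "x $$ (i, j) = 0" if "i < N" "j < N" "(i, j) \<notin> {(i, j). j < i}" for i j
    using that assms(1) by (auto simp: n_minus_def)
  show "P (B + c \<cdot>\<^sub>m E N i j)" if "B \<in> carrier_mat N N"
    "\<And>r s. r < N \<Longrightarrow> s < N \<Longrightarrow> (r, s) \<notin> {(i, j). j < i} \<Longrightarrow> B $$ (r, s) = 0"
    "P B" "i < N" "j < N" "(i, j) \<in> {(i, j). j < i}" for B c i j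
    using that by (intro assms(3)) (auto simp: n_minus_def)
qed (use assms in auto)

lemma whittaker_vectors_simps:
  "\<zero>\<^bsub>whittaker_vectors N W\<^esub> = \<zero>\<^bsub>W\<^esub>" "x \<oplus>\<^bsub>whittaker_vectors N W\<^esub> y = x \<oplus>\<^bsub>W\<^esub> y" "c \<odot>\<^bsub>whittaker_vectors N W\<^esub> x = c \<odot>\<^bsub>W\<^esub> x"
  by (simp_all add: whittaker_vectors_def)

subsection \<open>Right modules over the enveloping algebra in coordinates\<close>

lemma (in kspace) minus_sc: "v \<in> carrier V \<Longrightarrow> w \<in> carrier V \<Longrightarrow> v \<ominus> w = v \<oplus> (- 1) \<odot> w"
  by (simp add: M.minus_eq neg_sc)

lemma (in kspace) crd_diff: "v \<in> carrier V \<Longrightarrow> w \<in> carrier V \<Longrightarrow> crd (v \<ominus> w) = crd v - crd w"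
  by (simp add: minus_sc crd_add crd_scale)

locale umod =
  fixes N :: nat and W :: "('k::field_char_0, ('k mat list \<Rightarrow> 'k) set, 'w) rmod" (structure)
  assumes rm: "right_module (Um N) W"
begin

sublocale rm: right_module "Um N" W by (rule rm)
sublocale kspace W by (rule kspaceI) (rule rm.vectorspace)

definition act :: "'k mat \<Rightarrow> 'w \<Rightarrow> 'w" where "act x w = w \<triangleleft> uea_incl (mirabolic_lie N) x"

lemma act_closed: "x \<in> carrier (mirabolic_lie N) \<Longrightarrow> w \<in> carrier W \<Longrightarrow> act x w \<in> carrier W"
  unfolding act_def by (intro rm.ract_closed ml.inc_closed)

lemma act_add: "x \<in> carrier (mirabolic_lie N) \<Longrightarrow> w \<in> carrier W \<Longrightarrow> v \<in> carrier W \<Longrightarrow> act x (w \<oplus> v) = act x w \<oplus> act x v"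
  unfolding act_def by (intro rm.ract_add_left ml.inc_closed)

lemma act_scale: "x \<in> carrier (mirabolic_lie N) \<Longrightarrow> w \<in> carrier W \<Longrightarrow> act x (c \<odot> w) = c \<odot> act x w"
  unfolding act_def by (intro rm.ract_smult_left ml.inc_closed)

lemma act_mat_add: "x \<in> carrier (mirabolic_lie N) \<Longrightarrow> y \<in> carrier (mirabolic_lie N) \<Longrightarrow> w \<in> carrier W \<Longrightarrow>
    act (x + y) w = act x w \<oplus> act y w"
  using ml.inc_add[of x N y] by (simp add: act_def rm.ract_add_right ml.inc_closed mirabolic_simps)

lemma act_mat_scale: "x \<in> carrier (mirabolic_lie N) \<Longrightarrow> w \<in> carrier W \<Longrightarrow> act (c \<cdot>\<^sub>m x) w = c \<odot> act x w"
  using ml.inc_smult[of x N c] by (simp add: act_def rm.ract_smult_right ml.inc_closed mirabolic_simps)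

lemma zero_mirabolic: "0\<^sub>m N N \<in> carrier (mirabolic_lie N)"
  by (auto simp: mirabolic_carrier)

lemma act_zero: "w \<in> carrier W \<Longrightarrow> act (0\<^sub>m N N) w = \<zero>"
proof -
  assume w: "w \<in> carrier W"
  have "0 \<cdot>\<^sub>m 0\<^sub>m N N = (0\<^sub>m N N :: 'k mat)" by (rule eq_matI) auto
  then show ?thesis
    using act_mat_scale[OF zero_mirabolic w, of 0] zero_sc[OF act_closed[OF zero_mirabolic w]] by simp
qed

lemma act_bracket: "x \<in> carrier (mirabolic_lie N) \<Longrightarrow> y \<in> carrier (mirabolic_lie N) \<Longrightarrow> w \<in> carrier W \<Longrightarrow>
    act y (act x w) = act x (act y w) \<oplus> act (x * y - y * x) w"
  using ml.inc_bracket[of x N y] ml.L_bracket[of x N y]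
  by (simp add: act_def mirabolic_simps rm.ract_add_right ml.inc_closed ml.U_mult_closed flip: rm.ract_mult)

text \<open>The value 0 outside the range of indices makes \<open>e i j\<close> linear for all
  \<open>i\<close> and \<open>j\<close>, as \<open>mir_ops\<close> demands.\<close>

definition e :: "nat \<Rightarrow> nat \<Rightarrow> ('w \<Rightarrow>\<^sub>0 'k) \<Rightarrow> ('w \<Rightarrow>\<^sub>0 'k)" where "e i j = (if i < N \<and> Suc j < N then lift (act (E N i j)) else (\<lambda>_. 0))"

lemma e_crd: "i < N \<Longrightarrow> Suc j < N \<Longrightarrow> w \<in> carrier W \<Longrightarrow> e i j (crd w) = crd (act (E N i j) w)"
  by (simp add: e_def lift_crd)

lemma e_lc: "i < N \<Longrightarrow> Suc j < N \<Longrightarrow> e i j f = crd (act (E N i j) (lc (cutoff bas f)))"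
  by (simp add: e_def lift_def)

lemma act_E_bracket:
  assumes "i < N" "Suc j < N" "k < N" "Suc l < N" "w \<in> carrier W"
  shows "crd (act (E N k l) (act (E N i j) w)) = crd (act (E N i j) (act (E N k l) w)) +
    (if j = k then crd (act (E N i l) w) else 0) - (if l = i then crd (act (E N k j) w) else 0)"
proof -
  let ?X = "E N i j * E N k l - E N k l * E N i j :: 'k mat"
  have m: "E N i j \<in> carrier (mirabolic_lie N)" "E N k l \<in> carrier (mirabolic_lie N)"
    "E N i l \<in> carrier (mirabolic_lie N)" "E N k j \<in> carrier (mirabolic_lie N)"
    using assms by (auto intro: E_mirabolic)
  have z: "act (0\<^sub>m N N) w = \<zero>" using assms act_zero by simp
  have dif: "x - y = x + (- 1) \<cdot>\<^sub>m y" if "x \<in> carrier_mat N N" "y \<in> carrier_mat N N" for x y :: "'k mat"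
    using that by (intro eq_matI) auto
  have zm: "0\<^sub>m N N \<in> carrier (mirabolic_lie N)" by (auto simp: mirabolic_carrier)
  define P where "P = (if j = k then E N i l else 0\<^sub>m N N :: 'k mat)"
  define Q where "Q = (if l = i then E N k j else 0\<^sub>m N N :: 'k mat)"
  have PQ: "P \<in> carrier (mirabolic_lie N)" "Q \<in> carrier (mirabolic_lie N)" using m zm by (auto simp: P_def Q_def)
  then have PQc: "P \<in> carrier_mat N N" "Q \<in> carrier_mat N N" by (auto simp: mirabolic_carrier)
  have "?X = P - Q" using assms by (simp add: E_mult P_def Q_def)
  also have "\<dots> = P + (- 1) \<cdot>\<^sub>m Q" by (rule dif[OF PQc])
  finally have "act ?X w = act P w \<oplus> (- 1) \<odot> act Q w"
    using PQ assms(5) ml.L_smult[of Q N "- 1"] by (simp add: act_mat_add act_mat_scale mirabolic_simps)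
  then have "crd (act ?X w) = crd (act P w) - crd (act Q w)"
    using PQ assms(5) by (simp add: crd_add crd_scale act_closed)
  moreover have "crd (act P w) = (if j = k then crd (act (E N i l) w) else 0)" "crd (act Q w) = (if l = i then crd (act (E N k j) w) else 0)"
    using z by (auto simp: P_def Q_def crd_zero)
  moreover have "?X \<in> carrier (mirabolic_lie N)" using ml.L_bracket[OF m(1,2)] by (simp add: mirabolic_simps)
  then have "crd (act (E N k l) (act (E N i j) w)) = crd (act (E N i j) (act (E N k l) w)) + crd (act ?X w)"
    unfolding act_bracket[OF m(1,2) assms(5)] by (intro crd_add act_closed m assms(5))
  ultimately show ?thesis by simp
qed

sublocale mir_ops fsc N e
proof
  show "is_linear fsc fsc (e i j)" for i j
    unfolding e_def using E_mirabolic[of i N j]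
    by (auto intro!: lift_lin act_closed act_add act_scale fsc.is_linear_const_zero)
  show "e k l (e i j w) = e i j (e k l w) + (if j = k then e i l w else 0) - (if l = i then e k j w else 0)"
    if "i < N" "Suc j < N" "k < N" "Suc l < N" for i j k l w
  proof -
    let ?v = "lc (cutoff bas w)"
    have v: "?v \<in> carrier W" by (rule lc_SV[OF cutoff_SV])
    show ?thesis
      using act_E_bracket[OF that v] that v
      by (simp add: e_lc[of _ _ w] e_crd E_mirabolic act_closed)
  qed
qed

lemma stable_SV: "stable SV"
  unfolding stable_def using SV_sub SV_cases by (auto simp: e_crd act_closed E_mirabolic dest!: SV_cases)

lemma npsi_act:
  assumes "x \<in> n_minus N" "w \<in> carrier W"
  shows "w \<triangleleft> (uea_incl (mirabolic_lie N) x \<ominus>\<^bsub>Um N\<^esub> (psi N x \<odot>\<^bsub>Um N\<^esub> \<one>\<^bsub>Um N\<^esub>)) = act x w \<ominus> psi N x \<odot> w"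
proof -
  have i: "uea_incl (mirabolic_lie N) x \<in> carrier (Um N)" using assms by (intro ml.inc_closed n_minus_mirabolic)
  have o: "psi N x \<odot>\<^bsub>Um N\<^esub> \<one>\<^bsub>Um N\<^esub> \<in> carrier (Um N)" using ml.U_one_closed by blast
  have "w \<triangleleft> (uea_incl (mirabolic_lie N) x \<ominus>\<^bsub>Um N\<^esub> (psi N x \<odot>\<^bsub>Um N\<^esub> \<one>\<^bsub>Um N\<^esub>)) =
      act x w \<oplus> (- 1) \<odot> (psi N x \<odot> w)"
    using i o assms
    by (simp add: ml.U.M.minus_eq ml.U.neg_sc rm.ract_add_right rm.ract_smult_right rm.ract_one ml.U_one_closed act_def)
  then show ?thesis using assms act_closed[OF n_minus_mirabolic, of x w] by (simp add: minus_sc)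
qed

lemma p_crd: "a \<in> neg \<Longrightarrow> w \<in> carrier W \<Longrightarrow>
    p a (crd w) = crd (act (E N (fst a) (snd a)) w \<ominus> psi N (E N (fst a) (snd a) :: 'k mat) \<odot> w)"
  using act_closed[OF E_mirabolic, of "fst a" "snd a" w]
  by (auto simp: p_def neg_def e_crd psi_E crd_diff sc_one zero_sc crd_zero)

text \<open>The condition for all x in n_- reduces to matrix units, because the action and \<psi>
  are linear in x.\<close>

lemma whittaker_vectors_iff:
  "w \<in> carrier (whittaker_vectors N W) \<longleftrightarrow> w \<in> carrier W \<and> crd w \<in> invs SV"
proof
  assume w: "w \<in> carrier (whittaker_vectors N W)"
  then have wc: "w \<in> carrier W" by (simp add: whittaker_vectors_def)
  have "p a (crd w) = 0" if a: "a \<in> neg" for a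
  proof -
    have E: "E N (fst a) (snd a) \<in> n_minus N" using a by (auto simp: neg_def intro: E_n_minus)
    then have "w \<triangleleft> (uea_incl (mirabolic_lie N) (E N (fst a) (snd a)) \<ominus>\<^bsub>Um N\<^esub> (psi N (E N (fst a) (snd a) :: 'k mat) \<odot>\<^bsub>Um N\<^esub> \<one>\<^bsub>Um N\<^esub>)) = \<zero>"
      using w by (auto simp: whittaker_vectors_def n_minus_psi_def)
    then show ?thesis using p_crd[OF a wc] npsi_act[OF E wc] crd_zero by simp
  qed
  then show "w \<in> carrier W \<and> crd w \<in> invs SV" using wc by (simp add: invs_def)
next
  assume w: "w \<in> carrier W \<and> crd w \<in> invs SV"
  have "act x w \<ominus> psi N x \<odot> w = \<zero>" if "x \<in> n_minus N" for x
    using that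
  proof (induction rule: n_minus_induct)
    case zero
    show ?case using w by (simp add: act_zero psi_zero zero_sc)
  next
    case (add B c i j)
    have a: "(i, j) \<in> neg" using add by (simp add: neg_def)
    have E: "E N i j \<in> carrier (mirabolic_lie N)" using add by (intro E_mirabolic) auto
    have B: "B \<in> carrier (mirabolic_lie N)" "B \<in> carrier_mat N N" using add by (auto intro: n_minus_mirabolic simp: n_minus_def)
    have "crd (act (E N i j) w \<ominus> psi N (E N i j :: 'k mat) \<odot> w) = 0"
      using p_crd[OF a, of w] w a by (simp add: invs_def)
    then have "act (E N i j) w \<ominus> psi N (E N i j :: 'k mat) \<odot> w = \<zero>"
      using w act_closed[OF E] by (subst (asm) crd_eq_0) (auto simp: minus_sc)
    then have 1: "act (E N i j) w = psi N (E N i j :: 'k mat) \<odot> w" using w act_closed[OF E] by simp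
    have 2: "act B w = psi N B \<odot> w" using add.IH w act_closed[OF B(1)] by simp
    have "act (B + c \<cdot>\<^sub>m E N i j) w = act B w \<oplus> c \<odot> act (E N i j) w"
      using w B E ml.L_smult[OF E, of c] by (simp add: act_mat_add[OF B(1)] act_mat_scale[OF E] mirabolic_simps)
    also have "\<dots> = psi N (B + c \<cdot>\<^sub>m E N i j) \<odot> w" unfolding 1 2 using w B by (simp add: psi_add psi_smult add_sc sc_sc)
    finally show ?case using w by (simp add: M.r_neg M.minus_eq)
  qed
  then show "w \<in> carrier (whittaker_vectors N W)"
    using w npsi_act by (auto simp: whittaker_vectors_def n_minus_psi_def)
qed

lemma whittaker_vectors_kspace: "vectorspace class_ring (whittaker_vectors N W)"
proof -
  have sub: "is_subspace fsc (invs SV)" by (rule invs_sub[OF SV_sub])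
  have WW: "x \<in> carrier W" if "x \<in> carrier (whittaker_vectors N W)" for x using that by (simp add: whittaker_vectors_iff)
  show ?thesis
  proof (rule vectorspaceI, unfold whittaker_vectors_simps, goal_cases)
    case (1 x y) then show ?case using fsc.sub_add[OF sub] by (simp add: whittaker_vectors_iff crd_add)
  next
    case 2 then show ?case using fsc.sub_zero[OF sub] by (simp add: whittaker_vectors_iff crd_zero)
  next
    case (3 c x) then show ?case using fsc.sub_scale[OF sub] by (simp add: whittaker_vectors_iff crd_scale)
  next
    case (5 x y) then show ?case using WW M.a_comm by blast
  qed (auto dest!: WW simp: M.a_assoc sc_add add_sc sc_sc sc_one zero_sc)
qed

lemma nil_npsi:
  assumes "x \<in> n_minus N" "w \<in> carrier W" "crd w \<in> nil (Suc n)"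
  shows "act x w \<ominus> psi N x \<odot> w \<in> carrier W \<and> crd (act x w \<ominus> psi N x \<odot> w) \<in> nil n"
proof -
  have cl: "act x w \<ominus> psi N x \<odot> w \<in> carrier W" if "x \<in> n_minus N" for x
    using act_closed[OF n_minus_mirabolic[OF that]] assms by (simp add: minus_sc)
  have cr: "crd (act x w \<ominus> psi N x \<odot> w) = crd (act x w) - fsc (psi N x) (crd w)" if "x \<in> n_minus N" for x
    using act_closed[OF n_minus_mirabolic[OF that]] assms by (simp add: crd_diff crd_scale)
  have "crd (act x w \<ominus> psi N x \<odot> w) \<in> nil n"
    using assms(1)
  proof (induction rule: n_minus_induct)
    case zero
    have zm: "0\<^sub>m N N \<in> n_minus N" by (auto simp: n_minus_def)
    show ?case unfolding cr[OF zm] using assms fsc.sub_zero[OF nil_sub] by (simp add: crd_zero act_zero psi_zero)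
  next
    case (add B c i j)
    have a: "(i, j) \<in> neg" using add by (simp add: neg_def)
    have En: "E N i j \<in> n_minus N" using add by (intro E_n_minus)
    have E: "E N i j \<in> carrier (mirabolic_lie N)" using add by (intro E_mirabolic) auto
    have B: "B \<in> carrier (mirabolic_lie N)" "B \<in> carrier_mat N N" using add by (auto intro: n_minus_mirabolic simp: n_minus_def)
    have BE: "B + c \<cdot>\<^sub>m E N i j \<in> n_minus N" using add En by (auto simp: n_minus_def)
    have 1: "crd (act (E N i j) w \<ominus> psi N (E N i j :: 'k mat) \<odot> w) \<in> nil n"
      using p_crd[OF a, of w] assms a by (auto simp: nil_Suc)
    have "act (B + c \<cdot>\<^sub>m E N i j) w = act B w \<oplus> c \<odot> act (E N i j) w"
      using assms B E ml.L_smult[OF E, of c] by (simp add: act_mat_add[OF B(1)] act_mat_scale[OF E] mirabolic_simps)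
    then have "crd (act (B + c \<cdot>\<^sub>m E N i j) w \<ominus> psi N (B + c \<cdot>\<^sub>m E N i j) \<odot> w) =
        crd (act B w \<ominus> psi N B \<odot> w) + fsc c (crd (act (E N i j) w \<ominus> psi N (E N i j :: 'k mat) \<odot> w))"
      unfolding cr[OF BE] cr[OF add(1)] cr[OF En] using assms B E act_closed[OF B(1) assms(2)] act_closed[OF E assms(2)]
      by (simp add: crd_add crd_scale act_closed psi_add psi_smult fsc.scale_right_diff_distrib fsc.scale_left_distrib)
    then show ?case using add.IH 1 by (simp add: fsc.sub_add[OF nil_sub] fsc.sub_scale[OF nil_sub])
  qed
  then show ?thesis using cl assms by blast
qed

lemma foldl_npsi:
  assumes "w \<in> carrier W" "crd w \<in> nil (length ys)" "set ys \<subseteq> n_minus_psi N"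
  shows "foldl (ract W) w ys = \<zero>"
  using assms
proof (induction ys arbitrary: w)
  case Nil then show ?case using crd_eq_0 by (simp add: nil_0)
next
  case (Cons y ys)
  then obtain x where x: "x \<in> n_minus N" "y = uea_incl (mirabolic_lie N) x \<ominus>\<^bsub>Um N\<^esub> (psi N x \<odot>\<^bsub>Um N\<^esub> \<one>\<^bsub>Um N\<^esub>)"
    by (auto simp: n_minus_psi_def)
  have "w \<triangleleft> y = act x w \<ominus> psi N x \<odot> w" unfolding x(2) using npsi_act[OF x(1) Cons.prems(1)] .
  then show ?case using nil_npsi[OF x(1) Cons.prems(1)] Cons by simp
qed

lemma fold_p_crd:
  assumes "w \<in> carrier W" "set u \<subseteq> neg"
  shows "fold p u (crd w) = crd (foldl (ract W) w (map (\<lambda>a. uea_incl (mirabolic_lie N) (E N (fst a) (snd a)) \<ominus>\<^bsub>Um N\<^esub>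
    (psi N (E N (fst a) (snd a) :: 'k mat) \<odot>\<^bsub>Um N\<^esub> \<one>\<^bsub>Um N\<^esub>)) u))"
  using assms
proof (induction u arbitrary: w)
  case Nil then show ?case by simp
next
  case (Cons a u)
  have E: "E N (fst a) (snd a) \<in> n_minus N" using Cons by (auto simp: neg_def intro: E_n_minus)
  have "act (E N (fst a) (snd a)) w \<ominus> psi N (E N (fst a) (snd a) :: 'k mat) \<odot> w \<in> carrier W"
    using act_closed[OF n_minus_mirabolic[OF E]] Cons by (simp add: M.minus_eq)
  then show ?case using Cons p_crd[of a w] npsi_act[OF E, of w] by simp
qed

text \<open>The elements of \<open>n_minus_psi N\<close> act by linear combinations of the operators
  \<open>p a\<close>. So vanishing under words of length \<open>n\<close> in the latter and under
  products of \<open>n\<close> elements of the former are the same condition.\<close>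

lemma whittaker_iff: "whittaker_module N W \<longleftrightarrow> (\<forall>f\<in>SV. \<exists>n. f \<in> nil n)"
proof
  assume *: "whittaker_module N W"
  show "\<forall>f\<in>SV. \<exists>n. f \<in> nil n"
  proof
    fix f assume "f \<in> SV"
    then obtain w where w: "w \<in> carrier W" "f = crd w" using SV_cases by blast
    obtain n where n: "\<forall>ys. length ys = n \<and> set ys \<subseteq> n_minus_psi N \<longrightarrow> foldl (ract W) w ys = \<zero>"
      using * w by (auto simp: whittaker_module_def)
    have "fold p u f = 0" if "set u \<subseteq> neg" "length u = n" for u
    proof -
      let ?ys = "map (\<lambda>a. uea_incl (mirabolic_lie N) (E N (fst a) (snd a)) \<ominus>\<^bsub>Um N\<^esub>
        (psi N (E N (fst a) (snd a) :: 'k mat) \<odot>\<^bsub>Um N\<^esub> \<one>\<^bsub>Um N\<^esub>)) u"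
      have "set ?ys \<subseteq> n_minus_psi N"
      proof
        fix y assume "y \<in> set ?ys"
        then obtain a where a: "a \<in> set u" "y = uea_incl (mirabolic_lie N) (E N (fst a) (snd a)) \<ominus>\<^bsub>Um N\<^esub>
          (psi N (E N (fst a) (snd a) :: 'k mat) \<odot>\<^bsub>Um N\<^esub> \<one>\<^bsub>Um N\<^esub>)" by auto
        have "a \<in> neg" using that a by blast
        then have "E N (fst a) (snd a) \<in> n_minus N" by (auto simp: neg_def intro: E_n_minus)
        then show "y \<in> n_minus_psi N" unfolding a(2) n_minus_psi_def by blast
      qed
      then have "foldl (ract W) w ?ys = \<zero>" using n that by simp
      then show ?thesis using fold_p_crd[OF w(1) that(1)] w crd_zero by simp
    qed
    then have "f \<in> nil n" by (simp add: nil_def)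
    then show "\<exists>n. f \<in> nil n" by blast
  qed
next
  assume *: "\<forall>f\<in>SV. \<exists>n. f \<in> nil n"
  show "whittaker_module N W"
    unfolding whittaker_module_def
  proof (intro conjI ballI)
    show "right_module (Um N) W" by (rule rm)
    fix w assume w: "w \<in> carrier W"
    then obtain n where "crd w \<in> nil n" using * crd_SV by blast
    then show "\<exists>n. \<forall>ys. length ys = n \<and> set ys \<subseteq> n_minus_psi N \<longrightarrow> foldl (ract W) w ys = \<zero>"
      using foldl_npsi[OF w] by (intro exI[of _ n]) simp
  qed
qed

end

locale whit = fixes N and W :: "('k::field_char_0, ('k mat list \<Rightarrow> 'k) set, 'w) rmod" (structure)
  assumes wm: "whittaker_module N W"
begin

sublocale umod N W using wm by (auto simp: whittaker_module_def intro: umod.intro)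

sublocale mir_mod fsc N e SV
  using whittaker_iff wm by unfold_locales (auto simp: stable_SV)

end

text \<open>Compatibility passes from matrix units to m_N by linearity and to the enveloping algebra
  by \<open>U_induct\<close>.\<close>

lemma rmod_homI:
  assumes "umod N W" "umod N X" and lin: "f \<in> lin_hom W X"
    and E: "\<And>w i j. w \<in> carrier W \<Longrightarrow> i < N \<Longrightarrow> Suc j < N \<Longrightarrow> f (umod.act N W (E N i j) w) = umod.act N X (E N i j) (f w)"
  shows "f \<in> rmod_hom (Um N) W X"
proof -
  interpret W: umod N W by fact
  interpret X: umod N X by fact
  have fc: "f w \<in> carrier X" if "w \<in> carrier W" for w using lin_homD(1)[OF lin that] .
  have M: "f (W.act x w) = X.act x (f w)" if "x \<in> carrier (mirabolic_lie N)" "w \<in> carrier W" for x w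
    using that(1)
  proof (induction rule: mirabolic_induct)
    case zero
    show ?case using that(2) fc[OF that(2)] lin_hom_zero[OF W.kspace_axioms X.kspace_axioms lin]
      by (simp add: W.act_zero X.act_zero)
  next
    case (add B c i j)
    have E: "E N i j \<in> carrier (mirabolic_lie N)" "c \<cdot>\<^sub>m E N i j \<in> carrier (mirabolic_lie N)"
      using E_mirabolic[OF add(2,3)] ml.L_smult[OF E_mirabolic[OF add(2,3)], of c] by (simp_all add: mirabolic_simps)
    show ?case
      using add E that(2) fc[OF that(2)] assms(4)[OF that(2) add(2,3)] W.act_closed[OF add(1) that(2)] W.act_closed[OF E(1) that(2)]
      by (simp add: W.act_mat_add[OF add(1)] X.act_mat_add[OF add(1)] W.act_mat_scale[OF E(1)] X.act_mat_scale[OF E(1)]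
          lin_homD(3,4)[OF lin] W.act_closed)
  qed
  have "f (w \<triangleleft>\<^bsub>W\<^esub> u) = f w \<triangleleft>\<^bsub>X\<^esub> u" if "u \<in> carrier (Um N)" "w \<in> carrier W" for u w
    using that
  proof (induction arbitrary: w rule: ml.U_induct)
    case one then show ?case using fc by (simp add: W.rm.ract_one X.rm.ract_one)
  next
    case (add y z) then show ?case using fc
      by (simp add: W.rm.ract_add_right X.rm.ract_add_right W.rm.ract_closed lin_homD(3)[OF lin])
  next
    case (smult c y) then show ?case using fc
      by (simp add: W.rm.ract_smult_right X.rm.ract_smult_right W.rm.ract_closed lin_homD(4)[OF lin])
  next
    case (mult y x)
    then show ?case using fc M[OF mult(2)]
      by (simp add: W.rm.ract_mult X.rm.ract_mult ml.inc_closed W.rm.ract_closed W.act_def X.act_def)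
  qed
  then show ?thesis using lin by (auto simp: rmod_hom_def)
qed

subsection \<open>Fully faithful and essentially surjective functors\<close>

lemma is_functorD:
  assumes "is_functor C D F"
  shows "category C" "category D" "X \<in> Ob C \<Longrightarrow> fob F X \<in> Ob D"
    "X \<in> Ob C \<Longrightarrow> Y \<in> Ob C \<Longrightarrow> f \<in> Hom C X Y \<Longrightarrow> far F X Y f \<in> Hom D (fob F X) (fob F Y)"
    "X \<in> Ob C \<Longrightarrow> far F X X (Id C X) = Id D (fob F X)"
    "X \<in> Ob C \<Longrightarrow> Y \<in> Ob C \<Longrightarrow> Z \<in> Ob C \<Longrightarrow> f \<in> Hom C X Y \<Longrightarrow> g \<in> Hom C Y Z \<Longrightarrow>
      far F X Z (Comp C X Y Z g f) = Comp D (fob F X) (fob F Y) (fob F Z) (far F Y Z g) (far F X Y f)"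
  using assms by (auto simp: is_functor_def)

lemma equivalenceI:
  assumes F: "is_functor C D F"
    and faithful: "\<And>X Y f g. X \<in> Ob C \<Longrightarrow> Y \<in> Ob C \<Longrightarrow> f \<in> Hom C X Y \<Longrightarrow> g \<in> Hom C X Y \<Longrightarrow>
      far F X Y f = far F X Y g \<Longrightarrow> f = g"
    and full: "\<And>X Y h. X \<in> Ob C \<Longrightarrow> Y \<in> Ob C \<Longrightarrow> h \<in> Hom D (fob F X) (fob F Y) \<Longrightarrow>
      \<exists>f\<in>Hom C X Y. far F X Y f = h"
    and surj: "\<And>Z. Z \<in> Ob D \<Longrightarrow> \<exists>X\<in>Ob C. \<exists>i. iso_arrow D (fob F X) Z i"
  shows "equivalence_of_categories C D F"
proof -
  note Fob = is_functorD(3)[OF F] and Far = is_functorD(4)[OF F] and FId = is_functorD(5)[OF F] and FComp = is_functorD(6)[OF F]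
  interpret C: category C using is_functorD(1)[OF F] .
  interpret D: category D using is_functorD(2)[OF F] .
  have "\<forall>Z. \<exists>X. Z \<in> Ob D \<longrightarrow> X \<in> Ob C \<and> (\<exists>i. iso_arrow D (fob F X) Z i)" using surj by blast
  then obtain G0 where G0: "\<And>Z. Z \<in> Ob D \<Longrightarrow> G0 Z \<in> Ob C" "\<And>Z. Z \<in> Ob D \<Longrightarrow> \<exists>i. iso_arrow D (fob F (G0 Z)) Z i"
    by metis
  have "\<forall>Z. \<exists>i j. Z \<in> Ob D \<longrightarrow> i \<in> Hom D (fob F (G0 Z)) Z \<and> j \<in> Hom D Z (fob F (G0 Z)) \<and>
      Comp D (fob F (G0 Z)) Z (fob F (G0 Z)) j i = Id D (fob F (G0 Z)) \<and> Comp D Z (fob F (G0 Z)) Z i j = Id D Z"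
    using G0(2) unfolding iso_arrow_def by blast
  then obtain i j where i: "\<And>Z. Z \<in> Ob D \<Longrightarrow> i Z \<in> Hom D (fob F (G0 Z)) Z"
    and j: "\<And>Z. Z \<in> Ob D \<Longrightarrow> j Z \<in> Hom D Z (fob F (G0 Z))"
    and ji: "\<And>Z. Z \<in> Ob D \<Longrightarrow> Comp D (fob F (G0 Z)) Z (fob F (G0 Z)) (j Z) (i Z) = Id D (fob F (G0 Z))"
    and ij: "\<And>Z. Z \<in> Ob D \<Longrightarrow> Comp D Z (fob F (G0 Z)) Z (i Z) (j Z) = Id D Z"
    by metis
  \<comment> \<open>The arrow \<open>h\<close> conjugated by the chosen isomorphisms. Its preimage
    under \<open>F\<close>, unique by faithfulness, is the value of the quasi-inverse on
    \<open>h\<close>.\<close>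
  define t where "t Z Z' h = Comp D (fob F (G0 Z)) Z' (fob F (G0 Z')) (j Z') (Comp D (fob F (G0 Z)) Z Z' h (i Z))" for Z Z' h
  have t: "t Z Z' h \<in> Hom D (fob F (G0 Z)) (fob F (G0 Z'))" if "Z \<in> Ob D" "Z' \<in> Ob D" "h \<in> Hom D Z Z'" for Z Z' h
    using that i j G0 Fob by (simp add: t_def D.Comp_in_Hom)
  define G1 where "G1 Z Z' h = (SOME f. f \<in> Hom C (G0 Z) (G0 Z') \<and> far F (G0 Z) (G0 Z') f = t Z Z' h)" for Z Z' h
  have G1: "G1 Z Z' h \<in> Hom C (G0 Z) (G0 Z') \<and> far F (G0 Z) (G0 Z') (G1 Z Z' h) = t Z Z' h"
    if "Z \<in> Ob D" "Z' \<in> Ob D" "h \<in> Hom D Z Z'" for Z Z' h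
  proof -
    have "\<exists>f. f \<in> Hom C (G0 Z) (G0 Z') \<and> far F (G0 Z) (G0 Z') f = t Z Z' h"
      using full[of "G0 Z" "G0 Z'"] t[OF that] G0 that by blast
    then show ?thesis unfolding G1_def by (rule someI_ex)
  qed
  define G where "G = \<lparr>fob = G0, far = G1\<rparr>"
  have it: "Comp D (fob F (G0 Z)) (fob F (G0 Z')) Z' (i Z') (t Z Z' h) = Comp D (fob F (G0 Z)) Z Z' h (i Z)"
    if "Z \<in> Ob D" "Z' \<in> Ob D" "h \<in> Hom D Z Z'" for Z Z' h
  proof -
    have hi: "Comp D (fob F (G0 Z)) Z Z' h (i Z) \<in> Hom D (fob F (G0 Z)) Z'"
      using that i G0 Fob by (intro D.Comp_in_Hom) auto
    show ?thesis unfolding t_def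
      using D.Comp_assoc[of "fob F (G0 Z)" Z' "fob F (G0 Z')" Z' "Comp D (fob F (G0 Z)) Z Z' h (i Z)" "j Z'" "i Z'"]
        that i j G0 Fob hi ij D.Comp_Id_left by simp
  qed
  have Gfun: "is_functor D C G"
    unfolding is_functor_def
  proof (intro conjI ballI)
    show "category D" "category C" by unfold_locales
    fix X assume X: "X \<in> Ob D"
    show "fob G X \<in> Ob C" using G0 X by (simp add: G_def)
    have IdX: "Id D X \<in> Hom D X X" using D.Id_in_Hom X by blast
    have "t X X (Id D X) = Id D (fob F (G0 X))"
      using X i j ji G0 Fob by (simp add: t_def D.Comp_Id_left)
    then have "far F (G0 X) (G0 X) (G1 X X (Id D X)) = far F (G0 X) (G0 X) (Id C (G0 X))"
      using G1[OF X X IdX] FId G0(1)[OF X] by simp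
    then show "far G X X (Id D X) = Id C (fob G X)"
      using faithful[of "G0 X" "G0 X"] G0 X G1[OF X X IdX] C.Id_in_Hom by (simp add: G_def)
    fix Y assume Y: "Y \<in> Ob D"
    show "far G X Y f \<in> Hom C (fob G X) (fob G Y)" if "f \<in> Hom D X Y" for f
      using G1[OF X Y that] by (simp add: G_def)
    fix Z f g assume Z: "Z \<in> Ob D" and f: "f \<in> Hom D X Y" and g: "g \<in> Hom D Y Z"
    have gf: "Comp D X Y Z g f \<in> Hom D X Z" using X Y Z f g D.Comp_in_Hom by blast
    note tf = t[OF X Y f] and tg = t[OF Y Z g]
    note FX = Fob[OF G0(1)[OF X]] and FY = Fob[OF G0(1)[OF Y]] and FZ = Fob[OF G0(1)[OF Z]]
    have "Comp D (fob F (G0 X)) (fob F (G0 Y)) (fob F (G0 Z)) (t Y Z g) (t X Y f) = t X Z (Comp D X Y Z g f)"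
    proof -
      have gi: "Comp D (fob F (G0 Y)) Y Z g (i Y) \<in> Hom D (fob F (G0 Y)) Z"
        using Y Z g i FY by (intro D.Comp_in_Hom) auto
      have "Comp D (fob F (G0 X)) (fob F (G0 Y)) (fob F (G0 Z)) (t Y Z g) (t X Y f) =
          Comp D (fob F (G0 X)) Z (fob F (G0 Z)) (j Z) (Comp D (fob F (G0 X)) (fob F (G0 Y)) Z (Comp D (fob F (G0 Y)) Y Z g (i Y)) (t X Y f))"
        unfolding t_def[of Y Z g] using D.Comp_assoc[OF FX FY Z FZ tf gi j[OF Z]] by simp
      also have "Comp D (fob F (G0 X)) (fob F (G0 Y)) Z (Comp D (fob F (G0 Y)) Y Z g (i Y)) (t X Y f) =
          Comp D (fob F (G0 X)) Y Z g (Comp D (fob F (G0 X)) (fob F (G0 Y)) Y (i Y) (t X Y f))"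
        using D.Comp_assoc[OF FX FY Y Z tf i[OF Y] g] by simp
      also have "\<dots> = Comp D (fob F (G0 X)) Y Z g (Comp D (fob F (G0 X)) X Y f (i X))" using it[OF X Y f] by simp
      also have "\<dots> = Comp D (fob F (G0 X)) X Z (Comp D X Y Z g f) (i X)"
        using D.Comp_assoc[OF FX X Y Z i[OF X] f g] by simp
      finally show ?thesis by (simp add: t_def)
    qed
    then have "far F (G0 X) (G0 Z) (Comp C (G0 X) (G0 Y) (G0 Z) (G1 Y Z g) (G1 X Y f)) = far F (G0 X) (G0 Z) (G1 X Z (Comp D X Y Z g f))"
      using FComp[OF G0(1)[OF X] G0(1)[OF Y] G0(1)[OF Z]] G1[OF X Y f] G1[OF Y Z g] G1[OF X Z gf] by simp
    moreover have "Comp C (G0 X) (G0 Y) (G0 Z) (G1 Y Z g) (G1 X Y f) \<in> Hom C (G0 X) (G0 Z)"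
      using G0 X Y Z G1[OF X Y f] G1[OF Y Z g] by (intro C.Comp_in_Hom) auto
    ultimately show "far G X Z (Comp D X Y Z g f) = Comp C (fob G X) (fob G Y) (fob G Z) (far G Y Z g) (far G X Y f)"
      using faithful[of "G0 X" "G0 Z"] G0 X Z G1[OF X Z gf] by (simp add: G_def)
  qed
  have FG: "naturally_isomorphic D D (comp_functor F G) id_functor"
    unfolding naturally_isomorphic_def
  proof (intro exI[of _ i] conjI ballI)
    fix X assume X: "X \<in> Ob D"
    show "iso_arrow D (fob (comp_functor F G) X) (fob id_functor X) (i X)"
      unfolding iso_arrow_def using i[OF X] j[OF X] ij[OF X] ji[OF X]
      by (auto simp: comp_functor_def id_functor_def G_def)
    fix Y f assume Y: "Y \<in> Ob D" and f: "f \<in> Hom D X Y"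
    show "Comp D (fob (comp_functor F G) X) (fob (comp_functor F G) Y) (fob id_functor Y) (i Y) (far (comp_functor F G) X Y f) =
        Comp D (fob (comp_functor F G) X) (fob id_functor X) (fob id_functor Y) (far id_functor X Y f) (i X)"
      using it[OF X Y f] G1[OF X Y f] by (simp add: comp_functor_def id_functor_def G_def)
  qed
  \<comment> \<open>Fullness lifts the isomorphism at \<open>fob F X\<close> and its inverse along
    \<open>F\<close>. The lifts are mutually inverse by faithfulness and give the isomorphism from G
    F to the identity.\<close>
  have "\<forall>X. \<exists>u v. X \<in> Ob C \<longrightarrow> u \<in> Hom C (G0 (fob F X)) X \<and> v \<in> Hom C X (G0 (fob F X)) \<and>
      far F (G0 (fob F X)) X u = i (fob F X) \<and> far F X (G0 (fob F X)) v = j (fob F X)"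
  proof (intro allI)
    fix X
    show "\<exists>u v. X \<in> Ob C \<longrightarrow> u \<in> Hom C (G0 (fob F X)) X \<and> v \<in> Hom C X (G0 (fob F X)) \<and>
      far F (G0 (fob F X)) X u = i (fob F X) \<and> far F X (G0 (fob F X)) v = j (fob F X)"
    proof (cases "X \<in> Ob C")
      case True
      note FX = Fob[OF True]
      note GX = G0(1)[OF FX]
      show ?thesis using full[OF GX True i[OF FX]] full[OF True GX j[OF FX]] by blast
    qed blast
  qed
  then obtain u v where u: "\<And>X. X \<in> Ob C \<Longrightarrow> u X \<in> Hom C (G0 (fob F X)) X"
    and v: "\<And>X. X \<in> Ob C \<Longrightarrow> v X \<in> Hom C X (G0 (fob F X))"
    and Fu: "\<And>X. X \<in> Ob C \<Longrightarrow> far F (G0 (fob F X)) X (u X) = i (fob F X)"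
    and Fv: "\<And>X. X \<in> Ob C \<Longrightarrow> far F X (G0 (fob F X)) (v X) = j (fob F X)"
    by metis
  have GF: "naturally_isomorphic C C (comp_functor G F) id_functor"
    unfolding naturally_isomorphic_def
  proof (intro exI[of _ u] conjI ballI)
    fix X assume X: "X \<in> Ob C"
    note FX = Fob[OF X]
    note GX = G0(1)[OF FX]
    have "Comp C (G0 (fob F X)) X (G0 (fob F X)) (v X) (u X) = Id C (G0 (fob F X))"
      using GX X u[OF X] v[OF X] FComp[OF GX X GX u[OF X] v[OF X]] Fu[OF X] Fv[OF X] ji[OF FX] FId[OF GX]
      by (intro faithful[OF GX GX]) (auto intro: C.Comp_in_Hom C.Id_in_Hom)
    moreover have "Comp C X (G0 (fob F X)) X (u X) (v X) = Id C X"
      using GX X u[OF X] v[OF X] FComp[OF X GX X v[OF X] u[OF X]] Fu[OF X] Fv[OF X] ij[OF FX] FId[OF X]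
      by (intro faithful[OF X X]) (auto intro: C.Comp_in_Hom C.Id_in_Hom)
    ultimately show "iso_arrow C (fob (comp_functor G F) X) (fob id_functor X) (u X)"
      unfolding iso_arrow_def using u[OF X] v[OF X]
      by (auto simp: comp_functor_def id_functor_def G_def)
    fix Y f assume Y: "Y \<in> Ob C" and f: "f \<in> Hom C X Y"
    note FY = Fob[OF Y]
    note GY = G0(1)[OF FY]
    note Ff = Far[OF X Y f]
    note Gf = G1[OF FX FY Ff]
    have "Comp C (G0 (fob F X)) (G0 (fob F Y)) Y (u Y) (G1 (fob F X) (fob F Y) (far F X Y f)) = Comp C (G0 (fob F X)) X Y f (u X)"
    proof (rule faithful[OF GX Y])
      show "Comp C (G0 (fob F X)) (G0 (fob F Y)) Y (u Y) (G1 (fob F X) (fob F Y) (far F X Y f)) \<in> Hom C (G0 (fob F X)) Y"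
        using GX GY Y Gf u[OF Y] by (intro C.Comp_in_Hom) auto
      show "Comp C (G0 (fob F X)) X Y f (u X) \<in> Hom C (G0 (fob F X)) Y"
        using GX X Y f u[OF X] by (intro C.Comp_in_Hom) auto
      show "far F (G0 (fob F X)) Y (Comp C (G0 (fob F X)) (G0 (fob F Y)) Y (u Y) (G1 (fob F X) (fob F Y) (far F X Y f))) =
          far F (G0 (fob F X)) Y (Comp C (G0 (fob F X)) X Y f (u X))"
        using FComp[OF GX GY Y _ u[OF Y], of "G1 (fob F X) (fob F Y) (far F X Y f)"] FComp[OF GX X Y u[OF X] f] Gf Fu[OF X] Fu[OF Y] it[OF FX FY Ff]
        by simp
    qed
    then show "Comp C (fob (comp_functor G F) X) (fob (comp_functor G F) Y) (fob id_functor Y) (u Y) (far (comp_functor G F) X Y f) =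
        Comp C (fob (comp_functor G F) X) (fob id_functor X) (fob id_functor Y) (far id_functor X Y f) (u X)"
      by (simp add: comp_functor_def id_functor_def G_def)
  qed
  show ?thesis unfolding equivalence_of_categories_def using F Gfun FG GF by blast
qed

subsection \<open>The functor of Whittaker vectors\<close>

lemma lin_hom_id: "restrict id (carrier V) \<in> lin_hom V V" if "vectorspace class_ring V"
proof -
  interpret kspace V using that by (rule kspaceI)
  show ?thesis by (rule lin_homI) auto
qed

lemma lin_hom_compose:
  assumes "vectorspace class_ring V" "f \<in> lin_hom V W" "g \<in> lin_hom W X" shows "compose (carrier V) g f \<in> lin_hom V X"
proof -
  interpret kspace V using assms(1) by (rule kspaceI)
  show ?thesis by (rule lin_homI) (auto simp: compose_def lin_homD[OF assms(2)] lin_homD[OF assms(3)])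
qed

lemma compose_restrict_id:
  assumes "f \<in> lin_hom V W" shows "compose (carrier V) f (restrict id (carrier V)) = f"
    "compose (carrier V) (restrict id (carrier W)) f = f"
  using lin_homD(1,2)[OF assms] by (auto simp: compose_def fun_eq_iff extensional_def)

lemma compose_compose:
  assumes "f \<in> lin_hom V W" shows "compose (carrier V) h (compose (carrier V) g f) = compose (carrier V) (compose (carrier W) h g) f"
  using lin_homD(1)[OF assms] by (auto simp: compose_def fun_eq_iff)

lemma category_Vect: "category (Vect :: (('k::field, 'v) module, 'v \<Rightarrow> 'v) cat)"
  by unfold_locales
    (auto simp: Vect_def lin_hom_id lin_hom_compose compose_restrict_id compose_compose)

lemma rmod_hom_lin: "f \<in> rmod_hom U W X \<Longrightarrow> f \<in> lin_hom W X"
  by (simp add: rmod_hom_def)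

lemma rmod_hom_compose:
  assumes W: "right_module U W" and "f \<in> rmod_hom U W X" "g \<in> rmod_hom U X Y"
  shows "compose (carrier W) g f \<in> rmod_hom U W Y"
proof -
  interpret right_module U W by fact
  show ?thesis using assms lin_hom_compose[OF vectorspace, of f X g Y]
    by (auto simp: rmod_hom_def compose_def ract_closed lin_homD(1))
qed

lemma rmod_hom_id:
  assumes W: "right_module U W" shows "restrict id (carrier W) \<in> rmod_hom U W W"
proof -
  interpret right_module U W by fact
  show ?thesis using lin_hom_id[OF vectorspace] by (auto simp: rmod_hom_def ract_closed)
qed

lemma category_Wh: "category (Wh N :: (('k::field, ('k mat list \<Rightarrow> 'k) set, 'w) rmod, 'w \<Rightarrow> 'w) cat)"
proof (unfold_locales, unfold Wh_def cat.simps mem_Collect_eq whittaker_module_def, goal_cases)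
  case 1 then show ?case using rmod_hom_id by blast
next
  case 2 then show ?case using rmod_hom_compose by blast
next
  case 3 then show ?case using compose_restrict_id(1)[OF rmod_hom_lin] by blast
next
  case 4 then show ?case using compose_restrict_id(2)[OF rmod_hom_lin] by blast
next
  case 5 then show ?case using compose_compose[OF rmod_hom_lin] by blast
qed

lemma whittaker_vectors_hom:
  assumes W: "right_module (Um N) W" and X: "right_module (Um N) X" and f: "f \<in> rmod_hom (Um N) W X"
    and x: "x \<in> carrier (whittaker_vectors N W)"
  shows "f x \<in> carrier (whittaker_vectors N X)"
proof -
  interpret W: right_module "Um N" W by fact
  interpret X: right_module "Um N" X by fact
  have c: "y \<in> carrier (Um N)" if "y \<in> n_minus_psi N" for y
    using that by (auto simp: n_minus_psi_def ml.U.minus_sc ml.inc_closed n_minus_mirabolic ml.U_one_closed)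
  have "f (x \<triangleleft>\<^bsub>W\<^esub> y) = f x \<triangleleft>\<^bsub>X\<^esub> y" if "y \<in> n_minus_psi N" for y
    using f x c[OF that] by (auto simp: rmod_hom_def whittaker_vectors_def)
  then show ?thesis
    using x lin_homD(1)[OF rmod_hom_lin[OF f]] lin_hom_zero[OF kspaceI[OF W.vectorspace] kspaceI[OF X.vectorspace] rmod_hom_lin[OF f]]
    by (auto simp: whittaker_vectors_def)
qed

lemma whittaker_is_functor:
  "is_functor (Wh N :: (('k::field_char_0, ('k mat list \<Rightarrow> 'k) set, 'w) rmod, 'w \<Rightarrow> 'w) cat) Vect (whittaker_functor N)"
  unfolding is_functor_def
proof (intro conjI ballI)
  show "category (Wh N :: (('k, ('k mat list \<Rightarrow> 'k) set, 'w) rmod, 'w \<Rightarrow> 'w) cat)" by (rule category_Wh)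
  show "category (Vect :: (('k, 'w) module, 'w \<Rightarrow> 'w) cat)" by (rule category_Vect)
  fix W :: "('k, ('k mat list \<Rightarrow> 'k) set, 'w) rmod" assume "W \<in> Ob (Wh N)"
  then have W: "right_module (Um N) W" by (simp add: Wh_def whittaker_module_def)
  interpret W: umod N W using W by (rule umod.intro)
  show "fob (whittaker_functor N) W \<in> Ob Vect"
    using W.whittaker_vectors_kspace by (simp add: whittaker_functor_def Vect_def)
  show "far (whittaker_functor N) W W (Id (Wh N) W) = Id Vect (fob (whittaker_functor N) W)"
    by (auto simp: whittaker_functor_def Wh_def Vect_def whittaker_vectors_def)
  fix X :: "('k, ('k mat list \<Rightarrow> 'k) set, 'w) rmod" assume "X \<in> Ob (Wh N)"
  then have X: "right_module (Um N) X" by (simp add: Wh_def whittaker_module_def)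
  { fix f assume "f \<in> Hom (Wh N) W X"
    then have f: "f \<in> rmod_hom (Um N) W X" by (simp add: Wh_def)
    have "restrict f (carrier (whittaker_vectors N W)) \<in> lin_hom (whittaker_vectors N W) (whittaker_vectors N X)"
    proof (rule lin_homI)
      show "restrict f (carrier (whittaker_vectors N W)) (x \<oplus>\<^bsub>whittaker_vectors N W\<^esub> y) =
          restrict f (carrier (whittaker_vectors N W)) x \<oplus>\<^bsub>whittaker_vectors N X\<^esub> restrict f (carrier (whittaker_vectors N W)) y"
        if "x \<in> carrier (whittaker_vectors N W)" "y \<in> carrier (whittaker_vectors N W)" for x y
        using that vectorspace.axioms(1)[OF W.whittaker_vectors_kspace] kspaceI[OF W.whittaker_vectors_kspace] lin_homD(3)[OF rmod_hom_lin[OF f], of x y]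
          abelian_monoid.a_closed[OF abelian_group.axioms(1)[OF module.axioms(2)], of class_ring "whittaker_vectors N W" x y]
        by (simp add: whittaker_vectors_simps W.whittaker_vectors_iff)
      show "restrict f (carrier (whittaker_vectors N W)) (c \<odot>\<^bsub>whittaker_vectors N W\<^esub> x) =
          c \<odot>\<^bsub>whittaker_vectors N X\<^esub> restrict f (carrier (whittaker_vectors N W)) x"
        if "x \<in> carrier (whittaker_vectors N W)" for x c
        using that kspace.sc_closed[OF kspaceI[OF W.whittaker_vectors_kspace], of x c] lin_homD(4)[OF rmod_hom_lin[OF f], of x c]
        by (simp add: whittaker_vectors_simps W.whittaker_vectors_iff)
    qed (use whittaker_vectors_hom[OF W X f] in auto)
    then show "far (whittaker_functor N) W X f \<in> Hom Vect (fob (whittaker_functor N) W) (fob (whittaker_functor N) X)"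
      by (simp add: whittaker_functor_def Vect_def) }
  fix Y f g assume f: "f \<in> Hom (Wh N) W X" and g: "g \<in> Hom (Wh N) X Y"
  then show "far (whittaker_functor N) W Y (Comp (Wh N) W X Y g f) =
      Comp Vect (fob (whittaker_functor N) W) (fob (whittaker_functor N) X) (fob (whittaker_functor N) Y)
        (far (whittaker_functor N) X Y g) (far (whittaker_functor N) W X f)"
    using whittaker_vectors_hom[OF W X, of f]
    by (auto simp: whittaker_functor_def Vect_def Wh_def compose_def fun_eq_iff W.whittaker_vectors_iff)
qed

section \<open>Full faithfulness of the functor of Whittaker vectors\<close>

lemma whit_hom:
  assumes "whit N W" "whit N X" and f: "f \<in> rmod_hom (Um N) W X"
  shows "mir_mod_hom fsc N (umod.e N W) (kspace.SV W) fsc (umod.e N X) (kspace.SV X) (\<lambda>w. kspace.crd X (f (kspace.lc W w)))"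
proof -
  interpret W: whit N W by fact
  interpret X: whit N X by fact
  note fl = lin_homD[OF rmod_hom_lin[OF f]]
  show ?thesis
  proof unfold_locales
    show "X.crd (f (W.lc w)) \<in> X.SV" if "w \<in> W.SV" for w using that fl(1) W.lc_SV by simp
    show "X.crd (f (W.lc (w + v))) = X.crd (f (W.lc w)) + X.crd (f (W.lc v))" if "w \<in> W.SV" "v \<in> W.SV" for w v
      using that fl W.lc_SV by (simp add: W.lc_SV_add X.crd_add)
    show "X.crd (f (W.lc (W.e i j w))) = X.e i j (X.crd (f (W.lc w)))" if w: "w \<in> W.SV" and ij: "i < N" "Suc j < N" for i j w
    proof -
      obtain v where v: "v \<in> carrier W" "w = W.crd v" using W.SV_cases w by blast
      have "f (W.act (E N i j) v) = X.act (E N i j) (f v)"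
        using f v ml.inc_closed[OF E_mirabolic[OF ij]] by (auto simp: rmod_hom_def W.act_def X.act_def)
      then show ?thesis using v ij fl(1)[OF v(1)] W.act_closed[OF E_mirabolic[OF ij] v(1)]
        by (simp add: W.e_crd X.e_crd)
    qed
  qed
qed

lemma whit_faithful:
  assumes "whit N W" "whit N X" and f: "f \<in> rmod_hom (Um N) W X" and g: "g \<in> rmod_hom (Um N) W X"
    and eq: "\<And>x. x \<in> carrier (whittaker_vectors N W) \<Longrightarrow> f x = g x"
  shows "f = g"
proof -
  interpret W: whit N W by fact
  interpret X: whit N X by fact
  interpret f: mir_mod_hom fsc N W.e W.SV fsc X.e X.SV "\<lambda>w. X.crd (f (W.lc w))" by (rule whit_hom[OF assms(1-3)])
  interpret g: mir_mod_hom fsc N W.e W.SV fsc X.e X.SV "\<lambda>w. X.crd (g (W.lc w))" by (rule whit_hom[OF assms(1,2,4)])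
  \<comment> \<open>The difference of two homomorphisms is again one, and it vanishes on the
    invariants.\<close>
  interpret d: mir_mod_hom fsc N W.e W.SV fsc X.e X.SV "\<lambda>w. X.crd (f (W.lc w)) - X.crd (g (W.lc w))"
    by unfold_locales
      (auto simp: f.F_S g.F_S f.F_add g.F_add f.F_e g.F_e fsc.sub_diff[OF X.SV_sub] is_linear_diff[OF X.e_lin] algebra_simps)
  have fc: "f w \<in> carrier X" "g w \<in> carrier X" if "w \<in> carrier W" for w
    using lin_homD(1)[OF rmod_hom_lin[OF f] that] lin_homD(1)[OF rmod_hom_lin[OF g] that] by auto
  have "X.crd (f (W.lc w)) - X.crd (g (W.lc w)) = 0" if "w \<in> W.SV" for w
  proof (rule d.F_zero_of_invs[OF _ that])
    fix w assume w: "w \<in> W.invs W.SV"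
    then have "w \<in> W.SV" by (simp add: W.invs_def)
    then have "W.lc w \<in> carrier (whittaker_vectors N W)" using w by (simp add: W.whittaker_vectors_iff W.lc_SV W.crd_lc)
    then show "X.crd (f (W.lc w)) - X.crd (g (W.lc w)) = 0" using eq by simp
  qed
  from this[OF W.crd_SV] have "f w = g w" if "w \<in> carrier W" for w
    using that fc by (intro X.crd_inj) auto
  then show ?thesis using lin_homD(2)[OF rmod_hom_lin[OF f]] lin_homD(2)[OF rmod_hom_lin[OF g]]
    by (intro extensionalityI[of _ "carrier W"]) auto
qed

lemma whit_full:
  assumes "whit N W" "whit N X" and f: "f \<in> lin_hom (whittaker_vectors N W) (whittaker_vectors N X)"
  shows "\<exists>F\<in>rmod_hom (Um N) W X. restrict F (carrier (whittaker_vectors N W)) = f"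
proof -
  interpret W: whit N W by fact
  interpret X: whit N X by fact
  note fl = lin_homD[OF f]
  have lc: "W.lc w \<in> carrier (whittaker_vectors N W)" if "w \<in> W.invs W.SV" for w
    using that by (simp add: W.whittaker_vectors_iff W.lc_SV W.crd_lc W.invs_def)
  have S: "w \<in> W.SV" if "w \<in> W.invs W.SV" for w using that by (simp add: W.invs_def)
  have fc: "f x \<in> carrier X" "X.crd (f x) \<in> X.invs X.SV" if "x \<in> carrier (whittaker_vectors N W)" for x
    using fl(1)[OF that] by (auto simp: X.whittaker_vectors_iff)
  interpret P: mir_mod_pair fsc N W.e W.SV fsc X.e X.SV "\<lambda>w. X.crd (f (W.lc w))"
  proof unfold_locales
    show "X.crd (f (W.lc w)) \<in> X.invs X.SV" if "w \<in> W.invs W.SV" for w using fc lc that by blast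
    show "X.crd (f (W.lc (w + v))) = X.crd (f (W.lc w)) + X.crd (f (W.lc v))"
      if "w \<in> W.invs W.SV" "v \<in> W.invs W.SV" for w v
      using fl(3)[OF lc[OF that(1)] lc[OF that(2)]] fc lc that S
      by (simp add: W.lc_SV_add whittaker_vectors_simps X.crd_add)
    show "X.crd (f (W.lc (fsc c w))) = fsc c (X.crd (f (W.lc w)))" if "w \<in> W.invs W.SV" for c w
      using fl(4)[OF lc[OF that], of c] fc lc that S by (simp add: W.lc_SV_scale whittaker_vectors_simps X.crd_scale)
  qed
  obtain F where F0: "(\<forall>w\<in>W.SV. F w \<in> X.SV) \<and> (\<forall>w\<in>W.SV. \<forall>v\<in>W.SV. F (w + v) = F w + F v) \<and>
    (\<forall>c. \<forall>w\<in>W.SV. F (fsc c w) = fsc c (F w)) \<and>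
    (\<forall>i j. \<forall>w\<in>W.SV. i < N \<longrightarrow> Suc j < N \<longrightarrow> F (W.e i j w) = X.e i j (F w)) \<and>
    (\<forall>w\<in>W.invs W.SV. F w = X.crd (f (W.lc w)))"
    using P.extend_hom by (elim exE)
  have F: "w \<in> W.SV \<Longrightarrow> F w \<in> X.SV" "w \<in> W.SV \<Longrightarrow> v \<in> W.SV \<Longrightarrow> F (w + v) = F w + F v"
    "w \<in> W.SV \<Longrightarrow> F (fsc c w) = fsc c (F w)"
    "w \<in> W.SV \<Longrightarrow> i < N \<Longrightarrow> Suc j < N \<Longrightarrow> F (W.e i j w) = X.e i j (F w)"
    "w \<in> W.invs W.SV \<Longrightarrow> F w = X.crd (f (W.lc w))" for w v c i j
    using F0 by simp_all
  define H where "H = restrict (\<lambda>w. X.lc (F (W.crd w))) (carrier W)"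
  have H: "H w = X.lc (F (W.crd w))" if "w \<in> carrier W" for w using that by (simp add: H_def)
  have "H \<in> rmod_hom (Um N) W X"
  proof (rule rmod_homI)
    show "umod N W" "umod N X" by unfold_locales
    show "H \<in> lin_hom W X"
    proof (rule lin_homI)
      show "H \<in> extensional (carrier W)" by (simp add: H_def)
    qed (simp_all add: H F X.lc_SV W.crd_add W.crd_scale X.lc_SV_add X.lc_SV_scale)
    show "H (W.act (E N i j) w) = X.act (E N i j) (H w)" if "w \<in> carrier W" "i < N" "Suc j < N" for w i j
    proof -
      have "F (W.crd (W.act (E N i j) w)) = X.e i j (F (W.crd w))" using that by (simp add: F flip: W.e_crd)
      also have "\<dots> = X.crd (X.act (E N i j) (X.lc (F (W.crd w))))"
        using X.e_crd[OF that(2,3), of "X.lc (F (W.crd w))"] F(1)[of "W.crd w"] that by (simp add: X.lc_SV X.crd_lc)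
      finally show ?thesis using that F(1)[of "W.crd w"] W.act_closed[OF E_mirabolic[OF that(2,3)] that(1)]
          X.act_closed[OF E_mirabolic[OF that(2,3)], of "X.lc (F (W.crd w))"]
        by (simp add: H X.lc_SV)
    qed
  qed
  moreover have "restrict H (carrier (whittaker_vectors N W)) = f"
  proof (rule extensionalityI[of _ "carrier (whittaker_vectors N W)"])
    show "f \<in> extensional (carrier (whittaker_vectors N W))" by (rule fl(2))
    fix x assume x: "x \<in> carrier (whittaker_vectors N W)"
    then show "restrict H (carrier (whittaker_vectors N W)) x = f x"
      using F(5)[of "W.crd x"] fc[OF x] by (simp add: W.whittaker_vectors_iff H)
  qed simp
  ultimately show ?thesis by blast
qed

subsection \<open>Realising modules in a given universe\<close>

context mir_ops
begin

definition amat :: "'k mat \<Rightarrow> 'b \<Rightarrow> 'b" where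
  "amat x w = (\<Sum>(i, j)\<in>gens. sc (x $$ (i, j)) (e i j w))"

lemma gens_dim: "(i, j) \<in> gens \<Longrightarrow> i < N \<and> j < N" by (auto simp: gens_def)

lemma finite_gens: "finite gens"
  by (rule finite_subset[of _ "{..<N} \<times> {..<N}"]) (auto simp: gens_def)

lemma amat_add: "x \<in> carrier_mat N N \<Longrightarrow> y \<in> carrier_mat N N \<Longrightarrow> amat (x + y) w = amat x w + amat y w"
proof -
  assume *: "x \<in> carrier_mat N N" "y \<in> carrier_mat N N"
  have "amat (x + y) w = (\<Sum>(i, j)\<in>gens. sc (x $$ (i, j)) (e i j w) + sc (y $$ (i, j)) (e i j w))"
    unfolding amat_def by (rule sum.cong) (use * in \<open>auto simp: scale_left_distrib dest!: gens_dim\<close>)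
  then show ?thesis by (simp add: amat_def case_prod_unfold sum.distrib)
qed

lemma amat_smult: "x \<in> carrier_mat N N \<Longrightarrow> amat (c \<cdot>\<^sub>m x) w = sc c (amat x w)"
proof -
  assume *: "x \<in> carrier_mat N N"
  have "amat (c \<cdot>\<^sub>m x) w = (\<Sum>(i, j)\<in>gens. sc c (sc (x $$ (i, j)) (e i j w)))"
    unfolding amat_def by (rule sum.cong) (use * in \<open>auto dest!: gens_dim\<close>)
  then show ?thesis by (simp add: amat_def case_prod_unfold scale_sum_right)
qed

lemma amat_zero: "amat (0\<^sub>m N N) w = 0"
  unfolding amat_def by (rule sum.neutral) (auto dest!: gens_dim)

lemma amat_diff: "x \<in> carrier_mat N N \<Longrightarrow> y \<in> carrier_mat N N \<Longrightarrow> amat (x - y) w = amat x w - amat y w"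
proof -
  assume *: "x \<in> carrier_mat N N" "y \<in> carrier_mat N N"
  then have "amat ((x - y) + y) w = amat (x - y) w + amat y w" by (intro amat_add) auto
  moreover have "(x - y) + y = x" using * by (intro eq_matI) auto
  ultimately show ?thesis by simp
qed

lemma amat_E: assumes "(i, j) \<in> gens" shows "amat (E N i j) w = e i j w"
proof -
  have "amat (E N i j) w = (\<Sum>a\<in>gens. if a = (i, j) then e i j w else 0)"
    unfolding amat_def by (rule sum.cong) (auto dest!: gens_dim split: if_splits)
  then show ?thesis using assms finite_gens by simp
qed

lemma amat_lin: "is_linear sc sc (amat x)"
  by (rule is_linearI)
    (simp_all add: amat_def case_prod_unfold is_linear_add[OF e_lin] is_linear_scale[OF e_lin]
      scale_right_distrib sum.distrib scale_sum_right mult.commute)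

text \<open>Both sides are bilinear in \<open>x\<close> and \<open>y\<close>. The inner claim
  \<open>EE\<close> reduces \<open>y\<close> to a matrix unit while \<open>x\<close> is one, and the
  outer induction then treats \<open>x\<close>.\<close>

lemma amat_bracket:
  assumes x: "x \<in> carrier (mirabolic_lie N)" and y: "y \<in> carrier (mirabolic_lie N)"
  shows "amat (x * y - y * x) w = amat y (amat x w) - amat x (amat y w)"
proof -
  have EE: "amat (E N i j * y) w - amat (y * E N i j) w = amat y (amat (E N i j) w) - amat (E N i j) (amat y w)"
    if ij: "i < N" "Suc j < N" and y: "y \<in> carrier (mirabolic_lie N)" for i j y w
    using y
  proof (induction rule: mirabolic_induct)
    case zero
    show ?case by (simp add: amat_zero is_linear_zero[OF amat_lin])
  next
    case (add B c k l)
    have B: "B \<in> carrier_mat N N" using add by (simp add: mirabolic_carrier)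
    have g: "(i, j) \<in> gens" "(k, l) \<in> gens" using ij add by (auto simp: gens_def)
    have 1: "E N i j * (B + c \<cdot>\<^sub>m E N k l) = E N i j * B + c \<cdot>\<^sub>m (E N i j * E N k l)"
      using B by (simp add: mult_add_distrib_mat[of _ N N _ N] mult_smult_distrib[of _ N N _ N])
    have 2: "(B + c \<cdot>\<^sub>m E N k l) * E N i j = B * E N i j + c \<cdot>\<^sub>m (E N k l * E N i j)"
      using B by (simp add: add_mult_distrib_mat[of _ N N _ _ N] mult_smult_assoc_mat[of _ N N _ N])
    have m: "E N i j * B \<in> carrier_mat N N" "B * E N i j \<in> carrier_mat N N"
      "E N i j * E N k l \<in> carrier_mat N N" "E N k l * E N i j \<in> carrier_mat N N" using B by auto
    have "amat (E N i j * E N k l) w - amat (E N k l * E N i j) w = e k l (e i j w) - e i j (e k l w)"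
    proof -
      have "amat (E N i j * E N k l) w = (if j = k then e i l w else 0)"
        using g by (auto simp: E_mult gens_def amat_zero intro!: amat_E)
      moreover have "amat (E N k l * E N i j) w = (if l = i then e k j w else 0)"
        using g by (auto simp: E_mult gens_def amat_zero intro!: amat_E)
      ultimately show ?thesis using bracket[of i j k l w] g by (auto simp: gens_def)
    qed
    then have 3: "sc c (amat (E N i j * E N k l) w) - sc c (amat (E N k l * E N i j) w) =
        sc c (e k l (e i j w)) - sc c (e i j (e k l w))" by (simp flip: scale_right_diff_distrib)
    have IH: "amat (E N i j * B) w - amat (B * E N i j) w = amat B (e i j w) - e i j (amat B w)"
      using add.IH g by (simp add: amat_E)
    have cE: "c \<cdot>\<^sub>m (E N i j * E N k l) \<in> carrier_mat N N" "c \<cdot>\<^sub>m (E N k l * E N i j) \<in> carrier_mat N N" "c \<cdot>\<^sub>m E N k l \<in> carrier_mat N N" by auto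
    have "amat (E N i j * (B + c \<cdot>\<^sub>m E N k l)) w - amat ((B + c \<cdot>\<^sub>m E N k l) * E N i j) w =
        (amat (E N i j * B) w - amat (B * E N i j) w) + (sc c (amat (E N i j * E N k l) w) - sc c (amat (E N k l * E N i j) w))"
      unfolding 1 2 amat_add[OF m(1) cE(1)] amat_add[OF m(2) cE(2)] amat_smult[OF m(3)] amat_smult[OF m(4)] by (simp add: algebra_simps)
    also have "\<dots> = amat (B + c \<cdot>\<^sub>m E N k l) (amat (E N i j) w) - amat (E N i j) (amat (B + c \<cdot>\<^sub>m E N k l) w)"
      unfolding IH 3 amat_add[OF B cE(3)] amat_smult[OF E_carrier] amat_E[OF g(1)] amat_E[OF g(2)]
      by (simp add: is_linear_add[OF e_lin] is_linear_scale[OF e_lin])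
    finally show ?case .
  qed
  have "amat (x * y) w - amat (y * x) w = amat y (amat x w) - amat x (amat y w)"
    using x
  proof (induction rule: mirabolic_induct)
    case zero
    have "0\<^sub>m N N * y = 0\<^sub>m N N" "y * 0\<^sub>m N N = 0\<^sub>m N N" using y by (auto simp: mirabolic_carrier)
    then show ?case by (simp add: amat_zero is_linear_zero[OF amat_lin])
  next
    case (add B c i j)
    have B: "B \<in> carrier_mat N N" and yc: "y \<in> carrier_mat N N" using add y by (simp_all add: mirabolic_carrier)
    have 1: "y * (B + c \<cdot>\<^sub>m E N i j) = y * B + c \<cdot>\<^sub>m (y * E N i j)"
      using B yc by (simp add: mult_add_distrib_mat[of _ N N _ N] mult_smult_distrib[of _ N N _ N])
    have 2: "(B + c \<cdot>\<^sub>m E N i j) * y = B * y + c \<cdot>\<^sub>m (E N i j * y)"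
      using B yc by (simp add: add_mult_distrib_mat[of _ N N _ _ N] mult_smult_assoc_mat[of _ N N _ N])
    have m: "y * B \<in> carrier_mat N N" "B * y \<in> carrier_mat N N" "y * E N i j \<in> carrier_mat N N" "E N i j * y \<in> carrier_mat N N"
      "c \<cdot>\<^sub>m (y * E N i j) \<in> carrier_mat N N" "c \<cdot>\<^sub>m (E N i j * y) \<in> carrier_mat N N" "c \<cdot>\<^sub>m E N i j \<in> carrier_mat N N"
      using B yc by auto
    have 3: "sc c (amat (E N i j * y) w) - sc c (amat (y * E N i j) w) = sc c (amat y (amat (E N i j) w)) - sc c (amat (E N i j) (amat y w))"
      using EE[OF add(2,3) y, of w] by (simp flip: scale_right_diff_distrib)
    have "amat ((B + c \<cdot>\<^sub>m E N i j) * y) w - amat (y * (B + c \<cdot>\<^sub>m E N i j)) w =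
        (amat (B * y) w - amat (y * B) w) + (sc c (amat (E N i j * y) w) - sc c (amat (y * E N i j) w))"
      unfolding 1 2 amat_add[OF m(1) m(5)] amat_add[OF m(2) m(6)] amat_smult[OF m(3)] amat_smult[OF m(4)] by (simp add: algebra_simps)
    also have "\<dots> = amat y (amat (B + c \<cdot>\<^sub>m E N i j) w) - amat (B + c \<cdot>\<^sub>m E N i j) (amat y w)"
      unfolding add.IH 3 amat_add[OF B m(7)] amat_smult[OF E_carrier]
      by (simp add: is_linear_add[OF amat_lin] is_linear_scale[OF amat_lin])
    finally show ?case .
  qed
  then show ?thesis using x y by (subst amat_diff) (auto simp: mirabolic_carrier)
qed

lemma lie_action_amat: "lie_action (mirabolic_lie N) sc amat"
proof unfold_locales
  fix x y :: "'k mat" and w c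
  assume x: "x \<in> carrier (mirabolic_lie N)"
  show "is_linear sc sc (amat x)" by (rule amat_lin)
  show "amat (c \<odot>\<^bsub>mirabolic_lie N\<^esub> x) w = sc c (amat x w)"
    using x by (simp add: mirabolic_simps mirabolic_carrier amat_smult)
  assume y: "y \<in> carrier (mirabolic_lie N)"
  show "amat (x \<oplus>\<^bsub>mirabolic_lie N\<^esub> y) w = amat x w + amat y w"
    using x y by (simp add: mirabolic_simps mirabolic_carrier amat_add)
  show "amat (lie_bracket (mirabolic_lie N) x y) w = amat y (amat x w) - amat x (amat y w)"
    using amat_bracket[OF x y] by (simp add: mirabolic_simps)
qed

end

text \<open>Transports the module along an injection into the type in which the objects of the
  category must live.\<close>

locale realization = mir_mod +
  fixes emb :: "'b \<Rightarrow> 'w"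
  assumes emb_inj: "inj_on emb S"
begin

sublocale la: lie_action "mirabolic_lie N" sc amat by (rule lie_action_amat)

definition unemb :: "'w \<Rightarrow> 'b" where "unemb = inv_into S emb"

lemma unemb: "w \<in> S \<Longrightarrow> unemb (emb w) = w"
  using emb_inj by (simp add: unemb_def)

definition RW :: "('a, ('a mat list \<Rightarrow> 'a) set, 'w) rmod" where
  "RW = \<lparr>carrier = emb ` S, mult = undefined, one = undefined, zero = emb 0, add = (\<lambda>x y. emb (unemb x + unemb y)),
    smult = (\<lambda>c x. emb (sc c (unemb x))), ract = (\<lambda>x u. emb (la.uact u (unemb x)))\<rparr>"

lemma uact_S: "u \<in> carrier (Um N) \<Longrightarrow> w \<in> S \<Longrightarrow> la.uact u w \<in> S"
proof (induction arbitrary: w rule: ml.U_induct)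
  case one then show ?case by (simp add: la.uact_one)
next
  case (add y z) then show ?case by (simp add: la.uact_add sub_add[OF S_sub])
next
  case (smult c y) then show ?case by (simp add: la.uact_scale sub_scale[OF S_sub])
next
  case (mult y x)
  have "la.uact y w \<in> S" using mult by blast
  then have "amat x (la.uact y w) \<in> S"
    unfolding amat_def by (intro sub_sum[OF S_sub]) (auto simp: gens_def intro!: sub_scale[OF S_sub] S_e)
  then show ?case using mult by (simp add: la.uact_mult ml.inc_closed la.uact_inc)
qed

lemma RW_simps: "carrier RW = emb ` S" "x \<in> S \<Longrightarrow> y \<in> S \<Longrightarrow> emb x \<oplus>\<^bsub>RW\<^esub> emb y = emb (x + y)"
  "x \<in> S \<Longrightarrow> c \<odot>\<^bsub>RW\<^esub> emb x = emb (sc c x)" "\<zero>\<^bsub>RW\<^esub> = emb 0" "x \<in> S \<Longrightarrow> emb x \<triangleleft>\<^bsub>RW\<^esub> u = emb (la.uact u x)"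
  by (simp_all add: RW_def unemb)

lemma RW_module: "right_module (Um N) RW"
proof (rule right_module.intro)
  note S = sub_zero[OF S_sub] sub_add[OF S_sub] sub_scale[OF S_sub] uact_S
  show "vectorspace class_ring RW"
    by (rule vectorspaceI)
      (auto simp: RW_simps S algebra_simps scale_right_distrib scale_left_distrib)
next
  note S = sub_zero[OF S_sub] sub_add[OF S_sub] sub_scale[OF S_sub] uact_S
  fix w and y :: "('a mat list \<Rightarrow> 'a) set" assume w: "w \<in> carrier RW" and y: "y \<in> carrier (Um N)"
  then obtain s where s: "s \<in> S" "w = emb s" by (auto simp: RW_simps)
  show "w \<triangleleft>\<^bsub>RW\<^esub> y \<in> carrier RW" using s y by (auto simp: RW_simps S)
  show "(c \<odot>\<^bsub>RW\<^esub> w) \<triangleleft>\<^bsub>RW\<^esub> y = c \<odot>\<^bsub>RW\<^esub> (w \<triangleleft>\<^bsub>RW\<^esub> y)" for c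
    using s y by (simp add: RW_simps S la.uact_scale is_linear_scale[OF la.uact_lin])
  show "w \<triangleleft>\<^bsub>RW\<^esub> (c \<odot>\<^bsub>Um N\<^esub> y) = c \<odot>\<^bsub>RW\<^esub> (w \<triangleleft>\<^bsub>RW\<^esub> y)" for c
    using s y by (simp add: RW_simps S la.uact_scale is_linear_scale[OF la.uact_lin])
  fix z :: "('a mat list \<Rightarrow> 'a) set" assume z: "z \<in> carrier (Um N)"
  show "w \<triangleleft>\<^bsub>RW\<^esub> (y \<oplus>\<^bsub>Um N\<^esub> z) = w \<triangleleft>\<^bsub>RW\<^esub> y \<oplus>\<^bsub>RW\<^esub> w \<triangleleft>\<^bsub>RW\<^esub> z"
    using s y z by (simp add: RW_simps S la.uact_add)
  show "w \<triangleleft>\<^bsub>RW\<^esub> (y \<otimes>\<^bsub>Um N\<^esub> z) = w \<triangleleft>\<^bsub>RW\<^esub> y \<triangleleft>\<^bsub>RW\<^esub> z"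
    using s y z by (simp add: RW_simps S la.uact_mult)
next
  fix w w' and y :: "('a mat list \<Rightarrow> 'a) set" assume w: "w \<in> carrier RW" "w' \<in> carrier RW" and y: "y \<in> carrier (Um N)"
  then obtain s s' where "s \<in> S" "w = emb s" "s' \<in> S" "w' = emb s'" by (auto simp: RW_simps)
  then show "(w \<oplus>\<^bsub>RW\<^esub> w') \<triangleleft>\<^bsub>RW\<^esub> y = w \<triangleleft>\<^bsub>RW\<^esub> y \<oplus>\<^bsub>RW\<^esub> w' \<triangleleft>\<^bsub>RW\<^esub> y"
    using y by (simp add: RW_simps sub_add[OF S_sub] uact_S is_linear_add[OF la.uact_lin])
next
  show "w \<triangleleft>\<^bsub>RW\<^esub> \<one>\<^bsub>Um N\<^esub> = w" if "w \<in> carrier RW" for w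
    using that by (auto simp: RW_simps la.uact_one)
qed

sublocale RW: umod N RW by (rule umod.intro[OF RW_module])

lemma RW_p: assumes "s \<in> S" "a \<in> neg" shows "RW.p a (RW.crd (emb s)) = RW.crd (emb (p a s))"
proof -
  obtain i j where a: "a = (i, j)" "j < i" "i < N" using assms by (auto simp: neg_def)
  have es: "e i j s \<in> S" using a assms S_e by auto
  have "RW.act (E N i j) (emb s) = emb (e i j s)"
    using a assms by (simp add: RW.act_def RW_simps la.uact_inc E_mirabolic amat_E gens_def)
  then have "RW.e i j (RW.crd (emb s)) = RW.crd (emb (e i j s))"
    using a assms by (simp add: RW.e_crd RW_simps)
  moreover have "RW.crd (emb (e i j s - s)) = RW.crd (emb (e i j s)) - RW.crd (emb s)"
  proof -
    have "emb (e i j s - s) \<oplus>\<^bsub>RW\<^esub> emb s = emb (e i j s)" using es assms sub_diff[OF S_sub] by (simp add: RW_simps)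
    then have "RW.crd (emb (e i j s)) = RW.crd (emb (e i j s - s)) + RW.crd (emb s)"
      using es assms sub_diff[OF S_sub] RW.crd_add[of "emb (e i j s - s)" "emb s"] by (simp add: RW_simps)
    then show ?thesis by simp
  qed
  ultimately show ?thesis by (cases "i = Suc j") (simp_all add: RW.p_def p_def a(1))
qed

lemma RW_crd_zero: "s \<in> S \<Longrightarrow> RW.crd (emb s) = 0 \<longleftrightarrow> s = 0"
  using RW.crd_eq_0[of "emb s"] emb_inj sub_zero[OF S_sub] by (auto simp: RW_simps inj_on_def)

lemma RW_whittaker: "whittaker_module N RW"
  unfolding RW.whittaker_iff
proof
  fix f assume "f \<in> RW.SV"
  then obtain s where s: "s \<in> S" "f = RW.crd (emb s)" using RW.SV_cases by (auto simp: RW_simps)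
  obtain n where n: "s \<in> nil n" using S_nil s by blast
  have "fold RW.p u (RW.crd (emb s)) = RW.crd (emb (fold p u s))" if "set u \<subseteq> neg" for u
    using that s(1) by (induction u arbitrary: s) (simp_all add: RW_p S_p)
  then have "f \<in> RW.nil n" using n s RW_crd_zero[OF sub_zero[OF S_sub]] by (simp add: RW.nil_def nil_def)
  then show "\<exists>n. f \<in> RW.nil n" by blast
qed

lemma RW_invs: "carrier (whittaker_vectors N RW) = emb ` invs S"
proof -
  have "emb s \<in> carrier (whittaker_vectors N RW) \<longleftrightarrow> s \<in> invs S" if "s \<in> S" for s
    using that RW_p[OF that] RW_crd_zero[OF S_p[OF that]]
    by (auto simp: RW.whittaker_vectors_iff RW.invs_def invs_def RW_simps)
  moreover have "carrier (whittaker_vectors N RW) \<subseteq> emb ` S" by (auto simp: RW.whittaker_vectors_iff RW_simps)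
  ultimately show ?thesis by (auto simp: invs_def)
qed

end

subsection \<open>Cardinalities\<close>

unbundle cardinal_syntax

lemma card_lists_infinite: assumes "infinite A" shows "|lists A| \<le>o |A|"
proof -
  define Ln where "Ln n = {xs \<in> lists A. length xs = n}" for n
  have "|Ln n| \<le>o |A|" for n
  proof (induction n)
    case 0
    have "Ln 0 = {[]}" by (auto simp: Ln_def)
    then show ?case 
      using assms card_of_singl_ordLeq[of A "[] :: 'a list"] by auto
  next
    case (Suc n)
    have "Ln (Suc n) = (\<lambda>(x, xs). x # xs) ` (A \<times> Ln n)"
      by (auto simp: Ln_def length_Suc_conv image_iff)
    then have "|Ln (Suc n)| \<le>o |A \<times> Ln n|" by (simp add: card_of_image)
    also have "|A \<times> Ln n| \<le>o |A|"
      using card_of_Sigma_ordLeq_infinite[OF assms ordLeq_refl[OF card_of_Card_order], of "\<lambda>_. Ln n"] Suc by simp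
    finally show ?case .
  qed
  then have "|\<Union>n. Ln n| \<le>o |A|"
    using assms card_of_UNION_ordLeq_infinite[OF assms, of UNIV Ln] infinite_iff_card_of_nat by blast
  moreover have "(\<Union>n. Ln n) = lists A" by (auto simp: Ln_def)
  ultimately show ?thesis by simp
qed

text \<open>An element of \<open>gen V\<close> is encoded by a finite list of pairs of a vector and
  a word, and there are only countably many words.\<close>

lemma (in mir_ops) card_gen:
  assumes "infinite V" "0 \<in> V" shows "|gen V| \<le>o |V|"
proof -
  define ev where "ev ps = (\<Sum>(x, u)\<leftarrow>ps. fold e' u x)" for ps :: "('b \<times> (nat \<times> nat) list) list"
  have "x \<in> ev ` lists (V \<times> lists UNIV)" if "x \<in> gen V" for x
    using that
  proof induction
    case (word x u)
    then show ?case by (intro image_eqI[of _ _ "[(x, u)]"]) (auto simp: ev_def)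
  next
    case (add x y)
    then obtain ps qs where "ps \<in> lists (V \<times> lists UNIV)" "qs \<in> lists (V \<times> lists UNIV)" "x = ev ps" "y = ev qs" by blast
    then show ?case by (intro image_eqI[of _ _ "ps @ qs"]) (auto simp: ev_def)
  qed
  then have sub: "gen V \<subseteq> ev ` lists (V \<times> lists UNIV)" by blast
  have nat: "|UNIV :: nat set| \<le>o |V|" using assms(1) infinite_iff_card_of_nat by blast
  have "countable (lists (UNIV :: (nat \<times> nat) set))" by (rule countableI_type)
  then have "|lists (UNIV :: (nat \<times> nat) set)| \<le>o |UNIV :: nat set|"
    using card_of_ordLeq by (auto simp: countable_def)
  then have "|lists (UNIV :: (nat \<times> nat) set)| \<le>o |V|" using nat ordLeq_transitive by blast
  then have VL: "|V \<times> lists (UNIV :: (nat \<times> nat) set)| \<le>o |V|"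
    by (intro card_of_Sigma_ordLeq_infinite[OF assms(1)] card_of_mono1 ballI subset_refl)
  have inf: "infinite (V \<times> lists (UNIV :: (nat \<times> nat) set))"
    using assms(1) by (auto simp: finite_cartesian_product_iff)
  have "|gen V| \<le>o |ev ` lists (V \<times> lists UNIV)|" using sub by (rule card_of_mono1)
  also have "|ev ` lists (V \<times> lists UNIV)| \<le>o |lists (V \<times> lists (UNIV :: (nat \<times> nat) set))|" by (rule card_of_image)
  also have "|lists (V \<times> lists (UNIV :: (nat \<times> nat) set))| \<le>o |V \<times> lists (UNIV :: (nat \<times> nat) set)|" by (rule card_lists_infinite[OF inf])
  also note VL
  finally show ?thesis .
qed

unbundle no cardinal_syntax

subsection \<open>The equivalence of categories\<close>

lemma lin_hom_inverse:
  assumes V: "vectorspace class_ring V" and f: "f \<in> lin_hom V W" and bij: "bij_betw f (carrier V) (carrier W)"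
  shows "restrict (inv_into (carrier V) f) (carrier W) \<in> lin_hom W V"
proof -
  interpret kspace V using V by (rule kspaceI)
  note fl = lin_homD[OF f]
  have inj: "inj_on f (carrier V)" and im: "f ` carrier V = carrier W" using bij by (auto simp: bij_betw_def)
  have g: "inv_into (carrier V) f w \<in> carrier V" "f (inv_into (carrier V) f w) = w" if "w \<in> carrier W" for w
    using that im by (auto intro: inv_into_into f_inv_into_f)
  have eq: "inv_into (carrier V) f w = v" if "v \<in> carrier V" "f v = w" for v w
    using that inj by auto
  show ?thesis
  proof (rule lin_homI)
    fix x y assume x: "x \<in> carrier W" and y: "y \<in> carrier W"
    have "inv_into (carrier V) f (x \<oplus>\<^bsub>W\<^esub> y) = inv_into (carrier V) f x \<oplus>\<^bsub>V\<^esub> inv_into (carrier V) f y"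
      by (rule eq) (use g[OF x] g[OF y] fl(3) in auto)
    moreover have "x \<oplus>\<^bsub>W\<^esub> y \<in> carrier W"
      using fl(1)[OF M.a_closed[OF g(1)[OF x] g(1)[OF y]]] fl(3)[OF g(1)[OF x] g(1)[OF y]] g(2)[OF x] g(2)[OF y] by simp
    ultimately show "restrict (inv_into (carrier V) f) (carrier W) (x \<oplus>\<^bsub>W\<^esub> y) =
        restrict (inv_into (carrier V) f) (carrier W) x \<oplus>\<^bsub>V\<^esub> restrict (inv_into (carrier V) f) (carrier W) y"
      using x y by simp
  next
    fix c x assume x: "x \<in> carrier W"
    have "inv_into (carrier V) f (c \<odot>\<^bsub>W\<^esub> x) = c \<odot>\<^bsub>V\<^esub> inv_into (carrier V) f x"
      by (rule eq) (use g[OF x] fl(4) in auto)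
    moreover have "c \<odot>\<^bsub>W\<^esub> x \<in> carrier W"
      using fl(1)[OF sc_closed[OF g(1)[OF x], of c]] fl(4)[OF g(1)[OF x], of c] g(2)[OF x] by simp
    ultimately show "restrict (inv_into (carrier V) f) (carrier W) (c \<odot>\<^bsub>W\<^esub> x) = c \<odot>\<^bsub>V\<^esub> restrict (inv_into (carrier V) f) (carrier W) x"
      using x by simp
  qed (use g in auto)
qed

lemma iso_arrow_Vect:
  fixes V W :: "('k::field, 'v) module"
  assumes V: "vectorspace class_ring V" and f: "f \<in> lin_hom V W" and bij: "bij_betw f (carrier V) (carrier W)"
  shows "iso_arrow Vect W V (restrict (inv_into (carrier V) f) (carrier W))"
proof -
  have inj: "inj_on f (carrier V)" and im: "f ` carrier V = carrier W" using bij by (auto simp: bij_betw_def)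
  have "compose (carrier W) f (restrict (inv_into (carrier V) f) (carrier W)) = restrict id (carrier W)"
    using im by (auto simp: compose_def fun_eq_iff f_inv_into_f)
  moreover have "compose (carrier V) (restrict (inv_into (carrier V) f) (carrier W)) f = restrict id (carrier V)"
    using inj im by (auto simp: compose_def fun_eq_iff)
  ultimately show ?thesis
    unfolding iso_arrow_def using lin_hom_inverse[OF assms] f by (auto simp: Vect_def)
qed

section \<open>Direct sums of the function module\<close>

text \<open>Scalars on a direct sum of copies of the twisted polynomial module, one copy for each
  element of \<open>'w\<close>. The copies at basis vectors of V will be used.\<close>

definition esc :: "'k::field_char_0 \<Rightarrow> ('w \<Rightarrow>\<^sub>0 (nat \<times> nat \<times> nat, 'k) mpoly) \<Rightarrow> ('w \<Rightarrow>\<^sub>0 (nat \<times> nat \<times> nat, 'k) mpoly)" where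
  "esc c F = Poly_Mapping.map (psc c) F"

definition etw :: "nat \<Rightarrow> nat \<Rightarrow> nat \<Rightarrow> ('w \<Rightarrow>\<^sub>0 (nat \<times> nat \<times> nat, 'k::field_char_0) mpoly) \<Rightarrow> ('w \<Rightarrow>\<^sub>0 (nat \<times> nat \<times> nat, 'k) mpoly)" where
  "etw N i j F = Poly_Mapping.map (tw N i j) F"

lemma lookup_esc: "Poly_Mapping.lookup (esc c F) b = psc c (Poly_Mapping.lookup F b)"
  by (simp add: esc_def map.rep_eq when_def psc_def)

lemma lookup_etw: "Poly_Mapping.lookup (etw N i j F) b = tw N i j (Poly_Mapping.lookup F b)"
  by (simp add: etw_def map.rep_eq when_def is_linear_zero[OF tw.e_lin])

interpretation etw: mir_ops "esc :: 'k::field_char_0 \<Rightarrow> ('w \<Rightarrow>\<^sub>0 _) \<Rightarrow> _" N "etw N" for N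
proof
  show "esc a (x + y) = esc a x + esc a y" for a :: 'k and x y :: "'w \<Rightarrow>\<^sub>0 (nat \<times> nat \<times> nat, 'k) mpoly"
    by (rule poly_mapping_eqI) (simp add: lookup_esc lookup_add tw.scale_right_distrib)
  show "esc (a + b) x = esc a x + esc b x" for a b :: 'k and x :: "'w \<Rightarrow>\<^sub>0 (nat \<times> nat \<times> nat, 'k) mpoly"
    by (rule poly_mapping_eqI) (simp add: lookup_esc lookup_add tw.scale_left_distrib)
  show "esc a (esc b x) = esc (a * b) x" for a b :: 'k and x :: "'w \<Rightarrow>\<^sub>0 (nat \<times> nat \<times> nat, 'k) mpoly"
    by (rule poly_mapping_eqI) (simp add: lookup_esc)
  show "esc 1 x = x" for x :: "'w \<Rightarrow>\<^sub>0 (nat \<times> nat \<times> nat, 'k) mpoly"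
    by (rule poly_mapping_eqI) (simp add: lookup_esc)
  show "is_linear (esc :: 'k \<Rightarrow> ('w \<Rightarrow>\<^sub>0 _) \<Rightarrow> _) esc (etw N i j)" for i j
    by (rule is_linearI; rule poly_mapping_eqI)
      (simp_all add: lookup_esc lookup_etw lookup_add is_linear_add[OF tw.e_lin] is_linear_scale[OF tw.e_lin])
  show "etw N k l (etw N i j w) = etw N i j (etw N k l w) + (if j = k then etw N i l w else 0) - (if l = i then etw N k j w else 0)"
    if "i < N" "Suc j < N" "k < N" "Suc l < N" for i j k l and w :: "'w \<Rightarrow>\<^sub>0 (nat \<times> nat \<times> nat, 'k) mpoly"
    by (rule poly_mapping_eqI) (simp add: lookup_etw lookup_add lookup_minus tw.bracket[OF that])
qed

text \<open>Families of constant functions supported in \<open>B\<close>. The constants are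
  Whittaker vectors in each copy, and for a basis \<open>B\<close> of V these families form a copy
  of V.\<close>

definition evac :: "'w set \<Rightarrow> ('w \<Rightarrow>\<^sub>0 (nat \<times> nat \<times> nat, 'k::field_char_0) mpoly) set" where
  "evac B = {F. \<forall>b. (b \<notin> B \<longrightarrow> Poly_Mapping.lookup F b = 0) \<and> Poly_Mapping.lookup F b \<in> range pconst}"

definition emb_coord :: "('w \<Rightarrow>\<^sub>0 'k::field_char_0) \<Rightarrow> ('w \<Rightarrow>\<^sub>0 (nat \<times> nat \<times> nat, 'k) mpoly)" where
  "emb_coord f = Poly_Mapping.map pconst f"

lemma lookup_emb_coord: "Poly_Mapping.lookup (emb_coord f) b = pconst (Poly_Mapping.lookup f b)"
  by (simp add: emb_coord_def map.rep_eq when_def pconst_0)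

lemma pconst_inj: "pconst a = pconst b \<Longrightarrow> a = b"
  by (metis lookup_single_eq pconst_def)

lemma emb_coord_bij: "bij_betw (emb_coord :: ('w \<Rightarrow>\<^sub>0 'k::field_char_0) \<Rightarrow> _) (supp_in B) (evac B)"
  unfolding bij_betw_def
proof
  show "inj_on (emb_coord :: ('w \<Rightarrow>\<^sub>0 'k) \<Rightarrow> _) (supp_in B)"
  proof (rule inj_onI)
    fix f g :: "'w \<Rightarrow>\<^sub>0 'k" assume "emb_coord f = emb_coord g"
    then have "pconst (Poly_Mapping.lookup f b) = (pconst (Poly_Mapping.lookup g b) :: (nat \<times> nat \<times> nat, 'k) mpoly)" for b
      by (metis lookup_emb_coord)
    then show "f = g" using pconst_inj by (intro poly_mapping_eqI) blast
  qed
  show "(emb_coord :: ('w \<Rightarrow>\<^sub>0 'k) \<Rightarrow> _) ` supp_in B = evac B"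
  proof
    show "(emb_coord :: ('w \<Rightarrow>\<^sub>0 'k) \<Rightarrow> _) ` supp_in B \<subseteq> evac B" by (auto simp: evac_def supp_in_iff lookup_emb_coord pconst_0)
    show "evac B \<subseteq> (emb_coord :: ('w \<Rightarrow>\<^sub>0 'k) \<Rightarrow> _) ` supp_in B"
    proof
      fix F :: "'w \<Rightarrow>\<^sub>0 (nat \<times> nat \<times> nat, 'k) mpoly" assume F: "F \<in> evac B"
      define f where "f = Poly_Mapping.map (\<lambda>p. Poly_Mapping.lookup p 0) F"
      have lf: "Poly_Mapping.lookup f b = Poly_Mapping.lookup (Poly_Mapping.lookup F b) 0" for b
        by (simp add: f_def map.rep_eq when_def)
      have "pconst (Poly_Mapping.lookup f b) = Poly_Mapping.lookup F b" for b
      proof -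
        obtain c where "Poly_Mapping.lookup F b = pconst c" using F by (auto simp: evac_def)
        then show ?thesis by (simp add: lf) (simp add: pconst_def)
      qed
      then have "F = emb_coord f" by (intro poly_mapping_eqI) (simp add: lookup_emb_coord)
      moreover have "f \<in> supp_in B" using F by (auto simp: supp_in_iff lf evac_def)
      ultimately show "F \<in> emb_coord ` supp_in B" by blast
    qed
  qed
qed

lemma emb_coord_lin: "emb_coord (f + g) = emb_coord f + emb_coord g" "emb_coord (fsc c f) = esc c (emb_coord f)"
  by (rule poly_mapping_eqI, simp add: lookup_emb_coord lookup_add lookup_esc pconst_add pconst_mult psc_def)+

lemma evac_image: "evac B = emb_coord ` supp_in B"
  using emb_coord_bij[of B] unfolding bij_betw_def by blast

lemma evac_sub: "is_subspace (esc :: 'k::field_char_0 \<Rightarrow> _) (evac B :: ('w \<Rightarrow>\<^sub>0 (nat \<times> nat \<times> nat, 'k) mpoly) set)"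
  unfolding is_subspace_def
proof (intro conjI ballI allI)
  show "0 \<in> (evac B :: ('w \<Rightarrow>\<^sub>0 (nat \<times> nat \<times> nat, 'k) mpoly) set)"
    using rangeI[of pconst 0] by (simp add: evac_def pconst_0)
  fix F :: "'w \<Rightarrow>\<^sub>0 (nat \<times> nat \<times> nat, 'k) mpoly" assume "F \<in> evac B"
  then obtain f where f: "f \<in> supp_in B" "F = emb_coord f" by (auto simp: evac_image)
  show "esc c F \<in> evac B" for c
    using fsc.sub_scale[OF supp_in_sub f(1)] by (simp add: f(2) evac_image flip: emb_coord_lin)
  fix G :: "'w \<Rightarrow>\<^sub>0 (nat \<times> nat \<times> nat, 'k) mpoly" assume "G \<in> evac B"
  then obtain g where g: "g \<in> supp_in B" "G = emb_coord g" by (auto simp: evac_image)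
  show "F + G \<in> evac B"
    using fsc.sub_add[OF supp_in_sub f(1) g(1)] by (simp add: f(2) g(2) evac_image flip: emb_coord_lin)
qed

lemma (in kspace) crd_bij: "bij_betw crd (carrier V) SV"
  unfolding bij_betw_def
proof
  show "inj_on crd (carrier V)" using crd_inj by (auto simp: inj_on_def)
  show "crd ` carrier V = SV"
  proof
    show "SV \<subseteq> crd ` carrier V"
    proof
      fix f assume "f \<in> SV"
      then show "f \<in> crd ` carrier V" using SV_cases[of f] by blast
    qed
  qed auto
qed

lemma psc_one: "psc c 1 = pconst c"
  by (simp add: psc_def)

lemma evac_vac: assumes "F \<in> evac B" "a \<in> etw.neg N" shows "etw.p N a F = 0"
proof (rule poly_mapping_eqI)
  fix b
  obtain c where c: "Poly_Mapping.lookup F b = pconst c" using assms by (auto simp: evac_def)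
  have "tw.p N a (psc c 1) = 0"
    using assms(2) by (simp add: tw_whittaker is_linear_scale[OF tw.p_lin])
  then have "tw.p N a (pconst c) = 0" by (simp only: psc_one)
  then show "Poly_Mapping.lookup (etw.p N a F) b = Poly_Mapping.lookup 0 b"
    using c by (simp add: etw.p_def tw.p_def lookup_minus lookup_etw split: if_splits)
qed

lemma evac_mod: "mir_mod esc N (etw N) (etw.gen N (evac B))"
proof
  show "etw.stable N (etw.gen N (evac B))" by (rule etw.stable_gen[OF evac_sub])
  show "\<exists>n. w \<in> etw.nil N n" if "w \<in> etw.gen N (evac B)" for w
  proof (rule etw.loc_nil_gen[OF _ that])
    fix x assume "x \<in> evac B"
    then have "x \<in> etw.nil N 1" by (simp add: etw.nil_Suc etw.nil_0 evac_vac)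
    then show "\<exists>n. x \<in> etw.nil N n" by blast
  qed
qed

text \<open>Passing to the submodule generated by the constants gives local nilpotency by
  \<open>loc_nil_gen\<close>, and then \<open>gen_inter_invs\<close> determines all of its Whittaker
  vectors.\<close>

lemma evac_invs: "etw.invs N (etw.gen N (evac B)) = evac B"
proof -
  interpret mir_mod esc N "etw N" "etw.gen N (evac B)" by (rule evac_mod)
  have "evac B \<subseteq> etw.invs N (etw.gen N (evac B))"
    using etw.gen_base evac_vac by (auto simp: etw.invs_def)
  then show ?thesis using gen_inter_invs[OF evac_sub] by (auto simp: etw.invs_def)
qed

unbundle cardinal_syntax

text \<open>A nonzero V is infinite because the field is, so the generated submodule is no larger
  than V and fits into its carrier. The zero space is separate: there the type may be finite, but
  the module is 0.\<close>

lemma evac_embedding: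
  fixes V :: "('k::field_char_0, 'w, 'm) module_scheme"
  assumes "vectorspace class_ring V"
  shows "\<exists>emb :: ('w \<Rightarrow>\<^sub>0 (nat \<times> nat \<times> nat, 'k) mpoly) \<Rightarrow> 'w. inj_on emb (etw.gen N (evac (kspace.bas V)))"
proof -
  interpret kspace V using assms by (rule kspaceI)
  let ?S = "etw.gen N (evac bas) :: ('w \<Rightarrow>\<^sub>0 (nat \<times> nat \<times> nat, 'k) mpoly) set"
  show ?thesis
  proof (cases "\<exists>v\<in>carrier V. v \<noteq> \<zero>\<^bsub>V\<^esub>")
    case False
    have "SV \<subseteq> {0}"
    proof
      fix f assume "f \<in> SV"
      then show "f \<in> {0}" using SV_cases[of f] False crd_zero by auto
    qed
    then have "evac bas \<subseteq> {0 :: 'w \<Rightarrow>\<^sub>0 (nat \<times> nat \<times> nat, 'k) mpoly}"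
      by (auto simp: evac_image SV_def lookup_emb_coord pconst_0 intro!: poly_mapping_eqI)
    moreover have "etw.stable N {0 :: 'w \<Rightarrow>\<^sub>0 (nat \<times> nat \<times> nat, 'k) mpoly}"
      by (auto simp: etw.stable_def is_subspace_def is_linear_zero[OF etw.e_lin])
    ultimately have "?S \<subseteq> {0}" using etw.gen_least by blast
    then have "inj_on (\<lambda>_. undefined) ?S" by (auto simp: inj_on_def)
    then show ?thesis by blast
  next
    case True
    then obtain v where v: "v \<in> carrier V" "v \<noteq> \<zero>\<^bsub>V\<^esub>" by blast
    have "inj (\<lambda>c. c \<odot>\<^bsub>V\<^esub> v)"
    proof (rule injI)
      fix a b assume "a \<odot>\<^bsub>V\<^esub> v = b \<odot>\<^bsub>V\<^esub> v"
      then have "fsc a (crd v) = fsc b (crd v)" using v by (metis crd_scale)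
      moreover have "crd v \<noteq> 0" using crd_eq_0 v by blast
      ultimately show "a = b" by simp
    qed
    then have "infinite (range (\<lambda>c. c \<odot>\<^bsub>V\<^esub> v))" using finite_imageD infinite_UNIV_char_0 by blast
    moreover have "range (\<lambda>c. c \<odot>\<^bsub>V\<^esub> v) \<subseteq> carrier V" using v by auto
    ultimately have infV: "infinite (carrier V)" using finite_subset by blast
    from crd_bij have bij: "bij_betw (emb_coord \<circ> crd) (carrier V) (evac bas)"
      using emb_coord_bij[of bas] by (auto simp: SV_def intro: bij_betw_trans)
    then have inf: "infinite (evac bas :: ('w \<Rightarrow>\<^sub>0 (nat \<times> nat \<times> nat, 'k) mpoly) set)" using infV bij_betw_finite by blast
    have "|?S| \<le>o |evac bas :: ('w \<Rightarrow>\<^sub>0 (nat \<times> nat \<times> nat, 'k) mpoly) set|"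
      using etw.card_gen[OF inf] etw.sub_zero[OF evac_sub] by blast
    moreover have "|evac bas :: ('w \<Rightarrow>\<^sub>0 (nat \<times> nat \<times> nat, 'k) mpoly) set| \<le>o |carrier V|"
      using bij_betw_inv_into[OF bij] card_of_ordLeq[of "evac bas" "carrier V"] by (auto simp: bij_betw_def)
    ultimately have "|?S| \<le>o |carrier V|" using ordLeq_transitive by blast
    then show ?thesis using card_of_ordLeq[of ?S "carrier V"] by auto
  qed
qed

unbundle no cardinal_syntax

lemma whittaker_essentially_surjective:
  fixes V :: "('k::field_char_0, 'w) module"
  assumes V: "vectorspace class_ring V"
  shows "\<exists>W :: ('k, ('k mat list \<Rightarrow> 'k) set, 'w) rmod. whittaker_module N W \<and> (\<exists>i. iso_arrow Vect (whittaker_vectors N W) V i)"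
proof -
  interpret kspace V using V by (rule kspaceI)
  let ?S = "etw.gen N (evac bas) :: ('w \<Rightarrow>\<^sub>0 (nat \<times> nat \<times> nat, 'k) mpoly) set"
  obtain emb :: "('w \<Rightarrow>\<^sub>0 (nat \<times> nat \<times> nat, 'k) mpoly) \<Rightarrow> 'w" where emb: "inj_on emb ?S"
    using evac_embedding[OF V, of N] by blast
  interpret mm: mir_mod esc N "etw N" ?S by (rule evac_mod)
  interpret R: realization esc N "etw N" ?S emb by unfold_locales (rule emb)
  have wv: "carrier (whittaker_vectors N R.RW) = emb ` evac bas" by (simp add: R.RW_invs evac_invs)
  have ES: "evac bas \<subseteq> ?S" by (rule etw.gen_base)
  define f where "f = restrict (\<lambda>v. emb (emb_coord (crd v))) (carrier V)"
  have ec: "emb_coord (crd v) \<in> evac bas" if "v \<in> carrier V" for v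
    using crd_SV[OF that] emb_coord_bij[of bas] by (auto simp: SV_def bij_betw_def)
  have "bij_betw (emb \<circ> (emb_coord \<circ> crd)) (carrier V) (emb ` evac bas)"
    by (rule bij_betw_trans[OF bij_betw_trans[OF crd_bij[unfolded SV_def] emb_coord_bij]])
      (use emb ES inj_on_subset in \<open>auto simp: bij_betw_def\<close>)
  then have bij: "bij_betw f (carrier V) (carrier (whittaker_vectors N R.RW))"
    unfolding wv by (rule bij_betw_cong[THEN iffD1, rotated]) (simp add: f_def)
  have lin: "f \<in> lin_hom V (whittaker_vectors N R.RW)"
  proof (rule lin_homI)
    show "f x \<in> carrier (whittaker_vectors N R.RW)" if "x \<in> carrier V" for x
      using that ec by (simp add: f_def wv)
    show "f \<in> extensional (carrier V)" by (simp add: f_def)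
    show "f (x \<oplus>\<^bsub>V\<^esub> y) = f x \<oplus>\<^bsub>whittaker_vectors N R.RW\<^esub> f y" if "x \<in> carrier V" "y \<in> carrier V" for x y
      using that ec[OF that(1)] ec[OF that(2)] ES
      by (simp add: f_def whittaker_vectors_simps R.RW_simps crd_add emb_coord_lin subset_iff)
    show "f (c \<odot>\<^bsub>V\<^esub> x) = c \<odot>\<^bsub>whittaker_vectors N R.RW\<^esub> f x" if "x \<in> carrier V" for x c
      using that ec[OF that] ES
      by (simp add: f_def whittaker_vectors_simps R.RW_simps crd_scale emb_coord_lin subset_iff)
  qed
  have "iso_arrow Vect (whittaker_vectors N R.RW) V (restrict (inv_into (carrier V) f) (carrier (whittaker_vectors N R.RW)))"
    by (rule iso_arrow_Vect[OF V lin bij])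
  then show ?thesis using R.RW_whittaker by blast
qed

theorem whittaker_equivalence:
  "equivalence_of_categories (Wh N :: (('k::field_char_0, ('k mat list \<Rightarrow> 'k) set, 'w) rmod, 'w \<Rightarrow> 'w) cat)
    Vect (whittaker_functor N)"
proof (rule equivalenceI[OF whittaker_is_functor])
  fix W X :: "('k, ('k mat list \<Rightarrow> 'k) set, 'w) rmod"
  assume "W \<in> Ob (Wh N)" "X \<in> Ob (Wh N)"
  then have w: "whit N W" "whit N X" by (simp_all add: Wh_def whit_def)
  show "f = g" if "f \<in> Hom (Wh N) W X" "g \<in> Hom (Wh N) W X"
    "far (whittaker_functor N) W X f = far (whittaker_functor N) W X g" for f g
  proof (rule whit_faithful[OF w])
    show "f \<in> rmod_hom (Um N) W X" "g \<in> rmod_hom (Um N) W X" using that by (simp_all add: Wh_def)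
    show "f x = g x" if "x \<in> carrier (whittaker_vectors N W)" for x
      using fun_cong[OF \<open>far (whittaker_functor N) W X f = far (whittaker_functor N) W X g\<close>, of x] that
      by (simp add: whittaker_functor_def)
  qed
  show "\<exists>f\<in>Hom (Wh N) W X. far (whittaker_functor N) W X f = h"
    if "h \<in> Hom Vect (fob (whittaker_functor N) W) (fob (whittaker_functor N) X)" for h
    using whit_full[OF w, of h] that by (simp add: Wh_def Vect_def whittaker_functor_def)
next
  fix V :: "('k, 'w) module" assume "V \<in> Ob Vect"
  then show "\<exists>W\<in>Ob (Wh N). \<exists>i. iso_arrow Vect (fob (whittaker_functor N) W) V i"
    using whittaker_essentially_surjective[of V N] by (auto simp: Vect_def Wh_def whittaker_functor_def)
qed

subsection \<open>Regular functions on the mirabolic group\<close>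

abbreviation rs :: "nat \<Rightarrow> ('k::field mat \<Rightarrow> 'k) \<Rightarrow> 'k mat \<Rightarrow> 'k" where
  "rs N f \<equiv> restrict f (mirabolic_group N)"

lemma group_one: "1\<^sub>m N \<in> (mirabolic_group N :: 'k::field mat set)"
  by (auto simp: mirabolic_group_def)

lemma group_carrier: "g \<in> mirabolic_group N \<Longrightarrow> g \<in> carrier_mat N N"
  by (simp add: mirabolic_group_def)

lemma mat_prod_index: "g \<in> carrier_mat N N \<Longrightarrow> h \<in> carrier_mat N N \<Longrightarrow> i < N \<Longrightarrow> j < N \<Longrightarrow>
    (g * h) $$ (i, j) = (\<Sum>k<N. g $$ (i, k) * h $$ (k, j))"
  by (simp add: scalar_prod_def atLeast0LessThan)

lemma group_mult: "g \<in> mirabolic_group N \<Longrightarrow> h \<in> mirabolic_group N \<Longrightarrow> g * h \<in> mirabolic_group N"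
proof -
  assume g: "g \<in> mirabolic_group N" and h: "h \<in> mirabolic_group N"
  have gc: "g \<in> carrier_mat N N" "h \<in> carrier_mat N N" using g h group_carrier by auto
  have "(g * h) $$ (i, N - 1) = (if i = N - 1 then 1 else 0)" if i: "i < N" for i
  proof -
    have "(g * h) $$ (i, N - 1) = (\<Sum>k<N. if k = N - 1 then g $$ (i, N - 1) else 0)"
    proof -
      have "h $$ (k, N - 1) = (if k = N - 1 then 1 else 0)" if "k < N" for k
        using h that by (simp add: mirabolic_group_def)
      moreover have "N - 1 < N" using i by simp
      ultimately show ?thesis unfolding mat_prod_index[OF gc i \<open>N - 1 < N\<close>]
        by (intro sum.cong) simp_all
    qed
    also have "\<dots> = g $$ (i, N - 1)" using i by simp
    finally show ?thesis using g i by (simp add: mirabolic_group_def)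
  qed
  then show ?thesis using g h gc by (simp add: mirabolic_group_def det_mult[OF gc])
qed

lemma regular_ext: "p \<in> regular_funs N \<Longrightarrow> p \<in> extensional (mirabolic_group N)"
  by (induction rule: regular_funs.induct) (simp_all only: restrict_extensional)

lemma rs_regular: "p \<in> regular_funs N \<Longrightarrow> rs N p = p"
  by (rule extensional_restrict[OF regular_ext])

text \<open>Interpreted for the regular functions and for those on which two point derivations
  agree; by its expansion over permutations the determinant belongs to both.\<close>

locale fun_algebra =
  fixes N :: nat and T :: "('k::field mat \<Rightarrow> 'k) set"
  assumes const: "rs N (\<lambda>g. c) \<in> T" and entry: "i < N \<Longrightarrow> j < N \<Longrightarrow> rs N (\<lambda>g. g $$ (i, j)) \<in> T"
    and add: "rs N f \<in> T \<Longrightarrow> rs N f' \<in> T \<Longrightarrow> rs N (\<lambda>g. f g + f' g) \<in> T"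
    and mult: "rs N f \<in> T \<Longrightarrow> rs N f' \<in> T \<Longrightarrow> rs N (\<lambda>g. f g * f' g) \<in> T"
begin

lemma sum: "(\<And>i. i \<in> A \<Longrightarrow> rs N (f i) \<in> T) \<Longrightarrow> rs N (\<lambda>g. \<Sum>i\<in>A. f i g) \<in> T"
  by (induction A rule: infinite_finite_induct) (auto intro: const add)

lemma prod: "(\<And>i. i \<in> A \<Longrightarrow> rs N (f i) \<in> T) \<Longrightarrow> rs N (\<lambda>g. \<Prod>i\<in>A. f i g) \<in> T"
  by (induction A rule: infinite_finite_induct) (auto intro: const mult)

lemma det: "rs N det \<in> T"
proof -
  have "rs N (\<lambda>g :: 'k mat. \<Sum>p | p permutes {0..<N}. of_int (sign p) * (\<Prod>i = 0..<N. g $$ (i, p i))) \<in> T"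
  proof (intro sum mult const prod entry)
    show "i < N" if "i \<in> {0..<N}" for i using that by simp
    show "p i < N" if "p \<in> {p. p permutes {0..<N}}" "i \<in> {0..<N}" for p i
      using that permutes_in_image[of p "{0..<N}" i] by auto
  qed
  moreover have "rs N (\<lambda>g :: 'k mat. \<Sum>p | p permutes {0..<N}. of_int (sign p) * (\<Prod>i = 0..<N. g $$ (i, p i))) = rs N det"
    by (rule restrict_ext) (simp add: det_def'[OF group_carrier])
  ultimately show ?thesis by (simp only:)
qed

end

lemma regular_rs_add: "rs N f \<in> regular_funs N \<Longrightarrow> rs N f' \<in> regular_funs N \<Longrightarrow> rs N (\<lambda>g. f g + f' g) \<in> regular_funs N"
  using regular_funs.add[of "rs N f" N "rs N f'"] by (simp cong: restrict_cong)

lemma regular_rs_mult: "rs N f \<in> regular_funs N \<Longrightarrow> rs N f' \<in> regular_funs N \<Longrightarrow> rs N (\<lambda>g. f g * f' g) \<in> regular_funs N"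
  using regular_funs.mult[of "rs N f" N "rs N f'"] by (simp cong: restrict_cong)

interpretation reg: fun_algebra N "regular_funs N" for N
  by unfold_locales (auto intro: regular_funs.const regular_funs.entry regular_rs_add regular_rs_mult)

context
  fixes N :: nat and \<xi> :: "'k::field_char_0 mat" and D
  assumes D: "point_derivation N \<xi> D"
begin

lemma pd_const: "D (rs N (\<lambda>g. c)) = 0"
  using D by (simp add: point_derivation_def)

lemma pd_entry: "i < N \<Longrightarrow> j < N \<Longrightarrow> D (rs N (\<lambda>g. g $$ (i, j))) = \<xi> $$ (i, j)"
  using D by (simp add: point_derivation_def)

lemma pd_add: "rs N f \<in> regular_funs N \<Longrightarrow> rs N f' \<in> regular_funs N \<Longrightarrow> D (rs N (\<lambda>g. f g + f' g)) = D (rs N f) + D (rs N f')"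
proof -
  assume *: "rs N f \<in> regular_funs N" "rs N f' \<in> regular_funs N"
  then have "D (rs N (\<lambda>g. rs N f g + rs N f' g)) = D (rs N f) + D (rs N f')"
    using D unfolding point_derivation_def by blast
  moreover have "rs N (\<lambda>g. rs N f g + rs N f' g) = rs N (\<lambda>g. f g + f' g)" by (rule restrict_ext) simp
  ultimately show ?thesis by simp
qed

lemma pd_mult: "rs N f \<in> regular_funs N \<Longrightarrow> rs N f' \<in> regular_funs N \<Longrightarrow>
    D (rs N (\<lambda>g. f g * f' g)) = D (rs N f) * f' (1\<^sub>m N) + f (1\<^sub>m N) * D (rs N f')"
proof -
  assume *: "rs N f \<in> regular_funs N" "rs N f' \<in> regular_funs N"
  then have "D (rs N (\<lambda>g. rs N f g * rs N f' g)) = D (rs N f) * rs N f' (1\<^sub>m N) + rs N f (1\<^sub>m N) * D (rs N f')"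
    using D unfolding point_derivation_def by blast
  moreover have "rs N (\<lambda>g. rs N f g * rs N f' g) = rs N (\<lambda>g. f g * f' g)" by (rule restrict_ext) simp
  ultimately show ?thesis using group_one[of N, where 'k = 'k] by simp
qed

lemma pd_cmult: "rs N f \<in> regular_funs N \<Longrightarrow> D (rs N (\<lambda>g. c * f g)) = c * D (rs N f)"
  using pd_mult[of "\<lambda>_. c" f, OF regular_funs.const] by (simp only: pd_const mult_zero_left add_0)

lemma pd_sum: "(\<And>i. i \<in> A \<Longrightarrow> rs N (f i) \<in> regular_funs N) \<Longrightarrow> D (rs N (\<lambda>g. \<Sum>i\<in>A. f i g)) = (\<Sum>i\<in>A. D (rs N (f i)))"
proof (induction A rule: infinite_finite_induct)
  case (insert x A)
  have "rs N (\<lambda>g. \<Sum>i\<in>A. f i g) \<in> regular_funs N" by (intro reg.sum insert.prems) simp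
  then have "D (rs N (\<lambda>g. f x g + (\<Sum>i\<in>A. f i g))) = D (rs N (f x)) + D (rs N (\<lambda>g. \<Sum>i\<in>A. f i g))"
    by (intro pd_add insert.prems) simp_all
  then show ?case using insert.hyps insert.IH[OF insert.prems] by (simp only: sum.insert insert_iff simp_thms)
qed (simp_all add: pd_const)

text \<open>Differentiate the constant function det times its inverse; at the identity both factors
  are 1.\<close>

lemma pd_inv_det: "D (rs N (\<lambda>g. inverse (det g))) = - D (rs N det)"
proof -
  have "D (rs N (\<lambda>g. det g * inverse (det g))) = D (rs N det) + D (rs N (\<lambda>g. inverse (det g)))"
    using pd_mult[OF reg.det regular_funs.inv_det] by simp
  moreover have "rs N (\<lambda>g. det g * inverse (det g)) = rs N (\<lambda>g. 1 :: 'k)"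
    by (rule restrict_ext) (simp add: mirabolic_group_def)
  ultimately show ?thesis using pd_const[of 1] by (simp add: eq_neg_iff_add_eq_0 add.commute)
qed

end

text \<open>The value on the inverse determinant is fixed by the value on the determinant, and this
  is a polynomial in the entries.\<close>

lemma point_derivation_unique:
  assumes D: "point_derivation N \<xi> D" and D': "point_derivation N \<xi> D'" and "p \<in> regular_funs N"
  shows "D p = (D' p :: 'k::field_char_0)"
proof -
  interpret T: fun_algebra N "{p \<in> regular_funs N. D p = D' p}"
  proof unfold_locales
    show "rs N (\<lambda>g. c) \<in> {p \<in> regular_funs N. D p = D' p}" for c
      by (simp only: mem_Collect_eq pd_const[OF D] pd_const[OF D'] regular_funs.const)
    show "rs N (\<lambda>g. g $$ (i, j)) \<in> {p \<in> regular_funs N. D p = D' p}" if "i < N" "j < N" for i j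
      using regular_funs.entry[OF that] that by (simp add: pd_entry[OF D] pd_entry[OF D'])
    show "rs N (\<lambda>g. f g + f' g) \<in> {p \<in> regular_funs N. D p = D' p}"
      if "rs N f \<in> {p \<in> regular_funs N. D p = D' p}" "rs N f' \<in> {p \<in> regular_funs N. D p = D' p}" for f f'
      using that regular_rs_add[of f N f'] by (simp add: pd_add[OF D] pd_add[OF D'])
    show "rs N (\<lambda>g. f g * f' g) \<in> {p \<in> regular_funs N. D p = D' p}"
      if "rs N f \<in> {p \<in> regular_funs N. D p = D' p}" "rs N f' \<in> {p \<in> regular_funs N. D p = D' p}" for f f'
      using that regular_rs_mult[of f N f'] by (simp add: pd_mult[OF D] pd_mult[OF D'])
  qed
  show ?thesis using assms(3)
  proof induction
    case (const c) then show ?case by (simp only: pd_const[OF D] pd_const[OF D'])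
  next
    case (entry i j) then show ?case by (simp only: pd_entry[OF D] pd_entry[OF D'])
  next
    case inv_det then show ?case using T.det by (simp only: pd_inv_det[OF D] pd_inv_det[OF D'] mem_Collect_eq)
  next
    case (add p q)
    then show ?case using pd_add[OF D, of p q] pd_add[OF D', of p q] by (simp only: rs_regular)
  next
    case (mult p q)
    then show ?case using pd_mult[OF D, of p q] pd_mult[OF D', of p q] by (simp only: rs_regular)
  qed
qed

subsection \<open>Existence of tangent vectors\<close>

text \<open>Along the line \<open>1 + \<epsilon> \<xi>\<close> a regular function is a rational function \<open>a / b\<close> of \<open>\<epsilon>\<close> without
  pole at 0, and the tangent vector is its derivative.\<close>

definition line :: "nat \<Rightarrow> 'k::field mat \<Rightarrow> 'k \<Rightarrow> 'k mat" where "line N \<xi> t = 1\<^sub>m N + t \<cdot>\<^sub>m \<xi>"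

text \<open>The fraction \<open>a / b\<close> represents \<open>p\<close> along the line. Where
  \<open>b\<close> does not vanish the line has to stay inside the group, since \<open>p\<close> has
  no meaning outside.\<close>

definition germ :: "nat \<Rightarrow> 'k::field mat \<Rightarrow> ('k mat \<Rightarrow> 'k) \<Rightarrow> 'k poly \<Rightarrow> 'k poly \<Rightarrow> bool" where
  "germ N \<xi> p a b \<longleftrightarrow> poly b 0 \<noteq> 0 \<and>
    (\<forall>t. poly b t \<noteq> 0 \<longrightarrow> line N \<xi> t \<in> mirabolic_group N \<and> p (line N \<xi> t) * poly b t = poly a t)"

definition germ_deriv :: "'k::field_char_0 poly \<Rightarrow> 'k poly \<Rightarrow> 'k" where
  "germ_deriv a b = (poly (pderiv a) 0 * poly b 0 - poly a 0 * poly (pderiv b) 0) / (poly b 0)\<^sup>2"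

lemma line_det: assumes "\<xi> \<in> carrier_mat N N" shows "\<exists>d. \<forall>t. poly d t = det (line N \<xi> t)"
proof -
  define P where "P = mat N N (\<lambda>(i, j). [: (1\<^sub>m N :: 'a mat) $$ (i, j), \<xi> $$ (i, j) :])"
  have "poly (det P) t = det (line N \<xi> t)" for t
  proof -
    interpret comm_ring_hom "\<lambda>p :: 'a poly. poly p t" by unfold_locales auto
    have "map_mat (\<lambda>p. poly p t) P = line N \<xi> t"
      using assms by (intro eq_matI) (auto simp: P_def line_def)
    then show ?thesis using hom_det[of P] by simp
  qed
  then show ?thesis by blast
qed

text \<open>Over an infinite field two fractions that agree where both are defined satisfy
  \<open>a * b' = a' * b\<close> as polynomials. Comparing values and first derivatives at 0 gives
  the claim.\<close>

lemma germ_unique: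
  fixes \<xi> :: "'k::field_char_0 mat"
  assumes "germ N \<xi> p a b" "germ N \<xi> p a' b'" shows "germ_deriv a b = germ_deriv a' b'"
proof -
  \<comment> \<open>The factor \<open>b * b'\<close> makes the expression vanish also at the zeros
    of the denominators.\<close>
  have "poly ((a * b' - a' * b) * (b * b')) t = 0" for t
  proof (cases "poly b t = 0 \<or> poly b' t = 0")
    case False
    then have "p (line N \<xi> t) * poly b t = poly a t" "p (line N \<xi> t) * poly b' t = poly a' t"
      using assms by (auto simp: germ_def)
    then show ?thesis by (simp flip: \<open>p (line N \<xi> t) * poly b t = poly a t\<close> \<open>p (line N \<xi> t) * poly b' t = poly a' t\<close>)
  qed auto
  then have "(a * b' - a' * b) * (b * b') = 0" by (simp only: poly_all_0_iff_0[symmetric]) simp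
  moreover have "b \<noteq> 0" "b' \<noteq> 0" using assms by (auto simp: germ_def)
  ultimately have eq: "a * b' = a' * b" by simp
  have b: "poly b 0 \<noteq> 0" "poly b' 0 \<noteq> 0" using assms by (auto simp: germ_def)
  have "poly a 0 * poly b' 0 = poly a' 0 * poly b 0" using arg_cong[OF eq, of "\<lambda>p. poly p 0"] by simp
  then have v: "poly a' 0 = poly a 0 * poly b' 0 / poly b 0" using b by (simp add: field_simps)
  have "poly a 0 * poly (pderiv b') 0 + poly b' 0 * poly (pderiv a) 0 = poly a' 0 * poly (pderiv b) 0 + poly b 0 * poly (pderiv a') 0"
    using arg_cong[OF eq, of "\<lambda>p. poly (pderiv p) 0"] by (simp add: pderiv_mult)
  then have d: "poly (pderiv a') 0 = (poly a 0 * poly (pderiv b') 0 + poly b' 0 * poly (pderiv a) 0 - poly a' 0 * poly (pderiv b) 0) / poly b 0"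
    using b by (simp add: field_simps)
  show ?thesis unfolding germ_deriv_def d v using b by (simp add: field_simps power2_eq_square)
qed

text \<open>The determinant along the line serves as denominator: where it is nonzero the line lies
  in the group, and at 0 it equals 1.\<close>

lemma germ_const_like:
  assumes "\<xi> \<in> carrier (mirabolic_lie N)" "\<And>t. poly d t = det (line N \<xi> t)" "N \<ge> 1"
    and "\<And>t. line N \<xi> t \<in> mirabolic_group N \<Longrightarrow> f (line N \<xi> t) * poly d t = poly a t"
  shows "germ N \<xi> (rs N f) a d"
proof -
  have c: "line N \<xi> t \<in> carrier_mat N N" for t using assms(1) by (simp add: line_def mirabolic_carrier)
  have g: "line N \<xi> t \<in> mirabolic_group N" if "poly d t \<noteq> 0" for t
    using that assms(1,3) c[of t] by (auto simp: mirabolic_group_def assms(2) line_def mirabolic_carrier)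
  have "0 \<cdot>\<^sub>m \<xi> = 0\<^sub>m N N" using assms(1) by (intro eq_matI) (auto simp: mirabolic_carrier)
  then have "line N \<xi> 0 = 1\<^sub>m N" by (simp add: line_def)
  then have "poly d 0 \<noteq> 0" by (simp add: assms(2))
  then show ?thesis using g assms(4) by (simp add: germ_def)
qed

lemma germ_add:
  assumes "germ N \<xi> p a b" "germ N \<xi> q a' b'"
  shows "germ N \<xi> (rs N (\<lambda>g. p g + q g)) (a * b' + a' * b) (b * b')"
proof -
  have "(p (line N \<xi> t) + q (line N \<xi> t)) * poly (b * b') t = poly (a * b' + a' * b) t"
    if "p (line N \<xi> t) * poly b t = poly a t" "q (line N \<xi> t) * poly b' t = poly a' t" for t
    by (simp add: algebra_simps flip: that)
  then show ?thesis using assms by (simp add: germ_def)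
qed

lemma germ_mult:
  assumes "germ N \<xi> p a b" "germ N \<xi> q a' b'"
  shows "germ N \<xi> (rs N (\<lambda>g. p g * q g)) (a * a') (b * b')"
proof -
  have "p (line N \<xi> t) * q (line N \<xi> t) * poly (b * b') t = poly (a * a') t"
    if "p (line N \<xi> t) * poly b t = poly a t" "q (line N \<xi> t) * poly b' t = poly a' t" for t
    by (simp flip: that)
  then show ?thesis using assms by (simp add: germ_def)
qed

lemma germ_exists:
  assumes \<xi>: "\<xi> \<in> carrier (mirabolic_lie N)" and N: "N \<ge> 1" and "p \<in> regular_funs N"
  shows "\<exists>a b. germ N \<xi> p a b"
proof -
  have c: "\<xi> \<in> carrier_mat N N" using \<xi> by (simp add: mirabolic_carrier)
  obtain d where d: "\<And>t. poly d t = det (line N \<xi> t)" using line_det[OF c] by blast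
  note gc = germ_const_like[OF \<xi> d N]
  show ?thesis using assms(3)
  proof induction
    case (const c) show ?case by (intro exI, rule gc[of _ "Polynomial.smult c d"]) simp
  next
    case (entry i j)
    have "germ N \<xi> (rs N (\<lambda>g. g $$ (i, j))) ([: (1\<^sub>m N) $$ (i, j), \<xi> $$ (i, j) :] * d) d"
      using entry c by (intro gc) (auto simp: line_def algebra_simps)
    then show ?case by blast
  next
    case inv_det
    have "germ N \<xi> (rs N (\<lambda>g. inverse (det g))) 1 d" by (rule gc) (auto simp: d mirabolic_group_def)
    then show ?case by blast
  next
    case (add p q)
    then obtain a b a' b' where "germ N \<xi> p a b" "germ N \<xi> q a' b'" by blast
    then have "germ N \<xi> (rs N (\<lambda>g. p g + q g)) (a * b' + a' * b) (b * b')"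
      by (rule germ_add)
    then show ?case by blast
  next
    case (mult p q)
    then obtain a b a' b' where "germ N \<xi> p a b" "germ N \<xi> q a' b'" by blast
    then have "germ N \<xi> (rs N (\<lambda>g. p g * q g)) (a * a') (b * b')"
      by (rule germ_mult)
    then show ?case by blast
  qed
qed

definition line_deriv :: "nat \<Rightarrow> 'k::field_char_0 mat \<Rightarrow> ('k mat \<Rightarrow> 'k) \<Rightarrow> 'k" where
  "line_deriv N \<xi> p = (THE c. \<exists>a b. germ N \<xi> p a b \<and> c = germ_deriv a b)"

lemma line_deriv_eq: "germ N \<xi> p a b \<Longrightarrow> line_deriv N \<xi> p = germ_deriv a b"
  unfolding line_deriv_def using germ_unique by blast

lemma line_deriv_pd:
  assumes \<xi>: "\<xi> \<in> carrier (mirabolic_lie N)" and N: "N \<ge> 1"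
  shows "point_derivation N \<xi> (line_deriv N (\<xi> :: 'k::field_char_0 mat))"
proof -
  have c: "\<xi> \<in> carrier_mat N N" using \<xi> by (simp add: mirabolic_carrier)
  obtain d where d: "\<And>t. poly d t = det (line N \<xi> t)" using line_det[OF c] by blast
  note gc = germ_const_like[OF \<xi> d N]
  have z: "0 \<cdot>\<^sub>m \<xi> = 0\<^sub>m N N" using c by (intro eq_matI) auto
  then have l0: "line N \<xi> 0 = 1\<^sub>m N" by (simp add: line_def)
  have val: "p (1\<^sub>m N) = poly a 0 / poly b 0" if "germ N \<xi> p a b" for p :: "'k mat \<Rightarrow> 'k" and a b
    using that l0 by (auto simp: germ_def field_simps)
  have d0: "poly d 0 \<noteq> 0" by (simp add: d l0)
  show ?thesis unfolding point_derivation_def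
  proof (intro conjI allI ballI impI)
    fix e
    have "germ N \<xi> (rs N (\<lambda>g. e)) (Polynomial.smult e d) d" by (rule gc) simp
    then show "line_deriv N \<xi> (rs N (\<lambda>g. e)) = 0"
      by (simp add: line_deriv_eq germ_deriv_def pderiv_smult)
  next
    fix i j assume ij: "i < N" "j < N"
    have "germ N \<xi> (rs N (\<lambda>g. g $$ (i, j))) ([: (1\<^sub>m N) $$ (i, j), \<xi> $$ (i, j) :] * d) d"
      using ij c by (intro gc) (auto simp: line_def algebra_simps)
    then show "line_deriv N \<xi> (rs N (\<lambda>g. g $$ (i, j))) = \<xi> $$ (i, j)"
      using d0 by (simp only: line_deriv_eq germ_deriv_def pderiv_mult)
        (simp add: pderiv_pCons power2_eq_square field_simps)
  next
    fix p q :: "'k mat \<Rightarrow> 'k" assume "p \<in> regular_funs N" "q \<in> regular_funs N"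
    then obtain a b a' b' where g: "germ N \<xi> p a b" "germ N \<xi> q a' b'" using germ_exists[OF \<xi> N] by blast
    have b: "poly b 0 \<noteq> 0" "poly b' 0 \<noteq> 0" using g by (auto simp: germ_def)
    have "germ N \<xi> (rs N (\<lambda>g. p g + q g)) (a * b' + a' * b) (b * b')"
      using g by (rule germ_add)
    then show "line_deriv N \<xi> (rs N (\<lambda>g. p g + q g)) = line_deriv N \<xi> p + line_deriv N \<xi> q"
      using b by (simp add: line_deriv_eq[OF g(1)] line_deriv_eq[OF g(2)] line_deriv_eq germ_deriv_def pderiv_mult pderiv_add)
        (simp add: field_simps power2_eq_square)
    have "germ N \<xi> (rs N (\<lambda>g. p g * q g)) (a * a') (b * b')"
      using g by (rule germ_mult)
    then show "line_deriv N \<xi> (rs N (\<lambda>g. p g * q g)) = line_deriv N \<xi> p * q (1\<^sub>m N) + p (1\<^sub>m N) * line_deriv N \<xi> q"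
      using b by (simp add: line_deriv_eq[OF g(1)] line_deriv_eq[OF g(2)] line_deriv_eq germ_deriv_def pderiv_mult val[OF g(1)] val[OF g(2)])
        (simp add: field_simps power2_eq_square)
  qed
qed

text \<open>The derivative along the line witnesses existence, so the choice in
  \<open>tangent\<close> is a point derivation; by uniqueness it is the same on regular functions
  for every choice.\<close>

lemma tangent_pd:
  assumes "\<xi> \<in> carrier (mirabolic_lie N :: ('k::field_char_0, 'k mat) lie_alg)" "N \<ge> 1" shows "point_derivation N \<xi> (tangent N \<xi>)"
  unfolding tangent_def by (rule someI[where P = "point_derivation N \<xi>", OF line_deriv_pd[OF assms]])

lemma tangent_add:
  assumes "\<xi> \<in> carrier (mirabolic_lie N :: ('k::field_char_0, 'k mat) lie_alg)" "\<eta> \<in> carrier (mirabolic_lie N)" "N \<ge> 1" "p \<in> regular_funs N"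
  shows "tangent N (\<xi> + \<eta>) p = tangent N \<xi> p + tangent N \<eta> p"
proof -
  note D = tangent_pd[OF assms(1,3)] and D' = tangent_pd[OF assms(2,3)]
  have s: "\<xi> + \<eta> \<in> carrier (mirabolic_lie N)" using ml.L_add[OF assms(1,2)] by (simp add: mirabolic_simps)
  have "point_derivation N (\<xi> + \<eta>) (\<lambda>p. tangent N \<xi> p + tangent N \<eta> p)"
    using D D' assms(1,2) unfolding point_derivation_def by (auto simp: mirabolic_carrier algebra_simps)
  from point_derivation_unique[OF tangent_pd[OF s assms(3)] this assms(4)] show ?thesis .
qed

lemma tangent_smult:
  assumes "\<xi> \<in> carrier (mirabolic_lie N :: ('k::field_char_0, 'k mat) lie_alg)" "N \<ge> 1" "p \<in> regular_funs N"
  shows "tangent N (c \<cdot>\<^sub>m \<xi>) p = c * tangent N \<xi> p"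
proof -
  note D = tangent_pd[OF assms(1,2)]
  have s: "c \<cdot>\<^sub>m \<xi> \<in> carrier (mirabolic_lie N)" using ml.L_smult[OF assms(1)] by (simp add: mirabolic_simps)
  have "point_derivation N (c \<cdot>\<^sub>m \<xi>) (\<lambda>p. c * tangent N \<xi> p)"
    using D assms(1) unfolding point_derivation_def by (auto simp: mirabolic_carrier algebra_simps)
  from point_derivation_unique[OF tangent_pd[OF s assms(2)] this assms(3)] show ?thesis .
qed

text \<open>For \<open>x\<close> in n_- the matrices 1 + t x are lower unitriangular, so the
  determinant is constant along the line.\<close>

lemma tangent_det: 
  assumes x: "x \<in> n_minus N" and N: "N \<ge> 1" shows "tangent N x (rs N det) = (0 :: 'k::field_char_0)"
proof -
  have xm: "x \<in> carrier (mirabolic_lie N)" by (rule n_minus_mirabolic[OF x])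
  have xc: "x \<in> carrier_mat N N" using x by (simp add: n_minus_def)
  have det: "det (line N x t) = 1" for t
  proof -
    have "det (line N x t) = prod_list (diag_mat (line N x t))"
      by (rule det_lower_triangular[of N]) (use x xc in \<open>auto simp: line_def n_minus_def\<close>)
    also have "diag_mat (line N x t) = map (\<lambda>i. 1) [0..<N]"
      using x xc by (auto simp: diag_mat_def line_def n_minus_def)
    finally show ?thesis by (simp add: prod_list_replicate map_replicate_const)
  qed
  have "germ N x (rs N det) 1 1" by (rule germ_const_like[OF xm _ N]) (simp_all add: det)
  then have "line_deriv N x (rs N det) = 0" by (simp add: line_deriv_eq germ_deriv_def)
  then show ?thesis
    using point_derivation_unique[OF tangent_pd[OF xm N] line_deriv_pd[OF xm N] reg.det] by simp
qed

subsection \<open>Differentiated right translation\<close>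

definition rt :: "nat \<Rightarrow> 'k::field mat \<Rightarrow> ('k mat \<Rightarrow> 'k) \<Rightarrow> 'k mat \<Rightarrow> 'k" where
  "rt N g p = rs N (\<lambda>h. p (g * h))"

text \<open>The left-invariant vector field of \<eta>: at \<open>g\<close> it differentiates the
  function that sends \<open>h\<close> to \<open>p (g * h)\<close> at the identity.\<close>

definition rd :: "nat \<Rightarrow> 'k::field_char_0 mat \<Rightarrow> ('k mat \<Rightarrow> 'k) \<Rightarrow> 'k mat \<Rightarrow> 'k" where
  "rd N \<eta> p = rs N (\<lambda>g. tangent N \<eta> (rt N g p))"

lemma rt_rs: "g \<in> mirabolic_group N \<Longrightarrow> rt N g (rs N f) = rs N (\<lambda>h. f (g * h))"
  unfolding rt_def by (rule restrict_ext) (simp add: group_mult)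

lemma rt_entry: "g \<in> mirabolic_group N \<Longrightarrow> i < N \<Longrightarrow> j < N \<Longrightarrow>
    rt N g (rs N (\<lambda>g. g $$ (i, j))) = rs N (\<lambda>h. \<Sum>k<N. g $$ (i, k) * h $$ (k, j))"
  unfolding rt_def by (rule restrict_ext) (simp add: group_mult mat_prod_index[OF group_carrier group_carrier])

lemma rt_inv_det: "g \<in> mirabolic_group N \<Longrightarrow>
    rt N g (rs N (\<lambda>g. inverse (det g))) = rs N (\<lambda>h. inverse (det g) * inverse (det h))"
  unfolding rt_def by (rule restrict_ext) (simp add: group_mult det_mult[OF group_carrier group_carrier])

lemma rt_add: "g \<in> mirabolic_group N \<Longrightarrow> rt N g (rs N (\<lambda>g. p g + q g)) = rs N (\<lambda>h. rt N g p h + rt N g q h)"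
  unfolding rt_def by (rule restrict_ext) (simp add: group_mult)

lemma rt_mult: "g \<in> mirabolic_group N \<Longrightarrow> rt N g (rs N (\<lambda>g. p g * q g)) = rs N (\<lambda>h. rt N g p h * rt N g q h)"
  unfolding rt_def by (rule restrict_ext) (simp add: group_mult)

lemma rt_regular: assumes "g \<in> mirabolic_group N" "p \<in> regular_funs N" shows "rt N g p \<in> regular_funs N"
  using assms(2)
proof induction
  case (const c) show ?case unfolding rt_rs[OF assms(1)] by (rule regular_funs.const)
next
  case (entry i j) then show ?case unfolding rt_entry[OF assms(1) entry]
    by (intro reg.sum regular_rs_mult regular_funs.const regular_funs.entry) auto
next
  case inv_det show ?case unfolding rt_inv_det[OF assms(1)]
    by (intro regular_rs_mult regular_funs.const regular_funs.inv_det)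
next
  case (add p q) then show ?case unfolding rt_add[OF assms(1)] by (intro regular_funs.add)
next
  case (mult p q) then show ?case unfolding rt_mult[OF assms(1)] by (intro regular_funs.mult)
qed

lemma rt_one_arg: "g \<in> mirabolic_group N \<Longrightarrow> rt N g p (1\<^sub>m N) = p g"
  using group_carrier[of g N] by (simp add: rt_def group_one)

lemma rt_one: "p \<in> regular_funs N \<Longrightarrow> rt N (1\<^sub>m N) p = p"
proof -
  assume p: "p \<in> regular_funs N"
  have "rt N (1\<^sub>m N) p = rs N p" unfolding rt_def by (rule restrict_ext) (simp add: left_mult_one_mat[OF group_carrier])
  then show ?thesis using p by (simp only: rs_regular)
qed

lemma rd_one: "p \<in> regular_funs N \<Longrightarrow> rd N \<eta> p (1\<^sub>m N) = tangent N \<eta> p"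
  by (simp add: rd_def group_one rt_one)

locale tangent_vector =
  fixes N :: nat and \<eta> :: "'k::field_char_0 mat"
  assumes N: "N \<ge> 1" and \<eta>: "\<eta> \<in> carrier (mirabolic_lie N)"
begin

lemmas pd = tangent_pd[OF \<eta> N]
lemmas t_const = pd_const[OF pd] and t_entry = pd_entry[OF pd] and t_add = pd_add[OF pd] and t_mult = pd_mult[OF pd]
  and t_cmult = pd_cmult[OF pd] and t_sum = pd_sum[OF pd] and t_inv_det = pd_inv_det[OF pd]

lemma rd_const: "rd N \<eta> (rs N (\<lambda>g. c)) = rs N (\<lambda>g. 0)"
  unfolding rd_def by (rule restrict_ext) (simp only: rt_rs t_const)

lemma rd_entry: assumes "i < N" "j < N"
  shows "rd N \<eta> (rs N (\<lambda>g. g $$ (i, j))) = rs N (\<lambda>g. \<Sum>k<N. g $$ (i, k) * \<eta> $$ (k, j))"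
  unfolding rd_def
proof (rule restrict_ext)
  fix g :: "'k mat" assume g: "g \<in> mirabolic_group N"
  have "tangent N \<eta> (rs N (\<lambda>h. \<Sum>k<N. g $$ (i, k) * h $$ (k, j))) = (\<Sum>k<N. tangent N \<eta> (rs N (\<lambda>h. g $$ (i, k) * h $$ (k, j))))"
    using assms by (intro t_sum regular_rs_mult regular_funs.const regular_funs.entry) auto
  also have "\<dots> = (\<Sum>k<N. g $$ (i, k) * \<eta> $$ (k, j))"
    using assms by (intro sum.cong refl) (simp only: t_cmult regular_funs.entry t_entry lessThan_iff)
  finally show "tangent N \<eta> (rt N g (rs N (\<lambda>g. g $$ (i, j)))) = (\<Sum>k<N. g $$ (i, k) * \<eta> $$ (k, j))"
    by (simp only: rt_entry[OF g assms])
qed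

lemma rd_inv_det: "rd N \<eta> (rs N (\<lambda>g. inverse (det g))) = rs N (\<lambda>g. inverse (det g) * tangent N \<eta> (rs N (\<lambda>g. inverse (det g))))"
  unfolding rd_def by (rule restrict_ext) (simp only: rt_inv_det t_cmult regular_funs.inv_det)

lemma rd_add: assumes "p \<in> regular_funs N" "q \<in> regular_funs N"
  shows "rd N \<eta> (rs N (\<lambda>g. p g + q g)) = rs N (\<lambda>g. rd N \<eta> p g + rd N \<eta> q g)"
  unfolding rd_def
proof (rule restrict_ext)
  fix g :: "'k mat" assume g: "g \<in> mirabolic_group N"
  show "tangent N \<eta> (rt N g (rs N (\<lambda>g. p g + q g))) =
      rs N (\<lambda>g. tangent N \<eta> (rt N g p)) g + rs N (\<lambda>g. tangent N \<eta> (rt N g q)) g"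
    using t_add[of "rt N g p" "rt N g q"] rt_regular[OF g assms(1)] rt_regular[OF g assms(2)]
    by (simp only: rt_add[OF g] rs_regular restrict_apply g if_True)
qed

lemma rd_mult: assumes "p \<in> regular_funs N" "q \<in> regular_funs N"
  shows "rd N \<eta> (rs N (\<lambda>g. p g * q g)) = rs N (\<lambda>g. rd N \<eta> p g * q g + p g * rd N \<eta> q g)"
  unfolding rd_def
proof (rule restrict_ext)
  fix g :: "'k mat" assume g: "g \<in> mirabolic_group N"
  show "tangent N \<eta> (rt N g (rs N (\<lambda>g. p g * q g))) =
      rs N (\<lambda>g. tangent N \<eta> (rt N g p)) g * q g + p g * rs N (\<lambda>g. tangent N \<eta> (rt N g q)) g"
    using t_mult[of "rt N g p" "rt N g q"] rt_regular[OF g assms(1)] rt_regular[OF g assms(2)]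
    by (simp only: rt_mult[OF g] rs_regular restrict_apply g if_True rt_one_arg[OF g])
qed

lemma rd_regular: assumes "p \<in> regular_funs N" shows "rd N \<eta> p \<in> regular_funs N"
  using assms
proof induction
  case (const c) show ?case unfolding rd_const by (rule regular_funs.const)
next
  case (entry i j) then show ?case unfolding rd_entry[OF entry]
    by (intro reg.sum regular_rs_mult regular_funs.const regular_funs.entry) auto
next
  case inv_det show ?case unfolding rd_inv_det
    by (intro regular_rs_mult regular_funs.const regular_funs.inv_det)
next
  case (add p q) then show ?case unfolding rd_add[OF add.hyps] by (intro regular_funs.add)
next
  case (mult p q) 
  have "rs N (\<lambda>g. rd N \<eta> p g * q g) \<in> regular_funs N" "rs N (\<lambda>g. p g * rd N \<eta> q g) \<in> regular_funs N"
    using mult by (auto intro: regular_funs.mult)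
  then show ?case unfolding rd_mult[OF mult.hyps] by (rule regular_rs_add)
qed

end

text \<open>In the product rule the mixed first-order terms are symmetric in \<xi> and \<eta> and
  cancel, so the left side is again a point derivation. On coordinates it gives the entries of the
  commutator, and point derivations are determined by these.\<close>

lemma tangent_commutator:
  assumes N: "N \<ge> 1" and \<xi>: "\<xi> \<in> carrier (mirabolic_lie N)" and \<eta>: "\<eta> \<in> carrier (mirabolic_lie N)"
    and p: "p \<in> regular_funs N"
  shows "tangent N \<xi> (rd N \<eta> p) - tangent N \<eta> (rd N \<xi> p) = tangent N (\<xi> * \<eta> - \<eta> * \<xi>) (p :: 'k::field_char_0 mat \<Rightarrow> 'k)"
proof -
  interpret x: tangent_vector N \<xi> using N \<xi> by unfold_locales
  interpret y: tangent_vector N \<eta> using N \<eta> by unfold_locales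
  have c: "\<xi> \<in> carrier_mat N N" "\<eta> \<in> carrier_mat N N" using \<xi> \<eta> by (auto simp: mirabolic_carrier)
  have br: "\<xi> * \<eta> - \<eta> * \<xi> \<in> carrier (mirabolic_lie N)" using ml.L_bracket[OF \<xi> \<eta>] by (simp add: mirabolic_simps)
  interpret z: tangent_vector N "\<xi> * \<eta> - \<eta> * \<xi>" using N br by unfold_locales
  have "point_derivation N (\<xi> * \<eta> - \<eta> * \<xi>) (\<lambda>p. tangent N \<xi> (rd N \<eta> p) - tangent N \<eta> (rd N \<xi> p))"
    unfolding point_derivation_def
  proof (intro conjI allI ballI impI)
    fix e show "tangent N \<xi> (rd N \<eta> (rs N (\<lambda>g. e))) - tangent N \<eta> (rd N \<xi> (rs N (\<lambda>g. e))) = 0"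
      by (simp only: x.rd_const y.rd_const x.t_const y.t_const diff_self)
  next
    fix i j assume ij: "i < N" "j < N"
    have t: "tangent N \<xi> (rs N (\<lambda>g. \<Sum>k<N. g $$ (i, k) * c k)) = (\<Sum>k<N. \<xi> $$ (i, k) * c k)"
      if "tangent_vector N \<xi>" for \<xi> :: "'k mat" and c
    proof -
      interpret tangent_vector N \<xi> by fact
      have "tangent N \<xi> (rs N (\<lambda>g. \<Sum>k<N. g $$ (i, k) * c k)) = (\<Sum>k<N. tangent N \<xi> (rs N (\<lambda>g. c k * g $$ (i, k))))"
        unfolding mult.commute[of _ "c _"]
        using ij by (intro t_sum regular_rs_mult regular_funs.const regular_funs.entry) auto
      also have "\<dots> = (\<Sum>k<N. \<xi> $$ (i, k) * c k)"
        using ij by (intro sum.cong refl) (simp only: t_cmult regular_funs.entry t_entry lessThan_iff mult.commute)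
      finally show ?thesis .
    qed
    show "tangent N \<xi> (rd N \<eta> (rs N (\<lambda>g. g $$ (i, j)))) - tangent N \<eta> (rd N \<xi> (rs N (\<lambda>g. g $$ (i, j)))) = (\<xi> * \<eta> - \<eta> * \<xi>) $$ (i, j)"
      using ij c unfolding x.rd_entry[OF ij] y.rd_entry[OF ij] t[OF x.tangent_vector_axioms] t[OF y.tangent_vector_axioms]
      by (simp add: mat_prod_index[OF c] mat_prod_index[OF c(2,1)] del: index_mult_mat(1))
  next
    fix p q :: "'k mat \<Rightarrow> 'k" assume pq: "p \<in> regular_funs N" "q \<in> regular_funs N"
    have m: "rs N (rd N \<xi> p) = rd N \<xi> p" "rs N (rd N \<xi> q) = rd N \<xi> q" "rs N (rd N \<eta> p) = rd N \<eta> p" "rs N (rd N \<eta> q) = rd N \<eta> q"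
      "rs N p = p" "rs N q = q"
      using pq by (simp_all only: rs_regular x.rd_regular y.rd_regular)
    have r: "rd N \<xi> p \<in> regular_funs N" "rd N \<xi> q \<in> regular_funs N" "rd N \<eta> p \<in> regular_funs N" "rd N \<eta> q \<in> regular_funs N"
      using pq by (simp_all only: x.rd_regular y.rd_regular)
    have a: "tangent N \<xi> (rs N (\<lambda>g. f g + f' g)) = tangent N \<xi> f + tangent N \<xi> f'"
      if "tangent_vector N \<xi>" "f \<in> regular_funs N" "f' \<in> regular_funs N" for \<xi> f f'
      using tangent_vector.t_add[OF that(1), of f f'] that(2,3) by (simp only: rs_regular)
    have b: "tangent N \<xi> (rs N (\<lambda>g. f g * f' g)) = tangent N \<xi> f * f' (1\<^sub>m N) + f (1\<^sub>m N) * tangent N \<xi> f'"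
      if "tangent_vector N \<xi>" "f \<in> regular_funs N" "f' \<in> regular_funs N" for \<xi> f f'
      using tangent_vector.t_mult[OF that(1), of f f'] that(2,3) by (simp only: rs_regular)
    note ax = a[OF x.tangent_vector_axioms] and ay = a[OF y.tangent_vector_axioms]
      and bx = b[OF x.tangent_vector_axioms] and by' = b[OF y.tangent_vector_axioms]
    show "tangent N \<xi> (rd N \<eta> (rs N (\<lambda>g. p g + q g))) - tangent N \<eta> (rd N \<xi> (rs N (\<lambda>g. p g + q g))) =
        tangent N \<xi> (rd N \<eta> p) - tangent N \<eta> (rd N \<xi> p) + (tangent N \<xi> (rd N \<eta> q) - tangent N \<eta> (rd N \<xi> q))"
      unfolding x.rd_add[OF pq] y.rd_add[OF pq] ax[OF r(3,4)] ay[OF r(1,2)] by simp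
    have cc: "rs N (\<lambda>g. f g * q g + p g * f' g) = rs N (\<lambda>g. rs N (\<lambda>g. f g * q g) g + rs N (\<lambda>g. p g * f' g) g)" for f f'
      by (rule restrict_ext) simp
    show "tangent N \<xi> (rd N \<eta> (rs N (\<lambda>g. p g * q g))) - tangent N \<eta> (rd N \<xi> (rs N (\<lambda>g. p g * q g))) =
        (tangent N \<xi> (rd N \<eta> p) - tangent N \<eta> (rd N \<xi> p)) * q (1\<^sub>m N) + p (1\<^sub>m N) * (tangent N \<xi> (rd N \<eta> q) - tangent N \<eta> (rd N \<xi> q))"
      unfolding x.rd_mult[OF pq] y.rd_mult[OF pq] cc
        ax[OF regular_funs.mult[OF r(3) pq(2)] regular_funs.mult[OF pq(1) r(4)]]
        ay[OF regular_funs.mult[OF r(1) pq(2)] regular_funs.mult[OF pq(1) r(2)]]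
        bx[OF r(3) pq(2)] bx[OF pq(1) r(4)] by'[OF r(1) pq(2)] by'[OF pq(1) r(2)] rd_one[OF pq(1)] rd_one[OF pq(2)]
      by (simp add: algebra_simps)
  qed
  from point_derivation_unique[OF this z.pd p] show ?thesis .
qed

subsection \<open>Local nilpotency of right translation\<close>

primrec nilR :: "nat \<Rightarrow> nat \<Rightarrow> ('k::field_char_0 mat \<Rightarrow> 'k) set" where
  "nilR N 0 = {rs N (\<lambda>g. 0)}"
| "nilR N (Suc n) = {p \<in> regular_funs N. \<forall>x\<in>n_minus N. rd N x p \<in> nilR N n}"

locale nilpotency =
  fixes N :: nat and TYPE_k :: "'k::field_char_0 itself"
  assumes N1: "N \<ge> 1"
begin

lemma tv: "x \<in> n_minus N \<Longrightarrow> tangent_vector N (x :: 'k mat)"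
  using N1 by unfold_locales (auto dest: n_minus_mirabolic)

lemma nilR_regular: "p \<in> nilR N n \<Longrightarrow> (p :: 'k mat \<Rightarrow> 'k) \<in> regular_funs N"
  by (cases n) (auto simp: regular_funs.const simp del: restrict_apply)

lemma nilR_zero: "rs N (\<lambda>g. 0 :: 'k) \<in> nilR N n"
proof (induction n)
  case (Suc n)
  have "rd N x (rs N (\<lambda>g. 0 :: 'k)) \<in> nilR N n" if "x \<in> n_minus N" for x
    unfolding tangent_vector.rd_const[OF tv[OF that]] by (rule Suc.IH)
  then show ?case unfolding nilR.simps using regular_funs.const by blast
qed (simp only: nilR.simps singleton_iff)

lemma nilR_Suc: "(p :: 'k mat \<Rightarrow> 'k) \<in> nilR N n \<Longrightarrow> p \<in> nilR N (Suc n)"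
proof (induction n arbitrary: p)
  case 0 then show ?case using nilR_zero[of 1] by (simp only: nilR.simps(1) singleton_iff One_nat_def)
next
  case (Suc n)
  show ?case unfolding nilR.simps(2)[of N "Suc n"] using Suc.prems Suc.IH by (auto simp only: nilR.simps(2)[of N n])
qed

lemma nilR_mono: "(p :: 'k mat \<Rightarrow> 'k) \<in> nilR N m \<Longrightarrow> m \<le> n \<Longrightarrow> p \<in> nilR N n"
  by (rule lift_Suc_mono_le[of "nilR N", THEN subsetD]) (auto simp only: nilR_Suc subset_iff)

lemma nilR_add: "p \<in> nilR N n \<Longrightarrow> q \<in> nilR N n \<Longrightarrow> rs N (\<lambda>g. p g + q g :: 'k) \<in> nilR N n"
proof (induction n arbitrary: p q)
  case 0
  have "rs N (\<lambda>g. rs N (\<lambda>g. 0 :: 'k) g + rs N (\<lambda>g. 0) g) = rs N (\<lambda>g. 0)" by (rule restrict_ext) simp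
  then show ?case using 0 by (simp only: nilR.simps singleton_iff)
next
  case (Suc n)
  then have pq: "p \<in> regular_funs N" "q \<in> regular_funs N" by (simp_all only: nilR.simps mem_Collect_eq)
  have "rd N x (rs N (\<lambda>g. p g + q g)) \<in> nilR N n" if "x \<in> n_minus N" for x
    unfolding tangent_vector.rd_add[OF tv[OF that] pq] using Suc.prems that by (intro Suc.IH) (simp_all only: nilR.simps mem_Collect_eq)
  then show ?case using regular_funs.add[OF pq] by (simp only: nilR.simps mem_Collect_eq) blast
qed

text \<open>By the product rule each derivative is a sum of two products in which one of the orders
  has dropped.\<close>

lemma nilR_mult: "p \<in> nilR N m \<Longrightarrow> q \<in> nilR N n \<Longrightarrow> rs N (\<lambda>g. p g * q g :: 'k) \<in> nilR N (m + n)"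
proof (induction "m + n" arbitrary: m n p q rule: less_induct)
  case less
  show ?case
  proof (cases "m = 0 \<or> n = 0")
    case True
    then have "p = rs N (\<lambda>g. 0) \<or> q = rs N (\<lambda>g. 0)" using less.prems by (metis nilR.simps(1) singletonD)
    then have "rs N (\<lambda>g. p g * q g :: 'k) = rs N (\<lambda>g. 0)" by (intro restrict_ext) auto
    then show ?thesis by (simp only: nilR_zero)
  next
    case False
    then obtain m' n' where mn: "m = Suc m'" "n = Suc n'" by (meson not0_implies_Suc)
    have pq: "p \<in> regular_funs N" "q \<in> regular_funs N" using less.prems nilR_regular by blast+
    have "rd N x (rs N (\<lambda>g. p g * q g)) \<in> nilR N (m' + Suc n')" if x: "x \<in> n_minus N" for x
    proof -
      have xp: "rd N x p \<in> nilR N m'" and xq: "rd N x q \<in> nilR N n'" 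
        using less.prems x mn by (simp_all only: nilR.simps mem_Collect_eq)
      have "rs N (\<lambda>g. rd N x p g * q g) \<in> nilR N (m' + Suc n')"
        using less.prems mn by (intro less.hyps xp) simp_all
      moreover have "rs N (\<lambda>g. p g * rd N x q g) \<in> nilR N (m' + Suc n')"
        unfolding add_Suc_shift[symmetric] using less.prems mn by (intro less.hyps xq) simp_all
      ultimately have "rs N (\<lambda>g. rs N (\<lambda>g. rd N x p g * q g) g + rs N (\<lambda>g. p g * rd N x q g) g) \<in> nilR N (m' + Suc n')"
        by (rule nilR_add)
      moreover have "rs N (\<lambda>g. rs N (\<lambda>g. rd N x p g * q g) g + rs N (\<lambda>g. p g * rd N x q g) g)
          = rs N (\<lambda>g. rd N x p g * q g + p g * rd N x q g)" by (rule restrict_ext) simp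
      ultimately show ?thesis by (simp only: tangent_vector.rd_mult[OF tv[OF x] pq])
    qed
    then have "rs N (\<lambda>g. p g * q g) \<in> nilR N (Suc (m' + Suc n'))"
      using regular_funs.mult[OF pq] by (simp only: nilR.simps mem_Collect_eq) blast
    then show ?thesis by (simp add: mn)
  qed
qed

lemma nilR_const: "rs N (\<lambda>g. c :: 'k) \<in> nilR N 1"
  unfolding One_nat_def nilR.simps using regular_funs.const tangent_vector.rd_const[OF tv] by blast

text \<open>The scalar is treated as a factor of order 1, at the cost of one in the bound.\<close>

lemma nilR_cmult: "p \<in> nilR N n \<Longrightarrow> rs N (\<lambda>g. c * p g :: 'k) \<in> nilR N (Suc n)"
proof -
  assume "p \<in> nilR N n"
  from nilR_mult[OF nilR_const[of c] this] have "rs N (\<lambda>g. rs N (\<lambda>g. c) g * p g) \<in> nilR N (Suc n)" by simp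
  moreover have "rs N (\<lambda>g. rs N (\<lambda>g. c) g * p g) = rs N (\<lambda>g. c * p g)" by (rule restrict_ext) simp
  ultimately show ?thesis by (simp only:)
qed

lemma nilR_sum: "(\<And>i. i \<in> A \<Longrightarrow> rs N (f i) \<in> nilR N n) \<Longrightarrow> rs N (\<lambda>g. \<Sum>i\<in>A. f i g :: 'k) \<in> nilR N n"
proof (induction A rule: infinite_finite_induct)
  case (insert x A)
  have "rs N (\<lambda>g. rs N (f x) g + rs N (\<lambda>g. \<Sum>i\<in>A. f i g) g) \<in> nilR N n"
    by (intro nilR_add insert.IH insert.prems) auto
  moreover have "rs N (\<lambda>g. rs N (f x) g + rs N (\<lambda>g. \<Sum>i\<in>A. f i g) g) = rs N (\<lambda>g. \<Sum>i\<in>insert x A. f i g)"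
    using insert.hyps by (intro restrict_ext) simp
  ultimately show ?case by (simp only:)
qed (simp_all only: nilR_zero sum.infinite sum.empty simp_thms)

text \<open>A lower triangular matrix maps the column \<open>j\<close> of coordinates to columns \<open>k > j\<close>.\<close>

lemma nilR_entry: "i < N \<Longrightarrow> j < N \<Longrightarrow> rs N (\<lambda>g. g $$ (i, j) :: 'k) \<in> nilR N (2 * (N - j))"
proof (induction "N - j" arbitrary: j rule: less_induct)
  case less
  obtain m where m: "N - j = Suc m" using less.prems(2) by (metis Suc_diff_Suc)
  \<comment> \<open>The 2 in the bound: passing from column \<open>j\<close> to a later column costs
    one derivative, and the factor \<open>x $$ (k, j)\<close> costs one more through
    \<open>nilR_cmult\<close>.\<close>
  have "rd N x (rs N (\<lambda>g. g $$ (i, j))) \<in> nilR N (Suc (2 * m))" if x: "x \<in> n_minus N" for x :: "'k mat"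
    unfolding tangent_vector.rd_entry[OF tv[OF x] less.prems]
  proof (rule nilR_sum)
    fix k assume k: "k \<in> {..<N}"
    show "rs N (\<lambda>g. g $$ (i, k) * x $$ (k, j)) \<in> nilR N (Suc (2 * m))"
    proof (cases "k \<le> j")
      case True
      then have "x $$ (k, j) = 0" using x k less.prems by (simp add: n_minus_def)
      then show ?thesis by (simp only: mult_zero_right nilR_zero)
    next
      case False
      have "rs N (\<lambda>g. g $$ (i, k) :: 'k) \<in> nilR N (2 * (N - k))" using False k less.prems by (intro less.hyps) auto
      then have "rs N (\<lambda>g. g $$ (i, k) :: 'k) \<in> nilR N (2 * m)" by (rule nilR_mono) (use False m in simp)
      from nilR_cmult[OF this, of "x $$ (k, j)"] have "rs N (\<lambda>g. x $$ (k, j) * rs N (\<lambda>g. g $$ (i, k)) g) \<in> nilR N (Suc (2 * m))" .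
      moreover have "rs N (\<lambda>g. x $$ (k, j) * rs N (\<lambda>g. g $$ (i, k)) g) = rs N (\<lambda>g. g $$ (i, k) * x $$ (k, j))"
        by (rule restrict_ext) simp
      ultimately show ?thesis by (simp only:)
    qed
  qed
  then have "rs N (\<lambda>g. g $$ (i, j) :: 'k) \<in> nilR N (Suc (Suc (2 * m)))"
    using regular_funs.entry[OF less.prems] by (simp only: nilR.simps(2)[of N "Suc (2 * m)"] mem_Collect_eq) blast
  then show ?case by (simp add: m)
qed

lemma nilR_inv_det: "rs N (\<lambda>g. inverse (det g) :: 'k) \<in> nilR N 1"
proof -
  have "rd N x (rs N (\<lambda>g. inverse (det g) :: 'k)) = rs N (\<lambda>g. 0)" if x: "x \<in> n_minus N" for x
    unfolding tangent_vector.rd_inv_det[OF tv[OF x]] tangent_vector.t_inv_det[OF tv[OF x]] tangent_det[OF x N1]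
    by (rule restrict_ext) simp
  then show ?thesis unfolding One_nat_def nilR.simps using regular_funs.inv_det by blast
qed

lemma nilR_exists: "p \<in> regular_funs N \<Longrightarrow> \<exists>n. (p :: 'k mat \<Rightarrow> 'k) \<in> nilR N n"
proof (induction rule: regular_funs.induct)
  case (add p q)
  then obtain m n where "p \<in> nilR N m" "q \<in> nilR N n" by blast
  then have "p \<in> nilR N (max m n)" "q \<in> nilR N (max m n)" by (auto intro: nilR_mono)
  then show ?case using nilR_add by blast
qed (blast intro: nilR_const nilR_entry nilR_inv_det nilR_mult)+

end

subsection \<open>The differentiated action\<close>

context kspace
begin

definition functional :: "('v \<Rightarrow> 'k) \<Rightarrow> bool" where
  "functional \<mu> \<longleftrightarrow> (\<forall>v\<in>carrier V. \<forall>w\<in>carrier V. \<mu> (v \<oplus> w) = \<mu> v + \<mu> w) \<and> (\<forall>c. \<forall>v\<in>carrier V. \<mu> (c \<odot> v) = c * \<mu> v)"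

lemma functional_crd: "functional (\<lambda>v. Poly_Mapping.lookup (crd v) b)"
  by (simp add: functional_def crd_add crd_scale lookup_add)

lemma functional_zero: "functional \<mu> \<Longrightarrow> \<mu> \<zero> = 0"
proof -
  assume "functional \<mu>"
  then have "\<mu> (0 \<odot> \<zero>) = 0 * \<mu> \<zero>" unfolding functional_def by blast
  then show ?thesis by (simp add: sc_zero)
qed

text \<open>The coordinate functionals already separate vectors. Equations in a representation thus
  become equations between scalar functions on the group.\<close>

lemma separation:
  assumes "v \<in> carrier V" "w \<in> carrier V" "\<And>\<mu>. functional \<mu> \<Longrightarrow> \<mu> v = \<mu> w" shows "v = w"
  using assms(3)[OF functional_crd] by (intro crd_inj[OF assms(1,2)] poly_mapping_eqI) simp

lemma finsum_lessThan_closed: "(\<And>i. i < n \<Longrightarrow> u i \<in> carrier V) \<Longrightarrow> (\<Oplus>i\<in>{..<n}. c i \<odot> u i) \<in> carrier V" for n :: nat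
  by (rule finsum_closed) auto

lemma functional_finsum:
  fixes n :: nat
  assumes "functional \<mu>" "\<And>i. i < n \<Longrightarrow> u i \<in> carrier V"
  shows "\<mu> (\<Oplus>i\<in>{..<n}. c i \<odot> u i) = (\<Sum>i<n. c i * \<mu> (u i))"
  using assms(2)
proof (induction n)
  case 0 then show ?case using functional_zero[OF assms(1)] by simp
next
  case (Suc n)
  have u: "u n \<in> carrier V" "\<And>i. i < n \<Longrightarrow> u i \<in> carrier V" using Suc.prems by auto
  have "(\<Oplus>i\<in>{..<Suc n}. c i \<odot> u i) = c n \<odot> u n \<oplus> (\<Oplus>i\<in>{..<n}. c i \<odot> u i)"
    unfolding lessThan_Suc using u by (intro finsum_insert) auto
  then show ?case using assms(1) u finsum_lessThan_closed[of n u c] Suc.IH[OF u(2)]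
    by (simp add: functional_def add.commute)
qed

end

locale rep = mirabolic_rep N V for N and V :: "('k::field_char_0, 'v) grep" (structure) +
  assumes N: "N \<ge> 1"
begin

sublocale kspace V by (rule kspaceI[OF vectorspace])
sublocale nilpotency N "TYPE('k)" using N by unfold_locales

lemma functional_gact: "functional \<mu> \<Longrightarrow> g \<in> mirabolic_group N \<Longrightarrow> functional (\<lambda>v. \<mu> (gact V g v))"
  using gact_hom[of g] by (simp add: functional_def LinearCombinations.module_hom_def Pi_iff)

text \<open>Through these matrix coefficients statements about \<open>ad\<close> become statements
  about \<open>tangent\<close> and \<open>rd\<close> on regular functions.\<close>

definition cf :: "('v \<Rightarrow> 'k) \<Rightarrow> 'v \<Rightarrow> 'k mat \<Rightarrow> 'k" where "cf \<mu> v = rs N (\<lambda>g. \<mu> (gact V g v))"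

lemma cf_expansion: 
  assumes "functional \<mu>" "orbit_expansion N V v n p u"
  shows "cf \<mu> v = rs N (\<lambda>g. \<Sum>i<n. \<mu> (u i) * p i g)"
  unfolding cf_def
proof (rule restrict_ext)
  fix g :: "'k mat" assume g: "g \<in> mirabolic_group N"
  show "\<mu> (gact V g v) = (\<Sum>i<n. \<mu> (u i) * p i g)"
    using functional_finsum[OF assms(1), of n u "\<lambda>i. p i g"] assms(2) g by (simp add: orbit_expansion_def mult.commute)
qed

lemma expansion_term: assumes "orbit_expansion N V v n p u" "i < n" shows "rs N (\<lambda>g. c * p i g) \<in> regular_funs N"
  using assms regular_rs_mult[OF regular_funs.const, of "p i" N c] by (simp only: orbit_expansion_def rs_regular)

lemma cf_regular: assumes "functional \<mu>" "v \<in> carrier V" shows "cf \<mu> v \<in> regular_funs N"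
proof -
  obtain n p u where e: "orbit_expansion N V v n p u" using rational[OF assms(2)] by blast
  show ?thesis unfolding cf_expansion[OF assms(1) e] by (rule reg.sum) (simp only: expansion_term[OF e] lessThan_iff)
qed

lemma tangent_cf:
  assumes "\<xi> \<in> carrier (mirabolic_lie N)" "functional \<mu>" "orbit_expansion N V v n p u"
  shows "\<mu> (\<Oplus>i\<in>{..<n}. tangent N \<xi> (p i) \<odot> u i) = tangent N \<xi> (cf \<mu> v)"
proof -
  interpret tangent_vector N \<xi> using N assms(1) by unfold_locales
  have "tangent N \<xi> (cf \<mu> v) = (\<Sum>i<n. tangent N \<xi> (rs N (\<lambda>g. \<mu> (u i) * p i g)))"
    unfolding cf_expansion[OF assms(2,3)] by (rule t_sum) (simp only: expansion_term[OF assms(3)] lessThan_iff)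
  also have "\<dots> = (\<Sum>i<n. tangent N \<xi> (p i) * \<mu> (u i))"
  proof (rule sum.cong[OF refl])
    fix i assume "i \<in> {..<n}"
    then have "p i \<in> regular_funs N" using assms(3) by (simp add: orbit_expansion_def)
    then show "tangent N \<xi> (rs N (\<lambda>g. \<mu> (u i) * p i g)) = tangent N \<xi> (p i) * \<mu> (u i)"
      using t_cmult[of "p i" "\<mu> (u i)"] by (simp only: rs_regular mult.commute)
  qed
  also have "\<dots> = \<mu> (\<Oplus>i\<in>{..<n}. tangent N \<xi> (p i) \<odot> u i)"
    using assms(3) by (intro functional_finsum[OF assms(2), symmetric]) (simp add: orbit_expansion_def)
  finally show ?thesis by simp
qed

text \<open>By \<open>tangent_cf\<close> every functional takes the same value on the vectors
  obtained from two expansions of an orbit map, so these vectors agree and the description in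
  \<open>ad\<close> is meaningful.\<close>

lemma ad_spec: 
  assumes "\<xi> \<in> carrier (mirabolic_lie N)" "v \<in> carrier V"
  shows "ad N V \<xi> v \<in> carrier V" "functional \<mu> \<Longrightarrow> \<mu> (ad N V \<xi> v) = tangent N \<xi> (cf \<mu> v)"
proof -
  obtain n p u where e: "orbit_expansion N V v n p u" using rational[OF assms(2)] by blast
  have cl: "(\<Oplus>i\<in>{..<n}. tangent N \<xi> (p i) \<odot> u i) \<in> carrier V" if "orbit_expansion N V v n p u" for n p u
    using that by (intro finsum_lessThan_closed) (simp add: orbit_expansion_def)
  have eq: "ad N V \<xi> v = (\<Oplus>i\<in>{..<n}. tangent N \<xi> (p i) \<odot> u i)"
    unfolding ad_def
  proof (rule the_equality)
    show "\<exists>n' p' u'. orbit_expansion N V v n' p' u' \<and> (\<Oplus>i\<in>{..<n}. tangent N \<xi> (p i) \<odot> u i) = (\<Oplus>i\<in>{..<n'}. tangent N \<xi> (p' i) \<odot> u' i)"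
      using e by blast
    fix w assume "\<exists>n p u. orbit_expansion N V v n p u \<and> w = (\<Oplus>i\<in>{..<n}. tangent N \<xi> (p i) \<odot> u i)"
    then obtain n' p' u' where e': "orbit_expansion N V v n' p' u'" and w: "w = (\<Oplus>i\<in>{..<n'}. tangent N \<xi> (p' i) \<odot> u' i)" by blast
    show "w = (\<Oplus>i\<in>{..<n}. tangent N \<xi> (p i) \<odot> u i)" unfolding w
      by (rule separation[OF cl[OF e'] cl[OF e]]) (simp only: tangent_cf[OF assms(1) _ e] tangent_cf[OF assms(1) _ e'])
  qed
  show "ad N V \<xi> v \<in> carrier V" unfolding eq by (rule cl[OF e])
  show "\<mu> (ad N V \<xi> v) = tangent N \<xi> (cf \<mu> v)" if "functional \<mu>" unfolding eq by (rule tangent_cf[OF assms(1) that e])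
qed

lemma ad_eqI:
  assumes "\<xi> \<in> carrier (mirabolic_lie N)" "v \<in> carrier V" "w \<in> carrier V" "\<And>\<mu>. functional \<mu> \<Longrightarrow> \<mu> w = tangent N \<xi> (cf \<mu> v)"
  shows "ad N V \<xi> v = w"
  by (rule separation[OF ad_spec(1)[OF assms(1,2)] assms(3)]) (simp only: ad_spec(2)[OF assms(1,2)] assms(4))

lemma cf_add: "functional \<mu> \<Longrightarrow> v \<in> carrier V \<Longrightarrow> w \<in> carrier V \<Longrightarrow> cf \<mu> (v \<oplus> w) = rs N (\<lambda>g. cf \<mu> v g + cf \<mu> w g)"
  unfolding cf_def by (rule restrict_ext) (use functional_gact in \<open>force simp: functional_def[of "\<lambda>v. \<mu> (gact V _ v)"]\<close>)

lemma cf_scale: "functional \<mu> \<Longrightarrow> v \<in> carrier V \<Longrightarrow> cf \<mu> (c \<odot> v) = rs N (\<lambda>g. c * cf \<mu> v g)"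
  unfolding cf_def by (rule restrict_ext) (use functional_gact in \<open>force simp: functional_def[of "\<lambda>v. \<mu> (gact V _ v)"]\<close>)

text \<open>A functional composed with the action of \<open>g\<close> is again a functional, and its
  matrix coefficient is the translate by \<open>rt N g\<close>.\<close>

lemma cf_ad: assumes "\<xi> \<in> carrier (mirabolic_lie N)" "functional \<mu>" "v \<in> carrier V"
  shows "cf \<mu> (ad N V \<xi> v) = rd N \<xi> (cf \<mu> v)"
  unfolding cf_def[of \<mu> "ad N V \<xi> v"] rd_def
proof (rule restrict_ext)
  fix g :: "'k mat" assume g: "g \<in> mirabolic_group N"
  have "cf (\<lambda>v. \<mu> (gact V g v)) v = rt N g (cf \<mu> v)"
    unfolding cf_def rt_rs[OF g] by (rule restrict_ext) (simp add: gact_mult g assms(3))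
  then show "\<mu> (gact V g (ad N V \<xi> v)) = tangent N \<xi> (rt N g (cf \<mu> v))"
    using ad_spec(2)[OF assms(1,3) functional_gact[OF assms(2) g]] by (simp only:)
qed

lemma ad_add: assumes \<xi>: "\<xi> \<in> carrier (mirabolic_lie N)" and v: "v \<in> carrier V" "w \<in> carrier V"
  shows "ad N V \<xi> (v \<oplus> w) = ad N V \<xi> v \<oplus> ad N V \<xi> w"
proof (rule ad_eqI[OF \<xi>])
  interpret tangent_vector N \<xi> using N \<xi> by unfold_locales
  fix \<mu> assume \<mu>: "functional \<mu>"
  have "\<mu> (ad N V \<xi> v \<oplus> ad N V \<xi> w) = tangent N \<xi> (cf \<mu> v) + tangent N \<xi> (cf \<mu> w)"
    using \<mu> ad_spec[OF \<xi>] v by (simp add: functional_def[of \<mu>]) 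
  then show "\<mu> (ad N V \<xi> v \<oplus> ad N V \<xi> w) = tangent N \<xi> (cf \<mu> (v \<oplus> w))"
    using t_add[of "cf \<mu> v" "cf \<mu> w"] cf_regular[OF \<mu>] v by (simp only: cf_add[OF \<mu> v] rs_regular)
qed (use ad_spec[OF \<xi>] v in auto)

lemma ad_scale: assumes \<xi>: "\<xi> \<in> carrier (mirabolic_lie N)" and v: "v \<in> carrier V"
  shows "ad N V \<xi> (c \<odot> v) = c \<odot> ad N V \<xi> v"
proof (rule ad_eqI[OF \<xi>])
  interpret tangent_vector N \<xi> using N \<xi> by unfold_locales
  fix \<mu> assume \<mu>: "functional \<mu>"
  have "\<mu> (c \<odot> ad N V \<xi> v) = c * tangent N \<xi> (cf \<mu> v)"
    using \<mu> ad_spec[OF \<xi>] v by (simp add: functional_def[of \<mu>]) 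
  then show "\<mu> (c \<odot> ad N V \<xi> v) = tangent N \<xi> (cf \<mu> (c \<odot> v))"
    using t_cmult[of "cf \<mu> v" c] cf_regular[OF \<mu>] v by (simp only: cf_scale[OF \<mu> v] rs_regular)
qed (use ad_spec[OF \<xi>] v in auto)

lemma ad_mat_add: assumes \<xi>: "\<xi> \<in> carrier (mirabolic_lie N)" "\<eta> \<in> carrier (mirabolic_lie N)" and v: "v \<in> carrier V"
  shows "ad N V (\<xi> + \<eta>) v = ad N V \<xi> v \<oplus> ad N V \<eta> v"
proof (rule ad_eqI)
  fix \<mu> assume \<mu>: "functional \<mu>"
  show "\<mu> (ad N V \<xi> v \<oplus> ad N V \<eta> v) = tangent N (\<xi> + \<eta>) (cf \<mu> v)"
    using \<mu> ad_spec[OF \<xi>(1) v] ad_spec[OF \<xi>(2) v] tangent_add[OF \<xi> N cf_regular[OF \<mu> v]] by (simp add: functional_def[of \<mu>])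
qed (use ad_spec[OF \<xi>(1) v] ad_spec[OF \<xi>(2) v] ml.L_add[OF \<xi>] v in \<open>auto simp: mirabolic_simps\<close>)

lemma ad_mat_scale: assumes \<xi>: "\<xi> \<in> carrier (mirabolic_lie N)" and v: "v \<in> carrier V"
  shows "ad N V (c \<cdot>\<^sub>m \<xi>) v = c \<odot> ad N V \<xi> v"
proof (rule ad_eqI)
  fix \<mu> assume \<mu>: "functional \<mu>"
  show "\<mu> (c \<odot> ad N V \<xi> v) = tangent N (c \<cdot>\<^sub>m \<xi>) (cf \<mu> v)"
    using \<mu> ad_spec[OF \<xi> v] tangent_smult[OF \<xi> N cf_regular[OF \<mu> v]] by (simp add: functional_def[of \<mu>])
qed (use ad_spec[OF \<xi> v] ml.L_smult[OF \<xi>] v in \<open>auto simp: mirabolic_simps\<close>)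

text \<open>By \<open>cf_ad\<close> a composite of two \<open>ad\<close> becomes
  \<open>tangent\<close> after \<open>rd\<close> on matrix coefficients, so
  \<open>tangent_commutator\<close> applies.\<close>

lemma ad_bracket: assumes \<xi>: "\<xi> \<in> carrier (mirabolic_lie N)" "\<eta> \<in> carrier (mirabolic_lie N)" and v: "v \<in> carrier V"
  shows "ad N V (\<xi> * \<eta> - \<eta> * \<xi>) v = ad N V \<xi> (ad N V \<eta> v) \<oplus> (- 1) \<odot> ad N V \<eta> (ad N V \<xi> v)"
proof (rule ad_eqI)
  note a = ad_spec(1)[OF \<xi>(1) v] ad_spec(1)[OF \<xi>(2) v]
  note aa = ad_spec(1)[OF \<xi>(1) a(2)] ad_spec(1)[OF \<xi>(2) a(1)]
  fix \<mu> assume \<mu>: "functional \<mu>"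
  have "\<mu> (ad N V \<xi> (ad N V \<eta> v) \<oplus> (- 1) \<odot> ad N V \<eta> (ad N V \<xi> v)) = \<mu> (ad N V \<xi> (ad N V \<eta> v)) - \<mu> (ad N V \<eta> (ad N V \<xi> v))"
    using \<mu> aa by (simp add: functional_def)
  also have "\<dots> = tangent N \<xi> (rd N \<eta> (cf \<mu> v)) - tangent N \<eta> (rd N \<xi> (cf \<mu> v))"
    by (simp only: ad_spec(2)[OF \<xi>(1) a(2) \<mu>] ad_spec(2)[OF \<xi>(2) a(1) \<mu>] cf_ad[OF \<xi>(1) \<mu> v] cf_ad[OF \<xi>(2) \<mu> v])
  also have "\<dots> = tangent N (\<xi> * \<eta> - \<eta> * \<xi>) (cf \<mu> v)" by (rule tangent_commutator[OF N \<xi> cf_regular[OF \<mu> v]])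
  finally show "\<mu> (ad N V \<xi> (ad N V \<eta> v) \<oplus> (- 1) \<odot> ad N V \<eta> (ad N V \<xi> v)) = tangent N (\<xi> * \<eta> - \<eta> * \<xi>) (cf \<mu> v)" .
next
  show "\<xi> * \<eta> - \<eta> * \<xi> \<in> carrier (mirabolic_lie N)" using ml.L_bracket[OF \<xi>] by (simp add: mirabolic_simps)
qed (use ad_spec[OF \<xi>(1)] ad_spec[OF \<xi>(2)] v in auto)

primrec adnil :: "nat \<Rightarrow> 'v set" where
  "adnil 0 = {\<zero>}"
| "adnil (Suc n) = {v \<in> carrier V. \<forall>x\<in>n_minus N. ad N V x v \<in> adnil n}"

text \<open>By \<open>cf_ad\<close> each \<open>ad\<close> turns into one \<open>rd\<close> on all
  matrix coefficients. At order 0 the coefficient at the identity recovers the value of the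
  functional on \<open>v\<close>.\<close>

lemma adnil_criterion: "v \<in> carrier V \<Longrightarrow> (\<And>\<mu>. functional \<mu> \<Longrightarrow> cf \<mu> v \<in> nilR N n) \<Longrightarrow> v \<in> adnil n"
proof (induction n arbitrary: v)
  case 0
  have "v = \<zero>"
  proof (rule separation)
    fix \<mu> assume \<mu>: "functional \<mu>"
    have "cf \<mu> v (1\<^sub>m N) = 0" using 0(2)[OF \<mu>] group_one[of N, where 'k = 'k] by simp
    then show "\<mu> v = \<mu> \<zero>" using 0(1) group_one[of N, where 'k = 'k] by (simp add: cf_def gact_one functional_zero[OF \<mu>])
  qed (use 0 in auto)
  then show ?case by simp
next
  case (Suc n)
  have "ad N V x v \<in> adnil n" if x: "x \<in> n_minus N" for x
  proof (rule Suc.IH)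
    note xm = n_minus_mirabolic[OF x]
    show "ad N V x v \<in> carrier V" by (rule ad_spec(1)[OF xm Suc.prems(1)])
    show "cf \<mu> (ad N V x v) \<in> nilR N n" if "functional \<mu>" for \<mu>
      using Suc.prems(2)[OF that] x by (simp only: cf_ad[OF xm that Suc.prems(1)] nilR.simps mem_Collect_eq)
  qed
  then show ?case using Suc.prems(1) by simp
qed

text \<open>The bound is uniform in the functional: an orbit map involves finitely many regular
  functions, and the functional enters only through their scalar coefficients.\<close>

lemma ex_adnil: assumes v: "v \<in> carrier V" shows "\<exists>n. v \<in> adnil n"
proof -
  obtain n p u where e: "orbit_expansion N V v n p u" using rational[OF v] by blast
  have "\<forall>i<n. \<exists>m. p i \<in> nilR N m" using e by (auto simp only: orbit_expansion_def intro: nilR_exists)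
  then obtain m where m: "\<And>i. i < n \<Longrightarrow> p i \<in> nilR N (m i)" by metis
  have "p i \<in> nilR N (\<Sum>i<n. m i)" if "i < n" for i
    by (rule nilR_mono[OF m[OF that]]) (use that in \<open>auto intro: member_le_sum\<close>)
  then have "cf \<mu> v \<in> nilR N (Suc (\<Sum>i<n. m i))" if "functional \<mu>" for \<mu>
    unfolding cf_expansion[OF that e] by (intro nilR_sum nilR_cmult) simp
  then show ?thesis using adnil_criterion[OF v] by blast
qed

end

text \<open>A functional on W composed with \<open>f\<close> is a functional on V with the same
  matrix coefficient.\<close>

lemma rep_hom_ad:
  assumes V: "rep N V" and W: "rep N W" and f: "f \<in> rep_hom N V W"
    and \<xi>: "\<xi> \<in> carrier (mirabolic_lie N)" and v: "v \<in> carrier V"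
  shows "f (ad N V \<xi> v) = ad N W \<xi> (f v)"
proof -
  interpret V: rep N V by fact
  interpret W: rep N W by fact
  have lin: "f \<in> lin_hom V W" and g: "\<And>g v. g \<in> mirabolic_group N \<Longrightarrow> v \<in> carrier V \<Longrightarrow> f (gact V g v) = gact W g (f v)"
    using f by (auto simp: rep_hom_def)
  note l = lin[unfolded lin_hom_iff]
  have fc: "f v \<in> carrier W" if "v \<in> carrier V" for v using l that by blast
  show ?thesis
  proof (rule W.ad_eqI[OF \<xi> fc[OF v] fc[OF V.ad_spec(1)[OF \<xi> v]], symmetric])
    fix \<mu> assume \<mu>: "W.functional \<mu>"
    have \<mu>f: "V.functional (\<lambda>v. \<mu> (f v))" using \<mu> l fc by (simp add: V.functional_def W.functional_def)
    have "V.cf (\<lambda>v. \<mu> (f v)) v = W.cf \<mu> (f v)" unfolding V.cf_def W.cf_def by (rule restrict_ext) (simp add: g v)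
    then show "\<mu> (f (ad N V \<xi> v)) = tangent N \<xi> (W.cf \<mu> (f v))" using V.ad_spec(2)[OF \<xi> v \<mu>f] by simp
  qed
qed

subsection \<open>Tensor products\<close>

context kspace
begin

lemma span_subsp: "S \<subseteq> carrier V \<Longrightarrow> subsp (lin_span V S)"
  using span_is_submodule[of S] by (simp add: subsp_def LinearCombinations.submodule_def)

lemma span_base: "S \<subseteq> carrier V \<Longrightarrow> S \<subseteq> lin_span V S"
  by (rule in_own_span)

lemma span_least: "subsp T \<Longrightarrow> S \<subseteq> T \<Longrightarrow> lin_span V S \<subseteq> T"
  by (rule span_is_subset) (auto simp: subsp_def LinearCombinations.submodule_def module_axioms)

end

definition bilinear ::
  "('k::field, 'v, 'm) module_scheme \<Rightarrow> ('k, 'w, 'n) module_scheme \<Rightarrow> ('k, 'x, 'l) module_scheme \<Rightarrow> ('v \<Rightarrow> 'w \<Rightarrow> 'x) \<Rightarrow> bool" where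
  "bilinear V W X h \<longleftrightarrow> (\<forall>v\<in>carrier V. \<forall>w\<in>carrier W. h v w \<in> carrier X \<and>
    (\<forall>v'\<in>carrier V. h (v \<oplus>\<^bsub>V\<^esub> v') w = h v w \<oplus>\<^bsub>X\<^esub> h v' w) \<and> (\<forall>w'\<in>carrier W. h v (w \<oplus>\<^bsub>W\<^esub> w') = h v w \<oplus>\<^bsub>X\<^esub> h v w') \<and>
    (\<forall>c. h (c \<odot>\<^bsub>V\<^esub> v) w = c \<odot>\<^bsub>X\<^esub> h v w \<and> h v (c \<odot>\<^bsub>W\<^esub> w) = c \<odot>\<^bsub>X\<^esub> h v w))"

lemma bilinearD:
  assumes "bilinear V W X h" "v \<in> carrier V" "w \<in> carrier W"
  shows "h v w \<in> carrier X" "v' \<in> carrier V \<Longrightarrow> h (v \<oplus>\<^bsub>V\<^esub> v') w = h v w \<oplus>\<^bsub>X\<^esub> h v' w"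
    "w' \<in> carrier W \<Longrightarrow> h v (w \<oplus>\<^bsub>W\<^esub> w') = h v w \<oplus>\<^bsub>X\<^esub> h v w'"
    "h (c \<odot>\<^bsub>V\<^esub> v) w = c \<odot>\<^bsub>X\<^esub> h v w" "h v (c \<odot>\<^bsub>W\<^esub> w) = c \<odot>\<^bsub>X\<^esub> h v w"
  using assms unfolding bilinear_def by blast+

locale tens = V: kspace V + W: kspace W
  for V :: "('k::field, 'v, 'm) module_scheme" and W :: "('k, 'w, 'n) module_scheme"
begin

abbreviation FS :: "('k, 'v \<times> 'w \<Rightarrow> 'k) module" where "FS \<equiv> free_space (carrier V \<times> carrier W)"
abbreviation "rels \<equiv> tensor_rels V W"
abbreviation "T \<equiv> tensor V W"
abbreviation "pt \<equiv> pure_tensor V W"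

sublocale F: kspace FS by (rule free_space_kspace)

definition tgens :: "('v \<times> 'w \<Rightarrow> 'k) set" where
  "tgens = {\<lambda>s. single (v \<oplus>\<^bsub>V\<^esub> v', w) s - single (v, w) s - single (v', w) s | v v' w.
        v \<in> carrier V \<and> v' \<in> carrier V \<and> w \<in> carrier W} \<union>
     {\<lambda>s. single (v, w \<oplus>\<^bsub>W\<^esub> w') s - single (v, w) s - single (v, w') s | v w w'.
        v \<in> carrier V \<and> w \<in> carrier W \<and> w' \<in> carrier W} \<union>
     {\<lambda>s. single (c \<odot>\<^bsub>V\<^esub> v, w) s - c * single (v, w) s | c v w.
        v \<in> carrier V \<and> w \<in> carrier W} \<union>
     {\<lambda>s. single (v, c \<odot>\<^bsub>W\<^esub> w) s - c * single (v, w) s | c v w.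
        v \<in> carrier V \<and> w \<in> carrier W}"

lemma rels_eq: "rels = lin_span FS tgens"
  by (simp add: tensor_rels_def tgens_def)

lemma FS_single: "v \<in> carrier V \<Longrightarrow> w \<in> carrier W \<Longrightarrow> single (v, w) \<in> carrier FS"
  by (rule single_free) simp

lemma FS_smult: "p \<in> carrier FS \<Longrightarrow> (\<lambda>s. c * p s) \<in> carrier FS"
  using F.sc_closed[of p c] by (simp only: free_space_simps)

lemma FS_minus: "p \<in> carrier FS \<Longrightarrow> q \<in> carrier FS \<Longrightarrow> p \<ominus>\<^bsub>FS\<^esub> q = (\<lambda>s. p s - q s)"
  by (simp add: F.M.minus_eq F.neg_sc free_space_simps)

lemma FS_diff: "p \<in> carrier FS \<Longrightarrow> q \<in> carrier FS \<Longrightarrow> (\<lambda>s. p s - q s) \<in> carrier FS"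
  using F.M.minus_closed[of p q] by (simp only: FS_minus)

lemma tgens_FS: "tgens \<subseteq> carrier FS"
  unfolding tgens_def by (auto intro!: FS_diff FS_smult FS_single)

lemma rels_subsp: "F.subsp rels"
  unfolding rels_eq by (rule F.span_subsp[OF tgens_FS])

lemma tgens_rels: "x \<in> tgens \<Longrightarrow> x \<in> rels"
  unfolding rels_eq using F.span_base[OF tgens_FS] by blast

sublocale T: kspace T
  unfolding tensor_def by (rule F.quotient_kspace[OF rels_subsp])

lemma pt_closed: "v \<in> carrier V \<Longrightarrow> w \<in> carrier W \<Longrightarrow> pt v w \<in> carrier T"
  unfolding tensor_def pure_tensor_def F.quotient_carrier using FS_single by blast

lemma T_add: "p \<in> carrier FS \<Longrightarrow> q \<in> carrier FS \<Longrightarrow> (rels +>\<^bsub>FS\<^esub> p) \<oplus>\<^bsub>T\<^esub> (rels +>\<^bsub>FS\<^esub> q) = rels +>\<^bsub>FS\<^esub> (\<lambda>s. p s + q s)"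
  using F.quotient_add[OF rels_subsp, of p q] by (simp only: tensor_def free_space_simps)

lemma T_smult: "p \<in> carrier FS \<Longrightarrow> c \<odot>\<^bsub>T\<^esub> (rels +>\<^bsub>FS\<^esub> p) = rels +>\<^bsub>FS\<^esub> (\<lambda>s. c * p s)"
  using F.quotient_smult[OF rels_subsp, of p] by (simp only: tensor_def free_space_simps)

lemma FS_add: "p \<in> carrier FS \<Longrightarrow> q \<in> carrier FS \<Longrightarrow> (\<lambda>s. p s + q s) \<in> carrier FS"
  using F.M.a_closed[of p q] by (simp only: free_space_simps)

lemma rels_coset: "p \<in> carrier FS \<Longrightarrow> q \<in> carrier FS \<Longrightarrow> (\<lambda>s. p s - q s) \<in> tgens \<Longrightarrow> rels +>\<^bsub>FS\<^esub> p = rels +>\<^bsub>FS\<^esub> q"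
  using F.coset_eq[OF rels_subsp, of p q] tgens_rels by (simp only: FS_minus)

lemma pt_add_left: "v \<in> carrier V \<Longrightarrow> v' \<in> carrier V \<Longrightarrow> w \<in> carrier W \<Longrightarrow> pt (v \<oplus>\<^bsub>V\<^esub> v') w = pt v w \<oplus>\<^bsub>T\<^esub> pt v' w"
  unfolding pure_tensor_def
  by (simp only: T_add FS_single, rule rels_coset) (simp_all only: FS_single FS_add V.M.a_closed W.M.a_closed, unfold tgens_def diff_diff_eq[symmetric], blast)

lemma pt_add_right: "v \<in> carrier V \<Longrightarrow> w \<in> carrier W \<Longrightarrow> w' \<in> carrier W \<Longrightarrow> pt v (w \<oplus>\<^bsub>W\<^esub> w') = pt v w \<oplus>\<^bsub>T\<^esub> pt v w'"
  unfolding pure_tensor_def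
  by (simp only: T_add FS_single, rule rels_coset) (simp_all only: FS_single FS_add V.M.a_closed W.M.a_closed, unfold tgens_def diff_diff_eq[symmetric], blast)

lemma pt_smult_left: "v \<in> carrier V \<Longrightarrow> w \<in> carrier W \<Longrightarrow> pt (c \<odot>\<^bsub>V\<^esub> v) w = c \<odot>\<^bsub>T\<^esub> pt v w"
  unfolding pure_tensor_def
  by (simp only: T_smult FS_single, rule rels_coset) (simp_all only: FS_single FS_smult V.sc_closed W.sc_closed, unfold tgens_def, blast)

lemma pt_smult_right: "v \<in> carrier V \<Longrightarrow> w \<in> carrier W \<Longrightarrow> pt v (c \<odot>\<^bsub>W\<^esub> w) = c \<odot>\<^bsub>T\<^esub> pt v w"
  unfolding pure_tensor_def
  by (simp only: T_smult FS_single, rule rels_coset) (simp_all only: FS_single FS_smult V.sc_closed W.sc_closed, unfold tgens_def, blast)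

text \<open>The coefficients of a combination of pure tensors are absorbed into the first
  factor.\<close>

lemma tensor_induct [consumes 1, case_names zero add]:
  assumes "t \<in> carrier T" "P \<zero>\<^bsub>T\<^esub>"
    and "\<And>t v w. t \<in> carrier T \<Longrightarrow> v \<in> carrier V \<Longrightarrow> w \<in> carrier W \<Longrightarrow> P t \<Longrightarrow> P (t \<oplus>\<^bsub>T\<^esub> pt v w)"
  shows "P t"
proof -
  obtain p where p: "p \<in> carrier FS" "t = rels +>\<^bsub>FS\<^esub> p" using assms(1) unfolding tensor_def F.quotient_carrier by blast
  have "P (rels +>\<^bsub>FS\<^esub> p)" using p(1)
  proof (induction rule: free_space_induct)
    case zero
    then show ?case using assms(2) F.quotient_zero[OF rels_subsp] by (simp only: tensor_def free_space_simps)
  next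
    case (add p c s)
    obtain v w where s: "s = (v, w)" "v \<in> carrier V" "w \<in> carrier W" using add(2) by blast
    have "(rels +>\<^bsub>FS\<^esub> p) \<in> carrier T" unfolding tensor_def F.quotient_carrier using add(1) by blast
    then have "P ((rels +>\<^bsub>FS\<^esub> p) \<oplus>\<^bsub>T\<^esub> pt (c \<odot>\<^bsub>V\<^esub> v) w)" using s add(3) by (intro assms(3)) auto
    moreover have "pt (c \<odot>\<^bsub>V\<^esub> v) w = rels +>\<^bsub>FS\<^esub> (\<lambda>t. c * single s t)"
      unfolding pt_smult_left[OF s(2,3)] unfolding pure_tensor_def s(1) by (rule T_smult[OF FS_single[OF s(2,3)]])
    ultimately show ?case using add(1) FS_smult[OF FS_single[OF s(2,3)], of c] by (simp only: T_add s(1))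
  qed
  then show ?thesis by (simp only: p(2))
qed

lemma lin_hom_tensor_eq:
  assumes X: "kspace X" and f: "f \<in> lin_hom T X" "g \<in> lin_hom T X"
    and eq: "\<And>v w. v \<in> carrier V \<Longrightarrow> w \<in> carrier W \<Longrightarrow> f (pt v w) = g (pt v w)"
  shows "f = g"
proof (rule extensionalityI[OF lin_homD(2)[OF f(1)] lin_homD(2)[OF f(2)]])
  fix t assume "t \<in> carrier T"
  then show "f t = g t"
  proof (induction rule: tensor_induct)
    case zero
    show ?case by (simp only: lin_hom_zero[OF T.kspace_axioms X f(1)] lin_hom_zero[OF T.kspace_axioms X f(2)])
  next
    case (add t v w)
    then show ?case by (simp add: lin_homD(3)[OF f(1)] lin_homD(3)[OF f(2)] pt_closed eq)
  qed
qed

text \<open>The linear extension of \<open>h\<close> to the free space kills the bilinear relations,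
  and a linear map on the tensor product is determined by pure tensors. So the description in the
  definition denotes a unique map.\<close>

lemma tensor_lift:
  assumes X: "kspace X" and h: "bilinear V W X h"
  shows tensor_lift_hom: "tensor_lift V W X h \<in> lin_hom T X"
    and tensor_lift_pt: "v \<in> carrier V \<Longrightarrow> w \<in> carrier W \<Longrightarrow> tensor_lift V W X h (pt v w) = h v w"
proof -
  interpret X: kspace X by fact
  let ?h = "\<lambda>(v, w). h v w" let ?L = "ext_lin X ?h"
  have hc: "?h s \<in> carrier X" if "s \<in> carrier V \<times> carrier W" for s using that bilinearD(1)[OF h] by auto
  have L: "p \<in> carrier FS \<Longrightarrow> ?L p \<in> carrier X" "p \<in> carrier FS \<Longrightarrow> q \<in> carrier FS \<Longrightarrow> ?L (\<lambda>s. p s + q s) = ?L p \<oplus>\<^bsub>X\<^esub> ?L q"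
    "p \<in> carrier FS \<Longrightarrow> ?L (\<lambda>s. c * p s) = c \<odot>\<^bsub>X\<^esub> ?L p" for p q c
    using hc by (auto intro: X.ext_lin(1-3)[of "carrier V \<times> carrier W"])
  have Ld: "?L (\<lambda>s. p s - q s) = ?L p \<ominus>\<^bsub>X\<^esub> ?L q" if "p \<in> carrier FS" "q \<in> carrier FS" for p q
  proof -
    have "?L (\<lambda>s. p s + (- 1) * q s) = ?L p \<oplus>\<^bsub>X\<^esub> (- 1) \<odot>\<^bsub>X\<^esub> ?L q"
      using L(2)[OF that(1) FS_smult[OF that(2), of "- 1"]] L(3)[OF that(2), of "- 1"] by (simp only:)
    then show ?thesis using L(1)[OF that(1)] L(1)[OF that(2)] by (simp add: X.minus_sc)
  qed
  have Ls: "?L (single (v, w)) = h v w" if "v \<in> carrier V" "w \<in> carrier W" for v w using X.ext_lin(4)[of "carrier V \<times> carrier W" ?h "(v, w)"] hc that by simp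
  have K: "F.subsp {p \<in> carrier FS. ?L p = \<zero>\<^bsub>X\<^esub>}"
    unfolding F.subsp_def mem_Collect_eq free_space_simps
  proof (intro conjI ballI allI)
    show "(\<lambda>_. 0) \<in> carrier FS" using F.M.zero_closed by (simp only: free_space_simps)
    show "?L (\<lambda>_. 0) = \<zero>\<^bsub>X\<^esub>" by (simp add: ext_lin_def)
  qed (auto simp: FS_add FS_smult L X.sc_zero)
  have "tgens \<subseteq> {p \<in> carrier FS. ?L p = \<zero>\<^bsub>X\<^esub>}"
  proof
    fix x assume x: "x \<in> tgens"
    have 1: "a \<oplus>\<^bsub>X\<^esub> b \<ominus>\<^bsub>X\<^esub> a \<ominus>\<^bsub>X\<^esub> b = \<zero>\<^bsub>X\<^esub>" if "a \<in> carrier X" "b \<in> carrier X" for a b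
      using that X.M.r_neg[of "a \<oplus>\<^bsub>X\<^esub> b"] by (simp add: X.M.minus_eq X.M.minus_add X.M.a_assoc)
    have 2: "a \<ominus>\<^bsub>X\<^esub> a = \<zero>\<^bsub>X\<^esub>" if "a \<in> carrier X" for a using that by (simp add: X.M.minus_eq X.M.r_neg)
    note cl = FS_single FS_smult FS_diff V.sc_closed W.sc_closed V.M.a_closed W.M.a_closed bilinearD(1)[OF h] X.sc_closed X.M.a_closed
    have "?L x = \<zero>\<^bsub>X\<^esub>" using x unfolding tgens_def
      by (elim UnE CollectE exE conjE) 
        (simp_all add: Ld Ls L(3) cl bilinearD(2-)[OF h] 1 2)
    then show "x \<in> {p \<in> carrier FS. ?L p = \<zero>\<^bsub>X\<^esub>}" using x tgens_FS by blast
  qed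
  then have "rels \<subseteq> {p \<in> carrier FS. ?L p = \<zero>\<^bsub>X\<^esub>}" unfolding rels_eq by (rule F.span_least[OF K])
  then have R0: "?L x = \<zero>\<^bsub>X\<^esub>" if "x \<in> rels" for x using that by blast
  have "\<exists>!g. g \<in> lin_hom (quotient_space FS rels) X \<and> (\<forall>x\<in>carrier FS. g (rels +>\<^bsub>FS\<^esub> x) = ?L x)"
    by (rule F.quotient_factor[OF rels_subsp X]) (simp_all only: free_space_simps L(1,2,3) R0)
  then obtain g where g: "g \<in> lin_hom T X" "\<And>x. x \<in> carrier FS \<Longrightarrow> g (rels +>\<^bsub>FS\<^esub> x) = ?L x" unfolding tensor_def by blast
  have "\<exists>!f. f \<in> lin_hom T X \<and> (\<forall>v\<in>carrier V. \<forall>w\<in>carrier W. f (pt v w) = h v w)"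
  proof (rule ex1I[of _ g])
    show "g \<in> lin_hom T X \<and> (\<forall>v\<in>carrier V. \<forall>w\<in>carrier W. g (pt v w) = h v w)"
      using g(1) by (simp add: pure_tensor_def g(2) FS_single Ls)
    then show "f = g" if "f \<in> lin_hom T X \<and> (\<forall>v\<in>carrier V. \<forall>w\<in>carrier W. f (pt v w) = h v w)" for f
      using that by (intro lin_hom_tensor_eq[OF X]) auto
  qed
  from theI'[OF this] show "tensor_lift V W X h \<in> lin_hom T X"
    "v \<in> carrier V \<Longrightarrow> w \<in> carrier W \<Longrightarrow> tensor_lift V W X h (pt v w) = h v w"
    unfolding tensor_lift_def by blast+
qed

end

subsection \<open>The twisted quotient as a right module\<close>

context rep
begin

sublocale t: tens V "Um N" by (intro tens.intro kspace_axioms ml.U_kspace)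

abbreviation "X0 \<equiv> VU N V"
abbreviation "S \<equiv> psi_sub N V"
abbreviation "PQ \<equiv> psi_quotient N V"
abbreviation "VL \<equiv> VU_left N V"
abbreviation "VR \<equiv> VU_right N V"

lemmas inc_closed = ml.inc_closed[of _ N]

lemma left_bilinear:
  assumes \<xi>: "\<xi> \<in> carrier (mirabolic_lie N)"
  shows "bilinear V (Um N) X0 (\<lambda>v z. t.pt (ad N V \<xi> v) z \<oplus>\<^bsub>X0\<^esub> t.pt v (uea_incl (mirabolic_lie N) \<xi> \<otimes>\<^bsub>Um N\<^esub> z))"
  unfolding bilinear_def
proof (intro ballI conjI allI)
  fix v and z :: "('k mat list \<Rightarrow> 'k) set" assume v: "v \<in> carrier V" and z: "z \<in> carrier (Um N)"
  note cl = ad_spec(1)[OF \<xi>] ml.U_mult_closed[OF inc_closed[OF \<xi>]] t.pt_closed v z inc_closed[OF \<xi>]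
  show "t.pt (ad N V \<xi> v) z \<oplus>\<^bsub>X0\<^esub> t.pt v (uea_incl (mirabolic_lie N) \<xi> \<otimes>\<^bsub>Um N\<^esub> z) \<in> carrier X0"
    using cl by (intro t.T.M.a_closed) auto
  show "t.pt (ad N V \<xi> (v \<oplus> v')) z \<oplus>\<^bsub>X0\<^esub> t.pt (v \<oplus> v') (uea_incl (mirabolic_lie N) \<xi> \<otimes>\<^bsub>Um N\<^esub> z) =
      t.pt (ad N V \<xi> v) z \<oplus>\<^bsub>X0\<^esub> t.pt v (uea_incl (mirabolic_lie N) \<xi> \<otimes>\<^bsub>Um N\<^esub> z) \<oplus>\<^bsub>X0\<^esub>
      (t.pt (ad N V \<xi> v') z \<oplus>\<^bsub>X0\<^esub> t.pt v' (uea_incl (mirabolic_lie N) \<xi> \<otimes>\<^bsub>Um N\<^esub> z))"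
    if v': "v' \<in> carrier V" for v'
    using cl v' by (simp add: ad_add[OF \<xi>] t.pt_add_left t.T.M.a_ac)
  show "t.pt (ad N V \<xi> v) (z \<oplus>\<^bsub>Um N\<^esub> z') \<oplus>\<^bsub>X0\<^esub> t.pt v (uea_incl (mirabolic_lie N) \<xi> \<otimes>\<^bsub>Um N\<^esub> (z \<oplus>\<^bsub>Um N\<^esub> z')) =
      t.pt (ad N V \<xi> v) z \<oplus>\<^bsub>X0\<^esub> t.pt v (uea_incl (mirabolic_lie N) \<xi> \<otimes>\<^bsub>Um N\<^esub> z) \<oplus>\<^bsub>X0\<^esub>
      (t.pt (ad N V \<xi> v) z' \<oplus>\<^bsub>X0\<^esub> t.pt v (uea_incl (mirabolic_lie N) \<xi> \<otimes>\<^bsub>Um N\<^esub> z'))"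
    if z': "z' \<in> carrier (Um N)" for z'
    using cl z' by (simp add: ml.U_distr t.pt_add_right t.T.M.a_ac)
  fix c
  show "t.pt (ad N V \<xi> (c \<odot> v)) z \<oplus>\<^bsub>X0\<^esub> t.pt (c \<odot> v) (uea_incl (mirabolic_lie N) \<xi> \<otimes>\<^bsub>Um N\<^esub> z) =
      c \<odot>\<^bsub>X0\<^esub> (t.pt (ad N V \<xi> v) z \<oplus>\<^bsub>X0\<^esub> t.pt v (uea_incl (mirabolic_lie N) \<xi> \<otimes>\<^bsub>Um N\<^esub> z))"
    using cl by (simp add: ad_scale[OF \<xi>] t.pt_smult_left t.T.sc_add)
  show "t.pt (ad N V \<xi> v) (c \<odot>\<^bsub>Um N\<^esub> z) \<oplus>\<^bsub>X0\<^esub> t.pt v (uea_incl (mirabolic_lie N) \<xi> \<otimes>\<^bsub>Um N\<^esub> (c \<odot>\<^bsub>Um N\<^esub> z)) =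
      c \<odot>\<^bsub>X0\<^esub> (t.pt (ad N V \<xi> v) z \<oplus>\<^bsub>X0\<^esub> t.pt v (uea_incl (mirabolic_lie N) \<xi> \<otimes>\<^bsub>Um N\<^esub> z))"
    using cl by (simp add: ml.U_smultr t.pt_smult_right t.T.sc_add)
qed

lemma right_bilinear: "y \<in> carrier (Um N) \<Longrightarrow> bilinear V (Um N) X0 (\<lambda>v z. t.pt v (z \<otimes>\<^bsub>Um N\<^esub> y))"
  unfolding bilinear_def
  by (intro ballI conjI allI) (simp_all add: t.pt_closed ml.U_mult_closed t.pt_add_left t.pt_smult_left ml.U_distl ml.U_smultl t.pt_add_right t.pt_smult_right)

lemma VL_hom: "\<xi> \<in> carrier (mirabolic_lie N) \<Longrightarrow> VL \<xi> \<in> lin_hom X0 X0"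
  unfolding VU_left_def by (rule t.tensor_lift_hom[OF t.T.kspace_axioms left_bilinear])

lemma VL_pt: "\<xi> \<in> carrier (mirabolic_lie N) \<Longrightarrow> v \<in> carrier V \<Longrightarrow> z \<in> carrier (Um N) \<Longrightarrow>
    VL \<xi> (t.pt v z) = t.pt (ad N V \<xi> v) z \<oplus>\<^bsub>X0\<^esub> t.pt v (uea_incl (mirabolic_lie N) \<xi> \<otimes>\<^bsub>Um N\<^esub> z)"
  unfolding VU_left_def by (rule t.tensor_lift_pt[OF t.T.kspace_axioms left_bilinear])

lemma VR_hom: "y \<in> carrier (Um N) \<Longrightarrow> VR y \<in> lin_hom X0 X0"
  unfolding VU_right_def by (rule t.tensor_lift_hom[OF t.T.kspace_axioms right_bilinear])

lemma VR_pt: "y \<in> carrier (Um N) \<Longrightarrow> v \<in> carrier V \<Longrightarrow> z \<in> carrier (Um N) \<Longrightarrow> VR y (t.pt v z) = t.pt v (z \<otimes>\<^bsub>Um N\<^esub> y)"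
  unfolding VU_right_def by (rule t.tensor_lift_pt[OF t.T.kspace_axioms right_bilinear])

lemmas VL_lin = lin_homD(1,3,4)[OF VL_hom] and VL_zero = lin_hom_zero[OF t.T.kspace_axioms t.T.kspace_axioms VL_hom]
lemmas VR_lin = lin_homD(1,3,4)[OF VR_hom] and VR_zero = lin_hom_zero[OF t.T.kspace_axioms t.T.kspace_axioms VR_hom]

lemma VR_y_add: "t \<in> carrier X0 \<Longrightarrow> y \<in> carrier (Um N) \<Longrightarrow> z \<in> carrier (Um N) \<Longrightarrow> VR (y \<oplus>\<^bsub>Um N\<^esub> z) t = VR y t \<oplus>\<^bsub>X0\<^esub> VR z t"
proof (induction rule: t.tensor_induct)
  case zero then show ?case by (simp add: VR_zero)
next
  case (add t v w)
  then show ?case by (simp add: VR_lin t.pt_closed VR_pt ml.U_distr ml.U_mult_closed t.pt_add_right t.T.M.a_ac)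
qed

lemma VR_y_smult: "t \<in> carrier X0 \<Longrightarrow> y \<in> carrier (Um N) \<Longrightarrow> VR (c \<odot>\<^bsub>Um N\<^esub> y) t = c \<odot>\<^bsub>X0\<^esub> VR y t"
proof (induction rule: t.tensor_induct)
  case zero then show ?case by (simp add: VR_zero t.T.sc_zero)
next
  case (add t v w)
  then show ?case by (simp add: VR_lin t.pt_closed VR_pt ml.U_smultr ml.U_mult_closed t.pt_smult_right t.T.sc_add)
qed

lemma VR_one: "t \<in> carrier X0 \<Longrightarrow> VR \<one>\<^bsub>Um N\<^esub> t = t"
proof (induction rule: t.tensor_induct)
  case zero then show ?case by (simp add: VR_zero ml.U_one_closed)
next
  case (add t v w)
  then show ?case by (simp add: VR_lin t.pt_closed VR_pt ml.U_one_closed ml.U_one_right)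
qed

lemma VR_mult: "t \<in> carrier X0 \<Longrightarrow> y \<in> carrier (Um N) \<Longrightarrow> z \<in> carrier (Um N) \<Longrightarrow> VR (y \<otimes>\<^bsub>Um N\<^esub> z) t = VR z (VR y t)"
proof (induction rule: t.tensor_induct)
  case zero then show ?case by (simp add: VR_zero ml.U_mult_closed)
next
  case (add t v w)
  then show ?case by (simp add: VR_lin t.pt_closed VR_pt ml.U_mult_closed ml.U_assoc)
qed

lemma VR_VL: "t \<in> carrier X0 \<Longrightarrow> y \<in> carrier (Um N) \<Longrightarrow> \<xi> \<in> carrier (mirabolic_lie N) \<Longrightarrow> VR y (VL \<xi> t) = VL \<xi> (VR y t)"
proof (induction rule: t.tensor_induct)
  case zero then show ?case by (simp add: VR_zero VL_zero)
next
  case (add t v w)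
  then show ?case by (simp add: VR_lin VL_lin t.pt_closed VR_pt VL_pt ml.U_mult_closed ml.U_assoc inc_closed ad_spec)
qed

abbreviation psi_gens :: "('k, 'v) VU set" where
  "psi_gens \<equiv> {VL x t \<ominus>\<^bsub>X0\<^esub> (psi N x \<odot>\<^bsub>X0\<^esub> t) | x t. x \<in> n_minus N \<and> t \<in> carrier X0}"

lemma psi_gens_closed: "psi_gens \<subseteq> carrier X0"
  by (auto intro!: t.T.M.minus_closed VL_lin(1) n_minus_mirabolic)

lemma S_subsp: "t.T.subsp S"
  unfolding psi_sub_def by (rule t.T.span_subsp[OF psi_gens_closed])

lemma S_gens: "x \<in> n_minus N \<Longrightarrow> t \<in> carrier X0 \<Longrightarrow> VL x t \<ominus>\<^bsub>X0\<^esub> (psi N x \<odot>\<^bsub>X0\<^esub> t) \<in> S"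
  unfolding psi_sub_def using t.T.span_base[OF psi_gens_closed] by blast

lemma S_least: "t.T.subsp P \<Longrightarrow> (\<And>x t. x \<in> n_minus N \<Longrightarrow> t \<in> carrier X0 \<Longrightarrow> VL x t \<ominus>\<^bsub>X0\<^esub> (psi N x \<odot>\<^bsub>X0\<^esub> t) \<in> P) \<Longrightarrow> S \<subseteq> P"
  unfolding psi_sub_def by (rule t.T.span_least) auto

lemma S_VR: assumes y: "y \<in> carrier (Um N)" shows "s \<in> S \<Longrightarrow> VR y s \<in> S"
proof -
  have "S \<subseteq> {t \<in> carrier X0. VR y t \<in> S}"
  proof (rule S_least)
    show "t.T.subsp {t \<in> carrier X0. VR y t \<in> S}"
      using S_subsp y by (auto simp: t.T.subsp_def VR_lin VR_zero)
    fix x :: "'k mat" and t assume x: "x \<in> n_minus N" and t: "t \<in> carrier X0"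
    note xm = n_minus_mirabolic[OF x]
    have "VR y (VL x t \<ominus>\<^bsub>X0\<^esub> (psi N x \<odot>\<^bsub>X0\<^esub> t)) = VL x (VR y t) \<ominus>\<^bsub>X0\<^esub> (psi N x \<odot>\<^bsub>X0\<^esub> VR y t)"
      using y t xm by (simp add: lin_hom_diff[OF t.T.kspace_axioms t.T.kspace_axioms VR_hom] VL_lin VR_lin VR_VL)
    then show "VL x t \<ominus>\<^bsub>X0\<^esub> (psi N x \<odot>\<^bsub>X0\<^esub> t) \<in> {t \<in> carrier X0. VR y t \<in> S}"
      using S_gens[OF x VR_lin(1)[OF y t]] x t psi_gens_closed by auto
  qed
  then show "s \<in> S \<Longrightarrow> VR y s \<in> S" by blast
qed

abbreviation cl :: "('k, 'v) VU \<Rightarrow> ('k, 'v) VU set" where "cl t \<equiv> S +>\<^bsub>X0\<^esub> t"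

lemma PQ_carrier: "carrier PQ = cl ` carrier X0"
  using t.T.quotient_carrier[of S] by (simp add: psi_quotient_def module.defs)

lemma PQ_zero: "\<zero>\<^bsub>PQ\<^esub> = cl \<zero>\<^bsub>X0\<^esub>"
  using t.T.quotient_zero[OF S_subsp] by (simp add: psi_quotient_def module.defs)

lemma PQ_add: "s \<in> carrier X0 \<Longrightarrow> t \<in> carrier X0 \<Longrightarrow> cl s \<oplus>\<^bsub>PQ\<^esub> cl t = cl (s \<oplus>\<^bsub>X0\<^esub> t)"
  using t.T.quotient_add[OF S_subsp] by (simp add: psi_quotient_def module.defs)

lemma PQ_smult: "t \<in> carrier X0 \<Longrightarrow> c \<odot>\<^bsub>PQ\<^esub> cl t = cl (c \<odot>\<^bsub>X0\<^esub> t)"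
  using t.T.quotient_smult[OF S_subsp] by (simp add: psi_quotient_def module.defs)

lemma PQ_lin_hom: "lin_hom PQ Y = lin_hom (quotient_space X0 S) Y"
  by (rule Set.set_eqI) (simp add: lin_hom_iff psi_quotient_def module.defs)

lemma PQ_ract: assumes t: "t \<in> carrier X0" and y: "y \<in> carrier (Um N)"
  shows "cl t \<triangleleft>\<^bsub>PQ\<^esub> y = cl (VR y t)"
proof -
  have "cl (VR y s) = cl (VR y t)" if s: "s \<in> cl t" for s
  proof -
    obtain u where u: "u \<in> S" "s = u \<oplus>\<^bsub>X0\<^esub> t" using s unfolding t.T.mem_coset by blast
    have uX: "u \<in> carrier X0" using u(1) S_subsp by (auto simp: t.T.subsp_def)
    have "VR y s \<ominus>\<^bsub>X0\<^esub> VR y t = VR y u" unfolding u(2) using uX t y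
      by (simp add: VR_lin t.T.M.minus_eq t.T.M.a_assoc t.T.M.r_neg)
    then show ?thesis using t.T.coset_eq[OF S_subsp, of "VR y s" "VR y t"] S_VR[OF y u(1)] VR_lin(1)[OF y] uX t u(2) by simp
  qed
  moreover have "t \<in> cl t" using t S_subsp by (auto simp: t.T.mem_coset t.T.subsp_def intro!: bexI[of _ "\<zero>\<^bsub>X0\<^esub>"])
  ultimately have "(\<Union>s\<in>cl t. cl (VR y s)) = cl (VR y t)" by blast
  then show ?thesis by (simp add: psi_quotient_def module.defs)
qed

lemma PQ_vectorspace: "vectorspace class_ring PQ"
proof (rule vectorspaceI, goal_cases)
  case (5 x y)
  then obtain a b where "a \<in> carrier X0" "b \<in> carrier X0" "x = cl a" "y = cl b" unfolding PQ_carrier by blast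
  then show ?case by (simp add: PQ_add t.T.M.a_comm)
qed (auto simp: PQ_carrier PQ_zero PQ_add PQ_smult t.T.M.a_assoc t.T.sc_add t.T.add_sc t.T.sc_sc t.T.sc_one t.T.zero_sc)

lemma PQ_cases: "w \<in> carrier PQ \<Longrightarrow> (\<And>t. t \<in> carrier X0 \<Longrightarrow> w = cl t \<Longrightarrow> P) \<Longrightarrow> P"
  unfolding PQ_carrier by blast

lemma PQ_right_module: "right_module (Um N) PQ"
proof (rule right_module.intro[OF PQ_vectorspace], goal_cases)
  case (1 w y) then show ?case by (elim PQ_cases) (simp add: PQ_ract PQ_carrier VR_lin)
next
  case (2 w w' y) then show ?case by (elim PQ_cases) (simp add: PQ_ract PQ_add VR_lin)
next
  case (3 w y z) then show ?case by (elim PQ_cases) (simp add: PQ_ract PQ_add VR_lin VR_y_add)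
next
  case (4 w y c) then show ?case by (elim PQ_cases) (simp add: PQ_ract PQ_smult VR_lin)
next
  case (5 w y c) then show ?case by (elim PQ_cases) (simp add: PQ_ract PQ_smult VR_lin VR_y_smult)
next
  case (6 w) then show ?case by (elim PQ_cases) (simp add: PQ_ract ml.U_one_closed VR_one)
next
  case (7 w y z) then show ?case by (elim PQ_cases) (simp add: PQ_ract ml.U_mult_closed VR_lin VR_mult)
qed

lemma PQ_umod: "umod N PQ" by (rule umod.intro[OF PQ_right_module])

abbreviation "pc \<equiv> psi_class N V"

lemma pc_closed: "v \<in> carrier V \<Longrightarrow> z \<in> carrier (Um N) \<Longrightarrow> pc v z \<in> carrier PQ"
  unfolding psi_class_def PQ_carrier using t.pt_closed by blast

lemma pc_ract: "v \<in> carrier V \<Longrightarrow> z \<in> carrier (Um N) \<Longrightarrow> y \<in> carrier (Um N) \<Longrightarrow> pc v z \<triangleleft>\<^bsub>PQ\<^esub> y = pc v (z \<otimes>\<^bsub>Um N\<^esub> y)"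
  unfolding psi_class_def by (simp add: PQ_ract t.pt_closed VR_pt)

lemma pc_bilinear: "bilinear V (Um N) PQ pc"
  unfolding bilinear_def psi_class_def PQ_carrier
  by (intro ballI conjI allI) (simp_all add: t.pt_closed PQ_add PQ_smult t.pt_add_left t.pt_add_right t.pt_smult_left t.pt_smult_right)

lemma pc_rel: assumes x: "x \<in> n_minus N" and v: "v \<in> carrier V" and z: "z \<in> carrier (Um N)"
  shows "pc (ad N V x v) z \<oplus>\<^bsub>PQ\<^esub> pc v (uea_incl (mirabolic_lie N) x \<otimes>\<^bsub>Um N\<^esub> z) = psi N x \<odot>\<^bsub>PQ\<^esub> pc v z"
proof -
  note xm = n_minus_mirabolic[OF x]
  have "cl (VL x (t.pt v z)) = cl (psi N x \<odot>\<^bsub>X0\<^esub> t.pt v z)"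
    using t.T.coset_eq[OF S_subsp] S_gens[OF x] t.pt_closed[OF v z] VL_lin(1)[OF xm] by simp
  then show ?thesis unfolding psi_class_def using xm v z
    by (simp add: VL_pt PQ_add PQ_smult t.pt_closed ad_spec inc_closed ml.U_mult_closed)
qed

lemma PQ_induct [consumes 1, case_names zero add]:
  assumes "w \<in> carrier PQ" "P \<zero>\<^bsub>PQ\<^esub>"
    and "\<And>w v z. w \<in> carrier PQ \<Longrightarrow> v \<in> carrier V \<Longrightarrow> z \<in> carrier (Um N) \<Longrightarrow> P w \<Longrightarrow> P (w \<oplus>\<^bsub>PQ\<^esub> pc v z)"
  shows "P w"
proof -
  obtain t where t: "t \<in> carrier X0" "w = cl t" using assms(1) by (rule PQ_cases)
  have "P (cl t)" using t(1)
  proof (induction rule: t.tensor_induct)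
    case zero show ?case using assms(2) by (simp only: PQ_zero)
  next
    case (add t v w)
    have "P (cl t \<oplus>\<^bsub>PQ\<^esub> pc v w)" using add by (intro assms(3)) (simp_all add: PQ_carrier)
    then show ?case using add by (simp add: psi_class_def PQ_add t.pt_closed)
  qed
  then show ?thesis by (simp only: t(2))
qed

lemma PQ_hom_eq:
  assumes Y: "kspace Y" and f: "f \<in> lin_hom PQ Y" "g \<in> lin_hom PQ Y"
    and eq: "\<And>v z. v \<in> carrier V \<Longrightarrow> z \<in> carrier (Um N) \<Longrightarrow> f (pc v z) = g (pc v z)"
  shows "f = g"
proof (rule extensionalityI[OF lin_homD(2)[OF f(1)] lin_homD(2)[OF f(2)]])
  have k: "kspace PQ" by (rule kspaceI[OF PQ_vectorspace])
  fix w assume "w \<in> carrier PQ"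
  then show "f w = g w"
  proof (induction rule: PQ_induct)
    case zero
    show ?case by (simp only: lin_hom_zero[OF k Y f(1)] lin_hom_zero[OF k Y f(2)])
  next
    case (add w v z)
    then show ?case by (simp add: lin_homD(3)[OF f(1)] lin_homD(3)[OF f(2)] pc_closed eq)
  qed
qed

text \<open>The hypothesis \<open>rel\<close> says that the bilinear map from (v, z) to the image of
  \<open>f v\<close> under \<open>z\<close> is compatible with the left action of x - \<psi>(x) on
  the tensor product, so it kills \<open>psi_sub\<close>. This provides the functor on arrows and
  the maps to other Whittaker modules.\<close>

lemma PQ_universal:
  assumes Y: "umod N Y" and f: "f \<in> lin_hom V Y"
    and rel: "\<And>x v. x \<in> n_minus N \<Longrightarrow> v \<in> carrier V \<Longrightarrow>
      f (ad N V x v) \<oplus>\<^bsub>Y\<^esub> (f v \<triangleleft>\<^bsub>Y\<^esub> uea_incl (mirabolic_lie N) x) = psi N x \<odot>\<^bsub>Y\<^esub> f v"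
  shows "\<exists>h\<in>rmod_hom (Um N) PQ Y. \<forall>v\<in>carrier V. \<forall>z\<in>carrier (Um N). h (pc v z) = f v \<triangleleft>\<^bsub>Y\<^esub> z"
proof -
  interpret Y: umod N Y by fact
  note fl = lin_homD(1,3,4)[OF f]
  have bil: "bilinear V (Um N) Y (\<lambda>v z. f v \<triangleleft>\<^bsub>Y\<^esub> z)"
    unfolding bilinear_def
    by (intro ballI conjI allI) (simp_all add: fl Y.rm.ract_closed Y.rm.ract_add_left Y.rm.ract_add_right Y.rm.ract_smult_left Y.rm.ract_smult_right)
  define F where "F = tensor_lift V (Um N) Y (\<lambda>v z. f v \<triangleleft>\<^bsub>Y\<^esub> z)"
  have F: "F \<in> lin_hom X0 Y" unfolding F_def by (rule t.tensor_lift_hom[OF Y.kspace_axioms bil])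
  have Fp: "F (t.pt v z) = f v \<triangleleft>\<^bsub>Y\<^esub> z" if "v \<in> carrier V" "z \<in> carrier (Um N)" for v z
    unfolding F_def using that by (rule t.tensor_lift_pt[OF Y.kspace_axioms bil])
  note Fl = lin_homD(1,3,4)[OF F] and F0 = lin_hom_zero[OF t.T.kspace_axioms Y.kspace_axioms F]
  have FL: "F (VL x t) = psi N x \<odot>\<^bsub>Y\<^esub> F t" if "t \<in> carrier X0" and x: "x \<in> n_minus N" for x :: "'k mat" and t
    using that(1)
  proof (induction rule: t.tensor_induct)
    note xm = n_minus_mirabolic[OF x]
    case zero then show ?case by (simp add: VL_zero xm F0 Y.sc_zero)
  next
    note xm = n_minus_mirabolic[OF x]
    case (add t v z)
    have "F (VL x (t.pt v z)) = (f (ad N V x v) \<oplus>\<^bsub>Y\<^esub> (f v \<triangleleft>\<^bsub>Y\<^esub> uea_incl (mirabolic_lie N) x)) \<triangleleft>\<^bsub>Y\<^esub> z"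
      using add xm by (simp add: VL_pt Fl Fp t.pt_closed ad_spec inc_closed ml.U_mult_closed fl Y.rm.ract_closed Y.rm.ract_add_left Y.rm.ract_mult)
    also have "\<dots> = psi N x \<odot>\<^bsub>Y\<^esub> F (t.pt v z)"
      unfolding rel[OF x add(2)] using add by (simp add: Y.rm.ract_smult_left fl Fp)
    finally show ?case using add xm by (simp add: VL_lin Fl t.pt_closed Y.sc_add)
  qed
  have FS: "F s = \<zero>\<^bsub>Y\<^esub>" if "s \<in> S" for s
  proof -
    have "S \<subseteq> {t \<in> carrier X0. F t = \<zero>\<^bsub>Y\<^esub>}"
    proof (rule S_least)
      show "t.T.subsp {t \<in> carrier X0. F t = \<zero>\<^bsub>Y\<^esub>}" by (auto simp: t.T.subsp_def Fl F0 Y.sc_zero)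
      fix x :: "'k mat" and t assume x: "x \<in> n_minus N" and t: "t \<in> carrier X0"
      have "F (VL x t \<ominus>\<^bsub>X0\<^esub> (psi N x \<odot>\<^bsub>X0\<^esub> t)) = \<zero>\<^bsub>Y\<^esub>"
        using t VL_lin(1)[OF n_minus_mirabolic[OF x] t]
        by (simp add: lin_hom_diff[OF t.T.kspace_axioms Y.kspace_axioms F] FL[OF t x] Fl Y.M.minus_eq Y.M.r_neg)
      then show "VL x t \<ominus>\<^bsub>X0\<^esub> (psi N x \<odot>\<^bsub>X0\<^esub> t) \<in> {t \<in> carrier X0. F t = \<zero>\<^bsub>Y\<^esub>}" using x t psi_gens_closed by auto
    qed
    then show ?thesis using that by blast
  qed
  have FR: "F (VR y t) = F t \<triangleleft>\<^bsub>Y\<^esub> y" if "t \<in> carrier X0" "y \<in> carrier (Um N)" for t y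
    using that
  proof (induction rule: t.tensor_induct)
    case zero 
    have "\<zero>\<^bsub>Y\<^esub> \<triangleleft>\<^bsub>Y\<^esub> y = \<zero>\<^bsub>Y\<^esub>" using Y.rm.ract_smult_left[of "\<zero>\<^bsub>Y\<^esub>" y 0] zero by (simp add: Y.zero_sc Y.rm.ract_closed)
    then show ?case using zero by (simp add: VR_zero F0)
  next
    case (add t v z)
    then show ?case by (simp add: VR_lin VR_pt Fl Fp t.pt_closed ml.U_mult_closed fl Y.rm.ract_add_left Y.rm.ract_mult Y.rm.ract_closed)
  qed
  have "\<exists>!h. h \<in> lin_hom (quotient_space X0 S) Y \<and> (\<forall>t\<in>carrier X0. h (cl t) = F t)"
    by (rule t.T.quotient_factor[OF S_subsp Y.kspace_axioms]) (simp_all only: Fl FS)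
  then obtain h where h: "h \<in> lin_hom PQ Y" "\<And>t. t \<in> carrier X0 \<Longrightarrow> h (cl t) = F t" unfolding PQ_lin_hom by blast
  have "h (w \<triangleleft>\<^bsub>PQ\<^esub> y) = h w \<triangleleft>\<^bsub>Y\<^esub> y" if "w \<in> carrier PQ" "y \<in> carrier (Um N)" for w y
    using that by (elim PQ_cases) (simp add: PQ_ract h(2) VR_lin FR)
  then have "h \<in> rmod_hom (Um N) PQ Y" using h(1) by (simp add: rmod_hom_def)
  moreover have "h (pc v z) = f v \<triangleleft>\<^bsub>Y\<^esub> z" if "v \<in> carrier V" "z \<in> carrier (Um N)" for v z
    unfolding psi_class_def using that by (simp add: h(2) t.pt_closed Fp)
  ultimately show ?thesis by blast
qed

end

lemma crd_act_stable:
  assumes "umod N W" and M: "mir_ops.stable fsc N (umod.e N W) M" and x: "x \<in> carrier (mirabolic_lie N)"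
    and w: "w \<in> carrier W" "kspace.crd W w \<in> M"
  shows "kspace.crd W (umod.act N W x w) \<in> M"
proof -
  interpret umod N W by fact
  show ?thesis using x
  proof (induction rule: mirabolic_induct)
    case zero then show ?case using M w by (simp add: act_zero crd_zero stable_def is_subspace_def)
  next
    case (add B c i j)
    note E = E_mirabolic[OF add(2,3)]
    have "act (B + c \<cdot>\<^sub>m E N i j) w = act B w \<oplus>\<^bsub>W\<^esub> c \<odot>\<^bsub>W\<^esub> act (E N i j) w"
      using w add(1) E ml.L_smult[OF E, of c] by (simp add: act_mat_add act_mat_scale[OF E] mirabolic_simps)
    moreover have "crd (act (E N i j) w) \<in> M" using M w add(2,3) unfolding stable_def by (simp flip: e_crd)
    ultimately show ?case using add.IH M w act_closed[OF add(1) w(1)] act_closed[OF E w(1)]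
      by (simp add: crd_add crd_scale stable_def is_subspace_def)
  qed
qed

subsection \<open>The Whittaker module of a representation\<close>

context rep
begin

definition cr :: "'v \<Rightarrow> ('k, 'v) VU set \<Rightarrow>\<^sub>0 'k" where "cr v = kspace.crd PQ (pc v \<one>\<^bsub>Um N\<^esub>)"

lemma cr_SV: "v \<in> carrier V \<Longrightarrow> cr v \<in> kspace.SV PQ"
  unfolding cr_def by (intro kspace.crd_SV kspaceI[OF PQ_vectorspace] pc_closed ml.U_one_closed)

lemma cr_add: "v \<in> carrier V \<Longrightarrow> w \<in> carrier V \<Longrightarrow> cr (v \<oplus> w) = cr v + cr w"
  and cr_scale: "v \<in> carrier V \<Longrightarrow> cr (c \<odot> v) = fsc c (cr v)"
  unfolding cr_def
  by (simp_all add: bilinearD[OF pc_bilinear] ml.U_one_closed kspace.crd_add[OF kspaceI[OF PQ_vectorspace]]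
      kspace.crd_scale[OF kspaceI[OF PQ_vectorspace]])

lemma cr_p:
  assumes a: "a \<in> mir_ops.neg N" and v: "v \<in> carrier V"
  shows "mir_ops.p (umod.e N PQ) a (cr v) = - cr (ad N V (E N (fst a) (snd a)) v)"
proof -
  interpret X: umod N PQ by (rule PQ_umod)
  let ?E = "E N (fst a) (snd a) :: 'k mat"
  have En: "?E \<in> n_minus N" using a by (auto simp: X.neg_def intro: E_n_minus)
  note Em = n_minus_mirabolic[OF En]
  note cl = pc_closed[OF v ml.U_one_closed] pc_closed[OF v inc_closed[OF Em]] pc_closed[OF ad_spec(1)[OF Em v] ml.U_one_closed]
  have act: "X.act ?E (pc v \<one>\<^bsub>Um N\<^esub>) = pc v (uea_incl (mirabolic_lie N) ?E)"
    unfolding X.act_def using v Em by (simp add: pc_ract ml.U_one_closed inc_closed ml.U_one_left)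
  have "psi N ?E \<odot>\<^bsub>PQ\<^esub> pc v \<one>\<^bsub>Um N\<^esub> = pc (ad N V ?E v) \<one>\<^bsub>Um N\<^esub> \<oplus>\<^bsub>PQ\<^esub> pc v (uea_incl (mirabolic_lie N) ?E)"
    using pc_rel[OF En v ml.U_one_closed] inc_closed[OF Em] by (simp add: ml.U_one_right)
  then show ?thesis unfolding cr_def X.p_crd[OF a cl(1)] act using cl
    by (simp add: X.crd_diff X.crd_add)
qed

lemma cr_nil: "v \<in> carrier V \<Longrightarrow> v \<in> adnil n \<Longrightarrow> cr v \<in> mir_ops.nil N (umod.e N PQ) n"
proof (induction n arbitrary: v)
  interpret X: umod N PQ by (rule PQ_umod)
  case 0
  then have "cr v = cr (0 \<odot> v)" by (simp add: sc_zero)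
  then have "cr v = 0" using cr_scale[OF 0(1), of 0] by simp
  then show ?case by (simp add: X.nil_0)
next
  interpret X: umod N PQ by (rule PQ_umod)
  case (Suc n)
  have "X.p a (cr v) \<in> X.nil n" if a: "a \<in> X.neg" for a
  proof -
    have En: "E N (fst a) (snd a) \<in> n_minus N" using a by (auto simp: X.neg_def intro: E_n_minus)
    have "cr (ad N V (E N (fst a) (snd a)) v) \<in> X.nil n"
      using Suc.prems En by (intro Suc.IH ad_spec(1) n_minus_mirabolic) auto
    then show ?thesis unfolding cr_p[OF a Suc.prems(1)] using fsc.sub_minus[OF X.nil_sub] by blast
  qed
  then show ?case by (simp add: X.nil_Suc)
qed

lemma cr_sub: "is_subspace fsc (cr ` carrier V)"
  unfolding is_subspace_def
proof (intro conjI ballI allI)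
  have "cr (0 \<odot> \<zero>) = 0" using cr_scale[of \<zero> 0] by simp
  then have "cr \<zero> = 0" by (simp add: sc_zero)
  then show "0 \<in> cr ` carrier V" by (metis M.zero_closed imageI)
  show "x + y \<in> cr ` carrier V" if "x \<in> cr ` carrier V" "y \<in> cr ` carrier V" for x y
    using that M.a_closed by (auto simp flip: cr_add)
  show "fsc c x \<in> cr ` carrier V" if "x \<in> cr ` carrier V" for c x
    using that sc_closed by (auto simp flip: cr_scale)
qed

text \<open>The right action leads from the class of v \<otimes> 1 to the classes of v \<otimes> z,
  and these span the quotient.\<close>

lemma SV_gen: "kspace.SV PQ \<subseteq> mir_ops.gen N (umod.e N PQ) (cr ` carrier V)"
proof -
  interpret X: umod N PQ by (rule PQ_umod)
  let ?G = "X.gen (cr ` carrier V)"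
  have st: "X.stable ?G" by (rule X.stable_gen[OF cr_sub])
  have sub: "is_subspace fsc ?G" using st by (simp add: X.stable_def)
  have pcG: "X.crd (pc v z) \<in> ?G" if v: "v \<in> carrier V" and "z \<in> carrier (Um N)" for v z
    using that(2)
  proof (induction rule: ml.U_induct)
    case one show ?case using subsetD[OF X.gen_base imageI[OF v, of cr]] by (simp only: cr_def[of v])
  next
    case (add y z) then show ?case
      using v fsc.sub_add[OF sub] by (simp add: bilinearD[OF pc_bilinear] X.crd_add)
  next
    case (smult c y) then show ?case
      using v fsc.sub_scale[OF sub] by (simp add: bilinearD[OF pc_bilinear] X.crd_scale)
  next
    case (mult y x)
    have "pc v (y \<otimes>\<^bsub>Um N\<^esub> uea_incl (mirabolic_lie N) x) = X.act x (pc v y)"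
      using mult v by (simp add: X.act_def pc_ract inc_closed)
    then show ?case using crd_act_stable[OF PQ_umod st mult(2) pc_closed[OF v mult(1)] mult(3)] by simp
  qed
  have "X.crd w \<in> ?G" if "w \<in> carrier PQ" for w
    using that
  proof (induction rule: PQ_induct)
    case zero then show ?case using fsc.sub_zero[OF sub] by (simp add: X.crd_zero)
  next
    case (add w v z) then show ?case using pcG fsc.sub_add[OF sub] by (simp add: X.crd_add pc_closed)
  qed
  then show ?thesis using X.SV_cases by blast
qed

theorem PQ_whittaker: "whittaker_module N PQ"
proof -
  interpret X: umod N PQ by (rule PQ_umod)
  have "\<exists>n. x \<in> X.nil n" if "x \<in> cr ` carrier V" for x
    using that ex_adnil cr_nil by blast
  then show ?thesis unfolding X.whittaker_iff using X.loc_nil_gen SV_gen by blast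
qed

lemma PQ_whit: "whit N PQ" by (rule whit.intro[OF PQ_whittaker])

subsection \<open>The comparison map\<close>

definition iota :: "'v \<Rightarrow> ('k, 'v) VU set" where
  "iota v = kspace.lc PQ (mir_mod.proj N (umod.e N PQ) (kspace.SV PQ) (cr v))"

lemma crd_iota: "v \<in> carrier V \<Longrightarrow> kspace.crd PQ (iota v) = mir_mod.proj N (umod.e N PQ) (kspace.SV PQ) (cr v)"
proof -
  interpret X: whit N PQ by (rule PQ_whit)
  assume v: "v \<in> carrier V"
  show ?thesis unfolding iota_def using X.proj_props(1)[OF cr_SV[OF v]] by (intro X.crd_lc) (simp add: X.invs_def)
qed

lemma iota_whittaker: "v \<in> carrier V \<Longrightarrow> iota v \<in> carrier (whittaker_vectors N PQ)"
proof -
  interpret X: whit N PQ by (rule PQ_whit)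
  assume v: "v \<in> carrier V"
  have "X.proj (cr v) \<in> X.invs X.SV" by (rule X.proj_props(1)[OF cr_SV[OF v]])
  then show ?thesis using crd_iota[OF v] X.lc_SV[of "X.proj (cr v)"] by (simp add: X.whittaker_vectors_iff iota_def X.invs_def)
qed

lemma iota_lin: "restrict iota (carrier V) \<in> lin_hom V (whittaker_vectors N PQ)"
proof (rule lin_homI)
  interpret X: whit N PQ by (rule PQ_whit)
  have SVp: "X.proj (cr v) \<in> X.SV" if "v \<in> carrier V" for v
    using X.proj_props(1)[OF cr_SV[OF that]] by (simp add: X.invs_def)
  show "restrict iota (carrier V) (v \<oplus> w) = restrict iota (carrier V) v \<oplus>\<^bsub>whittaker_vectors N PQ\<^esub> restrict iota (carrier V) w"
    if "v \<in> carrier V" "w \<in> carrier V" for v w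
    using that SVp by (simp add: iota_def cr_add X.proj_add cr_SV X.lc_SV_add whittaker_vectors_simps)
  show "restrict iota (carrier V) (c \<odot> v) = c \<odot>\<^bsub>whittaker_vectors N PQ\<^esub> restrict iota (carrier V) v"
    if "v \<in> carrier V" for c v
    using that SVp by (simp add: iota_def cr_scale X.proj_scale cr_SV X.lc_SV_scale whittaker_vectors_simps)
qed (auto simp: iota_whittaker)

text \<open>Homomorphisms commute with the projection by \<open>F_proj\<close>, so the image of
  \<open>iota v\<close> depends only on the image of the class of v \<otimes> 1. Both naturality and
  injectivity of the comparison use this.\<close>

lemma iota_hom:
  assumes Y: "whit N Y" and h: "h \<in> rmod_hom (Um N) PQ Y" and v: "v \<in> carrier V"
  shows "h (iota v) = kspace.lc Y (mir_mod.proj N (umod.e N Y) (kspace.SV Y) (kspace.crd Y (h (pc v \<one>\<^bsub>Um N\<^esub>))))"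
proof -
  interpret X: whit N PQ by (rule PQ_whit)
  interpret Y: whit N Y by fact
  interpret H: mir_mod_hom fsc N X.e X.SV fsc Y.e Y.SV "\<lambda>w. Y.crd (h (X.lc w))"
    by (rule whit_hom[OF PQ_whit Y h])
  note hl = lin_homD(1)[OF rmod_hom_lin[OF h]]
  have c: "pc v \<one>\<^bsub>Um N\<^esub> \<in> carrier PQ" by (rule pc_closed[OF v ml.U_one_closed])
  have i: "iota v \<in> carrier PQ" using iota_whittaker[OF v] by (simp add: X.whittaker_vectors_iff)
  have "Y.crd (h (iota v)) = Y.proj (Y.crd (h (pc v \<one>\<^bsub>Um N\<^esub>)))"
    using H.F_proj[OF cr_SV[OF v]] c by (simp add: iota_def cr_def X.lc_crd)
  then show ?thesis using Y.lc_crd[OF hl[OF i]] by simp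
qed

text \<open>The submodule generated by the image of \<open>iota\<close> contains all classes \<open>v \<otimes> 1\<close>: by induction on
  the order of nilpotency of \<open>v\<close>, its image under \<open>\<nn>\<close> is there, and the cocycle can be solved there.\<close>

lemma iota_surj: "carrier (whittaker_vectors N PQ) \<subseteq> iota ` carrier V"
proof
  interpret X: whit N PQ by (rule PQ_whit)
  define V0 where "V0 = (\<lambda>v. X.proj (cr v)) ` carrier V"
  have V0_sub: "is_subspace fsc V0"
    using cr_sub unfolding is_subspace_def V0_def
  proof (intro conjI ballI allI, goal_cases)
    case 1
    have "0 \<in> cr ` carrier V" using cr_sub by (simp add: is_subspace_def)
    moreover have "X.proj 0 = 0" by (rule X.proj_invs[OF fsc.sub_zero[OF X.invs_sub[OF X.SV_sub]]])
    ultimately show ?case by (metis (no_types, lifting) image_iff)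
  next
    case (2 x y) then show ?case using M.a_closed by (auto simp: cr_SV simp flip: X.proj_add cr_add)
  next
    case (3 c x) then show ?case using sc_closed by (auto simp: cr_SV simp flip: X.proj_scale cr_scale)
  qed
  have V0_invs: "V0 \<subseteq> X.invs X.SV" unfolding V0_def using X.proj_props(1) cr_SV by blast
  let ?M = "X.gen V0"
  have V0_SV: "V0 \<subseteq> X.SV" using V0_invs by (auto simp: X.invs_def)
  have M_SV: "?M \<subseteq> X.SV" by (rule X.gen_least[OF X.stable_SV V0_SV])
  have M_st: "X.stable ?M" by (rule X.stable_gen[OF V0_sub])
  interpret M: mir_mod fsc N X.e ?M
    by unfold_locales (use M_st M_SV X.S_nil in auto)
  \<comment> \<open>The inclusion of the submodule; by naturality the projections computed in it and
    in the whole module agree.\<close>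
  interpret I: mir_mod_hom fsc N X.e ?M fsc X.e X.SV "\<lambda>w. w"
    by unfold_locales (use M_SV in auto)
  have crM: "v \<in> adnil n \<Longrightarrow> v \<in> carrier V \<Longrightarrow> cr v \<in> ?M" for v n
  proof (induction n arbitrary: v)
    case 0
    have "0 \<in> ?M" by (rule fsc.sub_zero[OF M.S_sub])
    moreover have "cr v \<in> X.nil 0" by (rule cr_nil[OF 0(2,1)])
    ultimately show ?case by (simp add: X.nil_0)
  next
    case (Suc n)
    have pM: "X.p a (cr v) \<in> ?M" if a: "a \<in> X.neg" for a
    proof -
      have En: "E N (fst a) (snd a) \<in> n_minus N" using a by (auto simp: X.neg_def intro: E_n_minus)
      have "cr (ad N V (E N (fst a) (snd a)) v) \<in> ?M"
        using Suc.prems En by (intro Suc.IH ad_spec(1) n_minus_mirabolic) auto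
      then show ?thesis unfolding cr_p[OF a Suc.prems(2)] using fsc.sub_minus[OF M.S_sub] by blast
    qed
    have "\<exists>w\<in>?M. \<forall>a\<in>X.neg. X.p a w = X.p a (cr v)"
      by (rule M.solve_cocycle[of "\<lambda>a. X.p a (cr v)", OF pM X.p_p])
    then obtain w where w: "w \<in> ?M" "\<And>a. a \<in> X.neg \<Longrightarrow> X.p a w = X.p a (cr v)" by blast
    have wS: "w \<in> X.SV" using w(1) M_SV by blast
    \<comment> \<open>\<open>w\<close> and \<open>cr v\<close> have the same images under the
      lowering operators, so they differ by an invariant, and that is the difference of their
      projections.\<close>
    have "cr v - w \<in> X.invs X.SV"
      using w(2) wS cr_SV[OF Suc.prems(2)] fsc.sub_diff[OF X.SV_sub] by (simp add: X.invs_def is_linear_diff[OF X.p_lin])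
    then have "cr v - w = X.proj (cr v - w)" by (simp only: X.proj_invs)
    also have "\<dots> = X.proj (cr v) - X.proj w" by (rule X.proj_diff[OF cr_SV[OF Suc.prems(2)] wS])
    finally have eq: "cr v = w + X.proj (cr v) - X.proj w" by (simp add: algebra_simps)
    have "X.proj (cr v) \<in> ?M" using subsetD[OF X.gen_base, of "X.proj (cr v)" V0] Suc.prems(2) by (simp add: V0_def)
    moreover have "X.proj w \<in> ?M" using I.F_proj[OF w(1)] M.proj_props(1)[OF w(1)] by (simp add: X.invs_def)
    ultimately have "w + X.proj (cr v) - X.proj w \<in> ?M" using w(1) by (intro fsc.sub_add[OF M.S_sub] fsc.sub_diff[OF M.S_sub])
    then show ?case by (simp only: eq[symmetric])
  qed
  have "cr ` carrier V \<subseteq> ?M" using crM ex_adnil by blast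
  then have "X.SV \<subseteq> ?M" using SV_gen X.gen_least[OF M_st] by blast
  then have M_eq: "?M = X.SV" using M_SV by blast
  \<comment> \<open>Now that \<open>V0\<close> generates the whole module,
    \<open>gen_inter_invs\<close> identifies \<open>V0\<close> with all Whittaker vectors.\<close>
  have invs: "X.invs X.SV = V0" using X.gen_inter_invs[OF V0_sub V0_invs] unfolding M_eq by (auto simp: X.invs_def)
  fix x assume x: "x \<in> carrier (whittaker_vectors N PQ)"
  then have xc: "x \<in> carrier PQ" "X.crd x \<in> V0" by (simp_all add: X.whittaker_vectors_iff invs)
  then obtain v where v: "v \<in> carrier V" "X.crd x = X.proj (cr v)" unfolding V0_def by blast
  then have "x = iota v" unfolding iota_def using X.lc_crd[OF xc(1)] by simp
  then show "x \<in> iota ` carrier V" using v(1) by blast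
qed

end

section \<open>Injectivity of the comparison map\<close>

context rep
begin

lemma ad_zero_mat: "v \<in> carrier V \<Longrightarrow> ad N V (0\<^sub>m N N) v = \<zero>"
proof -
  assume v: "v \<in> carrier V"
  have z: "(0\<^sub>m N N :: 'k mat) \<in> carrier (mirabolic_lie N)" by (auto simp: mirabolic_carrier)
  have "0 \<cdot>\<^sub>m 0\<^sub>m N N = (0\<^sub>m N N :: 'k mat)" by (rule eq_matI) auto
  then show ?thesis using ad_mat_scale[OF z v, of 0] ad_spec(1)[OF z v] by (simp add: zero_sc)
qed

text \<open>The sign turns the left action of n_- on V into a right one, the one by which the
  lowering operators act on the classes of v \<otimes> 1 in \<open>cr_p\<close>.\<close>

definition nad :: "nat \<times> nat \<Rightarrow> ('v \<Rightarrow>\<^sub>0 'k) \<Rightarrow> ('v \<Rightarrow>\<^sub>0 'k)" where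
  "nad a = (if a \<in> mir_ops.neg N then lift (\<lambda>v. (- 1) \<odot> ad N V (E N (fst a) (snd a)) v) else (\<lambda>_. 0))"

lemma neg_mirabolic: "a \<in> mir_ops.neg N \<Longrightarrow> E N (fst a) (snd a) \<in> carrier (mirabolic_lie N)"
  by (auto simp: tw.neg_def intro!: E_mirabolic)

lemma nad_crd: "a \<in> mir_ops.neg N \<Longrightarrow> v \<in> carrier V \<Longrightarrow> nad a (crd v) = crd ((- 1) \<odot> ad N V (E N (fst a) (snd a)) v)"
  by (simp add: nad_def lift_crd)

lemma nad_bracket:
  assumes v: "v \<in> SV" and ij: "(i, j) \<in> mir_ops.neg N" and kl: "(k, l) \<in> mir_ops.neg N"
  shows "nad (k, l) (nad (i, j) v) = nad (i, j) (nad (k, l) v) + (if j = k then nad (i, l) v else 0) - (if l = i then nad (k, j) v else 0)"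
proof -
  obtain w where w: "w \<in> carrier V" "v = crd w" using SV_cases[OF v] by blast
  let ?A = "E N i j :: 'k mat" and ?B = "E N k l :: 'k mat"
  have A: "?A \<in> carrier (mirabolic_lie N)" and B: "?B \<in> carrier (mirabolic_lie N)"
    using neg_mirabolic[OF ij] neg_mirabolic[OF kl] by simp_all
  note cl = ad_spec(1)[OF A] ad_spec(1)[OF B] w(1)
  have n1: "nad (k, l) (nad (i, j) v) = crd (ad N V ?B (ad N V ?A w))" and n2: "nad (i, j) (nad (k, l) v) = crd (ad N V ?A (ad N V ?B w))"
    using cl by (simp_all add: w(2) nad_crd[OF ij] nad_crd[OF kl] ad_scale[OF A] ad_scale[OF B] sc_sc sc_one)
  have ord: "j < i" "i < N" "l < k" "k < N" using ij kl by (auto simp: tw.neg_def)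
  have br: "crd (ad N V (?B * ?A - ?A * ?B) w) = crd (ad N V ?B (ad N V ?A w)) - crd (ad N V ?A (ad N V ?B w))"
    unfolding ad_bracket[OF B A w(1)] using cl by (simp add: crd_add crd_scale)
  have m: "?B * ?A = (if l = i then E N k j else 0\<^sub>m N N)" "?A * ?B = (if j = k then E N i l else 0\<^sub>m N N)"
    using ord by (auto simp: E_mult)
  have neg: "(0\<^sub>m N N - P :: 'k mat) = (- 1) \<cdot>\<^sub>m P" "P - 0\<^sub>m N N = P" if "P \<in> carrier_mat N N" for P :: "'k mat"
    using that by (auto intro!: eq_matI)
  have "crd (ad N V (?B * ?A - ?A * ?B) w) = (if j = k then nad (i, l) v else 0) - (if l = i then nad (k, j) v else 0)"
  proof (cases "l = i")
    case True
    then have jk: "j \<noteq> k" using ord by simp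
    have kj: "(k, j) \<in> mir_ops.neg N" using True ord by (auto simp: tw.neg_def)
    then show ?thesis unfolding m using True jk w ad_spec(1)[OF neg_mirabolic[OF kj] w(1)]
      by (simp add: neg nad_crd[OF kj] crd_scale)
  next
    case False
    show ?thesis
    proof (cases "j = k")
      case True
      have il: "(i, l) \<in> mir_ops.neg N" using True ord by (auto simp: tw.neg_def)
      have "E N i l \<in> carrier (mirabolic_lie N :: ('k, 'k mat) lie_alg)" using neg_mirabolic[OF il] by simp
      then show ?thesis unfolding m using True False w ad_spec(1)[OF neg_mirabolic[OF il] w(1)]
        by (simp add: neg nad_crd[OF il] crd_scale ad_mat_scale)
    next
      case False2: False
      show ?thesis unfolding m using False False2 w by (simp add: neg ad_zero_mat crd_zero)
    qed
  qed
  then show ?thesis using br unfolding n1 n2 by (simp add: algebra_simps)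
qed

lemma nad_SV: assumes "v \<in> SV" "a \<in> mir_ops.neg N" shows "nad a v \<in> SV"
proof -
  obtain w where w: "w \<in> carrier V" "v = crd w" using SV_cases[OF assms(1)] by blast
  then show ?thesis using ad_spec(1)[OF neg_mirabolic[OF assms(2)] w(1)] by (simp add: nad_crd[OF assms(2)])
qed

lemma nad_lin: "is_linear fsc fsc (nad a)"
proof (cases "a \<in> mir_ops.neg N")
  case True
  note m = neg_mirabolic[OF True]
  show ?thesis unfolding nad_def if_P[OF True]
    by (rule lift_lin) (simp_all add: ad_spec(1)[OF m] ad_add[OF m] ad_scale[OF m] sc_add sc_sc)
qed (simp add: nad_def fsc.is_linear_const_zero)

lemma nad_nil: "v \<in> carrier V \<Longrightarrow> v \<in> adnil n \<Longrightarrow> set u \<subseteq> mir_ops.neg N \<Longrightarrow> length u = n \<Longrightarrow> fold nad u (crd v) = 0"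
proof (induction n arbitrary: v u)
  case 0 then show ?case by (simp add: crd_zero)
next
  case (Suc n)
  obtain a u' where u: "u = a # u'" "a \<in> mir_ops.neg N" "set u' \<subseteq> mir_ops.neg N" "length u' = n"
    using Suc.prems by (cases u) auto
  have En: "E N (fst a) (snd a) \<in> n_minus N" using u(2) by (auto simp: tw.neg_def intro: E_n_minus)
  let ?w = "ad N V (E N (fst a) (snd a)) v"
  have w: "?w \<in> carrier V" "?w \<in> adnil n" using Suc.prems En ad_spec(1)[OF n_minus_mirabolic[OF En]] by auto
  have "is_linear fsc fsc (fold nad u')"
  proof (induction u')
    case Nil then show ?case by (simp add: is_linear_def)
  next
    case (Cons b u') then show ?case using is_linear_comp[OF nad_lin[of b]] by (simp add: comp_def)
  qed
  then have "fold nad u' (crd ((- 1) \<odot> ?w)) = fsc (- 1) (fold nad u' (crd ?w))"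
    using w by (simp only: crd_scale is_linear_scale)
  then show ?case using Suc.IH[OF w u(3,4)] Suc.prems(1) by (simp add: u(1) nad_crd[OF u(2)])
qed

text \<open>Extending \<open>j\<close> along \<open>n\<close> gives a map from \<open>V\<close> to a Whittaker module with Whittaker vectors \<open>V\<close>
  that factors through the quotient and maps \<open>iota v\<close> to \<open>j v\<close>.\<close>

lemma iota_retract:
  assumes Y: "whit N Y" and jc: "\<And>v. v \<in> carrier V \<Longrightarrow> j v \<in> carrier (whittaker_vectors N Y)"
    and jadd: "\<And>v w. v \<in> carrier V \<Longrightarrow> w \<in> carrier V \<Longrightarrow> j (v \<oplus> w) = j v \<oplus>\<^bsub>Y\<^esub> j w"
    and jsc: "\<And>c v. v \<in> carrier V \<Longrightarrow> j (c \<odot> v) = c \<odot>\<^bsub>Y\<^esub> j v"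
  shows "\<exists>h. \<forall>v\<in>carrier V. h (iota v) = j v"
proof -
  interpret Y: whit N Y by fact
  define lam where "lam = (\<lambda>f. Y.crd (j (lc (cutoff bas f))))"
  have jY: "j v \<in> carrier Y" "Y.crd (j v) \<in> Y.invs Y.SV" if "v \<in> carrier V" for v
    using jc[OF that] by (simp_all add: Y.whittaker_vectors_iff)
  have lam_crd: "lam (crd v) = Y.crd (j v)" if "v \<in> carrier V" for v
    using crd_SV[OF that] that by (simp add: lam_def SV_def cutoff_id lc_crd)
  interpret B: lower_ext fsc N Y.e Y.SV fsc SV nad lam
  proof unfold_locales
    show "is_subspace fsc SV" by (rule SV_sub)
    show "is_linear fsc fsc (nad a)" for a by (rule nad_lin)
    show "nad a v \<in> SV" if "v \<in> SV" "a \<in> Y.neg" for v a by (rule nad_SV[OF that])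
    show "nad (k, l) (nad (i, j) v) = nad (i, j) (nad (k, l) v) + (if j = k then nad (i, l) v else 0) - (if l = i then nad (k, j) v else 0)"
      if "v \<in> SV" "(i, j) \<in> Y.neg" "(k, l) \<in> Y.neg" for v i j k l by (rule nad_bracket[OF that])
    show "\<exists>n. \<forall>u. set u \<subseteq> Y.neg \<and> length u = n \<longrightarrow> fold nad u v = 0" if "v \<in> SV" for v
    proof -
      obtain w where w: "w \<in> carrier V" "v = crd w" using SV_cases[OF \<open>v \<in> SV\<close>] by blast
      obtain n where "w \<in> adnil n" using ex_adnil[OF w(1)] by blast
      then show ?thesis using nad_nil[OF w(1)] w(2) by blast
    qed
    show "is_linear fsc fsc lam"
    proof (rule is_linearI)
      fix f g :: "'v \<Rightarrow>\<^sub>0 'k" and c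
      have l: "lc (cutoff bas f) \<in> carrier V" for f by (rule lc_SV[OF cutoff_SV])
      show "lam (f + g) = lam f + lam g"
        using l by (simp add: lam_def is_linear_add[OF cutoff_lin] lc_SV_add cutoff_SV jadd Y.crd_add jY)
      show "lam (fsc c f) = fsc c (lam f)"
        using l by (simp add: lam_def is_linear_scale[OF cutoff_lin] lc_SV_scale cutoff_SV jsc Y.crd_scale jY)
    qed
    show "lam v \<in> Y.invs Y.SV" if "v \<in> SV" for v
      using SV_cases[OF that] lam_crd jY by auto
  qed
  obtain f where f: "\<And>v. v \<in> SV \<Longrightarrow> f v \<in> Y.SV" "\<And>v. v \<in> SV \<Longrightarrow> Y.proj (f v) = lam v"
      "\<And>v a. v \<in> SV \<Longrightarrow> a \<in> Y.neg \<Longrightarrow> Y.p a (f v) = f (nad a v)"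
      "\<And>v w. v \<in> SV \<Longrightarrow> w \<in> SV \<Longrightarrow> f (v + w) = f v + f w" "\<And>c v. v \<in> SV \<Longrightarrow> f (fsc c v) = fsc c (f v)"
    using B.lower_extension by blast
  define g where "g = restrict (\<lambda>v. Y.lc (f (crd v))) (carrier V)"
  have g: "g v = Y.lc (f (crd v))" "g v \<in> carrier Y" "Y.crd (g v) = f (crd v)" if "v \<in> carrier V" for v
    using that f(1) by (simp_all add: g_def Y.lc_SV Y.crd_lc)
  have g_add: "g (v \<oplus> w) = g v \<oplus>\<^bsub>Y\<^esub> g w" if "v \<in> carrier V" "w \<in> carrier V" for v w
    using that f(1) by (simp add: g crd_add f(4) Y.lc_SV_add)
  have g_sc: "g (c \<odot> v) = c \<odot>\<^bsub>Y\<^esub> g v" if "v \<in> carrier V" for c v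
    using that f(1) by (simp add: g crd_scale f(5) Y.lc_SV_scale)
  have g_hom: "g \<in> lin_hom V Y" by (rule lin_homI) (simp_all add: g(2) g_add g_sc, simp add: g_def)
  \<comment> \<open>The equation \<open>Y.p a (f v) = f (nad a v)\<close> of the extension, solved
    for the action of the matrix unit: for matrix units this is the hypothesis \<open>rel\<close> of
    \<open>PQ_universal\<close>.\<close>
  have E_rel: "g (ad N V (E N i k) v) \<oplus>\<^bsub>Y\<^esub> Y.act (E N i k) (g v) = psi N (E N i k :: 'k mat) \<odot>\<^bsub>Y\<^esub> g v"
    if v: "v \<in> carrier V" and a: "(i, k) \<in> Y.neg" for i k v
  proof -
    have m: "E N i k \<in> carrier (mirabolic_lie N :: ('k, 'k mat) lie_alg)" using neg_mirabolic[OF a] by simp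
    note cl = g(2)[OF v] Y.act_closed[OF m g(2)[OF v]] ad_spec(1)[OF m v] g(2)[OF ad_spec(1)[OF m v]]
    have "Y.crd (Y.act (E N i k) (g v) \<ominus>\<^bsub>Y\<^esub> psi N (E N i k :: 'k mat) \<odot>\<^bsub>Y\<^esub> g v) = f (nad (i, k) (crd v))"
      using Y.p_crd[OF a g(2)[OF v]] f(3)[OF crd_SV[OF v] a] g(3)[OF v] by simp
    also have "\<dots> = Y.crd (g ((- 1) \<odot> ad N V (E N i k) v))" using cl by (simp add: nad_crd[OF a v] g(3))
    also have "\<dots> = - Y.crd (g (ad N V (E N i k) v))" using cl by (simp add: g_sc Y.crd_scale)
    finally have "Y.crd (g (ad N V (E N i k) v) \<oplus>\<^bsub>Y\<^esub> Y.act (E N i k) (g v)) = Y.crd (psi N (E N i k :: 'k mat) \<odot>\<^bsub>Y\<^esub> g v)"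
      using cl by (simp add: Y.crd_diff Y.crd_add algebra_simps)
    then show ?thesis using cl by (intro Y.crd_inj) auto
  qed
  have rel: "g (ad N V x v) \<oplus>\<^bsub>Y\<^esub> (g v \<triangleleft>\<^bsub>Y\<^esub> uea_incl (mirabolic_lie N) x) = psi N x \<odot>\<^bsub>Y\<^esub> g v"
    if "x \<in> n_minus N" and v: "v \<in> carrier V" for x v
    unfolding Y.act_def[symmetric] using that(1)
  proof (induction rule: n_minus_induct)
    case zero
    have "g \<zero> = \<zero>\<^bsub>Y\<^esub>" by (rule lin_hom_zero[OF kspace_axioms Y.kspace_axioms g_hom])
    then show ?case using v g(2)[OF v] by (simp add: ad_zero_mat Y.act_zero psi_zero Y.zero_sc)
  next
    case (add B c i k)
    have a: "(i, k) \<in> Y.neg" using add by (simp add: Y.neg_def)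
    have Em: "E N i k \<in> carrier (mirabolic_lie N :: ('k, 'k mat) lie_alg)" using neg_mirabolic[OF a] by simp
    have Bm: "B \<in> carrier (mirabolic_lie N)" "B \<in> carrier_mat N N" using add by (auto intro: n_minus_mirabolic simp: n_minus_def)
    have cE: "c \<cdot>\<^sub>m E N i k \<in> carrier (mirabolic_lie N)" using ml.L_smult[OF Em, of c] by (simp add: mirabolic_simps)
    note cl = g(2)[OF v] Y.act_closed[OF Em g(2)[OF v]] Y.act_closed[OF Bm(1) g(2)[OF v]] ad_spec(1)[OF Em v] ad_spec(1)[OF Bm(1) v]
      g(2)[OF ad_spec(1)[OF Em v]] g(2)[OF ad_spec(1)[OF Bm(1) v]]
    have "g (ad N V (B + c \<cdot>\<^sub>m E N i k) v) \<oplus>\<^bsub>Y\<^esub> Y.act (B + c \<cdot>\<^sub>m E N i k) (g v) =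
        (g (ad N V B v) \<oplus>\<^bsub>Y\<^esub> Y.act B (g v)) \<oplus>\<^bsub>Y\<^esub> c \<odot>\<^bsub>Y\<^esub> (g (ad N V (E N i k) v) \<oplus>\<^bsub>Y\<^esub> Y.act (E N i k) (g v))"
      using cl v by (simp add: ad_mat_add[OF Bm(1) cE] ad_mat_scale[OF Em] Y.act_mat_add[OF Bm(1) cE] Y.act_mat_scale[OF Em]
          g_add g_sc Y.sc_add Y.M.a_ac)
    also have "\<dots> = psi N (B + c \<cdot>\<^sub>m E N i k) \<odot>\<^bsub>Y\<^esub> g v"
      unfolding add.IH E_rel[OF v a] using Bm(2) cl by (simp add: psi_add psi_smult Y.add_sc Y.sc_sc)
    finally show ?case .
  qed
  obtain h where h: "h \<in> rmod_hom (Um N) PQ Y" "\<forall>v\<in>carrier V. \<forall>z\<in>carrier (Um N). h (pc v z) = g v \<triangleleft>\<^bsub>Y\<^esub> z"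
    using PQ_universal[OF Y.umod_axioms g_hom rel] by blast
  have "h (iota v) = j v" if v: "v \<in> carrier V" for v
  proof -
    have "h (pc v \<one>\<^bsub>Um N\<^esub>) = g v" using h(2) v g(2)[OF v] by (simp add: ml.U_one_closed Y.rm.ract_one)
    then have "h (iota v) = Y.lc (Y.proj (f (crd v)))" using iota_hom[OF Y h(1) v] v by (simp add: g(3))
    also have "\<dots> = j v" using v jY(1)[OF v] by (simp add: f(2) lam_crd Y.lc_crd)
    finally show ?thesis .
  qed
  then show ?thesis by blast
qed

text \<open>Essential surjectivity, applied in the carrier type of V, gives a Whittaker module whose
  Whittaker vectors are isomorphic to V through \<open>j\<close>. By \<open>iota_retract\<close> the
  vector \<open>j v\<close> depends only on \<open>iota v\<close>, and \<open>j\<close> is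
  injective.\<close>

lemma iota_inj: "inj_on iota (carrier V)"
proof -
  \<comment> \<open>Objects of \<open>Vect\<close> are plain module records, so the group action is
    dropped.\<close>
  let ?V = "module.truncate V"
  have V': "vectorspace class_ring ?V"
    by (rule vectorspaceI) (auto simp: module.defs M.a_assoc sc_add add_sc sc_sc sc_one zero_sc intro: M.a_comm)
  obtain Y :: "('k, ('k mat list \<Rightarrow> 'k) set, 'v) rmod" and i where Y: "whittaker_module N Y" and i: "iso_arrow Vect (whittaker_vectors N Y) ?V i"
    using whittaker_essentially_surjective[OF V'] by blast
  obtain j where j: "j \<in> lin_hom ?V (whittaker_vectors N Y)" "compose (carrier ?V) i j = restrict id (carrier ?V)"
    using i unfolding iso_arrow_def Vect_def by auto
  note jl = lin_homD(1,3,4)[OF j(1), unfolded whittaker_vectors_simps]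
  have ij: "i (j v) = v" if "v \<in> carrier V" for v
    using fun_cong[OF j(2), of v] that by (simp add: compose_def module.defs)
  have "\<exists>h. \<forall>v\<in>carrier V. h (iota v) = j v"
    by (rule iota_retract[OF whit.intro[OF Y]]) (use jl in \<open>simp_all add: module.defs\<close>)
  then obtain h where h: "\<And>v. v \<in> carrier V \<Longrightarrow> h (iota v) = j v" by blast
  show ?thesis by (rule inj_onI) (metis h ij)
qed

lemma iota_bij: "bij_betw iota (carrier V) (carrier (whittaker_vectors N PQ))"
  using iota_inj iota_surj iota_whittaker by (auto simp: bij_betw_def)

definition phi :: "('k, 'v) VU set \<Rightarrow> 'v" where
  "phi = restrict (inv_into (carrier V) (restrict iota (carrier V))) (carrier (whittaker_vectors N PQ))"

lemma phi_iso: "phi \<in> lin_iso (whittaker_vectors N PQ) V"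
proof -
  have b: "bij_betw (restrict iota (carrier V)) (carrier V) (carrier (whittaker_vectors N PQ))"
    using iota_bij by (simp cong: bij_betw_cong)
  have "bij_betw phi (carrier (whittaker_vectors N PQ)) (carrier V)"
    unfolding phi_def using bij_betw_inv_into[OF b] by (simp cong: bij_betw_cong)
  then show ?thesis using lin_hom_inverse[OF vectorspace iota_lin b] by (simp add: lin_iso_def phi_def)
qed

lemma phi_iota: "v \<in> carrier V \<Longrightarrow> phi (iota v) = v"
proof -
  assume v: "v \<in> carrier V"
  have "inj_on (restrict iota (carrier V)) (carrier V)" using iota_inj by (simp add: inj_on_def)
  from inv_into_f_f[OF this v] show ?thesis using v by (simp add: phi_def iota_whittaker)
qed

end

subsection \<open>Functoriality\<close>

text \<open>The map from \<open>v\<close> to the class of f v \<otimes> 1 satisfies the hypothesis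
  of \<open>PQ_universal\<close> because \<open>f\<close> commutes with \<open>ad\<close>. The
  induced map is unique since the classes of v \<otimes> z span, so the description in
  \<open>psi_quotient_functor\<close> denotes it.\<close>

lemma psi_far:
  assumes V: "rep N V" and W: "rep N W" and f: "f \<in> rep_hom N V W"
  shows psi_far_hom: "far (psi_quotient_functor N) V W f \<in> rmod_hom (Um N) (psi_quotient N V) (psi_quotient N W)"
    and psi_far_class: "v \<in> carrier V \<Longrightarrow> z \<in> carrier (Um N) \<Longrightarrow> far (psi_quotient_functor N) V W f (psi_class N V v z) = psi_class N W (f v) z"
    and psi_far_unique: "h \<in> lin_hom (psi_quotient N V) (psi_quotient N W) \<Longrightarrow>
      (\<And>v z. v \<in> carrier V \<Longrightarrow> z \<in> carrier (Um N) \<Longrightarrow> h (psi_class N V v z) = psi_class N W (f v) z) \<Longrightarrow>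
      far (psi_quotient_functor N) V W f = h"
proof -
  interpret V: rep N V by fact
  interpret W: rep N W by fact
  have fl: "f \<in> lin_hom V W" using f by (simp add: rep_hom_def)
  note fc = lin_homD(1)[OF fl]
  define g where "g = restrict (\<lambda>v. W.pc (f v) \<one>\<^bsub>Um N\<^esub>) (carrier V)"
  have g: "g v = W.pc (f v) \<one>\<^bsub>Um N\<^esub>" if "v \<in> carrier V" for v using that by (simp add: g_def)
  have gh: "g \<in> lin_hom V (psi_quotient N W)"
  proof (rule lin_homI)
    show "g \<in> extensional (carrier V)" by (simp add: g_def)
  qed (simp_all add: g fc W.pc_closed ml.U_one_closed lin_homD(3,4)[OF fl] bilinearD[OF W.pc_bilinear])
  have rel: "g (ad N V x v) \<oplus>\<^bsub>psi_quotient N W\<^esub> (g v \<triangleleft>\<^bsub>psi_quotient N W\<^esub> uea_incl (mirabolic_lie N) x) = psi N x \<odot>\<^bsub>psi_quotient N W\<^esub> g v"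
    if "x \<in> n_minus N" "v \<in> carrier V" for x v
  proof -
    note xm = n_minus_mirabolic[OF that(1)]
    show ?thesis using W.pc_rel[OF that(1) fc[OF that(2)] ml.U_one_closed] xm that V.ad_spec(1)[OF xm that(2)]
      by (simp add: g rep_hom_ad[OF V W f xm] W.pc_ract fc ml.U_one_closed V.inc_closed ml.U_one_left ml.U_one_right)
  qed
  obtain h where h: "h \<in> rmod_hom (Um N) (psi_quotient N V) (psi_quotient N W)"
      "\<And>v z. v \<in> carrier V \<Longrightarrow> z \<in> carrier (Um N) \<Longrightarrow> h (V.pc v z) = g v \<triangleleft>\<^bsub>psi_quotient N W\<^esub> z"
    using V.PQ_universal[OF W.PQ_umod gh rel] by blast
  have hc: "h (V.pc v z) = W.pc (f v) z" if "v \<in> carrier V" "z \<in> carrier (Um N)" for v z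
    using that h(2)[OF that] by (simp add: g W.pc_ract fc ml.U_one_closed ml.U_one_left)
  have un: "far (psi_quotient_functor N) V W f = h'"
    if h': "h' \<in> lin_hom (psi_quotient N V) (psi_quotient N W)"
      and hc': "\<And>v z. v \<in> carrier V \<Longrightarrow> z \<in> carrier (Um N) \<Longrightarrow> h' (V.pc v z) = W.pc (f v) z" for h'
    unfolding psi_quotient_functor_def cat_functor.simps
  proof (rule the_equality)
    show "h' \<in> lin_hom (psi_quotient N V) (psi_quotient N W) \<and> (\<forall>v\<in>carrier V. \<forall>z\<in>carrier (Um N). h' (V.pc v z) = W.pc (f v) z)"
      using h' hc' by simp
    show "k = h'" if "k \<in> lin_hom (psi_quotient N V) (psi_quotient N W) \<and> (\<forall>v\<in>carrier V. \<forall>z\<in>carrier (Um N). k (V.pc v z) = W.pc (f v) z)" for k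
      using that hc' by (intro V.PQ_hom_eq[OF kspaceI[OF W.PQ_vectorspace] _ h']) auto
  qed
  have eq: "far (psi_quotient_functor N) V W f = h" by (rule un[OF rmod_hom_lin[OF h(1)] hc])
  show "far (psi_quotient_functor N) V W f \<in> rmod_hom (Um N) (psi_quotient N V) (psi_quotient N W)" unfolding eq by (rule h(1))
  show "v \<in> carrier V \<Longrightarrow> z \<in> carrier (Um N) \<Longrightarrow> far (psi_quotient_functor N) V W f (psi_class N V v z) = psi_class N W (f v) z"
    unfolding eq by (rule hc)
  show "h \<in> lin_hom (psi_quotient N V) (psi_quotient N W) \<Longrightarrow>
      (\<And>v z. v \<in> carrier V \<Longrightarrow> z \<in> carrier (Um N) \<Longrightarrow> h (psi_class N V v z) = psi_class N W (f v) z) \<Longrightarrow>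
      far (psi_quotient_functor N) V W f = h" for h
    by (rule un)
qed

text \<open>By \<open>iota_hom\<close> the induced map sends \<open>iota v\<close> to the projection
  of the class of f v \<otimes> 1, which is \<open>iota (f v)\<close> in the other quotient.\<close>

lemma phi_natural:
  assumes V: "rep N V" and W: "rep N W" and f: "f \<in> rep_hom N V W" and x: "x \<in> carrier (whittaker_vectors N (psi_quotient N V))"
  shows "rep.phi N W (far (psi_quotient_functor N) V W f x) = f (rep.phi N V x)"
proof -
  interpret V: rep N V by fact
  interpret W: rep N W by fact
  obtain v where v: "v \<in> carrier V" "x = V.iota v" using V.iota_surj x by blast
  have fv: "f v \<in> carrier W" using f lin_homD(1)[of f V W] v by (simp add: rep_hom_def)
  have "far (psi_quotient_functor N) V W f x = W.iota (f v)"
    unfolding v(2) V.iota_hom[OF W.PQ_whit psi_far_hom[OF V W f] v(1)] psi_far_class[OF V W f v(1) ml.U_one_closed]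
    by (simp add: W.iota_def W.cr_def)
  then show ?thesis using v fv by (simp add: V.phi_iota W.phi_iota)
qed

lemma rep_hom_compose:
  assumes "mirabolic_rep N V" "f \<in> rep_hom N V W" "g \<in> rep_hom N W X" shows "compose (carrier V) g f \<in> rep_hom N V X"
proof -
  interpret mirabolic_rep N V by fact
  have "gact V h v \<in> carrier V" if "h \<in> mirabolic_group N" "v \<in> carrier V" for h v
    using gact_hom[OF that(1)] that(2) by (auto simp: LinearCombinations.module_hom_def)
  then show ?thesis using assms lin_hom_compose[OF vectorspace, of f W g X]
    by (auto simp: rep_hom_def compose_def lin_homD(1))
qed

lemma rep_hom_id: assumes "mirabolic_rep N V" shows "restrict id (carrier V) \<in> rep_hom N V V"
proof -
  interpret mirabolic_rep N V by fact
  have "gact V h v \<in> carrier V" if "h \<in> mirabolic_group N" "v \<in> carrier V" for h v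
    using gact_hom[OF that(1)] that(2) by (auto simp: LinearCombinations.module_hom_def)
  then show ?thesis using lin_hom_id[OF vectorspace] by (auto simp: rep_hom_def)
qed

lemma rep_hom_lin: "f \<in> rep_hom N V W \<Longrightarrow> f \<in> lin_hom V W"
  by (simp add: rep_hom_def)

lemma category_Rep: "category (Rep N :: (('k::field, 'v) grep, 'v \<Rightarrow> 'v) cat)"
proof (unfold_locales, unfold Rep_def cat.simps mem_Collect_eq, goal_cases)
  case 1 then show ?case by (rule rep_hom_id)
next
  case 2 then show ?case by (intro rep_hom_compose)
next
  case 3 then show ?case using compose_restrict_id(1)[OF rep_hom_lin] by blast
next
  case 4 then show ?case using compose_restrict_id(2)[OF rep_hom_lin] by blast
next
  case 5 then show ?case using compose_compose[OF rep_hom_lin] by blast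
qed

lemma psi_quotient_is_functor:
  assumes "N \<ge> 1"
  shows "is_functor (Rep N :: (('k::field_char_0, 'v) grep, 'v \<Rightarrow> 'v) cat) (Wh N) (psi_quotient_functor N)"
  unfolding is_functor_def
proof (intro conjI category_Rep category_Wh ballI)
  have ob: "fob (psi_quotient_functor N) = psi_quotient N" by (simp add: psi_quotient_functor_def)
  have rep: "rep N V" if "V \<in> Ob (Rep N)" for V :: "('k, 'v) grep"
    using that assms by (simp add: Rep_def rep_def rep_axioms_def)
  fix V :: "('k, 'v) grep" assume V: "V \<in> Ob (Rep N)"
  interpret V: rep N V by (rule rep[OF V])
  show "fob (psi_quotient_functor N) V \<in> Ob (Wh N)" using V.PQ_whittaker by (simp add: ob Wh_def)
  show "far (psi_quotient_functor N) V V (Id (Rep N) V) = Id (Wh N) (fob (psi_quotient_functor N) V)"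
    unfolding ob Rep_def Wh_def cat.simps
    by (rule psi_far_unique[OF rep[OF V] rep[OF V] rep_hom_id[OF V.mirabolic_rep_axioms] lin_hom_id[OF V.PQ_vectorspace]])
      (simp add: V.pc_closed)
  fix W :: "('k, 'v) grep" assume W: "W \<in> Ob (Rep N)"
  interpret W: rep N W by (rule rep[OF W])
  fix f assume f: "f \<in> Hom (Rep N) V W"
  then have f': "f \<in> rep_hom N V W" by (simp add: Rep_def)
  show "far (psi_quotient_functor N) V W f \<in> Hom (Wh N) (fob (psi_quotient_functor N) V) (fob (psi_quotient_functor N) W)"
    using psi_far_hom[OF rep[OF V] rep[OF W] f'] by (simp add: ob Wh_def)
  fix X :: "('k, 'v) grep" and g assume X: "X \<in> Ob (Rep N)" and g: "g \<in> Hom (Rep N) W X"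
  then have g': "g \<in> rep_hom N W X" by (simp add: Rep_def)
  interpret X: rep N X by (rule rep[OF X])
  note fl = lin_homD(1)[OF rep_hom_lin[OF f']]
  have "far (psi_quotient_functor N) V X (compose (carrier V) g f) =
      compose (carrier (psi_quotient N V)) (far (psi_quotient_functor N) W X g) (far (psi_quotient_functor N) V W f)"
    by (rule psi_far_unique[OF rep[OF V] rep[OF X] rep_hom_compose[OF V.mirabolic_rep_axioms f' g']
          lin_hom_compose[OF V.PQ_vectorspace rmod_hom_lin[OF psi_far_hom[OF rep[OF V] rep[OF W] f']] rmod_hom_lin[OF psi_far_hom[OF rep[OF W] rep[OF X] g']]]])
      (simp add: compose_def V.pc_closed fl psi_far_class[OF rep[OF V] rep[OF W] f'] psi_far_class[OF rep[OF W] rep[OF X] g'])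
  then show "far (psi_quotient_functor N) V X (Comp (Rep N) V W X g f) =
      Comp (Wh N) (fob (psi_quotient_functor N) V) (fob (psi_quotient_functor N) W) (fob (psi_quotient_functor N) X)
        (far (psi_quotient_functor N) W X g) (far (psi_quotient_functor N) V W f)"
    by (simp add: ob Rep_def Wh_def)
qed

theorem theorem2:
  fixes N :: nat
  assumes "N \<ge> 1"
  shows
    "equivalence_of_categories
       (Wh N :: (('k::{alg_closed_field, field_char_0},
                  ('k mat list \<Rightarrow> 'k) set, 'w) rmod, 'w \<Rightarrow> 'w) cat)
       Vect (whittaker_functor N)
     \<and> is_functor (Rep N :: (('k, 'v) grep, 'v \<Rightarrow> 'v) cat) (Wh N) (psi_quotient_functor N)
     \<and> (\<exists>\<phi>.
          (\<forall>V \<in> Ob (Rep N :: (('k, 'v) grep, 'v \<Rightarrow> 'v) cat).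
             \<phi> V \<in> lin_iso (whittaker_vectors N (psi_quotient N V)) V) \<and>
          (\<forall>V \<in> Ob (Rep N). \<forall>W \<in> Ob (Rep N). \<forall>f \<in> Hom (Rep N) V W.
             \<forall>x \<in> carrier (whittaker_vectors N (psi_quotient N V)).
               \<phi> W (far (psi_quotient_functor N) V W f x) = f (\<phi> V x)))"
proof (intro conjI exI[of _ "rep.phi N"] ballI)
  have rep: "rep N V" if "V \<in> Ob (Rep N)" for V :: "('k, 'v) grep"
    using that assms by (simp add: Rep_def rep_def rep_axioms_def)
  show "equivalence_of_categories (Wh N :: (('k, ('k mat list \<Rightarrow> 'k) set, 'w) rmod, 'w \<Rightarrow> 'w) cat) Vect (whittaker_functor N)"
    by (rule whittaker_equivalence)
  show "is_functor (Rep N :: (('k, 'v) grep, 'v \<Rightarrow> 'v) cat) (Wh N) (psi_quotient_functor N)"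
    by (rule psi_quotient_is_functor[OF assms])
  show "rep.phi N V \<in> lin_iso (whittaker_vectors N (psi_quotient N V)) V" if "V \<in> Ob (Rep N)" for V :: "('k, 'v) grep"
    by (rule rep.phi_iso[OF rep[OF that]])
  show "rep.phi N W (far (psi_quotient_functor N) V W f x) = f (rep.phi N V x)"
    if "V \<in> Ob (Rep N)" "W \<in> Ob (Rep N)" "f \<in> Hom (Rep N) V W" "x \<in> carrier (whittaker_vectors N (psi_quotient N V))"
    for V W :: "('k, 'v) grep" and f x
    using that by (intro phi_natural rep) (simp_all add: Rep_def)
qed

end
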